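(* Let $(\Sigma,j,h)$ be a closed connected Riemann surface of genus $g_\Sigma$ with compatible Riemannian metric $h$ and canonical $\mathrm{Spin}^c$-spinor bundle $S^c$. Suppose that $(M,J,g,\omega)$ is a Kähler manifold of complex dimension $n>0$ with Levi--Civita connection $\nabla^M=\nabla^g$, and that $f\colon\Sigma\to M$ is a $J$-holomorphic curve. If $\psi\in\Gamma(S^c\otimes_{\mathbb C}f^*T^{\mathbb C}M)$ is an element of one of the four vector spaces $$\ker\bar\partial^{f\prime}\oplus\ker\bar\partial^{f\prime\prime},\qquad \ker\bar\partial^{f\prime *}\oplus\ker\bar\partial^{f\prime\prime *},\qquad \ker\bar\partial^{f\prime}\oplus\ker\bar\partial^{f\prime\prime *},\qquad \ker\bar\partial^{f\prime\prime}\oplus\ker\bar\partial^{f\prime *},$$ then $(f,\psi)$ is Dirac-harmonic. At least one of these vector spaces is non-zero, except possibly in the case that $g_\Sigma=1$ and $c_1(A)=0$, where $A=f_*[\Sigma]\in H_2(M;\mathbb Z)$ and $c_1(A)=\langle c_1(TM,J),A\rangle$.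
   Context: Riemann surfaces are closed, connected and oriented by the complex structure. The Kähler form is $\omega(x,y)=g(Jx,y)$. A $J$-holomorphic curve is a smooth map $f\colon\Sigma\to M$ with $df\circ j=J\circ df$. Canonical $\mathrm{Spin}^c$-structure: $S^c=S^{c+}\oplus S^{c-}$ with $S^{c+}=\Lambda^{0,0}=\underline{\mathbb C}$ and $S^{c-}=\Lambda^{0,1}=K^{-1}$. For a local $h$-orthonormal frame $(e_1,e_2=je_1)$ put $\bar\epsilon=\frac1{\sqrt2}(e_1+ie_2)$, $\bar\kappa=\frac1{\sqrt2}(e_1^*-ie_2^* )$. Clifford multiplication is $e_1\cdot\phi=\phi\bar\kappa$, $e_2\cdot\phi=i\phi\bar\kappa$ for $\phi\in S^{c+}$ and $e_1\cdot\beta=-\beta(\bar\epsilon)$, $e_2\cdot\beta=i\beta(\bar\epsilon)$ for $\beta\in S^{c-}$. The Levi--Civita connection $\nabla^h$ induces the connection on $S^c$ (trivial connection $d$ on $S^{c+}$). $T^{\mathbb C}M=TM\otimes_{\mathbb R}\mathbb C=T^{1,0}M\oplus T^{0,1}M$ ($\pm i$-eigenbundles of $J$), and $S^c\otimes_{\mathbb R}f^*TM\cong S^c\otimes_{\mathbb C}f^*T^{\mathbb C}M$ canonically. $\nabla^f$ is the connection on $f^*TM$ pulled back from $\nabla^M$, extended complex linearly to $f^*T^{\mathbb C}M$; together with $\nabla^h$ it induces a connection $\nabla^f$ on $S^c\otimes_{\mathbb C}f^*T^{\mathbb C}M$. The Dirac operator along $f$ is $D^f\psi=\sum_{\alpha=1}^2e_\alpha\cdot\nabla^f_{e_\alpha}\psi$.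 Dolbeault operators: $\bar\partial^{f\prime}\colon\Gamma(f^*T^{1,0}M)\to\Omega^{0,1}(f^*T^{1,0}M)$, $\bar\partial^{f\prime}\psi=\frac12(\nabla^f\psi+J\circ\nabla^f\psi\circ j)$, and $\bar\partial^{f\prime\prime}\colon\Gamma(f^*T^{0,1}M)\to\Omega^{0,1}(f^*T^{0,1}M)$, $\bar\partial^{f\prime\prime}\psi=\frac12(\nabla^f\psi-J\circ\nabla^f\psi\circ j)$, with formal $L^2$-adjoints $\bar\partial^{f\prime *}$, $\bar\partial^{f\prime\prime *}$. Here $\Gamma(f^*T^{1,0}M)=\Gamma(S^{c+}\otimes f^*T^{1,0}M)$, $\Omega^{0,1}(f^*T^{1,0}M)=\Gamma(S^{c-}\otimes f^*T^{1,0}M)$, and similarly for $T^{0,1}M$, so all kernels are subspaces of $\Gamma(S^c\otimes_{\mathbb C}f^*T^{\mathbb C}M)$. Dirac-harmonic: a pair $(f,\psi)$ with $f\colon\Sigma\to M$ smooth and $\psi\in\Gamma(S^c\otimes_{\mathbb C}f^*T^{\mathbb C}M)$ is Dirac-harmonic if $$\tau(f)=\mathcal R(f,\psi),\qquad D^f\psi=0.$$ Here $\tau(f)=\sum_\alpha(\nabla^f_{e_\alpha}df)(e_\alpha)\in\Gamma(f^*TM)$ is the tension field (with $df\in\Omega^1(f^*TM)$ and the connection induced by $\nabla^h$ and $\nabla^f$). The curvature term $\mathcal R(f,\psi)\in\Gamma(f^*TM)$ is defined by $g(\mathcal R(f,\psi),f^*X)=\frac12\langle\psi,R^f(X,\psi)\rangle$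 for all $f^*X\in f^*TM$, where $\langle\cdot,\cdot\rangle$ is the Hermitian bundle metric, $R(X,Y)Z=[\nabla^g_X,\nabla^g_Y]Z-\nabla^g_{[X,Y]}Z$, and $R^f(X,\phi\otimes f^*Z)=\sum_{\alpha=1}^2e_\alpha\cdot\phi\otimes f^*(R(X,df(e_\alpha))Z)$ extended complex linearly in the spinor argument (the right-hand side $\langle\psi,R^f(X,\psi)\rangle$ is real). *)

theory Defs
  imports "HOL-Analysis.Analysis" "HOL-Homology.Homology"
begin

section \<open>Smooth maps between open subsets of Euclidean spaces\<close>

fun Ck_on :: "nat \<Rightarrow> 'a::real_normed_vector set \<Rightarrow> ('a \<Rightarrow> 'b::real_normed_vector) \<Rightarrow> bool" where
  "Ck_on 0 X F \<longleftrightarrow> continuous_on X F"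
| "Ck_on (Suc k) X F \<longleftrightarrow>
     (\<forall>x\<in>X. F differentiable (at x)) \<and> (\<forall>v. Ck_on k X (\<lambda>x. frechet_derivative F (at x) v))"

text \<open>Only used for open sets.\<close>
definition smooth_on :: "'a::real_normed_vector set \<Rightarrow> ('a \<Rightarrow> 'b::real_normed_vector) \<Rightarrow> bool" where
  "smooth_on X F \<longleftrightarrow> (\<forall>k. Ck_on k X F)"

section \<open>Complex manifolds\<close>

text \<open>A chart is a pair of its domain and its coordinate map. The model space is \<open>complex\<close> for
  Riemann surfaces and \<open>complex ^ 'n\<close> for complex manifolds of dimension \<open>CARD('n)\<close>, and
  \<open>J0\<close> is multiplication by the imaginary unit on the model space.\<close>
type_synonym ('p, 'e) chart = "'p set \<times> ('p \<Rightarrow> 'e)"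

definition chart_inv :: "('p, 'e) chart \<Rightarrow> 'e \<Rightarrow> 'p" where
  "chart_inv c = inv_into (fst c) (snd c)"

definition complex_atlas ::
    "('e::euclidean_space \<Rightarrow> 'e) \<Rightarrow> ('p::topological_space, 'e) chart set \<Rightarrow> bool" where
  "complex_atlas J0 A \<longleftrightarrow>
     (\<Union>c\<in>A. fst c) = UNIV \<and>
     (\<forall>c\<in>A. open (fst c) \<and> open (snd c ` fst c) \<and>
        homeomorphism (fst c) (snd c ` fst c) (snd c) (chart_inv c)) \<and>
     (\<forall>c\<in>A. \<forall>d\<in>A. \<forall>x\<in>snd c ` (fst c \<inter> fst d).
        \<exists>L. ((snd d \<circ> chart_inv c) has_derivative L) (at x) \<and> (\<forall>v. L (J0 v) = J0 (L v)))"

text \<open>\<open>riem X p\<close> is the metric on the tangent space at \<open>p\<close>; see below for the model of tangent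
  spaces.\<close>
record ('p, 'e) riem_mfd =
  atlas :: "('p, 'e) chart set"
  riem :: "'p \<Rightarrow> 'e \<Rightarrow> 'e \<Rightarrow> real"

text \<open>The tangent space at \<open>p\<close> is identified with the model space by means of one chart chosen
  at each point. As transition maps are holomorphic, the complex structure on each tangent space is
  multiplication by the imaginary unit, whatever the choice. The choice varies discontinuously with
  \<open>p\<close>, so smoothness and differentiation of sections always go through \<open>to_chart\<close> and
  \<open>from_chart\<close>, which translate between the tangent space at \<open>p\<close> and the coordinates of an
  arbitrary chart around \<open>p\<close>.\<close>
definition chart_at :: "('p, 'e) riem_mfd \<Rightarrow> 'p \<Rightarrow> ('p, 'e) chart" where
  "chart_at X p = (SOME c. c \<in> atlas X \<and> p \<in> fst c)"

definition to_chart ::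
    "('p, 'e::euclidean_space) riem_mfd \<Rightarrow> ('p, 'e) chart \<Rightarrow> 'p \<Rightarrow> 'e \<Rightarrow> 'e" where
  "to_chart X c p =
     frechet_derivative (snd c \<circ> chart_inv (chart_at X p)) (at (snd (chart_at X p) p))"

definition from_chart ::
    "('p, 'e::euclidean_space) riem_mfd \<Rightarrow> ('p, 'e) chart \<Rightarrow> 'p \<Rightarrow> 'e \<Rightarrow> 'e" where
  "from_chart X c p =
     frechet_derivative (snd (chart_at X p) \<circ> chart_inv c) (at (snd c p))"

text \<open>Coordinate expression of a field of bilinear forms.\<close>
definition bilin_loc ::
    "('p, 'e::euclidean_space) riem_mfd \<Rightarrow> ('p \<Rightarrow> 'e \<Rightarrow> 'e \<Rightarrow> real) \<Rightarrow> ('p, 'e) chart \<Rightarrow> 'e \<Rightarrow> 'e \<Rightarrow> 'e \<Rightarrow> real"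
  where
  "bilin_loc X B c x v w =
     B (chart_inv c x) (from_chart X c (chart_inv c x) v) (from_chart X c (chart_inv c x) w)"

definition riemannian_metric :: "('p, 'e::euclidean_space) riem_mfd \<Rightarrow> bool" where
  "riemannian_metric X \<longleftrightarrow>
     (\<forall>p. bilinear (riem X p) \<and> (\<forall>v w. riem X p v w = riem X p w v) \<and>
          (\<forall>v. v \<noteq> 0 \<longrightarrow> riem X p v v > 0)) \<and>
     (\<forall>c\<in>atlas X. \<forall>v w. smooth_on (snd c ` fst c) (\<lambda>x. bilin_loc X (riem X) c x v w))"

section \<open>Levi-Civita connection and curvature\<close>

text \<open>The Christoffel form in the chart \<open>c\<close> at the coordinate point \<open>x\<close>: the Levi-Civita
  connection is \<open>D + \<Gamma>\<close> for the unique \<open>\<Gamma>\<close> that is symmetric (torsion-free) and makes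
  the metric parallel.\<close>
definition christoffel ::
    "('p, 'e::euclidean_space) riem_mfd \<Rightarrow> ('p, 'e) chart \<Rightarrow> 'e \<Rightarrow> 'e \<Rightarrow> 'e \<Rightarrow> 'e" where
  "christoffel X c x = (THE \<Gamma>. bilinear \<Gamma> \<and> (\<forall>u v. \<Gamma> u v = \<Gamma> v u) \<and>
     (\<forall>u v w. frechet_derivative (\<lambda>y. bilin_loc X (riem X) c y v w) (at x) u =
        bilin_loc X (riem X) c x (\<Gamma> u v) w + bilin_loc X (riem X) c x v (\<Gamma> u w)))"

text \<open>Covariant derivative and Lie bracket of vector fields in a chart.\<close>
definition cov ::
    "('p, 'e::euclidean_space) riem_mfd \<Rightarrow> ('p, 'e) chart \<Rightarrow> ('e \<Rightarrow> 'e) \<Rightarrow> ('e \<Rightarrow> 'e) \<Rightarrow> 'e \<Rightarrow> 'e" where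
  "cov X c U V y = frechet_derivative V (at y) (U y) + christoffel X c y (U y) (V y)"

definition lie :: "('e::euclidean_space \<Rightarrow> 'e) \<Rightarrow> ('e \<Rightarrow> 'e) \<Rightarrow> 'e \<Rightarrow> 'e" where
  "lie U V y = frechet_derivative V (at y) (U y) - frechet_derivative U (at y) (V y)"

definition curvature_field ::
    "('p, 'e::euclidean_space) riem_mfd \<Rightarrow> ('p, 'e) chart \<Rightarrow>
       ('e \<Rightarrow> 'e) \<Rightarrow> ('e \<Rightarrow> 'e) \<Rightarrow> ('e \<Rightarrow> 'e) \<Rightarrow> 'e \<Rightarrow> 'e" where
  "curvature_field X c U V Z y =
     cov X c U (cov X c V Z) y - cov X c V (cov X c U Z) y - cov X c (lie U V) Z y"

text \<open>The curvature tensor \<open>R(u,v)w\<close> at \<open>p\<close>; tensoriality allows the extension of tangent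
  vectors by constant fields.\<close>
definition curv :: "('p, 'e::euclidean_space) riem_mfd \<Rightarrow> 'p \<Rightarrow> 'e \<Rightarrow> 'e \<Rightarrow> 'e \<Rightarrow> 'e" where
  "curv X p u v w =
     curvature_field X (chart_at X p) (\<lambda>_. u) (\<lambda>_. v) (\<lambda>_. w) (snd (chart_at X p) p)"

section \<open>Riemann surfaces and Kaehler manifolds\<close>

definition riemann_surface ::
    "('s::{t2_space,second_countable_topology}, complex) riem_mfd \<Rightarrow> bool" where
  "riemann_surface \<Sigma> \<longleftrightarrow> complex_atlas (\<lambda>z. \<i> * z) (atlas \<Sigma>) \<and>
     compact (UNIV :: 's set) \<and> connected (UNIV :: 's set)"

definition compatible_metric :: "('s, complex) riem_mfd \<Rightarrow> bool" where
  "compatible_metric \<Sigma> \<longleftrightarrow> riemannian_metric \<Sigma> \<and>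
     (\<forall>p v w. riem \<Sigma> p (\<i> * v) (\<i> * w) = riem \<Sigma> p v w)"

definition kaehler_form ::
    "('m, complex ^ 'n) riem_mfd \<Rightarrow> 'm \<Rightarrow> complex ^ 'n \<Rightarrow> complex ^ 'n \<Rightarrow> real" where
  "kaehler_form M q x y = riem M q (\<i> *s x) y"

definition kaehler_manifold ::
    "('m::{t2_space,second_countable_topology}, complex ^ 'n) riem_mfd \<Rightarrow> bool" where
  "kaehler_manifold M \<longleftrightarrow> complex_atlas (\<lambda>v. \<i> *s v) (atlas M) \<and> riemannian_metric M \<and>
     (\<forall>q v w. riem M q (\<i> *s v) (\<i> *s w) = riem M q v w) \<and>
     \<comment> \<open>the Kaehler form is closed\<close>
     (\<forall>c\<in>atlas M. \<forall>x\<in>snd c ` fst c. \<forall>u v w.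
        frechet_derivative (\<lambda>y. bilin_loc M (kaehler_form M) c y v w) (at x) u +
        frechet_derivative (\<lambda>y. bilin_loc M (kaehler_form M) c y w u) (at x) v +
        frechet_derivative (\<lambda>y. bilin_loc M (kaehler_form M) c y u v) (at x) w = 0)"

text \<open>The first homology group of a closed oriented surface of genus \<open>k\<close> is free of rank
  \<open>2 k\<close>.\<close>
definition has_genus :: "'s topology \<Rightarrow> nat \<Rightarrow> bool" where
  "has_genus X k \<longleftrightarrow> homology_group 1 X \<cong> free_Abelian_group {..<2 * k}"

definition smooth_map ::
    "('s::topological_space, 'd::euclidean_space) riem_mfd \<Rightarrow>
     ('m::topological_space, 'e::euclidean_space) riem_mfd \<Rightarrow> ('s \<Rightarrow> 'm) \<Rightarrow> bool" where
  "smooth_map \<Sigma> M f \<longleftrightarrow> continuous_on UNIV f \<and>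
     (\<forall>c\<in>atlas \<Sigma>. \<forall>d\<in>atlas M.
        smooth_on (snd c ` (fst c \<inter> f -` fst d)) (snd d \<circ> f \<circ> chart_inv c))"

definition differential ::
    "('s, 'd::euclidean_space) riem_mfd \<Rightarrow> ('m, 'e::euclidean_space) riem_mfd \<Rightarrow> ('s \<Rightarrow> 'm) \<Rightarrow> 's \<Rightarrow> 'd \<Rightarrow> 'e"
  where
  "differential \<Sigma> M f p =
     frechet_derivative (snd (chart_at M (f p)) \<circ> f \<circ> chart_inv (chart_at \<Sigma> p))
       (at (snd (chart_at \<Sigma> p) p))"

definition J_holomorphic_curve ::
    "('s::topological_space, complex) riem_mfd \<Rightarrow> ('m::topological_space, complex ^ 'n) riem_mfd \<Rightarrow>
       ('s \<Rightarrow> 'm) \<Rightarrow> bool" where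
  "J_holomorphic_curve \<Sigma> M f \<longleftrightarrow> smooth_map \<Sigma> M f \<and>
     (\<forall>p v. differential \<Sigma> M f p (\<i> * v) = \<i> *s differential \<Sigma> M f p v)"

section \<open>Sections of and one-forms with values in the pulled-back tangent bundle\<close>

text \<open>A section of \<open>f\<^sup>*TM\<close> is a function \<open>s\<close> with \<open>s p\<close> in the tangent space at \<open>f p\<close>; an
  \<open>f\<^sup>*TM\<close>-valued one-form \<open>\<beta>\<close> takes in addition a tangent vector of the surface at \<open>p\<close>.\<close>

definition section_loc ::
    "('m, 'e::euclidean_space) riem_mfd \<Rightarrow> ('s \<Rightarrow> 'm) \<Rightarrow> ('s, complex) chart \<Rightarrow> ('m, 'e) chart \<Rightarrow>
       ('s \<Rightarrow> 'e) \<Rightarrow> complex \<Rightarrow> 'e" where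
  "section_loc M f c d s x = to_chart M d (f (chart_inv c x)) (s (chart_inv c x))"

definition form_loc ::
    "('s, complex) riem_mfd \<Rightarrow> ('m, 'e::euclidean_space) riem_mfd \<Rightarrow> ('s \<Rightarrow> 'm) \<Rightarrow>
       ('s, complex) chart \<Rightarrow> ('m, 'e) chart \<Rightarrow> ('s \<Rightarrow> complex \<Rightarrow> 'e) \<Rightarrow> complex \<Rightarrow> complex \<Rightarrow> 'e" where
  "form_loc \<Sigma> M f c d \<beta> w x =
     to_chart M d (f (chart_inv c x))
       (\<beta> (chart_inv c x) (from_chart \<Sigma> c (chart_inv c x) w))"

definition smooth_section ::
    "('s, complex) riem_mfd \<Rightarrow> ('m, 'e::euclidean_space) riem_mfd \<Rightarrow> ('s \<Rightarrow> 'm) \<Rightarrow> ('s \<Rightarrow> 'e) \<Rightarrow> bool" where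
  "smooth_section \<Sigma> M f s \<longleftrightarrow> (\<forall>c\<in>atlas \<Sigma>. \<forall>d\<in>atlas M.
     smooth_on (snd c ` (fst c \<inter> f -` fst d)) (section_loc M f c d s))"

definition smooth_form ::
    "('s, complex) riem_mfd \<Rightarrow> ('m, 'e::euclidean_space) riem_mfd \<Rightarrow> ('s \<Rightarrow> 'm) \<Rightarrow>
       ('s \<Rightarrow> complex \<Rightarrow> 'e) \<Rightarrow> bool" where
  "smooth_form \<Sigma> M f \<beta> \<longleftrightarrow> (\<forall>p. linear (\<beta> p)) \<and> (\<forall>c\<in>atlas \<Sigma>. \<forall>d\<in>atlas M. \<forall>w.
     smooth_on (snd c ` (fst c \<inter> f -` fst d)) (form_loc \<Sigma> M f c d \<beta> w))"

text \<open>The pulled-back Levi-Civita connection on sections of \<open>f\<^sup>*TM\<close>, and the connection induced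
  by it and the Levi-Civita connection of the surface on \<open>f\<^sup>*TM\<close>-valued one-forms,
  \<open>(\<nabla>\<^sub>v \<beta>)(w) = \<nabla>\<^sub>v (\<beta>(w)) - \<beta>(\<nabla>\<^sub>v w)\<close>.\<close>
definition nabla ::
    "('s, complex) riem_mfd \<Rightarrow> ('m, 'e::euclidean_space) riem_mfd \<Rightarrow> ('s \<Rightarrow> 'm) \<Rightarrow> ('s \<Rightarrow> 'e) \<Rightarrow>
       's \<Rightarrow> complex \<Rightarrow> 'e" where
  "nabla \<Sigma> M f s p v =
     (let c = chart_at \<Sigma> p; d = chart_at M (f p) in
       frechet_derivative (section_loc M f c d s) (at (snd c p)) v +
       christoffel M d (snd d (f p)) (differential \<Sigma> M f p v) (s p))"

definition nabla_form ::
    "('s, complex) riem_mfd \<Rightarrow> ('m, 'e::euclidean_space) riem_mfd \<Rightarrow> ('s \<Rightarrow> 'm) \<Rightarrow>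
       ('s \<Rightarrow> complex \<Rightarrow> 'e) \<Rightarrow> 's \<Rightarrow> complex \<Rightarrow> complex \<Rightarrow> 'e" where
  "nabla_form \<Sigma> M f \<beta> p v w =
     (let c = chart_at \<Sigma> p; d = chart_at M (f p) in
       frechet_derivative (form_loc \<Sigma> M f c d \<beta> w) (at (snd c p)) v +
       christoffel M d (snd d (f p)) (differential \<Sigma> M f p v) (\<beta> p w) -
       \<beta> p (christoffel \<Sigma> c (snd c p) v w))"

text \<open>A frame \<open>(e\<^sub>1, e\<^sub>2 = j e\<^sub>1)\<close> at \<open>p\<close>, orthonormal for a compatible metric. Everything built
  from it below is pointwise and independent of the choice of frame.\<close>
definition e1 :: "('s, complex) riem_mfd \<Rightarrow> 's \<Rightarrow> complex" where
  "e1 \<Sigma> p = complex_of_real (1 / sqrt (riem \<Sigma> p 1 1))"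

definition e2 :: "('s, complex) riem_mfd \<Rightarrow> 's \<Rightarrow> complex" where
  "e2 \<Sigma> p = \<i> * e1 \<Sigma> p"

definition tension_field ::
    "('s, complex) riem_mfd \<Rightarrow> ('m, 'e::euclidean_space) riem_mfd \<Rightarrow> ('s \<Rightarrow> 'm) \<Rightarrow> 's \<Rightarrow> 'e" where
  "tension_field \<Sigma> M f p =
     nabla_form \<Sigma> M f (differential \<Sigma> M f) p (e1 \<Sigma> p) (e1 \<Sigma> p) +
     nabla_form \<Sigma> M f (differential \<Sigma> M f) p (e2 \<Sigma> p) (e2 \<Sigma> p)"

section \<open>Twisted spinors\<close>

text \<open>The complexification \<open>V \<otimes> \<complex>\<close> of a real vector space: the pair \<open>(a, b)\<close> is
  \<open>a \<otimes> 1 + b \<otimes> i\<close>. Real linear maps are extended complex linearly, that is componentwise.\<close>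
type_synonym 'e cpx = "'e \<times> 'e"

definition cmult :: "complex \<Rightarrow> 'e::real_vector cpx \<Rightarrow> 'e cpx" where
  "cmult z x = (Re z *\<^sub>R fst x - Im z *\<^sub>R snd x, Re z *\<^sub>R snd x + Im z *\<^sub>R fst x)"

definition cext :: "('e \<Rightarrow> 'e) \<Rightarrow> 'e cpx \<Rightarrow> 'e cpx" where
  "cext L x = (L (fst x), L (snd x))"

abbreviation JC :: "(complex ^ 'n) cpx \<Rightarrow> (complex ^ 'n) cpx" where
  "JC \<equiv> cext (\<lambda>v. \<i> *s v)"

definition T10 :: "(complex ^ 'n) cpx set" where
  "T10 = {x. JC x = cmult \<i> x}"

definition T01 :: "(complex ^ 'n) cpx set" where
  "T01 = {x. JC x = cmult (- \<i>) x}"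

text \<open>Hermitian extension of a real inner product, complex linear in the first argument.\<close>
definition herm :: "('e \<Rightarrow> 'e \<Rightarrow> real) \<Rightarrow> 'e cpx \<Rightarrow> 'e cpx \<Rightarrow> complex" where
  "herm B x y = Complex (B (fst x) (fst y) + B (snd x) (snd y)) (B (snd x) (fst y) - B (fst x) (snd y))"

text \<open>Elements of the fibre of \<open>S\<^sup>c \<otimes> f\<^sup>*T\<^sup>\<complex>M\<close>: the first component lies in
  \<open>S\<^sup>c\<^sup>+ \<otimes> f\<^sup>*T\<^sup>\<complex>M = f\<^sup>*T\<^sup>\<complex>M\<close>, the second one in \<open>S\<^sup>c\<^sup>- \<otimes> f\<^sup>*T\<^sup>\<complex>M\<close>, which
  is the space of complex antilinear maps from the tangent space of the surface to \<open>f\<^sup>*T\<^sup>\<complex>M\<close>.\<close>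
type_synonym 'e tspinor = "'e cpx \<times> (complex \<Rightarrow> 'e cpx)"

definition tspinor_add :: "'e::real_vector tspinor \<Rightarrow> 'e tspinor \<Rightarrow> 'e tspinor" where
  "tspinor_add \<phi> \<psi> = (fst \<phi> + fst \<psi>, \<lambda>w. snd \<phi> w + snd \<psi> w)"

definition tspinor_zero :: "'e::real_vector tspinor" where
  "tspinor_zero = (0, \<lambda>w. 0)"

definition csections ::
    "('s, complex) riem_mfd \<Rightarrow> ('m, 'e::euclidean_space) riem_mfd \<Rightarrow> ('s \<Rightarrow> 'm) \<Rightarrow> ('s \<Rightarrow> 'e cpx) set" where
  "csections \<Sigma> M f = {s. smooth_section \<Sigma> M f (\<lambda>p. fst (s p)) \<and> smooth_section \<Sigma> M f (\<lambda>p. snd (s p))}"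

definition cforms01 ::
    "('s, complex) riem_mfd \<Rightarrow> ('m, 'e::euclidean_space) riem_mfd \<Rightarrow> ('s \<Rightarrow> 'm) \<Rightarrow>
       ('s \<Rightarrow> complex \<Rightarrow> 'e cpx) set" where
  "cforms01 \<Sigma> M f = {\<beta>. smooth_form \<Sigma> M f (\<lambda>p w. fst (\<beta> p w)) \<and> smooth_form \<Sigma> M f (\<lambda>p w. snd (\<beta> p w)) \<and>
     (\<forall>p w. \<beta> p (\<i> * w) = cmult (- \<i>) (\<beta> p w))}"

definition twisted_spinors ::
    "('s, complex) riem_mfd \<Rightarrow> ('m, 'e::euclidean_space) riem_mfd \<Rightarrow> ('s \<Rightarrow> 'm) \<Rightarrow>
       ('s \<Rightarrow> 'e tspinor) set" where
  "twisted_spinors \<Sigma> M f =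
     {\<psi>. (\<lambda>p. fst (\<psi> p)) \<in> csections \<Sigma> M f \<and> (\<lambda>p. snd (\<psi> p)) \<in> cforms01 \<Sigma> M f}"

definition nablaC ::
    "('s, complex) riem_mfd \<Rightarrow> ('m, 'e::euclidean_space) riem_mfd \<Rightarrow> ('s \<Rightarrow> 'm) \<Rightarrow> ('s \<Rightarrow> 'e cpx) \<Rightarrow>
       's \<Rightarrow> complex \<Rightarrow> 'e cpx" where
  "nablaC \<Sigma> M f s p v =
     (nabla \<Sigma> M f (\<lambda>p. fst (s p)) p v, nabla \<Sigma> M f (\<lambda>p. snd (s p)) p v)"

definition nablaS ::
    "('s, complex) riem_mfd \<Rightarrow> ('m, 'e::euclidean_space) riem_mfd \<Rightarrow> ('s \<Rightarrow> 'm) \<Rightarrow> ('s \<Rightarrow> 'e tspinor) \<Rightarrow>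
       's \<Rightarrow> complex \<Rightarrow> 'e tspinor" where
  "nablaS \<Sigma> M f \<psi> p v =
     (nablaC \<Sigma> M f (\<lambda>p. fst (\<psi> p)) p v,
      \<lambda>w. (nabla_form \<Sigma> M f (\<lambda>p w. fst (snd (\<psi> p) w)) p v w,
           nabla_form \<Sigma> M f (\<lambda>p w. snd (snd (\<psi> p) w)) p v w))"

text \<open>\<open>\<kappa>\<close> is the form written with a bar in the usual notation,
  \<open>(e\<^sub>1\<^sup>* - i e\<^sub>2\<^sup>*)/\<surd>2\<close>, and \<open>eval_eps \<Sigma> p \<beta>\<close> is the value of \<open>\<beta>\<close>
  (extended complex linearly) at \<open>(e\<^sub>1 + i e\<^sub>2)/\<surd>2\<close>.\<close>
definition kappa :: "('s, complex) riem_mfd \<Rightarrow> 's \<Rightarrow> complex \<Rightarrow> complex" where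
  "kappa \<Sigma> p w =
     (complex_of_real (riem \<Sigma> p (e1 \<Sigma> p) w) - \<i> * complex_of_real (riem \<Sigma> p (e2 \<Sigma> p) w)) /
       complex_of_real (sqrt 2)"

definition eval_eps ::
    "('s, complex) riem_mfd \<Rightarrow> 's \<Rightarrow> (complex \<Rightarrow> 'e::real_vector cpx) \<Rightarrow> 'e cpx" where
  "eval_eps \<Sigma> p \<beta> =
     cmult (complex_of_real (1 / sqrt 2)) (\<beta> (e1 \<Sigma> p) + cmult \<i> (\<beta> (e2 \<Sigma> p)))"

text \<open>Clifford multiplication by \<open>e\<^sub>1\<close> and \<open>e\<^sub>2\<close>.\<close>
definition clifford1 ::
    "('s, complex) riem_mfd \<Rightarrow> 's \<Rightarrow> 'e::real_vector tspinor \<Rightarrow> 'e tspinor" where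
  "clifford1 \<Sigma> p \<phi> = (- eval_eps \<Sigma> p (snd \<phi>), \<lambda>w. cmult (kappa \<Sigma> p w) (fst \<phi>))"

definition clifford2 ::
    "('s, complex) riem_mfd \<Rightarrow> 's \<Rightarrow> 'e::real_vector tspinor \<Rightarrow> 'e tspinor" where
  "clifford2 \<Sigma> p \<phi> =
     (cmult \<i> (eval_eps \<Sigma> p (snd \<phi>)), \<lambda>w. cmult (\<i> * kappa \<Sigma> p w) (fst \<phi>))"

definition dirac ::
    "('s, complex) riem_mfd \<Rightarrow> ('m, 'e::euclidean_space) riem_mfd \<Rightarrow> ('s \<Rightarrow> 'm) \<Rightarrow> ('s \<Rightarrow> 'e tspinor) \<Rightarrow>
       's \<Rightarrow> 'e tspinor" where
  "dirac \<Sigma> M f \<psi> p =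
     tspinor_add (clifford1 \<Sigma> p (nablaS \<Sigma> M f \<psi> p (e1 \<Sigma> p)))
                 (clifford2 \<Sigma> p (nablaS \<Sigma> M f \<psi> p (e2 \<Sigma> p)))"

text \<open>The Hermitian metric on \<open>S\<^sup>c\<^sup>-\<close> is the one induced by the metric of the surface (so that
  \<open>\<kappa>\<close> has length one).\<close>
definition herm_form ::
    "('s, complex) riem_mfd \<Rightarrow> ('m, 'e) riem_mfd \<Rightarrow> ('s \<Rightarrow> 'm) \<Rightarrow> 's \<Rightarrow>
       (complex \<Rightarrow> 'e cpx) \<Rightarrow> (complex \<Rightarrow> 'e cpx) \<Rightarrow> complex" where
  "herm_form \<Sigma> M f p \<beta> \<gamma> =
     herm (riem M (f p)) (\<beta> (e1 \<Sigma> p)) (\<gamma> (e1 \<Sigma> p)) + herm (riem M (f p)) (\<beta> (e2 \<Sigma> p)) (\<gamma> (e2 \<Sigma> p))"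

definition herm_spinor ::
    "('s, complex) riem_mfd \<Rightarrow> ('m, 'e) riem_mfd \<Rightarrow> ('s \<Rightarrow> 'm) \<Rightarrow> 's \<Rightarrow> 'e tspinor \<Rightarrow> 'e tspinor \<Rightarrow> complex"
  where
  "herm_spinor \<Sigma> M f p \<phi> \<psi> =
     herm (riem M (f p)) (fst \<phi>) (fst \<psi>) + herm_form \<Sigma> M f p (snd \<phi>) (snd \<psi>)"

text \<open>\<open>R\<^sup>f(x, \<phi>)\<close> for \<open>x\<close> in the tangent space at \<open>f p\<close> and \<open>\<phi>\<close> in the fibre at \<open>p\<close>.\<close>
definition curv_spinor ::
    "('s, complex) riem_mfd \<Rightarrow> ('m, 'e::euclidean_space) riem_mfd \<Rightarrow> ('s \<Rightarrow> 'm) \<Rightarrow> 's \<Rightarrow> 'e \<Rightarrow>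
       'e tspinor \<Rightarrow> 'e tspinor" where
  "curv_spinor \<Sigma> M f p x \<phi> =
     (let R = (\<lambda>e. cext (curv M (f p) x (differential \<Sigma> M f p e))) in
       tspinor_add (clifford1 \<Sigma> p (R (e1 \<Sigma> p) (fst \<phi>), \<lambda>w. R (e1 \<Sigma> p) (snd \<phi> w)))
                   (clifford2 \<Sigma> p (R (e2 \<Sigma> p) (fst \<phi>), \<lambda>w. R (e2 \<Sigma> p) (snd \<phi> w))))"

definition curvature_term ::
    "('s, complex) riem_mfd \<Rightarrow> ('m, 'e::euclidean_space) riem_mfd \<Rightarrow> ('s \<Rightarrow> 'm) \<Rightarrow> ('s \<Rightarrow> 'e tspinor) \<Rightarrow>
       's \<Rightarrow> 'e" where
  "curvature_term \<Sigma> M f \<psi> p =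
     (THE y. \<forall>x. complex_of_real (riem M (f p) y x) =
               1 / 2 * herm_spinor \<Sigma> M f p (\<psi> p) (curv_spinor \<Sigma> M f p x (\<psi> p)))"

definition dirac_harmonic ::
    "('s::topological_space, complex) riem_mfd \<Rightarrow> ('m::topological_space, 'e::euclidean_space) riem_mfd \<Rightarrow>
       ('s \<Rightarrow> 'm) \<Rightarrow> ('s \<Rightarrow> 'e tspinor) \<Rightarrow> bool" where
  "dirac_harmonic \<Sigma> M f \<psi> \<longleftrightarrow>
     smooth_map \<Sigma> M f \<and> \<psi> \<in> twisted_spinors \<Sigma> M f \<and>
     (\<forall>p. tension_field \<Sigma> M f p = curvature_term \<Sigma> M f \<psi> p) \<and>
     (\<forall>p. dirac \<Sigma> M f \<psi> p = tspinor_zero)"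

section \<open>Dolbeault operators, formal adjoints and kernels\<close>

definition sections10 ::
    "('s, complex) riem_mfd \<Rightarrow> ('m, complex ^ 'n) riem_mfd \<Rightarrow> ('s \<Rightarrow> 'm) \<Rightarrow>
       ('s \<Rightarrow> (complex ^ 'n) cpx) set" where
  "sections10 \<Sigma> M f = {s \<in> csections \<Sigma> M f. \<forall>p. s p \<in> T10}"

definition sections01 ::
    "('s, complex) riem_mfd \<Rightarrow> ('m, complex ^ 'n) riem_mfd \<Rightarrow> ('s \<Rightarrow> 'm) \<Rightarrow>
       ('s \<Rightarrow> (complex ^ 'n) cpx) set" where
  "sections01 \<Sigma> M f = {s \<in> csections \<Sigma> M f. \<forall>p. s p \<in> T01}"

text \<open>\<open>\<Omega>\<^sup>0\<^sup>,\<^sup>1\<close> with values in \<open>f\<^sup>*T\<^sup>1\<^sup>,\<^sup>0M\<close> and in \<open>f\<^sup>*T\<^sup>0\<^sup>,\<^sup>1M\<close>.\<close>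
definition forms01_10 ::
    "('s, complex) riem_mfd \<Rightarrow> ('m, complex ^ 'n) riem_mfd \<Rightarrow> ('s \<Rightarrow> 'm) \<Rightarrow>
       ('s \<Rightarrow> complex \<Rightarrow> (complex ^ 'n) cpx) set" where
  "forms01_10 \<Sigma> M f = {\<beta> \<in> cforms01 \<Sigma> M f. \<forall>p w. \<beta> p w \<in> T10}"

definition forms01_01 ::
    "('s, complex) riem_mfd \<Rightarrow> ('m, complex ^ 'n) riem_mfd \<Rightarrow> ('s \<Rightarrow> 'm) \<Rightarrow>
       ('s \<Rightarrow> complex \<Rightarrow> (complex ^ 'n) cpx) set" where
  "forms01_01 \<Sigma> M f = {\<beta> \<in> cforms01 \<Sigma> M f. \<forall>p w. \<beta> p w \<in> T01}"

definition dbar' ::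
    "('s, complex) riem_mfd \<Rightarrow> ('m, complex ^ 'n) riem_mfd \<Rightarrow> ('s \<Rightarrow> 'm) \<Rightarrow>
       ('s \<Rightarrow> (complex ^ 'n) cpx) \<Rightarrow> 's \<Rightarrow> complex \<Rightarrow> (complex ^ 'n) cpx" where
  "dbar' \<Sigma> M f s p v = (1 / 2) *\<^sub>R (nablaC \<Sigma> M f s p v + JC (nablaC \<Sigma> M f s p (\<i> * v)))"

definition dbar'' ::
    "('s, complex) riem_mfd \<Rightarrow> ('m, complex ^ 'n) riem_mfd \<Rightarrow> ('s \<Rightarrow> 'm) \<Rightarrow>
       ('s \<Rightarrow> (complex ^ 'n) cpx) \<Rightarrow> 's \<Rightarrow> complex \<Rightarrow> (complex ^ 'n) cpx" where
  "dbar'' \<Sigma> M f s p v = (1 / 2) *\<^sub>R (nablaC \<Sigma> M f s p v - JC (nablaC \<Sigma> M f s p (\<i> * v)))"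

text \<open>The Riemannian area measure, characterised by its coordinate density
  \<open>\<surd>(det h)\<close> in every chart.\<close>
definition area_measure :: "('s::topological_space, complex) riem_mfd \<Rightarrow> 's measure" where
  "area_measure \<Sigma> = (THE \<mu>. sets \<mu> = sets borel \<and>
     (\<forall>c\<in>atlas \<Sigma>. \<forall>B\<in>sets borel. B \<subseteq> fst c \<longrightarrow>
        emeasure \<mu> B =
          (\<integral>\<^sup>+x\<in>snd c ` B.
             ennreal (sqrt (bilin_loc \<Sigma> (riem \<Sigma>) c x 1 1 * bilin_loc \<Sigma> (riem \<Sigma>) c x \<i> \<i> -
                            (bilin_loc \<Sigma> (riem \<Sigma>) c x 1 \<i>)\<^sup>2)) \<partial>lborel)))"

definition L2_section ::
    "('s::topological_space, complex) riem_mfd \<Rightarrow> ('m, 'e) riem_mfd \<Rightarrow> ('s \<Rightarrow> 'm) \<Rightarrow>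
       ('s \<Rightarrow> 'e cpx) \<Rightarrow> ('s \<Rightarrow> 'e cpx) \<Rightarrow> complex" where
  "L2_section \<Sigma> M f s t = (LINT p|area_measure \<Sigma>. herm (riem M (f p)) (s p) (t p))"

definition L2_form ::
    "('s::topological_space, complex) riem_mfd \<Rightarrow> ('m, 'e) riem_mfd \<Rightarrow> ('s \<Rightarrow> 'm) \<Rightarrow>
       ('s \<Rightarrow> complex \<Rightarrow> 'e cpx) \<Rightarrow> ('s \<Rightarrow> complex \<Rightarrow> 'e cpx) \<Rightarrow> complex" where
  "L2_form \<Sigma> M f \<beta> \<gamma> = (LINT p|area_measure \<Sigma>. herm_form \<Sigma> M f p (\<beta> p) (\<gamma> p))"

text \<open>The value at \<open>\<beta>\<close> of the formal adjoint of \<open>D\<close>, an operator on the space \<open>E\<close> of smooth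
  sections.\<close>
definition formal_adjoint ::
    "'a set \<Rightarrow> ('a \<Rightarrow> 'a \<Rightarrow> complex) \<Rightarrow> ('b \<Rightarrow> 'b \<Rightarrow> complex) \<Rightarrow> ('a \<Rightarrow> 'b) \<Rightarrow> 'b \<Rightarrow> 'a" where
  "formal_adjoint E ipE ipF D \<beta> = (THE t. t \<in> E \<and> (\<forall>s\<in>E. ipF (D s) \<beta> = ipE s t))"

definition dbar'_adj ::
    "('s::topological_space, complex) riem_mfd \<Rightarrow> ('m, complex ^ 'n) riem_mfd \<Rightarrow> ('s \<Rightarrow> 'm) \<Rightarrow>
       ('s \<Rightarrow> complex \<Rightarrow> (complex ^ 'n) cpx) \<Rightarrow> 's \<Rightarrow> (complex ^ 'n) cpx" where
  "dbar'_adj \<Sigma> M f =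
     formal_adjoint (sections10 \<Sigma> M f) (L2_section \<Sigma> M f) (L2_form \<Sigma> M f) (dbar' \<Sigma> M f)"

definition dbar''_adj ::
    "('s::topological_space, complex) riem_mfd \<Rightarrow> ('m, complex ^ 'n) riem_mfd \<Rightarrow> ('s \<Rightarrow> 'm) \<Rightarrow>
       ('s \<Rightarrow> complex \<Rightarrow> (complex ^ 'n) cpx) \<Rightarrow> 's \<Rightarrow> (complex ^ 'n) cpx" where
  "dbar''_adj \<Sigma> M f =
     formal_adjoint (sections01 \<Sigma> M f) (L2_section \<Sigma> M f) (L2_form \<Sigma> M f) (dbar'' \<Sigma> M f)"

text \<open>The kernels, as sets of sections of \<open>S\<^sup>c \<otimes> f\<^sup>*T\<^sup>\<complex>M\<close>.\<close>
definition ker_dbar' ::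
    "('s, complex) riem_mfd \<Rightarrow> ('m, complex ^ 'n) riem_mfd \<Rightarrow> ('s \<Rightarrow> 'm) \<Rightarrow>
       ('s \<Rightarrow> (complex ^ 'n) tspinor) set" where
  "ker_dbar' \<Sigma> M f =
     {(\<lambda>p. (s p, \<lambda>w. 0)) | s. s \<in> sections10 \<Sigma> M f \<and> (\<forall>p v. dbar' \<Sigma> M f s p v = 0)}"

definition ker_dbar'' ::
    "('s, complex) riem_mfd \<Rightarrow> ('m, complex ^ 'n) riem_mfd \<Rightarrow> ('s \<Rightarrow> 'm) \<Rightarrow>
       ('s \<Rightarrow> (complex ^ 'n) tspinor) set" where
  "ker_dbar'' \<Sigma> M f =
     {(\<lambda>p. (s p, \<lambda>w. 0)) | s. s \<in> sections01 \<Sigma> M f \<and> (\<forall>p v. dbar'' \<Sigma> M f s p v = 0)}"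

definition ker_dbar'_adj ::
    "('s::topological_space, complex) riem_mfd \<Rightarrow> ('m, complex ^ 'n) riem_mfd \<Rightarrow> ('s \<Rightarrow> 'm) \<Rightarrow>
       ('s \<Rightarrow> (complex ^ 'n) tspinor) set" where
  "ker_dbar'_adj \<Sigma> M f =
     {(\<lambda>p. (0, \<beta> p)) | \<beta>. \<beta> \<in> forms01_10 \<Sigma> M f \<and> (\<forall>p. dbar'_adj \<Sigma> M f \<beta> p = 0)}"

definition ker_dbar''_adj ::
    "('s::topological_space, complex) riem_mfd \<Rightarrow> ('m, complex ^ 'n) riem_mfd \<Rightarrow> ('s \<Rightarrow> 'm) \<Rightarrow>
       ('s \<Rightarrow> (complex ^ 'n) tspinor) set" where
  "ker_dbar''_adj \<Sigma> M f =
     {(\<lambda>p. (0, \<beta> p)) | \<beta>. \<beta> \<in> forms01_01 \<Sigma> M f \<and> (\<forall>p. dbar''_adj \<Sigma> M f \<beta> p = 0)}"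

text \<open>Internal sum; it is direct for the pairs of kernels it is used for, since their values lie
  in complementary subbundles.\<close>
definition tspinor_sum ::
    "('s \<Rightarrow> 'e::real_vector tspinor) set \<Rightarrow> ('s \<Rightarrow> 'e tspinor) set \<Rightarrow> ('s \<Rightarrow> 'e tspinor) set"
    (infixl "\<oplus>\<^sub>s" 65) where
  "V \<oplus>\<^sub>s W = {(\<lambda>p. tspinor_add (\<phi> p) (\<psi> p)) | \<phi> \<psi>. \<phi> \<in> V \<and> \<psi> \<in> W}"

definition nonzero_space :: "('s \<Rightarrow> 'e::real_vector tspinor) set \<Rightarrow> bool" where
  "nonzero_space V \<longleftrightarrow> (\<exists>\<psi>\<in>V. \<psi> \<noteq> (\<lambda>p. tspinor_zero))"

section \<open>Fundamental class and first Chern class\<close>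

text \<open>The small simplex around \<open>p\<close> which in the chart \<open>c\<close> is the equilateral triangle of
  circumradius \<open>r\<close> centred at the coordinates of \<open>p\<close>, with counterclockwise vertices.\<close>
definition small_simplex ::
    "('s, complex) chart \<Rightarrow> 's \<Rightarrow> real \<Rightarrow> (nat \<Rightarrow> real) \<Rightarrow> 's" where
  "small_simplex c p r =
     restrict (\<lambda>t. chart_inv c
         (snd c p + complex_of_real r * (\<Sum>k\<le>2. complex_of_real (t k) * cis (2 * pi * real k / 3))))
       (standard_simplex 2)"

text \<open>The class in \<open>H\<^sub>2(\<Sigma>; \<int>)\<close> which restricts at each point to the local orientation given
  by the complex structure.\<close>
definition fundamental_class ::
    "('s::topological_space, complex) riem_mfd \<Rightarrow> 's chain set" where
  "fundamental_class \<Sigma> = (THE a. a \<in> carrier (homology_group 2 (euclidean :: 's topology)) \<and>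
     (\<forall>c\<in>atlas \<Sigma>. \<forall>p\<in>fst c. \<forall>r>0. cball (snd c p) r \<subseteq> snd c ` fst c \<longrightarrow>
        hom_induced 2 euclidean {} euclidean (- {p}) id a =
          homologous_rel_set 2 euclidean (- {p}) (frag_of (small_simplex c p r))))"

text \<open>Chern--Weil representative of the first Chern class of \<open>(TM, J)\<close>: the real number
  \<open>i/(2\<pi>) tr R(x,y)\<close>, with the complex trace of the curvature endomorphism.\<close>
definition chern_form ::
    "('m, complex ^ 'n) riem_mfd \<Rightarrow> 'm \<Rightarrow> complex ^ 'n \<Rightarrow> complex ^ 'n \<Rightarrow> real" where
  "chern_form M q x y =
     Re (\<i> / (2 * complex_of_real pi) * (\<Sum>k\<in>UNIV. curv M q x y (axis k 1) $ k))"

text \<open>Smooth singular 2-simplices, parametrised by the triangle of all \<open>(t\<^sub>1, t\<^sub>2)\<close> with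
  barycentric coordinates \<open>(1 - t\<^sub>1 - t\<^sub>2, t\<^sub>1, t\<^sub>2)\<close>; smooth means smoothly extendable.\<close>
definition triangle :: "(real \<times> real) set" where
  "triangle = {(t1, t2). 0 \<le> t1 \<and> 0 \<le> t2 \<and> t1 + t2 \<le> 1}"

definition smooth_triangle ::
    "('m::topological_space, 'e::euclidean_space) riem_mfd \<Rightarrow> (real \<times> real \<Rightarrow> 'm) \<Rightarrow> bool" where
  "smooth_triangle M u \<longleftrightarrow> (\<exists>W. open W \<and> triangle \<subseteq> W \<and> continuous_on W u \<and>
     (\<forall>d\<in>atlas M. smooth_on (W \<inter> u -` fst d) (snd d \<circ> u)))"

definition simplex_of_triangle :: "(real \<times> real \<Rightarrow> 'm) \<Rightarrow> (nat \<Rightarrow> real) \<Rightarrow> 'm" where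
  "simplex_of_triangle u = restrict (\<lambda>t. u (t 1, t 2)) (standard_simplex 2)"

definition triangle_integral ::
    "('m, 'e::euclidean_space) riem_mfd \<Rightarrow> ('m \<Rightarrow> 'e \<Rightarrow> 'e \<Rightarrow> real) \<Rightarrow> (real \<times> real \<Rightarrow> 'm) \<Rightarrow> real" where
  "triangle_integral M \<rho> u =
     (LINT t:triangle|lborel.
        (let du = frechet_derivative (snd (chart_at M (u t)) \<circ> u) (at t) in
          \<rho> (u t) (du (1, 0)) (du (0, 1))))"

text \<open>The pairing of the first Chern class of \<open>(TM, J)\<close> with \<open>A \<in> H\<^sub>2(M; \<int>)\<close>: the de Rham
  pairing of its Chern--Weil representative with any smooth singular cycle representing \<open>A\<close>.\<close>
definition chern_number ::
    "('m::topological_space, complex ^ 'n) riem_mfd \<Rightarrow> 'm chain set \<Rightarrow> real" where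
  "chern_number M A = (THE r. \<exists>N (a :: nat \<Rightarrow> int) u.
     (\<forall>i<N. smooth_triangle M (u i)) \<and>
     (let z = (\<Sum>i<N. frag_cmul (a i) (frag_of (simplex_of_triangle (u i)))) in
        singular_relcycle 2 euclidean {} z \<and> A = homologous_rel_set 2 euclidean {} z) \<and>
     r = (\<Sum>i<N. of_int (a i) * triangle_integral M (chern_form M) (u i)))"

end

theory Submission
  imports Defs "HOL-Complex_Analysis.Cauchy_Integral_Formula"
begin

text \<open>In holomorphic charts the complex structures are constant, so closedness of the Kaehler form makes
  them parallel and the Christoffel forms complex bilinear. Hence a holomorphic curve is harmonic, and the
  Dirac operator is \<open>\<surd>2\<close> times the sum of the Dolbeault operators and of minus a divergence, which
  the divergence theorem identifies with the formal adjoints. Curvature preserves the type, whereas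
  \<open>T\<^sup>1\<^sup>,\<^sup>0M\<close> and \<open>T\<^sup>0\<^sup>,\<^sup>1M\<close> are orthogonal and Clifford multiplication exchanges the two halves of
  the spinor bundle; therefore \<open>\<langle>\<psi>, R\<^sup>f(X, \<psi>)\<rangle> = 0\<close> for each of the four spaces.

  No index theorem is needed for the existence of a non-zero element: if \<open>df\<close> does not vanish
  identically, then the conjugate of \<open>\<partial>f\<close> lies in the kernel of the adjoint of the second Dolbeault operator,
  and otherwise \<open>f\<close> is constant and the constant sections of \<open>f\<^sup>*T\<^sup>1\<^sup>,\<^sup>0M\<close> are in the kernel of the first.\<close>

section \<open>Calculus of \<open>C\<^sup>k\<close> functions\<close>

text \<open>Two features of the definitions shape the proof. First, \<open>complex_atlas\<close>
  grants only that transition maps have a complex linear derivative at each point, while the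
  transformation law of the Christoffel forms involves their second derivatives and the symmetry of
  these; both are won from Cauchy's inequality. As tangent spaces are modelled in one chart chosen
  pointwise and discontinuously, every operator must be recomputed in arbitrary charts before it can
  be differentiated again or shown smooth. Second, Christoffel forms, area measure, curvature term
  and formal adjoints are definite descriptions, so each needs existence and uniqueness: by the
  Koszul formula, by gluing over a finite Borel partition, by definiteness of the metric, and by
  testing an adjoint against its own difference from the divergence. In complex dimension one,
  traces over a frame \<open>e\<close>, \<open>\<i> * e\<close> only rescale under holomorphic
  coordinate changes, and terms complex bilinear in \<open>e\<close> drop out. This is why the
  divergence needs no Christoffel form of the surface, and why its product with the area density is
  a flat divergence.\<close>

lemma frechet_derivative_eqI: "(F has_derivative F') (at x) \<Longrightarrow> frechet_derivative F (at x) = F'"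
  using frechet_derivative_at by metis

text \<open>\<open>frechet_derivative\<close> is a choice among the derivatives at \<open>x\<close>,
  and both functions have the same ones, so even an unspecified value agrees where no derivative
  exists.\<close>

lemma frechet_derivative_cong_open:
  assumes "open X" "x \<in> X" "\<And>y. y \<in> X \<Longrightarrow> F y = G y"
  shows "frechet_derivative F (at x) = frechet_derivative G (at x)"
proof -
  have "(F has_derivative D) (at x) \<longleftrightarrow> (G has_derivative D) (at x)" for D
    using assms has_derivative_transform_within_open[of _ D x UNIV X] by metis
  then show ?thesis by (simp add: frechet_derivative_def)
qed

lemma Ck_on_cong:
  assumes "open X" "\<And>x. x \<in> X \<Longrightarrow> F x = G x"
  shows "Ck_on k X F \<longleftrightarrow> Ck_on k X G"
  using assms(2)
proof (induction k arbitrary: F G)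
  case 0
  then show ?case using continuous_on_cong by fastforce
next
  case (Suc k)
  have d: "F differentiable (at x) \<longleftrightarrow> G differentiable (at x)" if "x \<in> X" for x
    unfolding differentiable_def
    using has_derivative_transform_within_open[OF _ assms(1) that, of _ _ UNIV] Suc.prems by metis
  have "Ck_on k X (\<lambda>x. frechet_derivative F (at x) v) = Ck_on k X (\<lambda>x. frechet_derivative G (at x) v)" for v
    by (rule Suc.IH) (simp add: frechet_derivative_cong_open[OF assms(1) _ Suc.prems])
  then show ?case using d by simp
qed

lemma Ck_on_subset: "Ck_on k X F \<Longrightarrow> Y \<subseteq> X \<Longrightarrow> Ck_on k Y F"
  by (induction k arbitrary: F) (auto intro: continuous_on_subset)

lemma Ck_on_SucI:
  assumes "open X" "\<And>x. x \<in> X \<Longrightarrow> (F has_derivative F' x) (at x)" "\<And>v. Ck_on k X (\<lambda>x. F' x v)"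
  shows "Ck_on (Suc k) X F"
proof -
  have "Ck_on k X (\<lambda>x. frechet_derivative F (at x) v)" for v
    using assms(3)[of v] by (subst Ck_on_cong[OF assms(1)]) (auto simp: frechet_derivative_eqI[OF assms(2)])
  then show ?thesis using assms(2) by (auto simp: differentiable_def)
qed

lemma Ck_on_derivD: "Ck_on (Suc k) X F \<Longrightarrow> x \<in> X \<Longrightarrow> (F has_derivative frechet_derivative F (at x)) (at x)"
  by (simp add: frechet_derivative_works)

lemma Ck_on_pred: "Ck_on (Suc k) X F \<Longrightarrow> Ck_on k X F"
proof (induction k arbitrary: F)
  case 0
  then show ?case
    by (auto intro!: continuous_at_imp_continuous_on differentiable_imp_continuous_within)
next
  case (Suc k)
  then show ?case by simp
qed

lemma Ck_on_continuous: "Ck_on k X F \<Longrightarrow> continuous_on X F"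
  by (induction k) (use Ck_on_pred in auto)

lemma Ck_on_const: "open X \<Longrightarrow> Ck_on k X (\<lambda>x. c)"
proof (induction k arbitrary: c)
  case (Suc k)
  then show ?case by (intro Ck_on_SucI[where F'="\<lambda>x v. 0"]) auto
qed auto

lemma Ck_on_add: "open X \<Longrightarrow> Ck_on k X F \<Longrightarrow> Ck_on k X G \<Longrightarrow> Ck_on k X (\<lambda>x. F x + G x)"
proof (induction k arbitrary: F G)
  case (Suc k)
  show ?case
    by (rule Ck_on_SucI[OF Suc.prems(1) has_derivative_add[OF Ck_on_derivD Ck_on_derivD]])
       (use Suc in auto)
qed (auto intro: continuous_intros)

lemma Ck_on_sum: "open X \<Longrightarrow> (\<And>i. i \<in> I \<Longrightarrow> Ck_on k X (F i)) \<Longrightarrow> Ck_on k X (\<lambda>x. \<Sum>i\<in>I. F i x)"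
  by (induction I rule: infinite_finite_induct) (auto simp: Ck_on_const Ck_on_add)

lemma Ck_on_linear:
  assumes "bounded_linear L" "open X" "Ck_on k X F"
  shows "Ck_on k X (\<lambda>x. L (F x))"
  using assms(3)
proof (induction k arbitrary: F)
  case 0
  then show ?case using assms(1) by (auto intro: linear_continuous_on_compose simp: bounded_linear.linear
    bounded_linear.continuous_on)
next
  case (Suc k)
  show ?case
    by (rule Ck_on_SucI[OF assms(2) bounded_linear.has_derivative[OF assms(1) Ck_on_derivD]])
       (use Suc in auto)
qed

lemma (in bounded_bilinear) Ck_on_prod:
  assumes "open X" "Ck_on k X F" "Ck_on k X G"
  shows "Ck_on k X (\<lambda>x. prod (F x) (G x))"
  using assms(2,3)
proof (induction k arbitrary: F G)
  case 0
  then show ?case by (auto intro: continuous_on)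
next
  case (Suc k)
  show ?case
    by (rule Ck_on_SucI[OF assms(1) FDERIV[OF Ck_on_derivD Ck_on_derivD]])
       (use Suc assms(1) Ck_on_pred[OF Suc.prems(1)] Ck_on_pred[OF Suc.prems(2)] in \<open>auto intro!: Ck_on_add\<close>)
qed

text \<open>\<open>Ck_on\<close> speaks of the derivative in one fixed direction at a time, whereas
  the chain rule evaluates the derivative of \<open>G\<close> at the moving vector obtained from
  \<open>F\<close>. Expanding that vector in the basis restores fixed directions and leaves finite
  sums of products; this is why the middle space is Euclidean.\<close>

lemma Ck_on_compose:
  fixes F :: "'a::real_normed_vector \<Rightarrow> 'b::euclidean_space"
    and G :: "'b \<Rightarrow> 'c::real_normed_vector"
  assumes "open X" "open Y" "F ` X \<subseteq> Y" "Ck_on k X F" "Ck_on k Y G"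
  shows "Ck_on k X (\<lambda>x. G (F x))"
  using assms(4,5)
proof (induction k arbitrary: G)
  case 0
  then show ?case using assms(3) continuous_on_compose2[of Y G X F] by auto
next
  case (Suc k)
  let ?DF = "\<lambda>x. frechet_derivative F (at x)" and ?DG = "\<lambda>y. frechet_derivative G (at y)"
  have G: "(G has_derivative ?DG (F x)) (at (F x))" if "x \<in> X" for x
    using Ck_on_derivD[OF Suc.prems(2)] assms(3) that by auto
  have d: "((\<lambda>x. G (F x)) has_derivative (\<lambda>v. \<Sum>b\<in>Basis. (?DF x v \<bullet> b) *\<^sub>R ?DG (F x) b)) (at x)" if "x \<in> X" for x
  proof -
    have "linear (?DG (F x))" using G[OF that] has_derivative_linear by blast
    then have "?DG (F x) (?DF x v) = (\<Sum>b\<in>Basis. (?DF x v \<bullet> b) *\<^sub>R ?DG (F x) b)" for v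
      by (subst (2) euclidean_representation[symmetric]) (simp add: linear_sum linear_cmul)
    then show ?thesis
      using has_derivative_compose[OF Ck_on_derivD[OF Suc.prems(1) that] G[OF that]] by simp
  qed
  show ?case
  proof (rule Ck_on_SucI[OF assms(1) d])
    fix v
    have 1: "Ck_on k X (\<lambda>x. ?DG (F x) b)" for b
      by (rule Suc.IH[OF Ck_on_pred[OF Suc.prems(1)]]) (use Suc.prems(2) in simp)
    have 2: "Ck_on k X (\<lambda>x. ?DF x v)" using Suc.prems(1) by simp
    show "Ck_on k X (\<lambda>x. \<Sum>b\<in>Basis. (?DF x v \<bullet> b) *\<^sub>R ?DG (F x) b)"
      by (intro Ck_on_sum bounded_bilinear.Ck_on_prod[OF bounded_bilinear_scaleR]
          Ck_on_linear[OF bounded_linear_inner_left] assms(1) 1 2)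
  qed
qed

lemma Ck_on_inverse:
  fixes F :: "'a::real_normed_vector \<Rightarrow> real"
  assumes "open X" "Ck_on k X F" "\<And>x. x \<in> X \<Longrightarrow> F x \<noteq> 0"
  shows "Ck_on k X (\<lambda>x. inverse (F x))"
  using assms(2)
proof (induction k)
  case 0
  then show ?case using assms(3) by (auto intro: continuous_intros)
next
  case (Suc k)
  note m = bounded_bilinear.Ck_on_prod[OF bounded_bilinear_mult assms(1)]
  show ?case
  proof (rule Ck_on_SucI[OF assms(1) Deriv.has_derivative_inverse[OF assms(3) Ck_on_derivD[OF Suc.prems]]])
    fix v
    have 1: "Ck_on k X (\<lambda>x. inverse (F x))" by (rule Suc.IH[OF Ck_on_pred[OF Suc.prems]])
    have 2: "Ck_on k X (\<lambda>x. frechet_derivative F (at x) v)" using Suc.prems by simp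
    show "Ck_on k X (\<lambda>x. - (inverse (F x) * frechet_derivative F (at x) v * inverse (F x)))"
      by (intro Ck_on_linear[OF bounded_linear_minus[OF bounded_linear_ident] assms(1)] m 1 2)
  qed auto
qed

text \<open>Mere continuity of \<open>g\<close> is enough at a zero of \<open>h\<close>:
  \<open>(g y - g x) * h y\<close> is a product of something tending to zero and something of order
  \<open>norm (y - x)\<close>. It serves for factors not yet known to be differentiable, and for the
  kink of a bump function.\<close>

lemma has_derivative_mult_vanishing:
  fixes g :: "'a::real_normed_vector \<Rightarrow> real" and h :: "'a \<Rightarrow> real"
  assumes g: "continuous (at x) g" and h: "(h has_derivative h') (at x)" and h0: "h x = 0"
  shows "((\<lambda>y. g y * h y) has_derivative (\<lambda>v. g x * h' v)) (at x)"
proof -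
  interpret bounded_linear h' using h has_derivative_bounded_linear by blast
  obtain K where K: "K > 0" "\<And>v. norm (h' v) \<le> norm v * K" using pos_bounded by blast
  have "((\<lambda>y. (g y - g x) * h y) has_derivative (\<lambda>v. 0)) (at x)"
    unfolding has_derivative_at_alt
  proof (intro conjI allI impI)
    fix e :: real assume e: "e > 0"
    \<comment> \<open>Tolerance 1 is enough for \<open>h\<close>, since this only serves to bound
      \<open>h y\<close> by \<open>(K + 1) * norm (y - x)\<close>; the smallness comes from
      \<open>g\<close>.\<close>
    obtain d1 where d1: "d1 > 0" "\<And>y. norm (y - x) < d1 \<Longrightarrow> norm (h y - h x - h' (y - x)) \<le> 1 * norm (y - x)"
      using h unfolding has_derivative_at_alt by (meson zero_less_one)
    have "e / (K + 1) > 0" using e K by simp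
    then obtain d2 where d2: "d2 > 0" "\<And>y. norm (y - x) < d2 \<Longrightarrow> norm (g y - g x) < e / (K + 1)"
      using g unfolding continuous_at_eps_delta dist_norm by metis
    have "norm ((g y - g x) * h y - (g x - g x) * h x - 0) \<le> e * norm (y - x)" if "norm (y - x) < min d1 d2" for y
    proof -
      have a: "norm (h y - h' (y - x)) \<le> norm (y - x)" using d1(2)[of y] that h0 by simp
      have "norm (h y) \<le> norm (h' (y - x)) + norm (h y - h' (y - x))" by (rule norm_triangle_sub)
      also have "\<dots> \<le> (K + 1) * norm (y - x)" using a K(2)[of "y - x"] by (simp add: algebra_simps)
      finally have "norm (h y) \<le> (K + 1) * norm (y - x)" .
      moreover have "norm (g y - g x) \<le> e / (K + 1)" using d2(2)[of y] that by simp
      ultimately have "norm (g y - g x) * norm (h y) \<le> e / (K + 1) * ((K + 1) * norm (y - x))"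
        by (intro mult_mono) (use e K in auto)
      also have "\<dots> = e * norm (y - x)" using K by (simp add: field_simps)
      finally show ?thesis by (simp add: abs_mult)
    qed
    then show "\<exists>d>0. \<forall>y. norm (y - x) < d \<longrightarrow> norm ((g y - g x) * h y - (g x - g x) * h x - 0) \<le> e * norm (y - x)"
      using d1(1) d2(1) by (intro exI[of _ "min d1 d2"]) auto
  qed simp
  from has_derivative_add[OF this has_derivative_mult_right[OF h, of "g x"]]
  show ?thesis by (simp add: algebra_simps)
qed

lemma bilinear_expand_left:
  fixes B :: "'a::euclidean_space \<Rightarrow> 'b::real_vector \<Rightarrow> 'c::real_vector"
  assumes "bilinear B"
  shows "B v w = (\<Sum>b\<in>Basis. (v \<bullet> b) *\<^sub>R B b w)"
proof -
  have l: "linear (\<lambda>v. B v w)" using assms by (simp add: bilinear_def)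
  have "B v w = B (\<Sum>b\<in>Basis. (v \<bullet> b) *\<^sub>R b) w" by (simp add: euclidean_representation)
  also have "\<dots> = (\<Sum>b\<in>Basis. (v \<bullet> b) *\<^sub>R B b w)"
    by (simp only: linear_sum[OF l] linear_cmul[OF l])
  finally show ?thesis .
qed

lemma bilinear_expand_right:
  fixes B :: "'b::real_vector \<Rightarrow> 'a::euclidean_space \<Rightarrow> 'c::real_vector"
  assumes "bilinear B"
  shows "B w v = (\<Sum>b\<in>Basis. (v \<bullet> b) *\<^sub>R B w b)"
  using bilinear_expand_left[of "\<lambda>v w. B w v" v w] assms by (simp add: bilinear_def)

locale nondegenerate_form =
  fixes B :: "'e::euclidean_space \<Rightarrow> 'e \<Rightarrow> real"
  assumes bil: "bilinear B" and pos: "v \<noteq> 0 \<Longrightarrow> B v v > 0"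
begin

text \<open>The Riesz operator of the form: \<open>op v\<close> represents the functional
  \<open>B v\<close> in the Euclidean inner product.\<close>

definition op :: "'e \<Rightarrow> 'e" where "op v = (\<Sum>b\<in>Basis. B v b *\<^sub>R b)"

lemma op_inner: "op v \<bullet> w = B v w"
proof -
  have "op v \<bullet> w = (\<Sum>b\<in>Basis. (w \<bullet> b) * B v b)"
    by (simp add: op_def inner_sum_left mult.commute inner_commute[of w])
  also have "\<dots> = B v w" by (subst bilinear_expand_right[OF bil, of v w]) simp
  finally show ?thesis .
qed

lemma linear_op: "linear op"
  using bil unfolding bilinear_def op_def
  by (auto simp: linear_iff scaleR_left_distrib sum.distrib scaleR_sum_right)

lemma inj_op: "inj op"
proof (subst linear_injective_0[OF linear_op], intro allI impI)
  fix v assume "op v = 0"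
  then have "B v v = 0" using op_inner[of v v] by simp
  then show "v = 0" using pos by force
qed

lemma eq_from_form: "(\<And>w. B v w = B v' w) \<Longrightarrow> v = v'"
  by (rule injD[OF inj_op]) (simp add: op_def)

text \<open>In finite dimension the injective \<open>op\<close> is surjective, so it hits the vector
  representing \<open>L\<close>.\<close>

lemma solve_form: assumes "linear L" obtains v where "\<And>w. B v w = L w"
proof -
  interpret linear L by fact
  have "surj op" using linear_op inj_op linear_injective_imp_surjective by blast
  then obtain v where v: "op v = (\<Sum>b\<in>Basis. L b *\<^sub>R b)" by (metis surj_def)
  have "B v w = L w" for w
  proof -
    have "L w = L (\<Sum>b\<in>Basis. (w \<bullet> b) *\<^sub>R b)" by (simp add: euclidean_representation)
    also have "\<dots> = op v \<bullet> w"
      by (simp add: v sum scale inner_sum_left mult.commute inner_commute[of w])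
    finally show ?thesis by (simp add: op_inner)
  qed
  then show thesis using that by blast
qed

end

text \<open>Solutions of a positive definite linear system depend on a parameter as regularly as the
  system does: this replaces the smoothness of matrix inversion.\<close>
lemma Ck_on_solve:
  fixes B :: "'a::real_normed_vector \<Rightarrow> 'e::euclidean_space \<Rightarrow> 'e \<Rightarrow> real"
  assumes X: "open X" and form: "\<And>x. x \<in> X \<Longrightarrow> nondegenerate_form (B x)"
    and B: "\<And>v w. Ck_on k X (\<lambda>x. B x v w)" and G: "\<And>w. Ck_on k X (\<lambda>x. B x (G x) w)"
  shows "Ck_on k X G"
  using B G
proof (induction k arbitrary: G)
  case 0
  have "isCont G x" if x: "x \<in> X" for x
  proof -
    interpret nondegenerate_form "B x" by (rule form[OF x])
    obtain m where m: "m > 0" "\<And>v. m * norm v \<le> norm (op v)"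
      using linear_inj_bounded_below_pos[OF linear_op inj_op] by metis
    define k where "k y = (\<Sum>b\<in>Basis. norm (B y (G y) b - B x (G x) b))" for y
    define q where "q y = (\<Sum>b\<in>Basis. \<Sum>b'\<in>Basis. norm (B y b b' - B x b b'))" for y
    have at: "at x within X = at x" using X x by (rule at_within_open[rotated])
    have c1: "((\<lambda>y. B y (G y) b) \<longlongrightarrow> B x (G x) b) (at x)" for b
      using 0(2)[of b] x at by (auto simp: continuous_on_def)
    have c2: "((\<lambda>y. B y b b') \<longlongrightarrow> B x b b') (at x)" for b b'
      using 0(1)[of b b'] x at by (auto simp: continuous_on_def)
    have k0: "(k \<longlongrightarrow> 0) (at x)" unfolding k_def
      by (intro tendsto_null_sum tendsto_norm_zero LIM_zero c1)
    have q0: "(q \<longlongrightarrow> 0) (at x)" unfolding q_def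
      by (intro tendsto_null_sum tendsto_norm_zero LIM_zero c2)
    \<comment> \<open>\<open>op\<close> of \<open>G y - G x\<close> splits into the change of the
      right-hand side and the change of the form, the latter applied to \<open>G y - G x\<close> and
      to \<open>G x\<close>. The middle term is absorbed on the left below, once
      \<open>q y < m / 2\<close>.\<close>
    have est: "m * norm (G y - G x) \<le> k y + q y * norm (G y - G x) + q y * norm (G x)" if y: "y \<in> X" for y
    proof -
      interpret y: nondegenerate_form "B y" by (rule form[OF y])
      have Q: "norm (\<Sum>b\<in>Basis. (B y v b - B x v b) *\<^sub>R b) \<le> q y * norm v" for v
      proof -
        have "norm (B y v b - B x v b) \<le> (\<Sum>b'\<in>Basis. norm (B y b' b - B x b' b)) * norm v" for b
        proof -
          have "B y v b - B x v b = (\<Sum>b'\<in>Basis. (v \<bullet> b') * (B y b' b - B x b' b))"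
            by (simp add: bilinear_expand_left[OF y.bil, of v b] bilinear_expand_left[OF bil, of v b]
                sum_subtractf algebra_simps)
          also have "norm \<dots> \<le> (\<Sum>b'\<in>Basis. norm (B y b' b - B x b' b) * norm v)"
          proof (rule sum_norm_le)
            fix b' :: 'e assume "b' \<in> Basis"
            then have "\<bar>v \<bullet> b'\<bar> \<le> norm v" by (rule Basis_le_norm)
            from mult_right_mono[OF this abs_ge_zero[of "B y b' b - B x b' b"]]
            show "norm ((v \<bullet> b') * (B y b' b - B x b' b)) \<le> norm (B y b' b - B x b' b) * norm v"
              by (simp only: real_norm_def abs_mult mult.commute[of "norm v"])
          qed
          finally show ?thesis by (simp add: sum_distrib_right)
        qed
        then have "norm (\<Sum>b\<in>Basis. (B y v b - B x v b) *\<^sub>R b) \<le> (\<Sum>b\<in>Basis. (\<Sum>b'\<in>Basis. norm (B y b' b - B x b' b)) * norm v)"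
          by (intro sum_norm_le) auto
        also have "\<dots> = q y * norm v"
          unfolding q_def by (subst sum.swap) (simp add: sum_distrib_right)
        finally show ?thesis .
      qed
      have eq: "op (G y - G x) = (\<Sum>b\<in>Basis. (B y (G y) b - B x (G x) b) *\<^sub>R b)
          - (\<Sum>b\<in>Basis. (B y (G y - G x) b - B x (G y - G x) b) *\<^sub>R b)
          - (\<Sum>b\<in>Basis. (B y (G x) b - B x (G x) b) *\<^sub>R b)"
        unfolding op_def sum_subtractf[symmetric] scaleR_left_diff_distrib[symmetric]
        by (intro sum.cong refl) (simp add: bilinear_lsub[OF y.bil] bilinear_lsub[OF bil])
      have "norm (op (G y - G x)) \<le> norm (\<Sum>b\<in>Basis. (B y (G y) b - B x (G x) b) *\<^sub>R b)
          + norm (\<Sum>b\<in>Basis. (B y (G y - G x) b - B x (G y - G x) b) *\<^sub>R b)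
          + norm (\<Sum>b\<in>Basis. (B y (G x) b - B x (G x) b) *\<^sub>R b)"
        unfolding eq by (rule order_trans[OF norm_triangle_ineq4 add_mono[OF norm_triangle_ineq4 order_refl]])
      also have "\<dots> \<le> k y + q y * norm (G y - G x) + q y * norm (G x)"
        unfolding k_def by (intro add_mono Q sum_norm_le) auto
      finally show ?thesis using m(2)[of "G y - G x"] by linarith
    qed
    have "eventually (\<lambda>y. q y < m / 2) (at x)"
      using q0 m(1) by (intro order_tendstoD(2)[of q 0]) auto
    moreover have "eventually (\<lambda>y. y \<in> X) (at x)"
      using X x by (rule eventually_at_in_open')
    ultimately have ev: "eventually (\<lambda>y. norm (G y - G x) \<le> (2 / m) * (k y + q y * norm (G x))) (at x)"
    proof eventually_elim
      case (elim y)
      have "q y * norm (G y - G x) \<le> m / 2 * norm (G y - G x)"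
        using elim(1) by (intro mult_right_mono) auto
      then show ?case using est[OF elim(2)] m(1) by (simp add: field_simps)
    qed
    have "((\<lambda>y. (2 / m) * (k y + q y * norm (G x))) \<longlongrightarrow> (2/m) * (0 + 0 * norm (G x))) (at x)"
      by (intro tendsto_intros k0 q0)
    then have "((\<lambda>y. (2 / m) * (k y + q y * norm (G x))) \<longlongrightarrow> 0) (at x)" by simp
    from Lim_null_comparison[OF ev this] have "((\<lambda>y. G y - G x) \<longlongrightarrow> 0) (at x)" .
    then show ?thesis by (simp add: isCont_def LIM_zero_iff)
  qed
  then have "continuous_on X G" by (intro continuous_at_imp_continuous_on ballI)
  then show ?case by (simp only: Ck_on.simps)
next
  case (Suc k)
  have Gk: "Ck_on k X G"
    using Ck_on_pred[OF Suc.prems(1)] Ck_on_pred[OF Suc.prems(2)] by (rule Suc.IH)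
  let ?K = "\<lambda>w x. frechet_derivative (\<lambda>y. B y (G y) w) (at x)"
  let ?DB = "\<lambda>b w x. frechet_derivative (\<lambda>y. B y b w) (at x)"
  \<comment> \<open>What \<open>B x\<close> of the derivative of \<open>G\<close> has to be by the
    product rule: the derivative of the right-hand side minus that of the coefficients.\<close>
  define R where "R x v w = ?K w x v - (\<Sum>b\<in>Basis. (G x \<bullet> b) * ?DB b w x v)" for x v w
  have R: "((\<lambda>y. B x (G y) w) has_derivative (\<lambda>v. R x v w)) (at x)" if x: "x \<in> X" for x w
  proof -
    interpret nondegenerate_form "B x" by (rule form[OF x])
    have c: "continuous (at x) (\<lambda>y. G y \<bullet> b)" for b
      using Ck_on_continuous[OF Gk] x X by (auto intro!: continuous_intros simp: continuous_on_eq_continuous_at)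
    have d: "((\<lambda>y. B y b w - B x b w) has_derivative ?DB b w x) (at x)" for b
      using has_derivative_diff[OF Ck_on_derivD[OF Suc.prems(1)[of b w] x] has_derivative_const[of "B x b w"]] by simp
    \<comment> \<open>The subtracted sum is \<open>B y (G y) w - B x (G y) w\<close>. Its factors
      \<open>B y b w - B x b w\<close> vanish at \<open>x\<close>, so continuity of the coordinates
      of \<open>G\<close> suffices to differentiate it.\<close>
    have "((\<lambda>y. B y (G y) w - (\<Sum>b\<in>Basis. (G y \<bullet> b) * (B y b w - B x b w))) has_derivative (\<lambda>v. R x v w)) (at x)"
      unfolding R_def
      by (intro has_derivative_diff has_derivative_sum has_derivative_mult_vanishing
          Ck_on_derivD[OF Suc.prems(2) x] c d) simp
    moreover have "B y (G y) w - (\<Sum>b\<in>Basis. (G y \<bullet> b) * (B y b w - B x b w)) = B x (G y) w" if "y \<in> X" for y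
    proof -
      interpret y: nondegenerate_form "B y" by (rule form[OF that])
      show ?thesis
        by (simp add: bilinear_expand_left[OF y.bil, of "G y" w] bilinear_expand_left[OF bil, of "G y" w]
                sum_subtractf algebra_simps)
    qed
    ultimately show ?thesis
      by (rule has_derivative_transform_within_open[OF _ X x])
  qed
  have "\<exists>G'. (G has_derivative G') (at x) \<and> (\<forall>v w. B x (G' v) w = R x v w)" if x: "x \<in> X" for x
  proof -
    interpret nondegenerate_form "B x" by (rule form[OF x])
    \<comment> \<open>A left inverse of \<open>op\<close> recovers \<open>G y\<close> from the
      numbers \<open>B x (G y) b\<close>, which have just been differentiated.\<close>
    obtain L where L: "linear L" "L \<circ> op = id"
      using linear_injective_left_inverse[OF linear_op inj_op] by blast
    let ?r = "\<lambda>v. \<Sum>b\<in>Basis. R x v b *\<^sub>R b"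
    have "((\<lambda>y. L (op (G y))) has_derivative (\<lambda>v. L (?r v))) (at x)"
      unfolding op_def
      by (intro bounded_linear.has_derivative[OF linear_conv_bounded_linear[THEN iffD1, OF L(1)]]
          has_derivative_sum has_derivative_scaleR_left R x)
    moreover have "L (op v) = v" for v using L(2) by (metis comp_apply id_apply)
    ultimately have 1: "(G has_derivative (\<lambda>v. L (?r v))) (at x)" by simp
    have "((\<lambda>y. B x (G y) w) has_derivative (\<lambda>v. B x (L (?r v)) w)) (at x)" for w
    proof -
      have "linear (\<lambda>v. B x v w)" using bil by (simp add: bilinear_def)
      from bounded_linear.has_derivative[OF linear_conv_bounded_linear[THEN iffD1, OF this] 1] show ?thesis .
    qed
    from has_derivative_unique[OF this R[OF x]]
    have "B x (L (?r v)) w = R x v w" for v w by (rule fun_cong)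
    then show ?thesis by (intro exI[of _ "\<lambda>v. L (?r v)"] conjI allI 1)
  qed
  then obtain G' where G': "\<And>x. x \<in> X \<Longrightarrow> (G has_derivative G' x) (at x)"
    "\<And>x v w. x \<in> X \<Longrightarrow> B x (G' x v) w = R x v w" by metis
  have "Ck_on k X (\<lambda>x. R x v w)" for v w
  proof -
    have 1: "Ck_on k X (\<lambda>x. ?DB b w x v)" for b
      using Suc.prems(1)[of b w] by simp
    have 2: "Ck_on k X (\<lambda>x. ?K w x v)"
      using Suc.prems(2)[of w] by simp
    have 3: "Ck_on k X (\<lambda>x. \<Sum>b\<in>Basis. (G x \<bullet> b) * ?DB b w x v)"
      by (intro Ck_on_sum X bounded_bilinear.Ck_on_prod[OF bounded_bilinear_mult]
        Ck_on_linear[OF bounded_linear_inner_left X Gk] 1)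
    show ?thesis
      unfolding R_def diff_conv_add_uminus
      by (rule Ck_on_add[OF X 2 Ck_on_linear[OF bounded_linear_minus[OF bounded_linear_ident] X 3]])
  qed
  then have "Ck_on k X (\<lambda>x. B x (G' x v) w)" for v w
    by (subst Ck_on_cong[OF X, of _ "\<lambda>x. R x v w"]) (simp_all add: G'(2))
  \<comment> \<open>The derivative solves a system with the same forms and right-hand side
    \<open>R\<close>, so the induction hypothesis applies to it.\<close>
  then have "Ck_on k X (\<lambda>x. G' x v)" for v
    by (intro Suc.IH Ck_on_pred[OF Suc.prems(1)])
  then show ?case by (intro Ck_on_SucI[OF X G'(1)])
qed

section \<open>Complex differentiable maps are twice differentiable\<close>

text \<open>A real Euclidean space with an abstract \<open>J\<close>, so that the same results serve
  \<open>complex\<close> and \<open>complex ^ 'n\<close>.\<close>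

locale complex_structure =
  fixes J :: "'e::euclidean_space \<Rightarrow> 'e"
  assumes linear_J: "linear J" and J_J [simp]: "J (J v) = - v"
begin

lemma bounded_linear_J: "bounded_linear J"
  using linear_J by (simp add: linear_conv_bounded_linear)

lemma J_add [simp]: "J (v + w) = J v + J w" and J_diff [simp]: "J (v - w) = J v - J w"
  and J_scaleR [simp]: "J (r *\<^sub>R v) = r *\<^sub>R J v" and J_0 [simp]: "J 0 = 0" and J_minus [simp]: "J (- v) = - J v"
  using linear_J by (simp_all add: linear_add linear_diff linear_cmul linear_0 linear_neg)

definition line :: "'e \<Rightarrow> 'e \<Rightarrow> complex \<Rightarrow> 'e" where
  "line x v z = x + (Re z *\<^sub>R v + Im z *\<^sub>R J v)"

text \<open>The functional that is complex linear for \<open>J\<close> and has the coordinate along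
  \<open>b\<close> as its real part. Composed with \<open>line\<close>, it turns vector-valued maps
  into holomorphic functions of one variable.\<close>

definition cfun :: "'e \<Rightarrow> 'e \<Rightarrow> complex" where
  "cfun b y = Complex (y \<bullet> b) (- (J y \<bullet> b))"

lemma bounded_linear_cfun: "bounded_linear (cfun b)"
  unfolding linear_conv_bounded_linear[symmetric]
  by (auto simp: linear_iff cfun_def complex_eq_iff inner_add_left)

lemma cfun_line: "cfun b (Re z *\<^sub>R y + Im z *\<^sub>R J y) = z * cfun b y"
  by (simp add: cfun_def complex_eq_iff inner_add_left inner_diff_left)

definition J_bound :: real where "J_bound = (SOME K. K > 0 \<and> (\<forall>v. norm (J v) \<le> K * norm v))"

lemma J_bound: "J_bound > 0" "norm (J v) \<le> J_bound * norm v"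
proof -
  have "\<exists>K. K > 0 \<and> (\<forall>v. norm (J v) \<le> K * norm v)"
    using bounded_linear.pos_bounded[OF bounded_linear_J] by (metis mult.commute)
  from someI_ex[OF this] show "J_bound > 0" "norm (J v) \<le> J_bound * norm v"
    by (auto simp: J_bound_def)
qed

lemma norm_line: "norm (line x v z - x) \<le> cmod z * ((1 + J_bound) * norm v)"
proof -
  have "norm (line x v z - x) \<le> norm (Re z *\<^sub>R v) + norm (Im z *\<^sub>R J v)"
    by (simp add: line_def norm_triangle_ineq del: norm_scaleR)
  also have "\<dots> \<le> cmod z * norm v + cmod z * (J_bound * norm v)"
    unfolding norm_scaleR
    by (intro add_mono mult_mono abs_Re_le_cmod abs_Im_le_cmod J_bound(2) order_refl norm_ge_zero)
  finally show ?thesis by (simp add: algebra_simps)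
qed

lemma norm_cfun:
  assumes "b \<in> Basis"
  shows "cmod (cfun b y) \<le> (1 + J_bound) * norm y"
proof -
  have "cmod (cfun b y) \<le> \<bar>y \<bullet> b\<bar> + \<bar>J y \<bullet> b\<bar>"
    using cmod_le[of "cfun b y"] by (simp add: cfun_def)
  also have "\<dots> \<le> norm y + norm (J y)" using assms by (intro add_mono Basis_le_norm)
  finally show ?thesis using J_bound(2)[of y] by (simp add: algebra_simps)
qed

lemma norm_from_cfun:
  fixes B :: real
  assumes "\<And>b. b \<in> Basis \<Longrightarrow> cmod (cfun b y) \<le> B"
  shows "norm y \<le> DIM('e) * B"
proof -
  have "norm y \<le> (\<Sum>b\<in>Basis. \<bar>y \<bullet> b\<bar>)" by (rule norm_le_l1)
  also have "\<dots> \<le> (\<Sum>b\<in>(Basis :: 'e set). B)"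
  proof (rule sum_mono)
    fix b :: 'e assume "b \<in> Basis"
    then show "\<bar>y \<bullet> b\<bar> \<le> B"
      using abs_Re_le_cmod[of "cfun b y"] assms[of b] by (simp add: cfun_def)
  qed
  finally show ?thesis by simp
qed

end

text \<open>Increments \<open>inverse (real n)\<close> give a sequence of quotients, to which
  uniqueness of limits and dominated convergence can be applied. The term for \<open>n = 0\<close>
  is zero and does not affect the limit.\<close>

lemma directional_difference_quotient:
  fixes G :: "'a::real_normed_vector \<Rightarrow> 'b::real_normed_vector"
  assumes "(G has_derivative D) (at x)"
  shows "(\<lambda>n. real n *\<^sub>R (G (x + inverse (real n) *\<^sub>R v) - G x)) \<longlonglongrightarrow> D v"
proof -
  interpret bounded_linear D using assms by (rule has_derivative_bounded_linear)
  have "((\<lambda>t. x + t *\<^sub>R v) has_derivative (\<lambda>h. h *\<^sub>R v)) (at (0::real))"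
    by (auto intro!: derivative_eq_intros)
  from has_derivative_compose[OF this, of G D]
  have "((\<lambda>t. G (x + t *\<^sub>R v)) has_derivative (\<lambda>h. D (h *\<^sub>R v))) (at (0::real))"
    using assms by simp
  then have "((\<lambda>t. norm (G (x + t *\<^sub>R v) - G x - t *\<^sub>R D v) / norm t) \<longlongrightarrow> 0) (at (0::real))"
    by (simp add: has_derivative_iff_norm scaleR)
  moreover have "filterlim (\<lambda>n. inverse (real (Suc n))) (at 0) sequentially"
    using LIMSEQ_inverse_real_of_nat by (simp add: filterlim_at)
  ultimately have "(\<lambda>n. norm (G (x + inverse (real (Suc n)) *\<^sub>R v) - G x - inverse (real (Suc n)) *\<^sub>R D v)
       / norm (inverse (real (Suc n)))) \<longlonglongrightarrow> 0"
    by (rule filterlim_compose)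
  moreover have "norm (G (x + inverse (real (Suc n)) *\<^sub>R v) - G x - inverse (real (Suc n)) *\<^sub>R D v)
       / norm (inverse (real (Suc n))) = norm (real (Suc n) *\<^sub>R (G (x + inverse (real (Suc n)) *\<^sub>R v) - G x) - D v)" for n
  proof -
    have "real (Suc n) *\<^sub>R (G (x + inverse (real (Suc n)) *\<^sub>R v) - G x) - D v
      = real (Suc n) *\<^sub>R (G (x + inverse (real (Suc n)) *\<^sub>R v) - G x - inverse (real (Suc n)) *\<^sub>R D v)"
      by (simp add: scaleR_right_diff_distrib del: of_nat_Suc)
    then show ?thesis by (simp add: divide_inverse mult.commute del: of_nat_Suc)
  qed
  ultimately have "(\<lambda>n. real (Suc n) *\<^sub>R (G (x + inverse (real (Suc n)) *\<^sub>R v) - G x) - D v) \<longlonglongrightarrow> 0"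
    by (simp only: tendsto_norm_zero_iff)
  then show ?thesis
    by (subst filterlim_sequentially_Suc[symmetric]) (simp only: LIM_zero_iff)
qed

text \<open>Goursat's situation: a complex linear derivative at each point, with no continuity of
  the derivative assumed.\<close>

locale complex_differentiable =
  dom: complex_structure J1 + cod: complex_structure J2
  for J1 :: "'a::euclidean_space \<Rightarrow> 'a" and J2 :: "'b::euclidean_space \<Rightarrow> 'b" +
  fixes S :: "'a set" and F :: "'a \<Rightarrow> 'b" and F' :: "'a \<Rightarrow> 'a \<Rightarrow> 'b"
  assumes open_S: "open S"
    and deriv: "x \<in> S \<Longrightarrow> (F has_derivative F' x) (at x)"
    and J_linear: "x \<in> S \<Longrightarrow> F' x (J1 v) = J2 (F' x v)"
begin

lemma has_field_derivative_line:
  assumes "dom.line x v z \<in> S"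
  shows "((\<lambda>z. cod.cfun b (F (dom.line x v z))) has_field_derivative cod.cfun b (F' (dom.line x v z) v)) (at z)"
proof -
  let ?y = "dom.line x v z"
  interpret L: bounded_linear "F' ?y" using deriv[OF assms] by (rule has_derivative_bounded_linear)
  have "(dom.line x v has_derivative (\<lambda>h. Re h *\<^sub>R v + Im h *\<^sub>R J1 v)) (at z)"
    unfolding dom.line_def by (auto intro!: derivative_eq_intros)
  from has_derivative_compose[OF this deriv[OF assms]]
  have "((\<lambda>z. F (dom.line x v z)) has_derivative (\<lambda>h. Re h *\<^sub>R F' ?y v + Im h *\<^sub>R J2 (F' ?y v))) (at z)"
    by (simp add: L.add L.scaleR J_linear[OF assms])
  from bounded_linear.has_derivative[OF cod.bounded_linear_cfun[of b] this]
  have "((\<lambda>z. cod.cfun b (F (dom.line x v z))) has_derivative (\<lambda>h. h * cod.cfun b (F' ?y v))) (at z)"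
    by (simp only: cod.cfun_line)
  then show ?thesis by (simp add: has_field_derivative_def mult_commute_abs)
qed

text \<open>The factor 2 leaves room for a strict inclusion, and \<open>1 + norm v\<close> in place
  of \<open>norm v\<close> keeps the denominator positive when \<open>v = 0\<close>.\<close>

lemma line_in_ball:
  assumes "cmod z \<le> r / (2 * (1 + dom.J_bound) * (1 + norm v))" "r > 0"
  shows "dom.line x v z \<in> ball x r"
proof -
  have p: "(1 + dom.J_bound) > 0" using dom.J_bound(1) by linarith
  have q: "1 + norm v > 0" by (simp add: add_pos_nonneg)
  have "norm (dom.line x v z - x) \<le> cmod z * ((1 + dom.J_bound) * norm v)" by (rule dom.norm_line)
  also have "\<dots> \<le> r / (2 * (1 + dom.J_bound) * (1 + norm v)) * ((1 + dom.J_bound) * (1 + norm v))"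
    using p q assms by (intro mult_mono) auto
  also have "\<dots> = r / 2" using p q by (simp add: divide_simps)
  finally show ?thesis using assms(2) by (simp add: dist_norm norm_minus_commute)
qed

lemma holomorphic_line:
  assumes "dom.line x v ` U \<subseteq> S" "open U"
  shows "(\<lambda>z. cod.cfun b (F (dom.line x v z))) holomorphic_on U"
    "\<And>z. z \<in> U \<Longrightarrow> deriv (\<lambda>z. cod.cfun b (F (dom.line x v z))) z = cod.cfun b (F' (dom.line x v z) v)"
proof -
  have *: "((\<lambda>z. cod.cfun b (F (dom.line x v z))) has_field_derivative cod.cfun b (F' (dom.line x v z) v)) (at z)"
    if "z \<in> U" for z
    using that assms(1) by (intro has_field_derivative_line) auto
  show "(\<lambda>z. cod.cfun b (F (dom.line x v z))) holomorphic_on U"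
    unfolding holomorphic_on_open[OF assms(2)] using * by blast
  show "\<And>z. z \<in> U \<Longrightarrow> deriv (\<lambda>z. cod.cfun b (F (dom.line x v z))) z = cod.cfun b (F' (dom.line x v z) v)"
    using * by (rule DERIV_imp_deriv)
qed

text \<open>Cauchy's inequality on a disc in the complex line through \<open>x\<close> in direction
  \<open>v\<close>, for each functional \<open>cfun b\<close>. The bound is proportional to
  \<open>M\<close>, so uniformly small values force uniformly small derivatives.\<close>

lemma Cauchy_estimate:
  assumes "ball x r \<subseteq> S" "r > 0" "\<And>y. y \<in> ball x r \<Longrightarrow> norm (F y) \<le> M" "norm v \<le> 1"
  shows "norm (F' x v) \<le> 4 * DIM('b) * (1 + cod.J_bound) * (1 + dom.J_bound) / r * M"
proof -
  \<comment> \<open>The radius of \<open>line_in_ball\<close> for \<open>norm v = 1\<close>; the two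
    factors 2 make up the 4 in the bound.\<close>
  define \<rho> where "\<rho> = r / (2 * (1 + dom.J_bound) * 2)"
  have p: "1 + dom.J_bound > 0" "1 + cod.J_bound > 0" using dom.J_bound(1) cod.J_bound(1) by auto
  have \<rho>: "\<rho> > 0" using p assms(2) by (simp add: \<rho>_def)
  have inb: "dom.line x v z \<in> ball x r" if "cmod z \<le> \<rho>" for z
  proof (rule line_in_ball[OF _ assms(2)])
    have "1 + norm v > 0" by (simp add: add_pos_nonneg)
    then have "\<rho> \<le> r / (2 * (1 + dom.J_bound) * (1 + norm v))"
      unfolding \<rho>_def using p assms(2,4) by (intro divide_left_mono mult_left_mono) auto
    then show "cmod z \<le> r / (2 * (1 + dom.J_bound) * (1 + norm v))" using that by linarith
  qed
  have "cmod (cod.cfun b (F' x v)) \<le> (1 + cod.J_bound) * M / \<rho>" if b: "b \<in> Basis" for b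
  proof -
    let ?h = "\<lambda>z. cod.cfun b (F (dom.line x v z))"
    have hol: "?h holomorphic_on ball 0 \<rho>"
      using inb assms(1) by (intro holomorphic_line) auto
    have cont: "continuous_on (cball 0 \<rho>) ?h"
    proof (intro continuous_at_imp_continuous_on ballI)
      fix z :: complex assume "z \<in> cball 0 \<rho>"
      then have "dom.line x v z \<in> S" using inb[of z] assms(1) by auto
      then show "isCont ?h z" by (rule DERIV_isCont[OF has_field_derivative_line])
    qed
    have bd: "cmod (?h z) \<le> (1 + cod.J_bound) * M" if "cmod (0 - z) = \<rho>" for z
    proof -
      have "cmod (?h z) \<le> (1 + cod.J_bound) * norm (F (dom.line x v z))" by (rule cod.norm_cfun[OF b])
      also have "\<dots> \<le> (1 + cod.J_bound) * M"
        using assms(3)[OF inb[of z]] that p by (intro mult_left_mono) auto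
      finally show ?thesis .
    qed
    have "cmod ((deriv ^^ 1) ?h 0) \<le> fact 1 * ((1 + cod.J_bound) * M) / \<rho> ^ 1"
      by (rule Cauchy_inequality[OF hol cont \<rho> bd])
    moreover have "deriv ?h 0 = cod.cfun b (F' (dom.line x v 0) v)"
      using inb assms(1) \<rho> by (intro holomorphic_line(2)[where U="ball 0 \<rho>"]) auto
    moreover have "dom.line x v 0 = x" by (simp add: dom.line_def)
    ultimately show ?thesis by simp
  qed
  from cod.norm_from_cfun[OF this]
  have "norm (F' x v) \<le> DIM('b) * ((1 + cod.J_bound) * M / \<rho>)" .
  also have "\<dots> = 4 * DIM('b) * (1 + cod.J_bound) * (1 + dom.J_bound) / r * M"
    using p assms(2) by (simp add: \<rho>_def divide_simps)
  finally show ?thesis .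
qed

text \<open>\<open>t0\<close> and \<open>C\<close> are chosen before \<open>x\<close>: they depend
  only on \<open>r\<close>, \<open>M\<close> and \<open>v\<close>. This uniformity makes the
  difference quotients converge uniformly.\<close>

lemma Taylor_estimate:
  assumes "r > 0"
  shows "\<exists>t0>0. \<exists>C. \<forall>x t. ball x r \<subseteq> S \<longrightarrow> (\<forall>y\<in>ball x r. norm (F y) \<le> M) \<longrightarrow> \<bar>t\<bar> \<le> t0 \<longrightarrow>
    norm (F (x + t *\<^sub>R v) - F x - t *\<^sub>R F' x v) \<le> C * t\<^sup>2"
proof -
  define \<rho> where "\<rho> = r / (2 * (1 + dom.J_bound) * (1 + norm v))"
  have p: "1 + dom.J_bound > 0" "1 + cod.J_bound > 0" "1 + norm v > 0"
    using dom.J_bound(1) cod.J_bound(1) by (auto simp: add_pos_nonneg)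
  have \<rho>: "\<rho> > 0" using p assms by (simp add: \<rho>_def)
  define B where "B = (1 + cod.J_bound) * M"
  \<comment> \<open>Cauchy's bound for the second derivative, on discs of radius
    \<open>\<rho>/2\<close> about the points of the half disc; the leading 2 is
    \<open>fact 2\<close>.\<close>
  define C where "C = 2 * B / (\<rho>/2)^2"
  have main: "norm (F (x + t *\<^sub>R v) - F x - t *\<^sub>R F' x v) \<le> DIM('b) * C * t\<^sup>2"
    if x: "ball x r \<subseteq> S" and M: "\<And>y. y \<in> ball x r \<Longrightarrow> norm (F y) \<le> M" and t: "\<bar>t\<bar> \<le> \<rho>/4" for x t
  proof -
    have inb: "dom.line x v z \<in> ball x r" if "cmod z \<le> \<rho>" for z
      using that line_in_ball[OF _ assms] by (simp add: \<rho>_def)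
    have "cmod (cod.cfun b (F (x + t *\<^sub>R v) - F x - t *\<^sub>R F' x v)) \<le> C * t\<^sup>2" if b: "b \<in> Basis" for b
    proof -
      let ?h = "\<lambda>z. cod.cfun b (F (dom.line x v z))"
      have hol: "?h holomorphic_on ball 0 \<rho>"
        using inb x by (intro holomorphic_line) auto
      have bd: "cmod (?h z) \<le> B" if "cmod z < \<rho>" for z
      proof -
        have "cmod (?h z) \<le> (1 + cod.J_bound) * norm (F (dom.line x v z))" by (rule cod.norm_cfun[OF b])
        also have "\<dots> \<le> (1 + cod.J_bound) * M"
          using M[OF inb[of z]] that p by (intro mult_left_mono) auto
        finally show ?thesis by (simp add: B_def)
      qed
      have d2: "cmod ((deriv ^^ 2) ?h z) \<le> C" if z: "z \<in> ball 0 (\<rho>/2)" for z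
      proof -
        have sub: "cball z (\<rho>/2) \<subseteq> ball 0 \<rho>"
        proof
          fix w assume "w \<in> cball z (\<rho>/2)"
          then have "cmod (w - z) \<le> \<rho>/2" "cmod z < \<rho>/2" using z by (auto simp: dist_norm norm_minus_commute)
          then show "w \<in> ball 0 \<rho>" using norm_triangle_sub[of w z] by simp
        qed
        have "cmod ((deriv ^^ 2) ?h z) \<le> fact 2 * B / (\<rho>/2)^2"
        proof (rule Cauchy_inequality)
          show "?h holomorphic_on ball z (\<rho>/2)"
            by (rule holomorphic_on_subset[OF hol subset_trans[OF ball_subset_cball sub]])
          show "continuous_on (cball z (\<rho>/2)) ?h"
            by (rule continuous_on_subset[OF holomorphic_on_imp_continuous_on[OF hol] sub])
          show "cmod (?h w) \<le> B" if "cmod (z - w) = \<rho>/2" for w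
          proof -
            have "w \<in> cball z (\<rho>/2)" using that by (simp add: dist_norm)
            then have "w \<in> ball 0 \<rho>" using sub by blast
            then show ?thesis by (intro bd) simp
          qed
        qed (use \<rho> in simp)
        then show ?thesis by (simp add: C_def)
      qed
      have "cmod ((deriv ^^ 0) ?h (of_real t) - (\<Sum>i\<le>1. (deriv ^^ i) ?h 0 * (of_real t - 0) ^ i / fact i))
          \<le> C * cmod (of_real t - 0) ^ Suc 1 / fact 1"
      proof (rule complex_Taylor[where f="\<lambda>i. (deriv ^^ i) ?h" and S="ball 0 (\<rho>/2)" and n=1])
        show "((deriv ^^ i) ?h has_field_derivative (deriv ^^ Suc i) ?h z) (at z within ball 0 (\<rho>/2))"
          if "z \<in> ball 0 (\<rho>/2)" for z i
        proof -
          have "((deriv ^^ i) ?h) holomorphic_on ball 0 \<rho>"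
            by (rule holomorphic_higher_deriv[OF hol]) simp
          then have "((deriv ^^ i) ?h has_field_derivative deriv ((deriv ^^ i) ?h) z) (at z)"
            by (rule holomorphic_derivI) (use that \<rho> in auto)
          then show ?thesis by (simp add: has_field_derivative_at_within)
        qed
        show "cmod ((deriv ^^ Suc 1) ?h z) \<le> C" if "z \<in> ball 0 (\<rho>/2)" for z
          using d2[OF that] by (simp add: numeral_2_eq_2)
      qed (use t \<rho> in auto)
      moreover have "deriv ?h 0 = cod.cfun b (F' (dom.line x v 0) v)"
        using inb x \<rho> by (intro holomorphic_line(2)[where U="ball 0 \<rho>"]) auto
      moreover have "dom.line x v 0 = x" "dom.line x v (of_real t) = x + t *\<^sub>R v" by (simp_all add: dom.line_def)
      moreover have eq: "cod.cfun b (F (x + t *\<^sub>R v) - F x - t *\<^sub>R F' x v)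
          = cod.cfun b (F (x + t *\<^sub>R v)) - cod.cfun b (F x) - of_real t * cod.cfun b (F' x v)"
        using bounded_linear.linear[OF cod.bounded_linear_cfun[of b]]
        by (simp add: linear_diff linear_cmul scaleR_conv_of_real)
      ultimately show ?thesis
        unfolding eq by (simp add: diff_diff_eq power2_eq_square mult.commute)
    qed
    from cod.norm_from_cfun[OF this] show ?thesis by (simp add: mult.assoc)
  qed
  show ?thesis
  proof (intro exI conjI allI impI)
    show "0 < \<rho>/4" using \<rho> by simp
  qed (use main in blast)
qed

text \<open>The difference quotients of \<open>F\<close> along \<open>v\<close> are again complex
  differentiable and converge uniformly to \<open>F' x v\<close> by \<open>Taylor_estimate\<close>.
  By \<open>Cauchy_estimate\<close> their derivatives converge uniformly as well, so the limit is
  differentiable. The second conclusion keeps these derivatives visible, for the proof of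
  symmetry.\<close>

lemma second_derivative:
  assumes x0: "x0 \<in> S"
  obtains D where "((\<lambda>x. F' x v) has_derivative D) (at x0)"
    "\<And>w. (\<lambda>n. real n *\<^sub>R (F' (x0 + inverse (real n) *\<^sub>R v) w - F' x0 w)) \<longlonglongrightarrow> D w"
proof -
  obtain r0 where r0: "r0 > 0" "cball x0 r0 \<subseteq> S"
    using open_S x0 open_contains_cball by blast
  \<comment> \<open>Room for nested balls: \<open>x\<close> ranges over radius \<open>r\<close>,
    Cauchy's inequality uses another \<open>r\<close> about it, Taylor's estimate a further
    \<open>r\<close> about those points, and adding an increment shorter than \<open>r\<close> still
    stays within \<open>r0\<close>.\<close>
  define r where "r = r0 / 4"
  have r: "r > 0" and r04: "r0 = 4 * r" using r0 by (simp_all add: r_def)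
  have "continuous_on (cball x0 r0) F"
    using r0(2) by (intro continuous_at_imp_continuous_on ballI has_derivative_continuous[OF deriv]) blast
  then have "compact (F ` cball x0 r0)" by (intro compact_continuous_image compact_cball)
  from compact_imp_bounded[OF this] obtain M where "\<forall>y\<in>F ` cball x0 r0. norm y \<le> M"
    unfolding bounded_iff ..
  then have M: "norm (F y) \<le> M" if "y \<in> cball x0 r0" for y using that by blast
  from Taylor_estimate[OF r, of M v] obtain t0 C where t0: "t0 > 0"
    and C: "\<forall>x t. ball x r \<subseteq> S \<longrightarrow> (\<forall>y\<in>ball x r. norm (F y) \<le> M) \<longrightarrow> \<bar>t\<bar> \<le> t0 \<longrightarrow>
      norm (F (x + t *\<^sub>R v) - F x - t *\<^sub>R F' x v) \<le> C * t\<^sup>2"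
    by (elim exE conjE)
  \<comment> \<open>Dropping the first \<open>N\<close> indices makes every increment shorter than
    \<open>r\<close> and every step at most \<open>t0\<close>; the shift is undone at the end by
    \<open>LIMSEQ_offset\<close>.\<close>
  obtain N :: nat where N: "N > 0" "inverse (real N) < min t0 (r / (1 + norm v))"
    using t0 r ex_inverse_of_nat_less[of "min t0 (r / (1 + norm v))"] by (auto simp: add_pos_nonneg)
  have small: "inverse (real (n + N)) \<le> t0" "norm (inverse (real (n + N)) *\<^sub>R v) < r" for n
  proof -
    have le: "inverse (real (n + N)) \<le> inverse (real N)"
      using N(1) by (intro le_imp_inverse_le) auto
    then show "inverse (real (n + N)) \<le> t0" using N(2) by linarith
    have "norm (inverse (real (n + N)) *\<^sub>R v) \<le> inverse (real N) * norm v"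
      using mult_right_mono[OF le norm_ge_zero[of v]] by simp
    also have "\<dots> \<le> inverse (real N) * (1 + norm v)" by (intro mult_left_mono) auto
    also have "\<dots> < r" using N(2) by (simp add: pos_less_divide_eq add_pos_nonneg)
    finally show "norm (inverse (real (n + N)) *\<^sub>R v) < r" .
  qed
  define q where "q n x = real (n + N) *\<^sub>R (F (x + inverse (real (n + N)) *\<^sub>R v) - F x)" for n x
  define q' where "q' n x w = real (n + N) *\<^sub>R (F' (x + inverse (real (n + N)) *\<^sub>R v) w - F' x w)" for n x w
  have sub: "ball x r \<subseteq> cball x0 r0" if "x \<in> ball x0 (2 * r)" for x
  proof
    fix y assume "y \<in> ball x r"
    then have "dist x0 y < 2 * r + r" using that dist_triangle[of x0 y x] by simp
    then show "y \<in> cball x0 r0" using r r04 by simp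
  qed
  have est: "norm (q n x - F' x v) \<le> C * inverse (real (n + N))" if x: "x \<in> ball x0 (2 * r)" for n x
  proof -
    let ?t = "inverse (real (n + N))"
    have t: "real (n + N) * ?t = 1" using N(1) by simp
    have "norm (F (x + ?t *\<^sub>R v) - F x - ?t *\<^sub>R F' x v) \<le> C * ?t\<^sup>2"
      by (rule C[rule_format]) (use sub[OF x] r0(2) M small(1)[of n] in auto)
    then have "real (n + N) * norm (F (x + ?t *\<^sub>R v) - F x - ?t *\<^sub>R F' x v) \<le> real (n + N) * (C * ?t\<^sup>2)"
      by (rule mult_left_mono) simp
    moreover have "real (n + N) * (C * ?t\<^sup>2) = C * ?t * (real (n + N) * ?t)"
      by (simp only: power2_eq_square ac_simps)
    moreover have "q n x - F' x v = real (n + N) *\<^sub>R (F (x + ?t *\<^sub>R v) - F x - ?t *\<^sub>R F' x v)"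
      using t by (simp add: q_def scaleR_right_diff_distrib)
    ultimately show ?thesis by (simp only: t norm_scaleR mult_1_right abs_of_nat)
  qed
  have q': "(q n has_derivative q' n x) (at x)" if x: "x \<in> ball x0 (3 * r)" for n x
  proof -
    let ?t = "inverse (real (n + N))"
    have "dist x0 (x + ?t *\<^sub>R v) \<le> dist x0 x + norm (?t *\<^sub>R v)"
      by (metis add_diff_cancel_left' dist_norm dist_triangle norm_minus_commute)
    then have "dist x0 (x + ?t *\<^sub>R v) \<le> r0" using x small(2)[of n] r04 by (simp del: norm_scaleR)
    then have y: "x + ?t *\<^sub>R v \<in> S" using r0(2) by auto
    have x': "x \<in> S" using x r0(2) r r04 by (auto simp: subset_iff)
    have "((\<lambda>x. x + ?t *\<^sub>R v) has_derivative (\<lambda>h. h)) (at x)" by (auto intro!: derivative_eq_intros)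
    from has_derivative_compose[OF this deriv[OF y]]
    have "((\<lambda>x. F (x + ?t *\<^sub>R v)) has_derivative F' (x + ?t *\<^sub>R v)) (at x)" .
    from has_derivative_scaleR_right[OF has_derivative_diff[OF this deriv[OF x']]]
    show ?thesis unfolding q_def q'_def .
  qed
  define K where "K = 4 * DIM('b) * (1 + cod.J_bound) * (1 + dom.J_bound) / r"
  have K: "K \<ge> 0" using cod.J_bound(1) dom.J_bound(1) r by (simp add: K_def)
  have cauchy: "norm (q' m x w - q' n x w) \<le> K * (C * inverse (real (m + N)) + C * inverse (real (n + N)))"
    if x: "x \<in> ball x0 r" and w: "norm w \<le> 1" for m n x w
  proof -
    have in_S: "y + inverse (real (k + N)) *\<^sub>R v \<in> S" "y \<in> S" if "y \<in> ball x0 (2 * r)" for k y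
    proof -
      have "dist x0 (y + inverse (real (k + N)) *\<^sub>R v) \<le> dist x0 y + norm (inverse (real (k + N)) *\<^sub>R v)"
        by (metis add_diff_cancel_left' dist_norm dist_triangle norm_minus_commute)
      then have "dist x0 (y + inverse (real (k + N)) *\<^sub>R v) \<le> r0" "dist x0 y \<le> r0"
        using that small(2)[of k] r r04 by (simp_all del: norm_scaleR)
      then show "y + inverse (real (k + N)) *\<^sub>R v \<in> S" "y \<in> S" using r0(2) by (auto simp only: mem_cball subset_iff)
    qed
    \<comment> \<open>The difference of two quotients is itself complex differentiable, so its small
      size, known from \<open>est\<close>, bounds its derivative.\<close>
    interpret D: complex_differentiable J1 J2 "ball x0 (2 * r)" "\<lambda>x. q m x - q n x" "\<lambda>x w. q' m x w - q' n x w"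
    proof unfold_locales
      fix y assume y: "y \<in> ball x0 (2 * r)"
      then have "y \<in> ball x0 (3 * r)" using r by simp
      from has_derivative_diff[OF q'[OF this] q'[OF this]]
      show "((\<lambda>x. q m x - q n x) has_derivative (\<lambda>w. q' m y w - q' n y w)) (at y)" .
      show "q' m y (J1 w) - q' n y (J1 w) = J2 (q' m y w - q' n y w)" for w
        by (simp only: q'_def J_linear[OF in_S(1)[OF y]] J_linear[OF in_S(2)[OF y]] cod.J_diff cod.J_scaleR)
    qed simp
    have "norm (q' m x w - q' n x w) \<le> 4 * DIM('b) * (1 + cod.J_bound) * (1 + dom.J_bound) / r *
      (C * inverse (real (m + N)) + C * inverse (real (n + N)))"
    proof (rule D.Cauchy_estimate)
      show sub': "ball x r \<subseteq> ball x0 (2 * r)"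
      proof
        fix y assume "y \<in> ball x r"
        then show "y \<in> ball x0 (2 * r)" using x dist_triangle[of x0 y x] by simp
      qed
      show "norm (q m y - q n y) \<le> C * inverse (real (m + N)) + C * inverse (real (n + N))" if "y \<in> ball x r" for y
      proof -
        have "norm (q m y - q n y) \<le> norm (q m y - F' y v) + norm (q n y - F' y v)"
          by (metis norm_triangle_ineq4 diff_diff_eq2 diff_add_cancel)
        then show ?thesis using est[of y m] est[of y n] that sub' by (auto simp: subset_iff)
      qed
    qed (use r w in auto)
    then show ?thesis by (simp add: K_def)
  qed
  define d where "d n = C * inverse (real (n + N))" for n
  have d: "d \<longlonglongrightarrow> 0" unfolding d_def
    using tendsto_mult_right_zero[OF LIMSEQ_ignore_initial_segment[OF lim_inverse_n]] by blast
  have cauchy': "norm (q' m x w - q' n x w) \<le> K * (d m + d n) * norm w" if x: "x \<in> ball x0 r" for m n x w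
  proof (cases "w = 0")
    case False
    have "x \<in> ball x0 (3 * r)" using x r by simp
    from has_derivative_linear[OF q'[OF this]] have l: "linear (q' k x)" for k .
    let ?u = "inverse (norm w) *\<^sub>R w"
    have w: "w = norm w *\<^sub>R ?u" using False by simp
    have "q' m x w - q' n x w = norm w *\<^sub>R (q' m x ?u - q' n x ?u)"
      by (subst w, subst (2) w) (simp only: linear_cmul[OF l] scaleR_right_diff_distrib)
    moreover have "norm (q' m x ?u - q' n x ?u) \<le> K * (d m + d n)"
      unfolding d_def by (rule cauchy[OF x]) (use False in simp)
    ultimately show ?thesis
      by (simp add: mult.commute mult_left_mono)
  next
    case True
    have "x \<in> ball x0 (3 * r)" using x r by simp
    from has_derivative_linear[OF q'[OF this]] have l: "linear (q' k x)" for k .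
    show ?thesis using True linear_0[OF l] by simp
  qed
  define g' where "g' x w = lim (\<lambda>n. q' n x w)" for x w
  have lim: "(\<lambda>n. q' n x w) \<longlonglongrightarrow> g' x w" if x: "x \<in> ball x0 r" for x w
  proof -
    have d': "(\<lambda>n. K * d n * norm w) \<longlonglongrightarrow> 0"
      using tendsto_mult_left_zero[OF tendsto_mult_right_zero[OF d, of K], of "norm w"] by simp
    have "Cauchy (\<lambda>n. q' n x w)"
    proof (rule CauchyI)
      fix e :: real assume "e > 0"
      then have "eventually (\<lambda>n. K * d n * norm w < e / 2) sequentially"
        by (intro order_tendstoD(2)[OF d']) simp
      then obtain n0 where n0: "\<And>n. n \<ge> n0 \<Longrightarrow> K * d n * norm w < e / 2"
        unfolding eventually_sequentially by blast
      have "norm (q' m x w - q' n x w) < e" if "m \<ge> n0" "n \<ge> n0" for m n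
        using cauchy'[OF x, of m w n] n0[OF that(1)] n0[OF that(2)] by (simp add: algebra_simps)
      then show "\<exists>M. \<forall>m\<ge>M. \<forall>n\<ge>M. norm (q' m x w - q' n x w) < e" by blast
    qed
    then show ?thesis unfolding g'_def by (simp add: Cauchy_convergent_iff convergent_LIMSEQ_iff)
  qed
  have bound: "norm (q' n x w - g' x w) \<le> K * d n * norm w" if x: "x \<in> ball x0 r" for n x w
  proof (rule LIMSEQ_le)
    show "(\<lambda>m. norm (q' n x w - q' m x w)) \<longlonglongrightarrow> norm (q' n x w - g' x w)"
      by (intro tendsto_intros lim[OF x])
    have "(\<lambda>m. K * (d n + d m) * norm w) \<longlonglongrightarrow> K * (d n + 0) * norm w"
      by (intro tendsto_intros d)
    then show "(\<lambda>m. K * (d n + d m) * norm w) \<longlonglongrightarrow> K * d n * norm w" by simp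
    show "\<exists>N. \<forall>m\<ge>N. norm (q' n x w - q' m x w) \<le> K * (d n + d m) * norm w"
      using cauchy'[OF x] by blast
  qed
  have limv: "(\<lambda>n. q n x) \<longlonglongrightarrow> F' x v" if x: "x \<in> ball x0 r" for x
  proof -
    have "x \<in> ball x0 (2 * r)" using x r by simp
    from est[OF this] have "norm (q n x - F' x v) \<le> d n" for n by (simp add: d_def)
    then have "(\<lambda>n. q n x - F' x v) \<longlonglongrightarrow> 0"
      by (intro Lim_null_comparison[OF _ d] always_eventually allI)
    then show ?thesis by (rule LIM_zero_cancel)
  qed
  have derf: "(q n has_derivative q' n x) (at x within ball x0 r)" if "x \<in> ball x0 r" for n x
  proof -
    have "x \<in> ball x0 (3 * r)" using that r by simp
    from q'[OF this] show ?thesis by (rule has_derivative_at_withinI)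
  qed
  have nle: "\<forall>\<^sub>F n in sequentially. \<forall>x\<in>ball x0 r. \<forall>h. norm (q' n x h - g' x h) \<le> e * norm h" if e: "e > 0" for e
  proof -
    have "(\<lambda>n. K * d n) \<longlonglongrightarrow> 0" by (rule tendsto_mult_right_zero[OF d])
    then have "eventually (\<lambda>n. K * d n < e) sequentially" using e by (rule order_tendstoD(2))
    then show ?thesis
    proof eventually_elim
      case (elim n)
      show ?case
      proof (intro ballI allI)
        fix x h assume "x \<in> ball x0 r"
        from bound[OF this] have "norm (q' n x h - g' x h) \<le> K * d n * norm h" .
        also have "\<dots> \<le> e * norm h" using elim by (intro mult_right_mono) auto
        finally show "norm (q' n x h - g' x h) \<le> e * norm h" .
      qed
    qed
  qed
  have x0r: "x0 \<in> ball x0 r" using r by simp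
  note has_derivative_sequence[OF convex_ball derf nle x0r limv[OF x0r]]
  then obtain g where g: "\<And>x. x \<in> ball x0 r \<Longrightarrow> (\<lambda>n. q n x) \<longlonglongrightarrow> g x"
    "\<And>x. x \<in> ball x0 r \<Longrightarrow> (g has_derivative g' x) (at x within ball x0 r)" by blast
  have gF: "g x = F' x v" if "x \<in> ball x0 r" for x
    by (rule LIMSEQ_unique[OF g(1)[OF that] limv[OF that]])
  have "(g has_derivative g' x0) (at x0)"
    using g(2)[OF x0r] at_within_open[OF x0r open_ball] by simp
  then have "((\<lambda>x. F' x v) has_derivative g' x0) (at x0)"
    by (rule has_derivative_transform_within_open[OF _ open_ball x0r gF])
  moreover have "(\<lambda>n. real n *\<^sub>R (F' (x0 + inverse (real n) *\<^sub>R v) w - F' x0 w)) \<longlonglongrightarrow> g' x0 w" for w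
    using lim[OF x0r, of w] unfolding q'_def by (rule LIMSEQ_offset)
  ultimately show thesis by (rule that)
qed

text \<open>Both sides are the limit of the same difference quotients, those of
  \<open>F' x w\<close> along \<open>v\<close>: one by \<open>second_derivative\<close>, the other
  by differentiability of \<open>F' x w\<close>.\<close>

lemma symmetric_second_derivative:
  assumes x0: "x0 \<in> S"
  shows "(\<lambda>x. F' x v) differentiable (at x0)"
    "frechet_derivative (\<lambda>x. F' x v) (at x0) w = frechet_derivative (\<lambda>x. F' x w) (at x0) v"
proof -
  obtain D where D: "((\<lambda>x. F' x v) has_derivative D) (at x0)"
    "\<And>w. (\<lambda>n. real n *\<^sub>R (F' (x0 + inverse (real n) *\<^sub>R v) w - F' x0 w)) \<longlonglongrightarrow> D w"
    using second_derivative[OF x0, of v] by blast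
  obtain E where E: "((\<lambda>x. F' x w) has_derivative E) (at x0)"
    using second_derivative[OF x0, of w] by blast
  have "D w = E v"
    using D(2)[of w] directional_difference_quotient[OF E, of v] LIMSEQ_unique by blast
  then show "(\<lambda>x. F' x v) differentiable (at x0)"
    "frechet_derivative (\<lambda>x. F' x v) (at x0) w = frechet_derivative (\<lambda>x. F' x w) (at x0) v"
    using D(1) E by (auto simp: frechet_derivative_eqI differentiable_def)
qed

end

section \<open>Charts of a complex manifold\<close>

lemma smooth_on_has_derivative:
  "smooth_on X F \<Longrightarrow> x \<in> X \<Longrightarrow> (F has_derivative frechet_derivative F (at x)) (at x)"
  unfolding smooth_on_def using Ck_on_derivD[of 0] by blast

lemma bilinear_expand:
  fixes B :: "'a::euclidean_space \<Rightarrow> 'b::euclidean_space \<Rightarrow> 'c::real_vector"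
  assumes "bilinear B"
  shows "B v w = (\<Sum>i\<in>Basis. \<Sum>j\<in>Basis. ((v \<bullet> i) * (w \<bullet> j)) *\<^sub>R B i j)"
proof -
  have "(v \<bullet> i) *\<^sub>R B i w = (\<Sum>j\<in>Basis. ((v \<bullet> i) * (w \<bullet> j)) *\<^sub>R B i j)" for i
    unfolding bilinear_expand_right[OF assms, of i w] by (simp only: scaleR_sum_right scaleR_scaleR)
  then show ?thesis unfolding bilinear_expand_left[OF assms, of v w] by (simp only:)
qed

text \<open>\<open>B\<close> is known to be differentiable only with both arguments frozen.
  Expansion in the basis reduces moving arguments to finite sums of products with frozen
  ones.\<close>

lemma bilinear_family_has_derivative:
  fixes B :: "'b::real_normed_vector \<Rightarrow> 'e::euclidean_space \<Rightarrow> 'e \<Rightarrow> 'f::real_normed_vector"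
  assumes Y: "open Y" "\<phi> x \<in> Y" and bil: "\<And>y. y \<in> Y \<Longrightarrow> bilinear (B y)"
    and B: "\<And>v w. ((\<lambda>y. B y v w) has_derivative B' v w) (at (\<phi> x))"
    and \<phi>: "(\<phi> has_derivative \<phi>') (at x)" and a: "(a has_derivative a') (at x)" and b: "(b has_derivative b') (at x)"
  shows "((\<lambda>z. B (\<phi> z) (a z) (b z)) has_derivative
    (\<lambda>u. B' (a x) (b x) (\<phi>' u) + B (\<phi> x) (a' u) (b x) + B (\<phi> x) (a x) (b' u))) (at x)"
proof -
  have ex: "B y v w = (\<Sum>i\<in>Basis. \<Sum>j\<in>Basis. ((v \<bullet> i) * (w \<bullet> j)) *\<^sub>R B y i j)" if "y \<in> Y" for y v w
    by (rule bilinear_expand[OF bil[OF that]])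
  have ex': "B' v w u = (\<Sum>i\<in>Basis. \<Sum>j\<in>Basis. ((v \<bullet> i) * (w \<bullet> j)) *\<^sub>R B' i j u)" for v w u
  proof -
    have "((\<lambda>y. \<Sum>i\<in>Basis. \<Sum>j\<in>Basis. ((v \<bullet> i) * (w \<bullet> j)) *\<^sub>R B y i j) has_derivative
      (\<lambda>u. \<Sum>i\<in>Basis. \<Sum>j\<in>Basis. ((v \<bullet> i) * (w \<bullet> j)) *\<^sub>R B' i j u)) (at (\<phi> x))"
      by (intro has_derivative_sum has_derivative_scaleR_right B)
    then have "((\<lambda>y. B y v w) has_derivative
      (\<lambda>u. \<Sum>i\<in>Basis. \<Sum>j\<in>Basis. ((v \<bullet> i) * (w \<bullet> j)) *\<^sub>R B' i j u)) (at (\<phi> x))"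
      by (rule has_derivative_transform_within_open[OF _ Y]) (rule ex[symmetric])
    from has_derivative_unique[OF B[of v w] this] show ?thesis by (rule fun_cong)
  qed
  have c: "((\<lambda>z. B (\<phi> z) i j) has_derivative (\<lambda>u. B' i j (\<phi>' u))) (at x)" for i j
    by (rule has_derivative_compose[OF \<phi> B])
  have 1: "((\<lambda>z. \<Sum>i\<in>Basis. \<Sum>j\<in>Basis. ((a z \<bullet> i) * (b z \<bullet> j)) *\<^sub>R B (\<phi> z) i j) has_derivative
      (\<lambda>u. \<Sum>i\<in>Basis. \<Sum>j\<in>Basis. ((a x \<bullet> i) * (b x \<bullet> j)) *\<^sub>R B' i j (\<phi>' u)
        + ((a x \<bullet> i) * (b' u \<bullet> j) + (a' u \<bullet> i) * (b x \<bullet> j)) *\<^sub>R B (\<phi> x) i j)) (at x)"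
    by (intro has_derivative_sum has_derivative_scaleR has_derivative_mult has_derivative_inner_left a b c)
  have 2: "(\<Sum>i\<in>Basis. \<Sum>j\<in>Basis. ((a x \<bullet> i) * (b x \<bullet> j)) *\<^sub>R B' i j (\<phi>' u)
        + ((a x \<bullet> i) * (b' u \<bullet> j) + (a' u \<bullet> i) * (b x \<bullet> j)) *\<^sub>R B (\<phi> x) i j)
     = B' (a x) (b x) (\<phi>' u) + B (\<phi> x) (a' u) (b x) + B (\<phi> x) (a x) (b' u)" for u
    unfolding ex'[of "a x" "b x"] ex[OF Y(2), of "a' u" "b x"] ex[OF Y(2), of "a x" "b' u"]
    by (simp add: scaleR_left_distrib sum.distrib algebra_simps)
  have "\<exists>Z. open Z \<and> x \<in> Z \<and> (\<forall>z\<in>Z. \<phi> z \<in> Y)"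
    using has_derivative_continuous[OF \<phi>] Y unfolding continuous_at_open by simp
  then obtain Z where Z: "open Z" "x \<in> Z" and "\<forall>z\<in>Z. \<phi> z \<in> Y" by (elim exE conjE)
  then have ZY: "\<phi> z \<in> Y" if "z \<in> Z" for z using that by (rule_tac bspec)
  have "((\<lambda>z. B (\<phi> z) (a z) (b z)) has_derivative
     (\<lambda>u. \<Sum>i\<in>Basis. \<Sum>j\<in>Basis. ((a x \<bullet> i) * (b x \<bullet> j)) *\<^sub>R B' i j (\<phi>' u)
        + ((a x \<bullet> i) * (b' u \<bullet> j) + (a' u \<bullet> i) * (b x \<bullet> j)) *\<^sub>R B (\<phi> x) i j)) (at x)"
    by (rule has_derivative_transform_within_open[OF 1 Z]) (rule ex[OF ZY, symmetric])
  then show ?thesis unfolding 2 .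
qed

lemma Ck_on_bilinear_family:
  fixes B :: "'b::euclidean_space \<Rightarrow> 'e::euclidean_space \<Rightarrow> 'e \<Rightarrow> 'f::real_normed_vector"
    and \<phi> :: "'a::real_normed_vector \<Rightarrow> 'b"
  assumes X: "open X" and Y: "open Y" "\<phi> ` X \<subseteq> Y" and bil: "\<And>y. y \<in> Y \<Longrightarrow> bilinear (B y)"
    and B: "\<And>v w. Ck_on k Y (\<lambda>y. B y v w)"
    and \<phi>: "Ck_on k X \<phi>" and a: "Ck_on k X a" and b: "Ck_on k X b"
  shows "Ck_on k X (\<lambda>z. B (\<phi> z) (a z) (b z))"
proof -
  have ex: "B (\<phi> z) (a z) (b z) = (\<Sum>i\<in>Basis. \<Sum>j\<in>Basis. (a z \<bullet> i) *\<^sub>R (b z \<bullet> j) *\<^sub>R B (\<phi> z) i j)" if "z \<in> X" for z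
  proof -
    have "\<phi> z \<in> Y" using that Y(2) by blast
    note b = bil[OF this]
    show ?thesis
      unfolding bilinear_expand[OF b, of "a z"] by (simp only: scaleR_scaleR)
  qed
  have "Ck_on k X (\<lambda>z. \<Sum>i\<in>Basis. \<Sum>j\<in>Basis. (a z \<bullet> i) *\<^sub>R (b z \<bullet> j) *\<^sub>R B (\<phi> z) i j)"
    by (intro Ck_on_sum X bounded_bilinear.Ck_on_prod[OF bounded_bilinear_scaleR]
        Ck_on_linear[OF bounded_linear_inner_left] a b Ck_on_compose[OF X Y \<phi>] B)
  then show ?thesis by (rule Ck_on_cong[THEN iffD2, OF X ex, rotated])
qed

locale complex_manifold = complex_structure J
  for J :: "'e::euclidean_space \<Rightarrow> 'e" +
  fixes X :: "('p::t2_space, 'e) riem_mfd"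
  assumes complex_atlas: "complex_atlas J (atlas X)"
begin

definition tr :: "('p, 'e) chart \<Rightarrow> ('p, 'e) chart \<Rightarrow> 'e \<Rightarrow> 'e" where
  "tr c d = snd d \<circ> chart_inv c"

definition dtr :: "('p, 'e) chart \<Rightarrow> ('p, 'e) chart \<Rightarrow> 'e \<Rightarrow> 'e \<Rightarrow> 'e" where
  "dtr c d x = frechet_derivative (tr c d) (at x)"

definition d2tr :: "('p, 'e) chart \<Rightarrow> ('p, 'e) chart \<Rightarrow> 'e \<Rightarrow> 'e \<Rightarrow> 'e \<Rightarrow> 'e" where
  "d2tr c d x v w = frechet_derivative (\<lambda>y. dtr c d y v) (at x) w"

lemma open_chart: "c \<in> atlas X \<Longrightarrow> open (fst c)" and open_chart_image: "c \<in> atlas X \<Longrightarrow> open (snd c ` fst c)"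
  and homeo: "c \<in> atlas X \<Longrightarrow> homeomorphism (fst c) (snd c ` fst c) (snd c) (chart_inv c)"
  using complex_atlas by (simp_all add: complex_atlas_def)

lemma chart_inv_snd [simp]: "c \<in> atlas X \<Longrightarrow> p \<in> fst c \<Longrightarrow> chart_inv c (snd c p) = p"
  using homeo by (rule homeomorphism_apply1)

lemma snd_chart_inv: "c \<in> atlas X \<Longrightarrow> x \<in> snd c ` fst c \<Longrightarrow> snd c (chart_inv c x) = x"
  by auto

lemma chart_inv_in: "c \<in> atlas X \<Longrightarrow> x \<in> snd c ` fst c \<Longrightarrow> chart_inv c x \<in> fst c"
  by auto

lemma chart_image_Int:
  assumes "c \<in> atlas X"
  shows "snd c ` (fst c \<inter> W) = snd c ` fst c \<inter> chart_inv c -` W"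
  using assms by (auto simp: image_iff)

lemma open_chart_image_Int:
  assumes c: "c \<in> atlas X" and W: "open W"
  shows "open (snd c ` (fst c \<inter> W))"
  unfolding chart_image_Int[OF c]
  by (rule continuous_open_preimage[OF homeomorphism_cont2[OF homeo[OF c]] open_chart_image[OF c] W])

lemma chart_at: "chart_at X p \<in> atlas X" "p \<in> fst (chart_at X p)"
proof -
  have "p \<in> (\<Union>c\<in>atlas X. fst c)" using complex_atlas by (simp add: complex_atlas_def)
  then have "\<exists>c. c \<in> atlas X \<and> p \<in> fst c" by blast
  from someI_ex[OF this] show "chart_at X p \<in> atlas X" "p \<in> fst (chart_at X p)"
    by (simp_all add: chart_at_def)
qed

lemma overlap_open: "c \<in> atlas X \<Longrightarrow> d \<in> atlas X \<Longrightarrow> open (snd c ` (fst c \<inter> fst d))"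
  by (intro open_chart_image_Int open_chart)

lemma tr_snd: "c \<in> atlas X \<Longrightarrow> p \<in> fst c \<Longrightarrow> tr c d (snd c p) = snd d p"
  by (simp add: tr_def)

lemma complex_differentiable_tr:
  assumes "c \<in> atlas X" "d \<in> atlas X"
  shows "complex_differentiable J J (snd c ` (fst c \<inter> fst d)) (tr c d) (dtr c d)"
proof unfold_locales
  show "open (snd c ` (fst c \<inter> fst d))" using assms by (rule overlap_open)
  fix x assume "x \<in> snd c ` (fst c \<inter> fst d)"
  then obtain L where L: "(tr c d has_derivative L) (at x)" "\<And>v. L (J v) = J (L v)"
    using complex_atlas assms unfolding complex_atlas_def tr_def by blast
  then have "dtr c d x = L" by (simp add: dtr_def frechet_derivative_eqI)
  with L show "(tr c d has_derivative dtr c d x) (at x)" "dtr c d x (J v) = J (dtr c d x v)" for v by auto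
qed

lemma tr_has_derivative:
  "\<lbrakk>c \<in> atlas X; d \<in> atlas X; x \<in> snd c ` (fst c \<inter> fst d)\<rbrakk> \<Longrightarrow> (tr c d has_derivative dtr c d x) (at x)"
  by (rule complex_differentiable.deriv[OF complex_differentiable_tr])

lemma dtr_J: "\<lbrakk>c \<in> atlas X; d \<in> atlas X; x \<in> snd c ` (fst c \<inter> fst d)\<rbrakk> \<Longrightarrow> dtr c d x (J v) = J (dtr c d x v)"
  by (rule complex_differentiable.J_linear[OF complex_differentiable_tr])

lemma dtr_has_derivative:
  assumes "c \<in> atlas X" "d \<in> atlas X" "x \<in> snd c ` (fst c \<inter> fst d)"
  shows "((\<lambda>y. dtr c d y v) has_derivative d2tr c d x v) (at x)"
  using complex_differentiable.symmetric_second_derivative(1)[OF complex_differentiable_tr[OF assms(1,2)] assms(3)]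
  by (simp add: d2tr_def[abs_def] frechet_derivative_works)

lemma d2tr_sym:
  assumes "c \<in> atlas X" "d \<in> atlas X" "x \<in> snd c ` (fst c \<inter> fst d)"
  shows "d2tr c d x v w = d2tr c d x w v"
  unfolding d2tr_def
  by (rule complex_differentiable.symmetric_second_derivative(2)[OF complex_differentiable_tr[OF assms(1,2)] assms(3)])

lemma linear_dtr: "\<lbrakk>c \<in> atlas X; d \<in> atlas X; x \<in> snd c ` (fst c \<inter> fst d)\<rbrakk> \<Longrightarrow> linear (dtr c d x)"
  by (rule has_derivative_linear[OF tr_has_derivative])

lemma dtr_chain:
  assumes c: "c \<in> atlas X" and d: "d \<in> atlas X" and e: "e \<in> atlas X" and p: "p \<in> fst c" "p \<in> fst d" "p \<in> fst e"
  shows "dtr d e (snd d p) (dtr c d (snd c p) v) = dtr c e (snd c p) v"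
proof -
  have 1: "(tr c d has_derivative dtr c d (snd c p)) (at (snd c p))"
    using p by (intro tr_has_derivative c d) blast
  have "(tr d e has_derivative dtr d e (snd d p)) (at (tr c d (snd c p)))"
    unfolding tr_snd[OF c p(1)] using p by (intro tr_has_derivative e d) blast
  from has_derivative_compose[OF 1 this]
  have "((\<lambda>y. tr d e (tr c d y)) has_derivative (\<lambda>v. dtr d e (snd d p) (dtr c d (snd c p) v))) (at (snd c p))" .
  moreover have "tr d e (tr c d y) = tr c e y" if "y \<in> snd c ` (fst c \<inter> fst d)" for y
    using that c d by (auto simp: tr_def)
  moreover have "snd c p \<in> snd c ` (fst c \<inter> fst d)" using p by blast
  ultimately have "(tr c e has_derivative (\<lambda>v. dtr d e (snd d p) (dtr c d (snd c p) v))) (at (snd c p))"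
    using has_derivative_transform_within_open[OF _ overlap_open[OF c d]] by blast
  then have "dtr c e (snd c p) = (\<lambda>v. dtr d e (snd d p) (dtr c d (snd c p) v))"
    unfolding dtr_def by (rule frechet_derivative_eqI)
  then show ?thesis by simp
qed

lemma dtr_self:
  assumes c: "c \<in> atlas X" and p: "p \<in> fst c"
  shows "dtr c c (snd c p) v = v"
proof -
  have "(tr c c has_derivative (\<lambda>v. v)) (at (snd c p))"
    by (rule has_derivative_transform_within_open[OF has_derivative_ident open_chart_image[OF c]])
       (use c p in \<open>auto simp: tr_def\<close>)
  then show ?thesis unfolding dtr_def by (simp add: frechet_derivative_eqI)
qed

lemma dtr_inverse:
  assumes "c \<in> atlas X" "d \<in> atlas X" "p \<in> fst c" "p \<in> fst d"
  shows "dtr d c (snd d p) (dtr c d (snd c p) v) = v"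
  using assms by (simp add: dtr_chain dtr_self)

text \<open>Translation between a tangent space and a chart is itself a transition derivative, with
  the chart chosen at \<open>p\<close> on one side; all compatibility rules are therefore instances
  of \<open>dtr_chain\<close>.\<close>

lemma to_chart_eq: "to_chart X c p = dtr (chart_at X p) c (snd (chart_at X p) p)"
  and from_chart_eq: "from_chart X c p = dtr c (chart_at X p) (snd c p)"
  by (simp_all add: to_chart_def from_chart_def dtr_def tr_def)

context
  fixes c p assumes c: "c \<in> atlas X" and p: "p \<in> fst c"
begin

lemma to_from_chart [simp]: "to_chart X c p (from_chart X c p v) = v"
  and from_to_chart [simp]: "from_chart X c p (to_chart X c p v) = v"
  using c p by (simp_all add: to_chart_eq from_chart_eq dtr_inverse chart_at)

lemma linear_to_chart: "linear (to_chart X c p)" and linear_from_chart: "linear (from_chart X c p)"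
  unfolding to_chart_eq from_chart_eq using c p chart_at[of p] by (auto intro!: linear_dtr)

lemma to_chart_J: "to_chart X c p (J v) = J (to_chart X c p v)"
  and from_chart_J: "from_chart X c p (J v) = J (from_chart X c p v)"
  unfolding to_chart_eq from_chart_eq using c p chart_at[of p] by (auto intro!: dtr_J)

lemma to_chart_trans: "d \<in> atlas X \<Longrightarrow> p \<in> fst d \<Longrightarrow> dtr c d (snd c p) (to_chart X c p v) = to_chart X d p v"
  and from_chart_trans: "d \<in> atlas X \<Longrightarrow> p \<in> fst d \<Longrightarrow> from_chart X d p (dtr c d (snd c p) v) = from_chart X c p v"
  unfolding to_chart_eq from_chart_eq using c p chart_at[of p] by (simp_all add: dtr_chain)

end

lemma to_chart_at [simp]: "to_chart X (chart_at X p) p v = v"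
  and from_chart_at [simp]: "from_chart X (chart_at X p) p v = v"
  by (simp_all add: to_chart_eq from_chart_eq dtr_self chart_at)

end

section \<open>The Levi-Civita connection of a Kaehler manifold in charts\<close>

text \<open>Instantiated with the surface as well as with the target manifold.\<close>
locale kaehler = complex_manifold J X
  for J :: "'e::euclidean_space \<Rightarrow> 'e" and X :: "('p::t2_space, 'e) riem_mfd" +
  assumes metric: "riemannian_metric X"
    and riem_J: "riem X q (J v) (J w) = riem X q v w"
    and closed: "\<lbrakk>c \<in> atlas X; x \<in> snd c ` fst c\<rbrakk> \<Longrightarrow>
        frechet_derivative (\<lambda>y. bilin_loc X (\<lambda>q v. riem X q (J v)) c y v w) (at x) u +
        frechet_derivative (\<lambda>y. bilin_loc X (\<lambda>q v. riem X q (J v)) c y w u) (at x) v +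
        frechet_derivative (\<lambda>y. bilin_loc X (\<lambda>q v. riem X q (J v)) c y u v) (at x) w = 0"
begin

abbreviation gloc :: "('p, 'e) chart \<Rightarrow> 'e \<Rightarrow> 'e \<Rightarrow> 'e \<Rightarrow> real" where
  "gloc \<equiv> bilin_loc X (riem X)"

definition dg :: "('p, 'e) chart \<Rightarrow> 'e \<Rightarrow> 'e \<Rightarrow> 'e \<Rightarrow> 'e \<Rightarrow> real" where
  "dg c x u v w = frechet_derivative (\<lambda>y. gloc c y v w) (at x) u"

abbreviation \<Gamma> :: "('p, 'e) chart \<Rightarrow> 'e \<Rightarrow> 'e \<Rightarrow> 'e \<Rightarrow> 'e" where
  "\<Gamma> \<equiv> christoffel X"

lemma riem_bilinear: "bilinear (riem X q)" and riem_sym: "riem X q v w = riem X q w v"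
  and riem_pos: "v \<noteq> 0 \<Longrightarrow> riem X q v v > 0"
  using metric unfolding riemannian_metric_def by blast+

lemma smooth_gloc: "c \<in> atlas X \<Longrightarrow> smooth_on (snd c ` fst c) (\<lambda>x. gloc c x v w)"
  using metric unfolding riemannian_metric_def by blast

lemma gloc_transform:
  assumes "c \<in> atlas X" "d \<in> atlas X" "p \<in> fst c" "p \<in> fst d"
  shows "gloc c (snd c p) v w = gloc d (snd d p) (dtr c d (snd c p) v) (dtr c d (snd c p) w)"
  using assms by (simp add: bilin_loc_def from_chart_trans)

lemma gloc_chart_at: "gloc (chart_at X p) (snd (chart_at X p) p) v w = riem X p v w"
  by (simp add: bilin_loc_def chart_at)

lemma gloc_sym: "gloc c x v w = gloc c x w v"
  unfolding bilin_loc_def by (rule riem_sym)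

context
  fixes c x assumes c: "c \<in> atlas X" and x: "x \<in> snd c ` fst c"
begin

lemma gloc_form: "nondegenerate_form (gloc c x)"
proof -
  have l: "linear (from_chart X c (chart_inv c x))"
    using c chart_inv_in[OF c x] by (rule linear_from_chart)
  have inj: "from_chart X c (chart_inv c x) v \<noteq> 0" if "v \<noteq> 0" for v
    using to_from_chart[OF c chart_inv_in[OF c x], of v] that
      linear_0[OF linear_to_chart[OF c chart_inv_in[OF c x]]] by metis
  show ?thesis
  proof
    have "linear (\<lambda>w. riem X (chart_inv c x) v (from_chart X c (chart_inv c x) w))" for v
      using linear_compose[OF l] riem_bilinear[of "chart_inv c x"] unfolding bilinear_def comp_def by blast
    moreover have "linear (\<lambda>v. riem X (chart_inv c x) (from_chart X c (chart_inv c x) v) w)" for w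
      using linear_compose[OF l] riem_bilinear[of "chart_inv c x"] unfolding bilinear_def comp_def by blast
    ultimately show "bilinear (gloc c x)" unfolding bilinear_def bilin_loc_def by blast
    show "gloc c x v v > 0" if "v \<noteq> 0" for v
      unfolding bilin_loc_def by (rule riem_pos[OF inj[OF that]])
  qed
qed

lemma gloc_bilinear: "bilinear (gloc c x)"
  using gloc_form by (rule nondegenerate_form.bil)

lemma gloc_J: "gloc c x (J v) (J w) = gloc c x v w"
  unfolding bilin_loc_def from_chart_J[OF c chart_inv_in[OF c x]] by (rule riem_J)

lemma gloc_J_left: "gloc c x (J v) w = - gloc c x v (J w)"
  using gloc_J[of v "J w"] by (simp add: bilinear_rneg[OF gloc_bilinear])

lemma gloc_has_derivative: "((\<lambda>y. gloc c y v w) has_derivative (\<lambda>u. dg c x u v w)) (at x)"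
  unfolding dg_def using smooth_on_has_derivative[OF smooth_gloc[OF c] x] .

lemma dg_eqI:
  assumes "((\<lambda>y. gloc c y v w) has_derivative D) (at x)"
  shows "dg c x u v w = D u"
  using has_derivative_unique[OF gloc_has_derivative assms] by (rule fun_cong)

lemma dg_transfer:
  assumes "(h has_derivative D) (at x)" "\<And>y. y \<in> snd c ` fst c \<Longrightarrow> h y = gloc c y v w"
  shows "dg c x u v w = D u"
  by (rule dg_eqI[OF has_derivative_transform_within_open[OF assms(1) open_chart_image[OF c] x assms(2)]])

end

context
  fixes c x assumes c: "c \<in> atlas X" and x: "x \<in> snd c ` fst c"
begin

lemma dg_linear: "linear (\<lambda>u. dg c x u v w)"
  by (rule has_derivative_linear[OF gloc_has_derivative[OF c x]])

lemma dg_sym: "dg c x u v w = dg c x u w v"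
  by (rule dg_transfer[OF c x gloc_has_derivative[OF c x] gloc_sym])

text \<open>In holomorphic charts \<open>J\<close> has constant coefficients, so the invariance of
  the metric may be differentiated term by term.\<close>

lemma dg_J: "dg c x u (J v) (J w) = dg c x u v w"
  by (rule dg_transfer[OF c x gloc_has_derivative[OF c x] gloc_J[OF c, symmetric]])

lemma dg_add_right: "dg c x u v (w + w') = dg c x u v w + dg c x u v w'"
  by (rule dg_transfer[OF c x has_derivative_add[OF gloc_has_derivative[OF c x] gloc_has_derivative[OF c x]]])
     (simp add: bilinear_radd[OF gloc_bilinear[OF c]])

lemma dg_scaleR_right: "dg c x u v (r *\<^sub>R w) = r * dg c x u v w"
  by (rule dg_transfer[OF c x has_derivative_mult_right[OF gloc_has_derivative[OF c x]]])
     (simp add: bilinear_rmul[OF gloc_bilinear[OF c]])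

lemma dg_add_left: "dg c x u (v + v') w = dg c x u v w + dg c x u v' w"
  using dg_add_right[of u w v v'] by (simp only: dg_sym[of u w])

lemma dg_scaleR_left: "dg c x u (r *\<^sub>R v) w = r * dg c x u v w"
  using dg_scaleR_right[of u w r v] by (simp only: dg_sym[of u w])

lemma dg_minus_left: "dg c x u (- v) w = - dg c x u v w"
  and dg_minus_right: "dg c x u v (- w) = - dg c x u v w"
  using dg_scaleR_left[of u "-1" v w] dg_scaleR_right[of u v "-1" w] by simp_all

lemma dg_J_left: "dg c x u (J v) w = - dg c x u v (J w)"
  using dg_J[of u v "J w"] by (simp add: dg_minus_right)

lemma dg_add: "dg c x (u + u') v w = dg c x u v w + dg c x u' v w"
  and dg_scaleR: "dg c x (r *\<^sub>R u) v w = r * dg c x u v w"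
  using linear_add[OF dg_linear] linear_cmul[OF dg_linear] by auto

lemma dg_closed: "dg c x u (J v) w + dg c x v (J w) u + dg c x w (J u) v = 0"
proof -
  have "frechet_derivative (\<lambda>y. bilin_loc X (\<lambda>q v. riem X q (J v)) c y v w) (at x) u = dg c x u (J v) w" for u v w
    unfolding dg_def
  proof (subst frechet_derivative_cong_open[OF open_chart_image[OF c] x])
    fix y assume "y \<in> snd c ` fst c"
    from from_chart_J[OF c chart_inv_in[OF c this]]
    show "bilin_loc X (\<lambda>q v. riem X q (J v)) c y v w = gloc c y (J v) w" by (simp add: bilin_loc_def)
  qed simp
  then show ?thesis using closed[OF c x, of v w u] by simp
qed

lemma koszul_exists:
  "\<exists>G. \<forall>w. gloc c x G w = (dg c x u v w + dg c x v u w - dg c x w u v) / 2"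
proof -
  have "linear (\<lambda>w. (dg c x u v w + dg c x v u w - dg c x w u v) / 2)"
    by (rule linearI) (simp_all add: dg_add_right dg_add dg_scaleR_right dg_scaleR algebra_simps add_divide_distrib diff_divide_distrib)
  from nondegenerate_form.solve_form[OF gloc_form[OF c x] this]
  show ?thesis by metis
qed

text \<open>Justifies the definite description in \<open>christoffel\<close>. The right-hand side is
  linear in \<open>w\<close>, hence represented by a vector depending bilinearly and symmetrically
  on \<open>u\<close> and \<open>v\<close>; it satisfies the defining conditions, and they in turn
  force it.\<close>

lemma koszul: "gloc c x (\<Gamma> c x u v) w = (dg c x u v w + dg c x v u w - dg c x w u v) / 2"
proof -
  note B = gloc_bilinear[OF c x]
  note eqI = nondegenerate_form.eq_from_form[OF gloc_form[OF c x]]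
  define K where "K u v w = (dg c x u v w + dg c x v u w - dg c x w u v) / 2" for u v w
  from koszul_exists have "\<exists>G. \<forall>u v w. gloc c x (G u v) w = K u v w" unfolding K_def by metis
  then obtain G where G: "gloc c x (G u v) w = K u v w" for u v w by blast
  let ?P = "\<lambda>\<Gamma>. bilinear \<Gamma> \<and> (\<forall>u v. \<Gamma> u v = \<Gamma> v u) \<and>
     (\<forall>u v w. frechet_derivative (\<lambda>y. gloc c y v w) (at x) u = gloc c x (\<Gamma> u v) w + gloc c x v (\<Gamma> u w))"
  have "?P G"
  proof (intro conjI allI)
    have "linear (G u)" for u
      by (intro linearI eqI) (simp_all add: G K_def bilinear_ladd[OF B] bilinear_lmul[OF B]
          dg_add_left dg_add_right dg_add dg_scaleR dg_scaleR_left dg_scaleR_right algebra_simps add_divide_distrib diff_divide_distrib)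
    moreover have sym: "G u v = G v u" for u v
      by (rule eqI) (simp add: G K_def dg_sym[of _ u v])
    ultimately show "bilinear G" unfolding bilinear_def by simp
    show "G u v = G v u" for u v by (rule sym)
    show "frechet_derivative (\<lambda>y. gloc c y v w) (at x) u = gloc c x (G u v) w + gloc c x v (G u w)" for u v w
      unfolding gloc_sym[of c x v] G by (simp add: K_def dg_def[symmetric] dg_sym[of _ w] field_simps)
  qed
  \<comment> \<open>Insert metricity in the three derivatives: by symmetry everything cancels except
    twice \<open>gloc c x (\<Gamma>' u v) w\<close>.\<close>
  moreover have "\<Gamma>' = G" if P: "?P \<Gamma>'" for \<Gamma>'
  proof (intro ext eqI)
    fix u v w
    have s: "\<Gamma>' u v = \<Gamma>' v u" for u v using P by blast
    have m: "dg c x u v w = gloc c x (\<Gamma>' u v) w + gloc c x (\<Gamma>' u w) v" for u v w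
    proof -
      have "dg c x u v w = gloc c x (\<Gamma>' u v) w + gloc c x v (\<Gamma>' u w)"
        using P unfolding dg_def by blast
      then show ?thesis by (simp only: gloc_sym[of c x v "\<Gamma>' u w"])
    qed
    show "gloc c x (\<Gamma>' u v) w = gloc c x (G u v) w"
      unfolding G K_def m by (simp add: s[of v u] s[of w u] s[of w v])
  qed
  ultimately have "\<Gamma> c x = G" unfolding christoffel_def by (rule the_equality)
  then show ?thesis by (simp add: G K_def)
qed

lemmas christoffel_eqI = nondegenerate_form.eq_from_form[OF gloc_form[OF c x]]

lemma christoffel_sym: "\<Gamma> c x u v = \<Gamma> c x v u"
  by (rule christoffel_eqI) (simp add: koszul dg_sym[of _ u v])

lemma christoffel_bilinear: "bilinear (\<Gamma> c x)"
proof -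
  have "linear (\<Gamma> c x u)" for u
    by (intro linearI christoffel_eqI) (simp_all add: koszul bilinear_ladd[OF gloc_bilinear[OF c x]] bilinear_lmul[OF gloc_bilinear[OF c x]]
          dg_add_left dg_add_right dg_add dg_scaleR dg_scaleR_left dg_scaleR_right algebra_simps add_divide_distrib diff_divide_distrib)
  then show ?thesis unfolding bilinear_def using christoffel_sym by simp
qed

lemma christoffel_metric: "dg c x u v w = gloc c x (\<Gamma> c x u v) w + gloc c x v (\<Gamma> c x u w)"
  unfolding gloc_sym[of c x v] koszul by (simp add: dg_sym[of _ w] field_simps)

text \<open>The complex structure is parallel because the Kaehler form is closed and the complex
  structure is constant in holomorphic coordinates.\<close>
lemma christoffel_J: "\<Gamma> c x u (J v) = J (\<Gamma> c x u v)"
proof (rule christoffel_eqI)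
  fix w
  \<comment> \<open>Twice the difference of the two sides is (1) minus (2), up to (3). Here (1) and
    (2) are closedness at \<open>u, v, w\<close> and at \<open>u, J v, J w\<close>, and (3) is the
    invariance of the metric.\<close>
  have 1: "dg c x u (J v) w + dg c x v u (J w) - dg c x w u (J v) = 0"
    using dg_closed[of u v w] unfolding dg_J_left[of w u v] dg_sym[of v "J w" u] by simp
  have 2: "dg c x u (J v) w - dg c x (J v) u w + dg c x (J w) u v = 0"
    using dg_closed[of u "J v" "J w"] unfolding dg_J[of u "J v" w] dg_J[of "J w" u v]
    by (simp add: dg_minus_left dg_sym[of _ w u])
  have 3: "dg c x u v (J w) = - dg c x u (J v) w" using dg_J_left[of u v w] by simp
  show "gloc c x (\<Gamma> c x u (J v)) w = gloc c x (J (\<Gamma> c x u v)) w"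
    unfolding gloc_J_left[OF c x, of "\<Gamma> c x u v"] koszul using 1 2 3 by argo
qed

lemma christoffel_J_left: "\<Gamma> c x (J u) v = J (\<Gamma> c x u v)"
  unfolding christoffel_sym[of "J u" v] christoffel_sym[of u v] by (rule christoffel_J)

end

text \<open>By the Koszul formula the Christoffel form solves a positive definite system built from
  the metric coefficients and their first derivatives, so \<open>Ck_on_solve\<close>
  applies.\<close>

lemma Ck_on_christoffel:
  assumes c: "c \<in> atlas X"
  shows "Ck_on k (snd c ` fst c) (\<lambda>x. \<Gamma> c x u v)"
proof (rule Ck_on_solve[OF open_chart_image[OF c] gloc_form[OF c]])
  show "Ck_on k (snd c ` fst c) (\<lambda>x. gloc c x v w)" for v w
    using smooth_gloc[OF c] by (simp add: smooth_on_def)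
  have d: "Ck_on k (snd c ` fst c) (\<lambda>x. dg c x u v w)" for u v w
    using smooth_gloc[OF c, of v w] unfolding smooth_on_def dg_def
    by (auto dest: spec[of _ "Suc k"])
  have "Ck_on k (snd c ` fst c) (\<lambda>x. (1/2) *\<^sub>R ((dg c x u v w + dg c x v u w) + (-1) *\<^sub>R dg c x w u v))" for w
    by (intro Ck_on_add Ck_on_linear[OF bounded_linear_scaleR_right] open_chart_image[OF c] d)
  then show "Ck_on k (snd c ` fst c) (\<lambda>x. gloc c x (\<Gamma> c x u v) w)" for w
    by (rule Ck_on_cong[THEN iffD2, OF open_chart_image[OF c], rotated]) (simp add: koszul[OF c])
qed

lemma christoffel_has_derivative:
  assumes "c \<in> atlas X" "x \<in> snd c ` fst c"
  shows "((\<lambda>x. \<Gamma> c x u v) has_derivative frechet_derivative (\<lambda>x. \<Gamma> c x u v) (at x)) (at x)"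
  using Ck_on_derivD[OF Ck_on_christoffel[OF assms(1)] assms(2)] .

text \<open>Differentiating \<open>gloc_transform\<close> adds terms with the second derivative
  \<open>H\<close> to each \<open>dg\<close>. In the Koszul combination the symmetry of
  \<open>H\<close> cancels all of them except twice the pairing of \<open>H u v\<close> with
  \<open>T w\<close>, which is the inhomogeneous term.\<close>

lemma christoffel_transform:
  assumes c: "c \<in> atlas X" and d: "d \<in> atlas X" and p: "p \<in> fst c" "p \<in> fst d"
  defines "T \<equiv> dtr c d (snd c p)" and "H \<equiv> d2tr c d (snd c p)"
  shows "\<Gamma> d (snd d p) (T u) (T v) = T (\<Gamma> c (snd c p) u v) - H u v"
proof -
  let ?x = "snd c p" and ?y = "snd d p"
  have x: "?x \<in> snd c ` (fst c \<inter> fst d)" and xc: "?x \<in> snd c ` fst c" and yd: "?y \<in> snd d ` fst d" using p by auto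
  note B = gloc_bilinear[OF d yd]
  have dgc: "dg c ?x u v w = dg d ?y (T u) (T v) (T w) + gloc d ?y (H v u) (T w) + gloc d ?y (T v) (H w u)" for u v w
  proof (rule dg_eqI[OF c xc])
    have "((\<lambda>z. gloc d (tr c d z) (dtr c d z v) (dtr c d z w)) has_derivative
      (\<lambda>u. dg d ?y (dtr c d ?x u) (dtr c d ?x v) (dtr c d ?x w) + gloc d (tr c d ?x) (d2tr c d ?x v u) (dtr c d ?x w)
        + gloc d (tr c d ?x) (dtr c d ?x v) (d2tr c d ?x w u))) (at ?x)"
    proof (rule bilinear_family_has_derivative[OF open_chart_image[OF d] _ gloc_bilinear[OF d] _ tr_has_derivative[OF c d x]
          dtr_has_derivative[OF c d x] dtr_has_derivative[OF c d x]])
      show "tr c d ?x \<in> snd d ` fst d" unfolding tr_snd[OF c p(1)] by (rule yd)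
      show "((\<lambda>y. gloc d y v w) has_derivative (\<lambda>u. dg d ?y u v w)) (at (tr c d ?x))" for v w
        unfolding tr_snd[OF c p(1)] by (rule gloc_has_derivative[OF d yd])
    qed
    then have 1: "((\<lambda>z. gloc d (tr c d z) (dtr c d z v) (dtr c d z w)) has_derivative
      (\<lambda>u. dg d ?y (T u) (T v) (T w) + gloc d ?y (H v u) (T w) + gloc d ?y (T v) (H w u))) (at ?x)"
      unfolding T_def H_def tr_snd[OF c p(1)] .
    show "((\<lambda>z. gloc c z v w) has_derivative
      (\<lambda>u. dg d ?y (T u) (T v) (T w) + gloc d ?y (H v u) (T w) + gloc d ?y (T v) (H w u))) (at ?x)"
    proof (rule has_derivative_transform_within_open[OF 1 overlap_open[OF c d] x])
      fix z assume "z \<in> snd c ` (fst c \<inter> fst d)"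
      then obtain q where q: "z = snd c q" "q \<in> fst c" "q \<in> fst d" by blast
      show "gloc d (tr c d z) (dtr c d z v) (dtr c d z w) = gloc c z v w"
        unfolding q(1) tr_snd[OF c q(2)] by (rule gloc_transform[OF c d q(2,3), symmetric])
    qed
  qed
  have Hs: "H u v = H v u" for u v unfolding H_def by (rule d2tr_sym[OF c d x])
  show ?thesis
  proof (rule christoffel_eqI[OF d yd])
    fix w'
    define w where "w = dtr d c ?y w'"
    have w': "w' = T w" unfolding w_def T_def using dtr_inverse[OF d c p(2,1)] by simp
    have "gloc d ?y (T (\<Gamma> c ?x u v)) (T w) = gloc c ?x (\<Gamma> c ?x u v) w"
      unfolding T_def by (rule gloc_transform[OF c d p, symmetric])
    also have "\<dots> = (dg c ?x u v w + dg c ?x v u w - dg c ?x w u v) / 2" by (rule koszul[OF c xc])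
    finally have e: "gloc d ?y (T (\<Gamma> c ?x u v)) (T w) = (dg c ?x u v w + dg c ?x v u w - dg c ?x w u v) / 2" .
    have "gloc d ?y (H u w) (T v) = gloc d ?y (T v) (H w u)" "gloc d ?y (T u) (H v w) = gloc d ?y (T u) (H w v)"
      "gloc d ?y (H v u) (T w) = gloc d ?y (H u v) (T w)"
      by (simp_all only: gloc_sym[of d ?y "H w u"] Hs[of u w] Hs[of v w] Hs[of u v])
    then show "gloc d ?y (\<Gamma> d ?y (T u) (T v)) w' = gloc d ?y (T (\<Gamma> c ?x u v) - H u v) w'"
      unfolding w' koszul[OF d yd] bilinear_lsub[OF B] e dgc by argo
  qed
qed

lemma curv_eq:
  defines "c p \<equiv> chart_at X p"
  shows "curv X p u v w =
    frechet_derivative (\<lambda>y. \<Gamma> (c p) y v w) (at (snd (c p) p)) u + \<Gamma> (c p) (snd (c p) p) u (\<Gamma> (c p) (snd (c p) p) v w)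
    - (frechet_derivative (\<lambda>y. \<Gamma> (c p) y u w) (at (snd (c p) p)) v + \<Gamma> (c p) (snd (c p) p) v (\<Gamma> (c p) (snd (c p) p) u w))"
proof -
  have "\<Gamma> (c p) (snd (c p) p) 0 w = 0"
    unfolding c_def using chart_at[of p] by (intro bilinear_lzero christoffel_bilinear) auto
  then show ?thesis
    unfolding curv_def curvature_field_def cov_def lie_def c_def by simp
qed

text \<open>\<open>J\<close> is constant in the chart and commutes with the Christoffel form in the
  last slot, hence also with its derivatives and with every term of \<open>curv_eq\<close>.\<close>

lemma curv_J: "curv X p u v (J w) = J (curv X p u v w)"
proof -
  let ?c = "chart_at X p"
  have x: "snd ?c p \<in> snd ?c ` fst ?c" using chart_at by blast
  have D: "frechet_derivative (\<lambda>y. \<Gamma> ?c y v (J w)) (at (snd ?c p)) u = J (frechet_derivative (\<lambda>y. \<Gamma> ?c y v w) (at (snd ?c p)) u)" for u v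
  proof -
    have "((\<lambda>y. J (\<Gamma> ?c y v w)) has_derivative (\<lambda>u. J (frechet_derivative (\<lambda>y. \<Gamma> ?c y v w) (at (snd ?c p)) u))) (at (snd ?c p))"
      by (rule bounded_linear.has_derivative[OF bounded_linear_J christoffel_has_derivative[OF chart_at(1) x]])
    then have "((\<lambda>y. \<Gamma> ?c y v (J w)) has_derivative (\<lambda>u. J (frechet_derivative (\<lambda>y. \<Gamma> ?c y v w) (at (snd ?c p)) u))) (at (snd ?c p))"
      by (rule has_derivative_transform_within_open[OF _ open_chart_image[OF chart_at(1)] x])
         (simp add: christoffel_J[OF chart_at(1)])
    then show ?thesis by (simp add: frechet_derivative_eqI)
  qed
  show ?thesis unfolding curv_eq D by (simp add: christoffel_J[OF chart_at(1) x])
qed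

end

section \<open>Holomorphic curves: covariant derivatives in charts\<close>

lemma linear_family_has_derivative:
  fixes L :: "'b::real_normed_vector \<Rightarrow> 'e::euclidean_space \<Rightarrow> 'f::real_normed_vector"
  assumes Y: "open Y" "\<phi> x \<in> Y" and lin: "\<And>y. y \<in> Y \<Longrightarrow> linear (L y)"
    and L: "\<And>v. ((\<lambda>y. L y v) has_derivative L' v) (at (\<phi> x))"
    and \<phi>: "(\<phi> has_derivative \<phi>') (at x)" and a: "(a has_derivative a') (at x)"
  shows "((\<lambda>z. L (\<phi> z) (a z)) has_derivative (\<lambda>u. L' (a x) (\<phi>' u) + L (\<phi> x) (a' u))) (at x)"
proof -
  obtain e :: 'e where e: "e \<in> Basis" using nonempty_Basis by blast
  \<comment> \<open>A dummy second argument, paired with the unit vector \<open>e\<close>, turns the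
    linear family into a bilinear one.\<close>
  define B where "B y v w = (w \<bullet> e) *\<^sub>R L y v" for y v w
  have "bilinear (B y)" if "y \<in> Y" for y
    unfolding bilinear_def B_def
    using linear_compose_scale_right[OF lin[OF that]]
    by (auto simp: linear_iff inner_add_left scaleR_left_distrib)
  moreover have "((\<lambda>y. B y v w) has_derivative (\<lambda>u. (w \<bullet> e) *\<^sub>R L' v u)) (at (\<phi> x))" for v w
    unfolding B_def by (rule has_derivative_scaleR_right[OF L])
  ultimately have "((\<lambda>z. B (\<phi> z) (a z) e) has_derivative
    (\<lambda>u. (e \<bullet> e) *\<^sub>R L' (a x) (\<phi>' u) + B (\<phi> x) (a' u) e + B (\<phi> x) (a x) 0)) (at x)"
    by (rule bilinear_family_has_derivative[OF Y _ _ \<phi> a has_derivative_const])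
  then show ?thesis using e by (simp add: B_def)
qed

lemma complex_linear_eq_mult:
  assumes "linear L" "\<And>v. L (\<i> * v) = \<i> * L v"
  shows "L v = v * L 1"
proof -
  have "v = Re v *\<^sub>R 1 + Im v *\<^sub>R (\<i> * 1)" by (simp add: complex_eq_iff)
  then have "L v = L (Re v *\<^sub>R 1 + Im v *\<^sub>R (\<i> * 1))" by (rule arg_cong)
  also have "\<dots> = Re v *\<^sub>R L 1 + Im v *\<^sub>R (\<i> * L 1)"
    by (simp only: linear_add[OF assms(1)] linear_cmul[OF assms(1)] assms(2))
  also have "\<dots> = v * L 1" by (simp add: complex_eq_iff)
  finally show ?thesis .
qed

text \<open>The mixed terms of the two summands cancel. Any trace over a frame \<open>z\<close>,
  \<open>\<i> * z\<close> can thus be taken at \<open>1\<close>, \<open>\<i>\<close> at the price of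
  a conformal factor.\<close>

lemma bilinear_conformal:
  fixes Q :: "complex \<Rightarrow> complex \<Rightarrow> 'f::real_vector"
  assumes "bilinear Q"
  shows "Q z z + Q (\<i> * z) (\<i> * z) = (cmod z)\<^sup>2 *\<^sub>R (Q 1 1 + Q \<i> \<i>)"
proof -
  have z: "z = Re z *\<^sub>R 1 + Im z *\<^sub>R \<i>" and iz: "\<i> * z = (- Im z) *\<^sub>R 1 + Re z *\<^sub>R \<i>"
    by (simp_all add: complex_eq_iff)
  have gen: "Q (a *\<^sub>R 1 + b *\<^sub>R \<i>) (a *\<^sub>R 1 + b *\<^sub>R \<i>) = a\<^sup>2 *\<^sub>R Q 1 1 + (a * b) *\<^sub>R (Q 1 \<i> + Q \<i> 1) + b\<^sup>2 *\<^sub>R Q \<i> \<i>" for a b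
    by (simp add: bilinear_ladd[OF assms] bilinear_radd[OF assms] bilinear_lmul[OF assms]
        bilinear_rmul[OF assms] power2_eq_square algebra_simps del: scaleR_conv_of_real)
  have "Q z z = (Re z)\<^sup>2 *\<^sub>R Q 1 1 + (Re z * Im z) *\<^sub>R (Q 1 \<i> + Q \<i> 1) + (Im z)\<^sup>2 *\<^sub>R Q \<i> \<i>"
    using gen[of "Re z" "Im z"] z by simp
  moreover have "Q (\<i> * z) (\<i> * z) = (- Im z)\<^sup>2 *\<^sub>R Q 1 1 + (- Im z * Re z) *\<^sub>R (Q 1 \<i> + Q \<i> 1) + (Re z)\<^sup>2 *\<^sub>R Q \<i> \<i>"
    using gen[of "- Im z" "Re z"] iz by (simp only:)
  ultimately show ?thesis by (simp add: cmod_power2 algebra_simps)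
qed

locale curve = S: kaehler "(*) \<i>" \<Sigma> + M: kaehler J M
  for \<Sigma> :: "('s::t2_space, complex) riem_mfd"
    and J :: "'e::euclidean_space \<Rightarrow> 'e" and M :: "('m::t2_space, 'e) riem_mfd" +
  fixes f :: "'s \<Rightarrow> 'm"
  assumes smooth: "smooth_map \<Sigma> M f"
    and holomorphic: "differential \<Sigma> M f p (\<i> * v) = J (differential \<Sigma> M f p v)"
begin

abbreviation W :: "('s, complex) chart \<Rightarrow> ('m, 'e) chart \<Rightarrow> complex set" where
  "W c d \<equiv> snd c ` (fst c \<inter> f -` fst d)"

definition floc :: "('s, complex) chart \<Rightarrow> ('m, 'e) chart \<Rightarrow> complex \<Rightarrow> 'e" where
  "floc c d = snd d \<circ> f \<circ> chart_inv c"

definition df :: "('s, complex) chart \<Rightarrow> ('m, 'e) chart \<Rightarrow> complex \<Rightarrow> complex \<Rightarrow> 'e" where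
  "df c d x v = frechet_derivative (floc c d) (at x) v"

definition cov0 :: "('s, complex) chart \<Rightarrow> ('m, 'e) chart \<Rightarrow> (complex \<Rightarrow> 'e) \<Rightarrow> complex \<Rightarrow> complex \<Rightarrow> 'e" where
  "cov0 c d \<sigma> k x = frechet_derivative \<sigma> (at x) k + M.\<Gamma> d (floc c d x) (df c d x k) (\<sigma> x)"

text \<open>The trace runs over the coordinate frame and omits the Christoffel form of the surface,
  which is complex bilinear, so that its contributions from \<open>1\<close> and \<open>\<i>\<close>
  cancel. Up to the conformal factor this is the metric trace of the covariant derivative.\<close>

definition Div :: "('s, complex) chart \<Rightarrow> ('m, 'e) chart \<Rightarrow> ('s \<Rightarrow> complex \<Rightarrow> 'e) \<Rightarrow> complex \<Rightarrow> 'e" where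
  "Div c d \<beta> x = cov0 c d (form_loc \<Sigma> M f c d \<beta> 1) 1 x + cov0 c d (form_loc \<Sigma> M f c d \<beta> \<i>) \<i> x"

abbreviation dfp :: "'s \<Rightarrow> complex \<Rightarrow> 'e" where "dfp \<equiv> differential \<Sigma> M f"

lemma f_continuous: "continuous_on UNIV f" using smooth by (simp add: smooth_map_def)

lemma open_preimage: "open A \<Longrightarrow> open (f -` A)"
  using f_continuous continuous_on_open_vimage[of UNIV f] by auto

lemma dtr_mult:
  assumes "c \<in> atlas \<Sigma>" "c' \<in> atlas \<Sigma>" "x \<in> snd c ` (fst c \<inter> fst c')"
  shows "S.dtr c c' x v = v * S.dtr c c' x 1"
  by (rule complex_linear_eq_mult[OF S.linear_dtr[OF assms] S.dtr_J[OF assms]])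

context
  fixes c d assumes c: "c \<in> atlas \<Sigma>" and d: "d \<in> atlas M"
begin

lemma W_open: "open (W c d)"
  by (intro S.open_chart_image_Int c open_preimage M.open_chart d)

lemma floc_smooth: "Ck_on k (W c d) (floc c d)"
  using smooth c d unfolding smooth_map_def smooth_on_def floc_def by blast

lemma floc_snd: "p \<in> fst c \<Longrightarrow> floc c d (snd c p) = snd d (f p)"
  using c by (simp add: floc_def)

lemma floc_in: "x \<in> W c d \<Longrightarrow> floc c d x \<in> snd d ` fst d"
  using c by (auto simp: floc_def)

lemma floc_has_derivative: "x \<in> W c d \<Longrightarrow> (floc c d has_derivative df c d x) (at x)"
  unfolding df_def[abs_def] by (rule Ck_on_derivD[OF floc_smooth])

lemma linear_df: "x \<in> W c d \<Longrightarrow> linear (df c d x)"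
  by (rule has_derivative_linear[OF floc_has_derivative])

lemma df_smooth: "Ck_on k (W c d) (\<lambda>x. df c d x v)"
  using floc_smooth[of "Suc k"] by (simp add: df_def)

end

lemma df_transform_d:
  assumes c: "c \<in> atlas \<Sigma>" and d: "d \<in> atlas M" "d' \<in> atlas M" and p: "p \<in> fst c" "f p \<in> fst d" "f p \<in> fst d'"
  shows "M.dtr d d' (snd d (f p)) (df c d (snd c p) v) = df c d' (snd c p) v"
proof -
  let ?x = "snd c p" and ?Z = "snd c ` (fst c \<inter> f -` (fst d \<inter> fst d'))"
  have x: "?x \<in> ?Z" "?x \<in> W c d" "?x \<in> W c d'" using p by auto
  have Z: "open ?Z" by (intro S.open_chart_image_Int c open_preimage open_Int M.open_chart d)
  have "snd d (f p) \<in> snd d ` (fst d \<inter> fst d')" using p by blast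
  then have "(M.tr d d' has_derivative M.dtr d d' (snd d (f p))) (at (floc c d ?x))"
    unfolding floc_snd[OF c d(1) p(1)] by (rule M.tr_has_derivative[OF d])
  from has_derivative_compose[OF floc_has_derivative[OF c d(1) x(2)] this]
  have "((\<lambda>y. M.tr d d' (floc c d y)) has_derivative (\<lambda>v. M.dtr d d' (snd d (f p)) (df c d ?x v))) (at ?x)" .
  then have "(floc c d' has_derivative (\<lambda>v. M.dtr d d' (snd d (f p)) (df c d ?x v))) (at ?x)"
    by (rule has_derivative_transform_within_open[OF _ Z x(1)]) (use c d in \<open>auto simp: floc_def M.tr_def\<close>)
  from has_derivative_unique[OF this floc_has_derivative[OF c d(2) x(3)]] show ?thesis by (rule fun_cong)
qed

lemma df_transform_c:
  assumes c: "c \<in> atlas \<Sigma>" "c' \<in> atlas \<Sigma>" and d: "d \<in> atlas M" and p: "p \<in> fst c" "p \<in> fst c'" "f p \<in> fst d"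
  shows "df c' d (snd c' p) (S.dtr c c' (snd c p) v) = df c d (snd c p) v"
proof -
  let ?x = "snd c p" and ?Z = "snd c ` (fst c \<inter> (fst c' \<inter> f -` fst d))"
  have x: "?x \<in> ?Z" "?x \<in> W c d" "?x \<in> snd c ` (fst c \<inter> fst c')" "snd c' p \<in> W c' d" using p by auto
  have Z: "open ?Z" by (intro S.open_chart_image_Int S.open_chart c open_preimage open_Int M.open_chart d)
  have "(floc c' d has_derivative df c' d (snd c' p)) (at (S.tr c c' ?x))"
    unfolding S.tr_snd[OF c(1) p(1)] by (rule floc_has_derivative[OF c(2) d x(4)])
  from has_derivative_compose[OF S.tr_has_derivative[OF c x(3)] this]
  have "((\<lambda>y. floc c' d (S.tr c c' y)) has_derivative (\<lambda>v. df c' d (snd c' p) (S.dtr c c' ?x v))) (at ?x)" .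
  then have "(floc c d has_derivative (\<lambda>v. df c' d (snd c' p) (S.dtr c c' ?x v))) (at ?x)"
    by (rule has_derivative_transform_within_open[OF _ Z x(1)]) (use c d in \<open>auto simp: floc_def S.tr_def\<close>)
  from has_derivative_unique[OF this floc_has_derivative[OF c(1) d x(2)]] show ?thesis by (rule fun_cong)
qed

lemma differential_df: "dfp p v = df (chart_at \<Sigma> p) (chart_at M (f p)) (snd (chart_at \<Sigma> p) p) v"
  by (simp add: differential_def df_def floc_def)

lemma df_eq:
  assumes c: "c \<in> atlas \<Sigma>" and d: "d \<in> atlas M" and p: "p \<in> fst c" "f p \<in> fst d"
  shows "df c d (snd c p) w = to_chart M d (f p) (dfp p (from_chart \<Sigma> c p w))"
  unfolding differential_df M.to_chart_eq S.from_chart_eq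
  using df_transform_d[OF S.chart_at(1) M.chart_at(1) d S.chart_at(2) M.chart_at(2) p(2)]
    df_transform_c[OF c S.chart_at(1) d p(1) S.chart_at(2) p(2)] by simp

lemma linear_dfp: "linear (dfp p)"
  unfolding differential_df[abs_def] using S.chart_at[of p] M.chart_at[of "f p"] by (intro linear_df) auto

lemma df_J:
  assumes c: "c \<in> atlas \<Sigma>" and d: "d \<in> atlas M" and x: "x \<in> W c d"
  shows "df c d x (\<i> * v) = J (df c d x v)"
proof -
  obtain p where p: "x = snd c p" "p \<in> fst c" "f p \<in> fst d" using x by blast
  show ?thesis unfolding p(1) df_eq[OF c d p(2,3)] S.from_chart_J[OF c p(2)] holomorphic
    by (rule M.to_chart_J[OF d p(3)])
qed

text \<open>In charts the curve is complex differentiable, so the result obtained for transition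
  maps applies to it too.\<close>

lemma df_second_derivative:
  assumes c: "c \<in> atlas \<Sigma>" and d: "d \<in> atlas M" and x: "x \<in> W c d"
  shows "frechet_derivative (\<lambda>y. df c d y v) (at x) w = frechet_derivative (\<lambda>y. df c d y w) (at x) v"
proof -
  have "complex_differentiable ((*) \<i>) J (W c d) (floc c d) (df c d)"
    by unfold_locales (use W_open[OF c d] floc_has_derivative[OF c d] df_J[OF c d] in auto)
  then show ?thesis using x by (rule complex_differentiable.symmetric_second_derivative(2))
qed

text \<open>The product rule yields a second derivative of the coordinate change of the target,
  which cancels the inhomogeneous term of \<open>christoffel_transform\<close>.\<close>

lemma cov0_transform:
  assumes c: "c \<in> atlas \<Sigma>" and d: "d \<in> atlas M" "d' \<in> atlas M" and p: "p \<in> fst c" "f p \<in> fst d" "f p \<in> fst d'"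
    and \<sigma>: "\<And>q. q \<in> fst c \<Longrightarrow> f q \<in> fst d \<Longrightarrow> f q \<in> fst d' \<Longrightarrow> \<sigma>' (snd c q) = M.dtr d d' (snd d (f q)) (\<sigma> (snd c q))"
    and diff: "(\<sigma> has_derivative \<sigma>1) (at (snd c p))"
  shows "cov0 c d' \<sigma>' k (snd c p) = M.dtr d d' (snd d (f p)) (cov0 c d \<sigma> k (snd c p))"
proof -
  let ?x = "snd c p" and ?y = "snd d (f p)" and ?Z = "snd c ` (fst c \<inter> f -` (fst d \<inter> fst d'))"
  have x: "?x \<in> ?Z" "?x \<in> W c d" "?x \<in> W c d'" using p by auto
  have y: "?y \<in> snd d ` (fst d \<inter> fst d')" using p by auto
  have Z: "open ?Z" by (intro S.open_chart_image_Int c open_preimage open_Int M.open_chart d)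
  have fx: "floc c d ?x = ?y" "floc c d' ?x = snd d' (f p)" using floc_snd[OF c] d p(1) by auto
  have "((\<lambda>z. M.dtr d d' (floc c d z) (\<sigma> z)) has_derivative
      (\<lambda>u. M.d2tr d d' ?y (\<sigma> ?x) (df c d ?x u) + M.dtr d d' (floc c d ?x) (\<sigma>1 u))) (at ?x)"
  proof (rule linear_family_has_derivative[OF M.overlap_open[OF d] _ M.linear_dtr[OF d] _ floc_has_derivative[OF c d(1) x(2)] diff])
    show "floc c d ?x \<in> snd d ` (fst d \<inter> fst d')" unfolding fx by (rule y)
    show "((\<lambda>y. M.dtr d d' y v) has_derivative M.d2tr d d' ?y v) (at (floc c d ?x))" for v
      unfolding fx by (rule M.dtr_has_derivative[OF d y])
  qed
  then have "(\<sigma>' has_derivative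
      (\<lambda>u. M.d2tr d d' ?y (\<sigma> ?x) (df c d ?x u) + M.dtr d d' (floc c d ?x) (\<sigma>1 u))) (at ?x)"
  proof (rule has_derivative_transform_within_open[OF _ Z x(1)])
    fix z assume "z \<in> ?Z"
    then obtain q where q: "z = snd c q" "q \<in> fst c" "f q \<in> fst d" "f q \<in> fst d'" by blast
    show "M.dtr d d' (floc c d z) (\<sigma> z) = \<sigma>' z"
      unfolding q(1) \<sigma>[OF q(2-4)] floc_snd[OF c d(1) q(2)] ..
  qed
  from frechet_derivative_eqI[OF this]
  have 1: "frechet_derivative \<sigma>' (at ?x) k = M.d2tr d d' ?y (\<sigma> ?x) (df c d ?x k) + M.dtr d d' ?y (\<sigma>1 k)"
    by (simp only: fx)
  have 2: "M.\<Gamma> d' (snd d' (f p)) (df c d' ?x k) (\<sigma>' ?x)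
      = M.dtr d d' ?y (M.\<Gamma> d ?y (df c d ?x k) (\<sigma> ?x)) - M.d2tr d d' ?y (df c d ?x k) (\<sigma> ?x)"
    unfolding df_transform_d[OF c d p, symmetric] \<sigma>[OF p] by (rule M.christoffel_transform[OF d p(2,3)])
  show ?thesis
    unfolding cov0_def fx 1 2 frechet_derivative_eqI[OF diff] linear_add[OF M.linear_dtr[OF d y]]
      M.d2tr_sym[OF d y, of "df c d ?x k"] by simp
qed

lemma cov0_metric:
  assumes c: "c \<in> atlas \<Sigma>" and d: "d \<in> atlas M" and x: "x \<in> W c d"
    and \<sigma>: "(\<sigma> has_derivative \<sigma>1) (at x)" and \<tau>: "(\<tau> has_derivative \<tau>1) (at x)"
  shows "((\<lambda>z. M.gloc d (floc c d z) (\<sigma> z) (\<tau> z)) has_derivative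
    (\<lambda>k. M.gloc d (floc c d x) (cov0 c d \<sigma> k x) (\<tau> x) + M.gloc d (floc c d x) (\<sigma> x) (cov0 c d \<tau> k x))) (at x)"
proof -
  let ?y = "floc c d x"
  have y: "?y \<in> snd d ` fst d" by (rule floc_in[OF c d x])
  note B = M.gloc_bilinear[OF d y]
  have "((\<lambda>z. M.gloc d (floc c d z) (\<sigma> z) (\<tau> z)) has_derivative
    (\<lambda>k. M.dg d ?y (df c d x k) (\<sigma> x) (\<tau> x) + M.gloc d ?y (\<sigma>1 k) (\<tau> x) + M.gloc d ?y (\<sigma> x) (\<tau>1 k))) (at x)"
    by (rule bilinear_family_has_derivative[OF M.open_chart_image[OF d] y M.gloc_bilinear[OF d] M.gloc_has_derivative[OF d y]
          floc_has_derivative[OF c d x] \<sigma> \<tau>])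
  moreover have "M.dg d ?y (df c d x k) (\<sigma> x) (\<tau> x) + M.gloc d ?y (\<sigma>1 k) (\<tau> x) + M.gloc d ?y (\<sigma> x) (\<tau>1 k)
    = M.gloc d ?y (cov0 c d \<sigma> k x) (\<tau> x) + M.gloc d ?y (\<sigma> x) (cov0 c d \<tau> k x)" for k
    unfolding cov0_def frechet_derivative_eqI[OF \<sigma>] frechet_derivative_eqI[OF \<tau>] M.christoffel_metric[OF d y]
      bilinear_ladd[OF B] bilinear_radd[OF B] by simp
  ultimately show ?thesis by simp
qed

lemma cov0_J:
  assumes c: "c \<in> atlas \<Sigma>" and d: "d \<in> atlas M" and x: "x \<in> W c d" and \<sigma>: "(\<sigma> has_derivative \<sigma>1) (at x)"
  shows "cov0 c d (\<lambda>z. J (\<sigma> z)) k x = J (cov0 c d \<sigma> k x)"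
  unfolding cov0_def frechet_derivative_eqI[OF \<sigma>]
    frechet_derivative_eqI[OF bounded_linear.has_derivative[OF M.bounded_linear_J \<sigma>]]
    M.christoffel_J[OF d floc_in[OF c d x]] by simp

lemma cov0_smooth:
  assumes c: "c \<in> atlas \<Sigma>" and d: "d \<in> atlas M" and \<sigma>: "\<And>k. Ck_on k (W c d) \<sigma>"
  shows "Ck_on k (W c d) (\<lambda>x. cov0 c d \<sigma> v x)"
proof -
  have o: "open (W c d)" by (rule W_open[OF c d])
  have s: "floc c d ` W c d \<subseteq> snd d ` fst d" using floc_in[OF c d] by blast
  have 1: "Ck_on k (W c d) (\<lambda>x. frechet_derivative \<sigma> (at x) v)" using \<sigma>[of "Suc k"] by simp
  have 2: "Ck_on k (W c d) (\<lambda>x. M.\<Gamma> d (floc c d x) (df c d x v) (\<sigma> x))"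
    by (rule Ck_on_bilinear_family[OF o M.open_chart_image[OF d] s M.christoffel_bilinear[OF d] M.Ck_on_christoffel[OF d]
          floc_smooth[OF c d] df_smooth[OF c d] \<sigma>])
  show ?thesis unfolding cov0_def by (rule Ck_on_add[OF o 1 2])
qed

lemma section_loc_snd: "c \<in> atlas \<Sigma> \<Longrightarrow> p \<in> fst c \<Longrightarrow> section_loc M f c d s (snd c p) = to_chart M d (f p) (s p)"
  by (simp add: section_loc_def)

lemma form_loc_snd: "c \<in> atlas \<Sigma> \<Longrightarrow> p \<in> fst c \<Longrightarrow>
    form_loc \<Sigma> M f c d \<beta> w (snd c p) = to_chart M d (f p) (\<beta> p (from_chart \<Sigma> c p w))"
  by (simp add: form_loc_def)

context
  fixes s assumes s: "smooth_section \<Sigma> M f s"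
begin

lemma section_smooth: "c \<in> atlas \<Sigma> \<Longrightarrow> d \<in> atlas M \<Longrightarrow> Ck_on k (W c d) (section_loc M f c d s)"
  using s unfolding smooth_section_def smooth_on_def by blast

lemma section_has_derivative: "c \<in> atlas \<Sigma> \<Longrightarrow> d \<in> atlas M \<Longrightarrow> x \<in> W c d \<Longrightarrow>
    (section_loc M f c d s has_derivative frechet_derivative (section_loc M f c d s) (at x)) (at x)"
  by (rule Ck_on_derivD[OF section_smooth])

text \<open>\<open>nabla\<close> is defined in the charts chosen at \<open>p\<close> and
  \<open>f p\<close>. In fixed charts, as here, the point may move, so that further differentiation
  makes sense.\<close>

lemma nabla_cov0:
  assumes c: "c \<in> atlas \<Sigma>" and d: "d \<in> atlas M" and p: "p \<in> fst c" "f p \<in> fst d"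
  shows "cov0 c d (section_loc M f c d s) k (snd c p) = to_chart M d (f p) (nabla \<Sigma> M f s p (from_chart \<Sigma> c p k))"
proof -
  let ?c = "chart_at \<Sigma> p" and ?d = "chart_at M (f p)"
  note C = S.chart_at[of p] and D = M.chart_at[of "f p"]
  let ?x = "snd c p" and ?x' = "snd ?c p" and ?Z = "snd c ` (fst c \<inter> (fst ?c \<inter> f -` fst ?d))"
  have x: "?x \<in> ?Z" "?x \<in> W c ?d" "?x' \<in> W ?c ?d" "?x \<in> snd c ` (fst c \<inter> fst ?c)" using p C D by auto
  have Z: "open ?Z" by (intro S.open_chart_image_Int S.open_chart c C open_preimage open_Int M.open_chart D)
  have "cov0 c d (section_loc M f c d s) k ?x = M.dtr ?d d (snd ?d (f p)) (cov0 c ?d (section_loc M f c ?d s) k ?x)"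
    by (rule cov0_transform[OF c D(1) d p(1) D(2) p(2) _ section_has_derivative[OF c D(1) x(2)]])
       (simp add: section_loc_snd[OF c] M.to_chart_trans D d)
  also have "cov0 c ?d (section_loc M f c ?d s) k ?x = nabla \<Sigma> M f s p (S.dtr c ?c ?x k)"
  proof -
    have "(section_loc M f ?c ?d s has_derivative frechet_derivative (section_loc M f ?c ?d s) (at ?x')) (at (S.tr c ?c ?x))"
      unfolding S.tr_snd[OF c p(1)] by (rule section_has_derivative[OF C(1) D(1) x(3)])
    from has_derivative_compose[OF S.tr_has_derivative[OF c C(1) x(4)] this]
    have "(section_loc M f c ?d s has_derivative (\<lambda>k. frechet_derivative (section_loc M f ?c ?d s) (at ?x') (S.dtr c ?c ?x k))) (at ?x)"
      by (rule has_derivative_transform_within_open[OF _ Z x(1)])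
         (use c C in \<open>auto simp: S.tr_def section_loc_def\<close>)
    from frechet_derivative_eqI[OF this]
    show ?thesis
      unfolding cov0_def nabla_def Let_def differential_df
      by (simp add: floc_snd[OF c D(1) p(1)] section_loc_snd[OF c p(1)]
          df_transform_c[OF c C(1) D(1) p(1) C(2) D(2)])
  qed
  finally show ?thesis by (simp only: M.to_chart_eq S.from_chart_eq)
qed

end

context
  fixes \<beta> assumes \<beta>: "smooth_form \<Sigma> M f \<beta>"
begin

lemma form_smooth: "c \<in> atlas \<Sigma> \<Longrightarrow> d \<in> atlas M \<Longrightarrow> Ck_on k (W c d) (form_loc \<Sigma> M f c d \<beta> w)"
  using \<beta> unfolding smooth_form_def smooth_on_def by blast

lemma form_has_derivative: "c \<in> atlas \<Sigma> \<Longrightarrow> d \<in> atlas M \<Longrightarrow> x \<in> W c d \<Longrightarrow>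
    (form_loc \<Sigma> M f c d \<beta> w has_derivative frechet_derivative (form_loc \<Sigma> M f c d \<beta> w) (at x)) (at x)"
  by (rule Ck_on_derivD[OF form_smooth])

lemma form_linear: "linear (\<beta> p)" using \<beta> by (simp add: smooth_form_def)

lemma form_loc_linear:
  assumes c: "c \<in> atlas \<Sigma>" and d: "d \<in> atlas M" and x: "x \<in> W c d"
  shows "linear (\<lambda>w. form_loc \<Sigma> M f c d \<beta> w x)"
proof -
  obtain p where p: "x = snd c p" "p \<in> fst c" "f p \<in> fst d" using x by blast
  have "linear (to_chart M d (f p) \<circ> (\<beta> p \<circ> from_chart \<Sigma> c p))"
    by (intro linear_compose S.linear_from_chart[OF c p(2)] M.linear_to_chart[OF d p(3)] form_linear)
  then show ?thesis unfolding p(1) form_loc_snd[OF c p(2)] comp_def .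
qed

text \<open>Makes \<open>bilinear_conformal\<close> applicable to the trace in
  \<open>Div\<close>.\<close>

lemma cov0_form_bilinear:
  assumes c: "c \<in> atlas \<Sigma>" and d: "d \<in> atlas M" and x: "x \<in> W c d"
  shows "bilinear (\<lambda>k w. cov0 c d (form_loc \<Sigma> M f c d \<beta> w) k x)"
proof -
  let ?b = "\<lambda>w. form_loc \<Sigma> M f c d \<beta> w"
  note B = M.christoffel_bilinear[OF d floc_in[OF c d x]]
  note l = form_loc_linear[OF c d]
  have D: "frechet_derivative (?b (v + w)) (at x) = (\<lambda>k. frechet_derivative (?b v) (at x) k + frechet_derivative (?b w) (at x) k)" for v w
  proof (rule frechet_derivative_eqI, rule has_derivative_transform_within_open[OF _ W_open[OF c d] x])
    show "((\<lambda>y. ?b v y + ?b w y) has_derivative (\<lambda>k. frechet_derivative (?b v) (at x) k + frechet_derivative (?b w) (at x) k)) (at x)"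
      by (intro has_derivative_add form_has_derivative c d x)
    show "?b v y + ?b w y = ?b (v + w) y" if "y \<in> W c d" for y using linear_add[OF l[OF that], of v w] by simp
  qed
  have E: "frechet_derivative (?b (r *\<^sub>R w)) (at x) = (\<lambda>k. r *\<^sub>R frechet_derivative (?b w) (at x) k)" for r w
  proof (rule frechet_derivative_eqI, rule has_derivative_transform_within_open[OF _ W_open[OF c d] x])
    show "((\<lambda>y. r *\<^sub>R ?b w y) has_derivative (\<lambda>k. r *\<^sub>R frechet_derivative (?b w) (at x) k)) (at x)"
      by (intro has_derivative_scaleR_right form_has_derivative c d x)
    show "r *\<^sub>R ?b w y = ?b (r *\<^sub>R w) y" if "y \<in> W c d" for y using linear_cmul[OF l[OF that], of r w] by simp
  qed
  have "linear (\<lambda>w. cov0 c d (?b w) k x)" for k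
    unfolding cov0_def
    by (rule linearI) (simp_all only: D E linear_add[OF l[OF x]] linear_cmul[OF l[OF x]] bilinear_radd[OF B] bilinear_rmul[OF B]
        scaleR_right_distrib ac_simps)
  moreover have "linear (\<lambda>k. cov0 c d (?b w) k x)" for w
    unfolding cov0_def
    by (rule linearI) (simp_all only: linear_add[OF has_derivative_linear[OF form_has_derivative[OF c d x]]]
        linear_cmul[OF has_derivative_linear[OF form_has_derivative[OF c d x]]]
        linear_add[OF linear_df[OF c d x]] linear_cmul[OF linear_df[OF c d x]] bilinear_ladd[OF B] bilinear_lmul[OF B]
        scaleR_right_distrib ac_simps)
  ultimately show ?thesis unfolding bilinear_def by blast
qed

lemma Div_transform_d:
  assumes c: "c \<in> atlas \<Sigma>" and d: "d \<in> atlas M" "d' \<in> atlas M" and p: "p \<in> fst c" "f p \<in> fst d" "f p \<in> fst d'"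
  shows "Div c d' \<beta> (snd c p) = M.dtr d d' (snd d (f p)) (Div c d \<beta> (snd c p))"
proof -
  have x: "snd c p \<in> W c d" and y: "snd d (f p) \<in> snd d ` (fst d \<inter> fst d')" using p by auto
  have "cov0 c d' (form_loc \<Sigma> M f c d' \<beta> w) k (snd c p) = M.dtr d d' (snd d (f p)) (cov0 c d (form_loc \<Sigma> M f c d \<beta> w) k (snd c p))" for k w
    by (rule cov0_transform[OF c d p _ form_has_derivative[OF c d(1) x]])
       (simp add: form_loc_snd[OF c] M.to_chart_trans d)
  then show ?thesis unfolding Div_def by (simp add: linear_add[OF M.linear_dtr[OF d y]])
qed

text \<open>The divergence is conformally covariant: the second derivatives of the holomorphic coordinate
  change cancel in the trace.\<close>
lemma Div_transform_c:
  assumes c: "c \<in> atlas \<Sigma>" "c' \<in> atlas \<Sigma>" and d: "d \<in> atlas M" and p: "p \<in> fst c" "p \<in> fst c'" "f p \<in> fst d"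
  shows "Div c d \<beta> (snd c p) = (cmod (S.dtr c c' (snd c p) 1))\<^sup>2 *\<^sub>R Div c' d \<beta> (snd c' p)"
proof -
  let ?x = "snd c p" and ?x' = "snd c' p" and ?Z = "snd c ` (fst c \<inter> (fst c' \<inter> f -` fst d))"
  let ?z = "S.dtr c c' ?x 1"
  have x: "?x \<in> ?Z" "?x \<in> W c d" "?x' \<in> W c' d" "?x \<in> snd c ` (fst c \<inter> fst c')" using p by auto
  have Z: "open ?Z" by (intro S.open_chart_image_Int S.open_chart c open_preimage open_Int M.open_chart d)
  have fx: "floc c d ?x = snd d (f p)" "floc c' d ?x' = snd d (f p)" using floc_snd c d p by auto
  let ?b = "\<lambda>w. form_loc \<Sigma> M f c d \<beta> w" and ?b' = "\<lambda>w. form_loc \<Sigma> M f c' d \<beta> w"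
  have b: "?b w (snd c q) = ?b' (S.dtr c c' (snd c q) w) (snd c' q)" if "q \<in> fst c" "q \<in> fst c'" "f q \<in> fst d" for w q
    using that by (simp add: form_loc_snd c S.from_chart_trans)
  have "((\<lambda>y. ?b' (S.dtr c c' y w) (S.tr c c' y)) has_derivative
    (\<lambda>k. frechet_derivative (?b' (S.dtr c c' ?x w)) (at ?x') (S.dtr c c' ?x k) + ?b' (S.d2tr c c' ?x w k) (S.tr c c' ?x))) (at ?x)" for w
  proof (rule linear_family_has_derivative[where L="\<lambda>y w. ?b' w y", OF W_open[OF c(2) d] _ form_loc_linear[OF c(2) d] _
        S.tr_has_derivative[OF c x(4)] S.dtr_has_derivative[OF c x(4)]])
    show "S.tr c c' ?x \<in> W c' d" unfolding S.tr_snd[OF c(1) p(1)] by (rule x(3))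
    show "(?b' v has_derivative frechet_derivative (?b' v) (at ?x')) (at (S.tr c c' ?x))" for v
      unfolding S.tr_snd[OF c(1) p(1)] by (rule form_has_derivative[OF c(2) d x(3)])
  qed
  then have "(?b w has_derivative
    (\<lambda>k. frechet_derivative (?b' (S.dtr c c' ?x w)) (at ?x') (S.dtr c c' ?x k) + ?b' (S.d2tr c c' ?x w k) (S.tr c c' ?x))) (at ?x)" for w
  proof (rule has_derivative_transform_within_open[OF _ Z x(1)])
    fix y assume "y \<in> ?Z"
    then obtain q where q: "y = snd c q" "q \<in> fst c" "q \<in> fst c'" "f q \<in> fst d" by blast
    show "?b' (S.dtr c c' y w) (S.tr c c' y) = ?b w y"
      unfolding q(1) S.tr_snd[OF c(1) q(2)] using b[OF q(2-4)] by simp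
  qed
  from frechet_derivative_eqI[OF this]
  have D: "frechet_derivative (?b w) (at ?x) k = frechet_derivative (?b' (S.dtr c c' ?x w)) (at ?x') (S.dtr c c' ?x k)
      + ?b' (S.d2tr c c' ?x w k) ?x'" for w k
    by (simp only: S.tr_snd[OF c(1) p(1)])
  have cov: "cov0 c d (?b w) k ?x = cov0 c' d (?b' (S.dtr c c' ?x w)) (S.dtr c c' ?x k) ?x' + ?b' (S.d2tr c c' ?x w k) ?x'" for w k
    unfolding cov0_def D fx b[OF p] df_transform_c[OF c d p, symmetric] by (simp add: ac_simps)
  have H: "S.d2tr c c' ?x (\<i> * v) w = \<i> * S.d2tr c c' ?x v w" for v w
  proof -
    have "((\<lambda>y. \<i> * S.dtr c c' y v) has_derivative (\<lambda>w. \<i> * S.d2tr c c' ?x v w)) (at ?x)"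
      by (rule has_derivative_mult_right[OF S.dtr_has_derivative[OF c x(4)]])
    then have "((\<lambda>y. S.dtr c c' y (\<i> * v)) has_derivative (\<lambda>w. \<i> * S.d2tr c c' ?x v w)) (at ?x)"
      by (rule has_derivative_transform_within_open[OF _ S.overlap_open[OF c] x(4)]) (simp add: S.dtr_J[OF c])
    from has_derivative_unique[OF S.dtr_has_derivative[OF c x(4)] this] show ?thesis by (rule fun_cong)
  qed
  \<comment> \<open>The second derivative is complex linear in its first slot by \<open>H\<close>
    and symmetric, hence complex bilinear; on the pair \<open>\<i>\<close>, \<open>\<i>\<close> it
    is minus its value on \<open>1\<close>, \<open>1\<close>.\<close>
  have "S.d2tr c c' ?x \<i> \<i> = - S.d2tr c c' ?x 1 1"
    using H[of 1 \<i>] H[of 1 1] S.d2tr_sym[OF c x(4), of 1 \<i>] by simp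
  then have "?b' (S.d2tr c c' ?x 1 1) ?x' + ?b' (S.d2tr c c' ?x \<i> \<i>) ?x' = 0"
    using linear_neg[OF form_loc_linear[OF c(2) d x(3)]] by simp
  then have "Div c d \<beta> ?x = cov0 c' d (?b' ?z) ?z ?x' + cov0 c' d (?b' (\<i> * ?z)) (\<i> * ?z) ?x'"
    unfolding Div_def cov dtr_mult[OF c x(4), of \<i>] by (simp add: algebra_simps)
  also have "\<dots> = (cmod ?z)\<^sup>2 *\<^sub>R (cov0 c' d (?b' 1) 1 ?x' + cov0 c' d (?b' \<i>) \<i> ?x')"
    by (rule bilinear_conformal[OF cov0_form_bilinear[OF c(2) d x(3)]])
  finally show ?thesis unfolding Div_def .
qed

end

end

section \<open>The conformal factor of the surface and divergences of one-forms\<close>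

lemma Ck_on_local:
  "(\<And>x. x \<in> X \<Longrightarrow> \<exists>Y. open Y \<and> x \<in> Y \<and> Ck_on k Y F) \<Longrightarrow> Ck_on k X F"
proof (induction k arbitrary: F)
  case 0
  have "isCont F x" if x: "x \<in> X" for x
  proof -
    obtain Y where Y: "open Y" "x \<in> Y" "continuous_on Y F" using 0[OF x] by auto
    then show ?thesis using continuous_on_eq_continuous_at by blast
  qed
  then have "continuous_on X F" by (intro continuous_at_imp_continuous_on ballI)
  then show ?case by (simp only: Ck_on.simps)
next
  case (Suc k)
  have "F differentiable (at x)" if x: "x \<in> X" for x
  proof -
    obtain Y where "open Y" "x \<in> Y" "Ck_on (Suc k) Y F" using Suc.prems[OF x] by blast
    then show ?thesis by simp
  qed
  moreover have "Ck_on k X (\<lambda>x. frechet_derivative F (at x) v)" for v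
  proof (rule Suc.IH)
    fix x assume "x \<in> X"
    then obtain Y where Y: "open Y" "x \<in> Y" "Ck_on (Suc k) Y F" using Suc.prems by blast
    then have "Ck_on k Y (\<lambda>x. frechet_derivative F (at x) v)" by simp
    with Y show "\<exists>Y. open Y \<and> x \<in> Y \<and> Ck_on k Y (\<lambda>x. frechet_derivative F (at x) v)" by blast
  qed
  ultimately show ?case by (simp only: Ck_on.simps) blast
qed

locale surface = kaehler "(*) \<i>" \<Sigma> for \<Sigma> :: "('s::t2_space, complex) riem_mfd"
begin

text \<open>The conformal factor in the chart chosen at \<open>p\<close>. Since that choice may jump
  with \<open>p\<close>, analytic statements use \<open>gloc c x 1 1\<close> in a fixed chart
  instead.\<close>

definition lam :: "'s \<Rightarrow> real" where "lam p = riem \<Sigma> p 1 1"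

lemma lam_pos: "lam p > 0"
  unfolding lam_def by (rule riem_pos) simp

lemma riem_mult: "riem \<Sigma> p z z = (cmod z)\<^sup>2 * lam p"
  using bilinear_conformal[OF riem_bilinear[of p], of z] riem_J[of p z z] riem_J[of p 1 1]
  by (simp add: lam_def)

lemma dtr_eq_mult:
  assumes "c \<in> atlas \<Sigma>" "c' \<in> atlas \<Sigma>" "x \<in> snd c ` (fst c \<inter> fst c')"
  shows "dtr c c' x v = v * dtr c c' x 1"
  by (rule complex_linear_eq_mult[OF linear_dtr[OF assms] dtr_J[OF assms]])

lemma from_chart_mult:
  assumes "c \<in> atlas \<Sigma>" "p \<in> fst c"
  shows "from_chart \<Sigma> c p v = v * from_chart \<Sigma> c p 1"
  by (rule complex_linear_eq_mult[OF linear_from_chart[OF assms] from_chart_J[OF assms]])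

lemma gloc_lam:
  assumes "c \<in> atlas \<Sigma>" "p \<in> fst c"
  shows "gloc c (snd c p) 1 1 = (cmod (from_chart \<Sigma> c p 1))\<^sup>2 * lam p"
  using assms by (simp add: bilin_loc_def riem_mult)

lemma gloc_pos: "c \<in> atlas \<Sigma> \<Longrightarrow> x \<in> snd c ` fst c \<Longrightarrow> gloc c x 1 1 > 0"
  by (rule nondegenerate_form.pos[OF gloc_form]) auto

definition oneform_loc :: "('s, complex) chart \<Rightarrow> ('s \<Rightarrow> complex \<Rightarrow> real) \<Rightarrow> complex \<Rightarrow> complex \<Rightarrow> real" where
  "oneform_loc c \<theta> w x = \<theta> (chart_inv c x) (from_chart \<Sigma> c (chart_inv c x) w)"

text \<open>For a conformal metric, the divergence is the flat one divided by the conformal factor.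
  It is a relation that includes the regularity of the form, so that one proof obligation covers all
  charts at once.\<close>

definition divergence_of :: "('s \<Rightarrow> real) \<Rightarrow> ('s \<Rightarrow> complex \<Rightarrow> real) \<Rightarrow> bool" where
  "divergence_of u \<theta> \<longleftrightarrow> (\<forall>p. linear (\<theta> p)) \<and>
     (\<forall>c\<in>atlas \<Sigma>. \<forall>w. Ck_on 1 (snd c ` fst c) (oneform_loc c \<theta> w)) \<and>
     (\<forall>c\<in>atlas \<Sigma>. \<forall>p\<in>fst c. gloc c (snd c p) 1 1 * u p =
        frechet_derivative (oneform_loc c \<theta> 1) (at (snd c p)) 1 + frechet_derivative (oneform_loc c \<theta> \<i>) (at (snd c p)) \<i>)"

end

section \<open>Harmonicity of holomorphic curves and the codifferential\<close>

context curve
begin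

sublocale S: surface \<Sigma> ..

lemma form_loc_differential:
  assumes c: "c \<in> atlas \<Sigma>" and d: "d \<in> atlas M" and x: "x \<in> W c d"
  shows "form_loc \<Sigma> M f c d dfp w x = df c d x w"
proof -
  obtain p where p: "x = snd c p" "p \<in> fst c" "f p \<in> fst d" using x by blast
  show ?thesis unfolding p(1) form_loc_snd[OF c p(2)] by (rule df_eq[OF c d p(2,3), symmetric])
qed

lemma smooth_form_differential: "smooth_form \<Sigma> M f dfp"
  unfolding smooth_form_def smooth_on_def
proof (intro conjI allI ballI)
  show "linear (dfp p)" for p by (rule linear_dfp)
  show "Ck_on k (W c d) (form_loc \<Sigma> M f c d dfp w)" if "c \<in> atlas \<Sigma>" "d \<in> atlas M" for c d w k
    by (rule Ck_on_cong[THEN iffD2, OF W_open[OF that] form_loc_differential[OF that] df_smooth[OF that]])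
qed

text \<open>Complex linearity of the differential and symmetry of its derivative pull out
  \<open>J\<close> twice.\<close>

lemma differential_second_derivative:
  assumes c: "c \<in> atlas \<Sigma>" and d: "d \<in> atlas M" and x: "x \<in> W c d"
  shows "frechet_derivative (form_loc \<Sigma> M f c d dfp (\<i> * w)) (at x) (\<i> * w)
    = - frechet_derivative (form_loc \<Sigma> M f c d dfp w) (at x) w"
proof -
  let ?D = "\<lambda>v. frechet_derivative (\<lambda>y. df c d y v) (at x)"
  have D: "frechet_derivative (form_loc \<Sigma> M f c d dfp v) (at x) = ?D v" for v
    by (rule frechet_derivative_cong_open[OF W_open[OF c d] x form_loc_differential[OF c d]])
  have J: "?D (\<i> * v) w = J (?D v w)" for v w
  proof -
    have "((\<lambda>y. df c d y v) has_derivative ?D v) (at x)"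
      by (rule Ck_on_derivD[OF df_smooth[OF c d] x])
    from bounded_linear.has_derivative[OF M.bounded_linear_J this]
    have "((\<lambda>y. df c d y (\<i> * v)) has_derivative (\<lambda>w. J (?D v w))) (at x)"
      by (rule has_derivative_transform_within_open[OF _ W_open[OF c d] x]) (simp add: df_J[OF c d])
    from frechet_derivative_eqI[OF this] show ?thesis by (rule fun_cong)
  qed
  have "?D (\<i> * w) (\<i> * w) = J (?D w (\<i> * w))" by (rule J)
  also have "?D w (\<i> * w) = ?D (\<i> * w) w" by (rule df_second_derivative[OF c d x])
  also have "\<dots> = J (?D w w)" by (rule J)
  finally show ?thesis unfolding D by simp
qed

lemma christoffel_differential_J:
  assumes c: "c \<in> atlas \<Sigma>" and d: "d \<in> atlas M" and x: "x \<in> W c d"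
  shows "M.\<Gamma> d (floc c d x) (df c d x (\<i> * v)) (df c d x (\<i> * v)) = - M.\<Gamma> d (floc c d x) (df c d x v) (df c d x v)"
  unfolding df_J[OF c d x] M.christoffel_J[OF d floc_in[OF c d x]] M.christoffel_J_left[OF d floc_in[OF c d x]] by simp

lemma Div_differential:
  assumes c: "c \<in> atlas \<Sigma>" and d: "d \<in> atlas M" and x: "x \<in> W c d"
  shows "Div c d dfp x = 0"
  using differential_second_derivative[OF c d x, of 1] christoffel_differential_J[OF c d x, of 1]
  unfolding Div_def cov0_def form_loc_differential[OF c d x] by simp

text \<open>Each of the three terms of \<open>nabla_form\<close> changes sign when both arguments
  are multiplied by \<open>\<i>\<close>, so the trace over \<open>e1\<close>, \<open>e2\<close>
  vanishes.\<close>

lemma tension_zero: "tension_field \<Sigma> M f p = 0"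
proof -
  let ?c = "chart_at \<Sigma> p" and ?d = "chart_at M (f p)"
  note C = S.chart_at[of p] and D = M.chart_at[of "f p"]
  let ?x = "snd ?c p"
  have x: "?x \<in> W ?c ?d" "?x \<in> snd ?c ` fst ?c" using C D by auto
  have "nabla_form \<Sigma> M f dfp p (\<i> * v) (\<i> * v) = - nabla_form \<Sigma> M f dfp p v v" for v
    using differential_second_derivative[OF C(1) D(1) x(1), of v]
      christoffel_differential_J[OF C(1) D(1) x(1), of v]
      linear_neg[OF linear_dfp]
    unfolding nabla_form_def Let_def S.christoffel_J[OF C(1) x(2)] S.christoffel_J_left[OF C(1) x(2)]
      floc_snd[OF C(1) D(1) C(2)] differential_df[symmetric] by simp
  then show ?thesis unfolding tension_field_def e2_def by simp
qed

text \<open>An unnormalised pointwise trace, over \<open>1\<close>, \<open>\<i>\<close> in the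
  chosen charts; division by \<open>lam\<close> gives the metric trace.\<close>

definition Divp :: "('s \<Rightarrow> complex \<Rightarrow> 'e) \<Rightarrow> 's \<Rightarrow> 'e" where
  "Divp \<beta> p = Div (chart_at \<Sigma> p) (chart_at M (f p)) \<beta> (snd (chart_at \<Sigma> p) p)"

lemma Divp_differential: "Divp dfp p = 0"
  unfolding Divp_def using S.chart_at[of p] M.chart_at[of "f p"] by (intro Div_differential) auto

context
  fixes \<beta> assumes \<beta>: "smooth_form \<Sigma> M f \<beta>"
begin

lemma Div_Divp:
  assumes c: "c \<in> atlas \<Sigma>" and d: "d \<in> atlas M" and p: "p \<in> fst c" "f p \<in> fst d"
  shows "Div c d \<beta> (snd c p) = (cmod (from_chart \<Sigma> c p 1))\<^sup>2 *\<^sub>R to_chart M d (f p) (Divp \<beta> p)"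
  unfolding Divp_def M.to_chart_eq S.from_chart_eq
  using Div_transform_c[OF \<beta> c S.chart_at(1) d p(1) S.chart_at(2) p(2)]
    Div_transform_d[OF \<beta> S.chart_at(1) M.chart_at(1) d S.chart_at(2) M.chart_at(2) p(2)] by simp

lemma Divp_J: "smooth_form \<Sigma> M f (\<lambda>p w. J (\<beta> p w))" "Divp (\<lambda>p w. J (\<beta> p w)) p = J (Divp \<beta> p)"
proof -
  have loc: "form_loc \<Sigma> M f c d (\<lambda>p w. J (\<beta> p w)) w x = J (form_loc \<Sigma> M f c d \<beta> w x)"
    if "c \<in> atlas \<Sigma>" "d \<in> atlas M" "x \<in> W c d" for c d w x
  proof -
    obtain p where p: "x = snd c p" "p \<in> fst c" "f p \<in> fst d" using \<open>x \<in> W c d\<close> by blast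
    show ?thesis unfolding p(1) form_loc_snd[OF that(1) p(2)] by (rule M.to_chart_J[OF that(2) p(3)])
  qed
  show "smooth_form \<Sigma> M f (\<lambda>p w. J (\<beta> p w))"
    unfolding smooth_form_def smooth_on_def
  proof (intro conjI allI ballI)
    show "linear (\<lambda>w. J (\<beta> p w))" for p
      using linear_compose[OF form_linear[OF \<beta>] M.linear_J] unfolding comp_def .
    show "Ck_on k (W c d) (form_loc \<Sigma> M f c d (\<lambda>p w. J (\<beta> p w)) w)" if "c \<in> atlas \<Sigma>" "d \<in> atlas M" for c d w k
      by (rule Ck_on_cong[THEN iffD2, OF W_open[OF that] loc[OF that]
            Ck_on_linear[OF M.bounded_linear_J W_open[OF that] form_smooth[OF \<beta> that]]])
  qed
  let ?c = "chart_at \<Sigma> p" and ?d = "chart_at M (f p)"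
  note C = S.chart_at[of p] and D = M.chart_at[of "f p"]
  have x: "snd ?c p \<in> W ?c ?d" using C D by auto
  have "cov0 ?c ?d (form_loc \<Sigma> M f ?c ?d (\<lambda>p w. J (\<beta> p w)) w) k (snd ?c p) = J (cov0 ?c ?d (form_loc \<Sigma> M f ?c ?d \<beta> w) k (snd ?c p))" for w k
  proof -
    have fd: "frechet_derivative (form_loc \<Sigma> M f ?c ?d (\<lambda>p w. J (\<beta> p w)) w) (at (snd ?c p))
      = frechet_derivative (\<lambda>z. J (form_loc \<Sigma> M f ?c ?d \<beta> w z)) (at (snd ?c p))"
      by (rule frechet_derivative_cong_open[OF W_open[OF C(1) D(1)] x loc[OF C(1) D(1)]])
    have "cov0 ?c ?d (form_loc \<Sigma> M f ?c ?d (\<lambda>p w. J (\<beta> p w)) w) k (snd ?c p)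
      = cov0 ?c ?d (\<lambda>z. J (form_loc \<Sigma> M f ?c ?d \<beta> w z)) k (snd ?c p)"
      unfolding cov0_def loc[OF C(1) D(1) x] fd ..
    also have "\<dots> = J (cov0 ?c ?d (form_loc \<Sigma> M f ?c ?d \<beta> w) k (snd ?c p))"
      by (rule cov0_J[OF C(1) D(1) x form_has_derivative[OF \<beta> C(1) D(1) x]])
    finally show ?thesis .
  qed
  then show "Divp (\<lambda>p w. J (\<beta> p w)) p = J (Divp \<beta> p)" unfolding Divp_def Div_def by simp
qed

text \<open>Minus the metric trace of the covariant derivative: the formal adjoint of
  \<open>nabla\<close>. On (0,1)-forms it is also that of the Dolbeault operators, since the
  (1,0)-part of a derivative is orthogonal to such forms.\<close>

definition dstar :: "'s \<Rightarrow> 'e" where "dstar p = - ((1 / S.lam p) *\<^sub>R Divp \<beta> p)"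

text \<open>Both \<open>lam\<close> and \<open>Divp\<close> depend on the charts chosen at each
  point. In a fixed chart they acquire the same factor, by \<open>gloc_lam\<close> and
  \<open>Div_Divp\<close>, and it cancels in the quotient.\<close>

lemma smooth_dstar: "smooth_section \<Sigma> M f dstar"
  unfolding smooth_section_def smooth_on_def
proof (intro ballI allI)
  fix c d k assume c: "c \<in> atlas \<Sigma>" and d: "d \<in> atlas M"
  have o: "open (W c d)" by (rule W_open[OF c d])
  have sub: "W c d \<subseteq> snd c ` fst c" by blast
  have "Ck_on k (snd c ` fst c) (\<lambda>x. S.gloc c x 1 1)" using S.smooth_gloc[OF c] by (simp add: smooth_on_def)
  from Ck_on_subset[OF this sub] have 1: "Ck_on k (W c d) (\<lambda>x. inverse (S.gloc c x 1 1))"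
    by (rule Ck_on_inverse[OF o]) (use S.gloc_pos[OF c] sub in force)
  have 2: "Ck_on k (W c d) (Div c d \<beta>)"
    unfolding Div_def[abs_def] by (intro Ck_on_add[OF o] cov0_smooth[OF c d] form_smooth[OF \<beta> c d])
  have 3: "Ck_on k (W c d) (\<lambda>x. - (inverse (S.gloc c x 1 1) *\<^sub>R Div c d \<beta> x))"
    by (intro Ck_on_linear[OF bounded_linear_minus[OF bounded_linear_ident] o]
        bounded_bilinear.Ck_on_prod[OF bounded_bilinear_scaleR o 1 2])
  have eq: "section_loc M f c d dstar x = - (inverse (S.gloc c x 1 1) *\<^sub>R Div c d \<beta> x)" if x: "x \<in> W c d" for x
  proof -
    obtain p where p: "x = snd c p" "p \<in> fst c" "f p \<in> fst d" using x by blast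
    let ?n = "(cmod (from_chart \<Sigma> c p 1))\<^sup>2"
    have "?n \<noteq> 0"
      using S.gloc_pos[OF c, of x] S.gloc_lam[OF c p(2)] p by auto
    then show ?thesis
      unfolding p(1) section_loc_snd[OF c p(2)] Div_Divp[OF c d p(2,3)] S.gloc_lam[OF c p(2)] dstar_def
        linear_neg[OF M.linear_to_chart[OF d p(3)]] linear_cmul[OF M.linear_to_chart[OF d p(3)]]
      by (simp add: divide_inverse)
  qed
  show "Ck_on k (W c d) (section_loc M f c d dstar)"
    by (rule Ck_on_cong[THEN iffD2, OF o eq 3])
qed

end

lemma linear_nabla:
  assumes s: "smooth_section \<Sigma> M f s"
  shows "linear (nabla \<Sigma> M f s p)"
proof -
  let ?c = "chart_at \<Sigma> p" and ?d = "chart_at M (f p)"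
  note C = S.chart_at[of p] and D = M.chart_at[of "f p"]
  have x: "snd ?c p \<in> W ?c ?d" and y: "snd ?d (f p) \<in> snd ?d ` fst ?d" using C D by auto
  note l1 = has_derivative_linear[OF section_has_derivative[OF s C(1) D(1) x]]
  note B = M.christoffel_bilinear[OF D(1) y]
  show ?thesis
    unfolding nabla_def Let_def
    by (rule linearI) (simp_all only: linear_add[OF l1] linear_cmul[OF l1] linear_add[OF linear_dfp] linear_cmul[OF linear_dfp]
        bilinear_ladd[OF B] bilinear_lmul[OF B] scaleR_right_distrib ac_simps)
qed

text \<open>Integration by parts before integrating: the Leibniz rule for the metric pairing, where
  compatibility of the connection with the metric leaves one term with \<open>nabla\<close> and one
  with the divergence of \<open>\<beta>\<close>.\<close>

lemma divergence_pairing: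
  assumes s: "smooth_section \<Sigma> M f s" and \<beta>: "smooth_form \<Sigma> M f \<beta>"
  shows "S.divergence_of
    (\<lambda>p. (1 / S.lam p) * (riem M (f p) (nabla \<Sigma> M f s p 1) (\<beta> p 1) + riem M (f p) (nabla \<Sigma> M f s p \<i>) (\<beta> p \<i>)
       + riem M (f p) (s p) (Divp \<beta> p)))
    (\<lambda>p w. riem M (f p) (s p) (\<beta> p w))" (is "S.divergence_of ?u ?\<theta>")
  unfolding S.divergence_of_def
proof (intro conjI allI ballI)
  fix p
  have "linear (riem M (f p) (s p) \<circ> \<beta> p)"
    by (intro linear_compose form_linear[OF \<beta>]) (use M.riem_bilinear[of "f p"] in \<open>auto simp: bilinear_def\<close>)
  then show "linear (?\<theta> p)" by (simp add: comp_def)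
next
  fix c w assume c: "c \<in> atlas \<Sigma>"
  have loc: "S.oneform_loc c ?\<theta> w x = M.gloc d (floc c d x) (section_loc M f c d s x) (form_loc \<Sigma> M f c d \<beta> w x)"
    if d: "d \<in> atlas M" and x: "x \<in> W c d" for d x w
  proof -
    obtain p where p: "x = snd c p" "p \<in> fst c" "f p \<in> fst d" using x by blast
    show ?thesis unfolding p(1) section_loc_snd[OF c p(2)] form_loc_snd[OF c p(2)] floc_snd[OF c d p(2)]
      S.oneform_loc_def bilin_loc_def using c d p by simp
  qed
  show "Ck_on 1 (snd c ` fst c) (S.oneform_loc c ?\<theta> w)"
  proof (rule Ck_on_local)
    fix x assume "x \<in> snd c ` fst c"
    then obtain p where p: "x = snd c p" "p \<in> fst c" by blast
    let ?d = "chart_at M (f p)"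
    note D = M.chart_at[of "f p"]
    have o: "open (W c ?d)" by (rule W_open[OF c D(1)])
    have sub: "floc c ?d ` W c ?d \<subseteq> snd ?d ` fst ?d" using floc_in[OF c D(1)] by blast
    have g1: "Ck_on 1 (snd ?d ` fst ?d) (\<lambda>y. M.gloc ?d y v w)" for v w
      using M.smooth_gloc[OF D(1)] unfolding smooth_on_def by blast
    have "Ck_on 1 (W c ?d) (\<lambda>x. M.gloc ?d (floc c ?d x) (section_loc M f c ?d s x) (form_loc \<Sigma> M f c ?d \<beta> w x))"
      by (rule Ck_on_bilinear_family[OF o M.open_chart_image[OF D(1)] sub M.gloc_bilinear[OF D(1)] g1
            floc_smooth[OF c D(1)] section_smooth[OF s c D(1)] form_smooth[OF \<beta> c D(1)]])
    then have "Ck_on 1 (W c ?d) (S.oneform_loc c ?\<theta> w)"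
      by (rule Ck_on_cong[THEN iffD2, OF o loc[OF D(1)], rotated])
    then show "\<exists>Y. open Y \<and> x \<in> Y \<and> Ck_on 1 Y (S.oneform_loc c ?\<theta> w)"
      using o p D(2) by blast
  qed
next
  fix c p assume c: "c \<in> atlas \<Sigma>" and p: "p \<in> fst c"
  have loc: "S.oneform_loc c ?\<theta> w x = M.gloc d (floc c d x) (section_loc M f c d s x) (form_loc \<Sigma> M f c d \<beta> w x)"
    if d: "d \<in> atlas M" and x: "x \<in> W c d" for d x w
  proof -
    obtain p where p: "x = snd c p" "p \<in> fst c" "f p \<in> fst d" using x by blast
    show ?thesis unfolding p(1) section_loc_snd[OF c p(2)] form_loc_snd[OF c p(2)] floc_snd[OF c d p(2)]
      S.oneform_loc_def bilin_loc_def using c d p by simp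
  qed
  let ?d = "chart_at M (f p)" and ?x = "snd c p" and ?z = "from_chart \<Sigma> c p 1"
  note D = M.chart_at[of "f p"]
  have x: "?x \<in> W c ?d" using p D by auto
  let ?n = "nabla \<Sigma> M f s p" and ?g = "riem M (f p)"
  have g: "M.gloc ?d (floc c ?d ?x) v w = ?g v w" for v w
    unfolding floc_snd[OF c D(1) p] by (rule M.gloc_chart_at)
  have D1: "frechet_derivative (S.oneform_loc c ?\<theta> w) (at ?x) k
    = ?g (?n (from_chart \<Sigma> c p k)) (\<beta> p (from_chart \<Sigma> c p w)) + ?g (s p) (cov0 c ?d (form_loc \<Sigma> M f c ?d \<beta> w) k ?x)" for w k
  proof -
    have "(S.oneform_loc c ?\<theta> w has_derivative (\<lambda>k. M.gloc ?d (floc c ?d ?x) (cov0 c ?d (section_loc M f c ?d s) k ?x) (form_loc \<Sigma> M f c ?d \<beta> w ?x)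
        + M.gloc ?d (floc c ?d ?x) (section_loc M f c ?d s ?x) (cov0 c ?d (form_loc \<Sigma> M f c ?d \<beta> w) k ?x))) (at ?x)"
      by (rule has_derivative_transform_within_open[OF cov0_metric[OF c D(1) x section_has_derivative[OF s c D(1) x] form_has_derivative[OF \<beta> c D(1) x]]
            W_open[OF c D(1)] x loc[OF D(1), symmetric]])
    from frechet_derivative_eqI[OF this] show ?thesis
      unfolding g nabla_cov0[OF s c D(1) p D(2)] section_loc_snd[OF c p] form_loc_snd[OF c p] by simp
  qed
  have Q: "bilinear (\<lambda>v w. ?g (?n v) (\<beta> p w))"
    unfolding bilinear_def
    using linear_compose[OF linear_nabla[OF s, of p]] linear_compose[OF form_linear[OF \<beta>, of p]] M.riem_bilinear[of "f p"]
    unfolding bilinear_def comp_def by blast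
  have "?g (?n ?z) (\<beta> p ?z) + ?g (?n (\<i> * ?z)) (\<beta> p (\<i> * ?z)) = (cmod ?z)\<^sup>2 * (?g (?n 1) (\<beta> p 1) + ?g (?n \<i>) (\<beta> p \<i>))"
    using bilinear_conformal[OF Q, of ?z] by simp
  moreover have "?g (s p) (cov0 c ?d (form_loc \<Sigma> M f c ?d \<beta> 1) 1 ?x) + ?g (s p) (cov0 c ?d (form_loc \<Sigma> M f c ?d \<beta> \<i>) \<i> ?x)
    = (cmod ?z)\<^sup>2 * ?g (s p) (Divp \<beta> p)"
    unfolding bilinear_radd[OF M.riem_bilinear, symmetric] Div_Divp[OF \<beta> c D(1) p D(2), unfolded Div_def]
      bilinear_rmul[OF M.riem_bilinear] by simp
  moreover have "from_chart \<Sigma> c p \<i> = \<i> * ?z" by (rule S.from_chart_mult[OF c p])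
  ultimately show "S.gloc c (snd c p) 1 1 * ?u p =
        frechet_derivative (S.oneform_loc c ?\<theta> 1) (at (snd c p)) 1 + frechet_derivative (S.oneform_loc c ?\<theta> \<i>) (at (snd c p)) \<i>"
    unfolding D1 S.gloc_lam[OF c p] using S.lam_pos[of p] by (simp add: algebra_simps)
qed

end

section \<open>Integration in the plane\<close>

text \<open>Areas are extended nonnegative integrals, while the change of variables theorem speaks
  of absolutely integrable functions; the two are matched for every finite value
  \<open>b\<close>.\<close>

lemma nn_integral_eq_absolutely_integrable_iff:
  fixes g :: "'a::euclidean_space \<Rightarrow> real"
  assumes m: "(\<lambda>x. indicator T x * g x) \<in> borel_measurable borel" and nn: "\<And>x. x \<in> T \<Longrightarrow> 0 \<le> g x" and b: "0 \<le> b"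
  shows "(\<integral>\<^sup>+x. ennreal (indicator T x * g x) \<partial>lborel) = ennreal b \<longleftrightarrow> g absolutely_integrable_on T \<and> integral T g = b"
proof -
  have m': "(\<lambda>x. indicator T x *\<^sub>R g x) \<in> borel_measurable lborel" using m by simp
  have "(\<integral>\<^sup>+x. ennreal (indicator T x * g x) \<partial>lborel) = ennreal b \<longleftrightarrow>
      integrable lborel (\<lambda>x. indicator T x * g x) \<and> (LINT x|lborel. indicator T x * g x) = b"
    by (rule nn_integral_eq_integrable) (use m nn b in \<open>auto simp: indicator_def\<close>)
  moreover have "g absolutely_integrable_on T \<longleftrightarrow> integrable lborel (\<lambda>x. indicator T x * g x)"
    unfolding set_integrable_def using integrable_completion[OF m'] by simp
  moreover have "integral T g = (LINT x|lborel. indicator T x * g x)" if "g absolutely_integrable_on T"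
    using set_lebesgue_integral_eq_integral(2)[OF that] integral_completion[OF m']
    unfolding set_lebesgue_integral_def by simp
  ultimately show ?thesis by metis
qed

lemma nn_integral_change_of_variables:
  fixes g :: "real^'n::{finite,wellorder} \<Rightarrow> real^'n::_" and f :: "real^'n::_ \<Rightarrow> real"
  assumes S: "S \<in> sets borel" and der: "\<And>x. x \<in> S \<Longrightarrow> (g has_derivative g' x) (at x)" and inj: "inj_on g S"
    and nn: "\<And>y. y \<in> g ` S \<Longrightarrow> 0 \<le> f y"
    and m1: "(\<lambda>y. indicator (g ` S) y * f y) \<in> borel_measurable borel"
    and m2: "(\<lambda>x. indicator S x * (\<bar>det (matrix (g' x))\<bar> * f (g x))) \<in> borel_measurable borel"
  shows "(\<integral>\<^sup>+y. ennreal (indicator (g ` S) y * f y) \<partial>lborel)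
    = (\<integral>\<^sup>+x. ennreal (indicator S x * (\<bar>det (matrix (g' x))\<bar> * f (g x))) \<partial>lborel)" (is "?L = ?R")
proof -
  have iff: "?L = ennreal b \<longleftrightarrow> ?R = ennreal b" if b: "b \<ge> 0" for b
  proof -
    have "S \<in> sets lebesgue" using S by simp
    then have *: "(\<lambda>x. \<bar>det (matrix (g' x))\<bar> *\<^sub>R (vec (f (g x)) :: real^1)) absolutely_integrable_on S \<and>
           integral S (\<lambda>x. \<bar>det (matrix (g' x))\<bar> *\<^sub>R (vec (f (g x)) :: real^1)) = vec b
     \<longleftrightarrow> (\<lambda>y. (vec (f y) :: real^1)) absolutely_integrable_on (g ` S) \<and> integral (g ` S) (\<lambda>y. (vec (f y) :: real^1)) = vec b"
      by (rule has_absolute_integral_change_of_variables[OF _ has_derivative_at_withinI[OF der] inj])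
    have "?L = ennreal b \<longleftrightarrow> f absolutely_integrable_on (g ` S) \<and> integral (g ` S) f = b"
      by (rule nn_integral_eq_absolutely_integrable_iff[OF m1 nn b])
    moreover have "?R = ennreal b \<longleftrightarrow> (\<lambda>x. \<bar>det (matrix (g' x))\<bar> * f (g x)) absolutely_integrable_on S \<and>
        integral S (\<lambda>x. \<bar>det (matrix (g' x))\<bar> * f (g x)) = b"
      by (rule nn_integral_eq_absolutely_integrable_iff[OF m2 _ b]) (use nn in auto)
    ultimately show ?thesis using *
      unfolding absolutely_integrable_on_1_iff integral_on_1_eq by (simp add: vec_eq_iff)
  qed
  \<comment> \<open>The equivalence concerns finite values only. If the left side is infinite, a
    finite right side would make it finite too.\<close>
  show ?thesis
  proof (cases "?L = \<infinity>")
    case True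
    then show ?thesis using iff[of "enn2real ?R"] by (cases ?R) auto
  next
    case False
    then obtain b where "b \<ge> 0" "?L = ennreal b" by (cases ?L) auto
    then show ?thesis using iff[of b] by simp
  qed
qed

text \<open>The change of variables theorem lives on \<open>real^'n\<close> with determinants, so
  planar integrals are carried over to \<open>real^2\<close> by a measure preserving
  identification.\<close>

definition vec_of_complex :: "complex \<Rightarrow> real^2" where "vec_of_complex z = vector [Re z, Im z]"
definition complex_of_vec :: "real^2 \<Rightarrow> complex" where "complex_of_vec v = Complex (v$1) (v$2)"

lemma complex_vec_inverse [simp]: "complex_of_vec (vec_of_complex z) = z" "vec_of_complex (complex_of_vec v) = v"
  by (simp_all add: complex_of_vec_def vec_of_complex_def vec_eq_iff forall_2)

lemma bounded_linear_vec_of_complex: "bounded_linear vec_of_complex"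
  unfolding linear_conv_bounded_linear[symmetric]
  by (rule linearI) (simp_all add: vec_of_complex_def vec_eq_iff forall_2)

lemma bounded_linear_complex_of_vec: "bounded_linear complex_of_vec"
  unfolding linear_conv_bounded_linear[symmetric]
  by (rule linearI) (simp_all add: complex_of_vec_def complex_eq_iff)

lemma complex_vec_measurable [measurable]:
  "vec_of_complex \<in> borel_measurable borel" "complex_of_vec \<in> borel_measurable borel"
  by (intro borel_measurable_continuous_onI linear_continuous_on bounded_linear_vec_of_complex bounded_linear_complex_of_vec)+

lemma distr_complex_of_vec: "distr lborel borel complex_of_vec = lborel"
proof (rule lborel_eqI[symmetric])
  fix l u :: complex assume lu: "\<And>b. b \<in> Basis \<Longrightarrow> l \<bullet> b \<le> u \<bullet> b"
  have le: "Re l \<le> Re u" "Im l \<le> Im u" using lu[of 1] lu[of \<i>] by (simp_all add: Basis_complex_def)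
  have B: "(Basis :: (real^2) set) = {axis 1 1, axis 2 1}"
    by (auto simp: Basis_vec_def UNIV_2)
  have ne: "axis 1 1 \<noteq> (axis 2 1 :: real^2)" by (simp add: axis_eq_axis)
  have "complex_of_vec -` box l u = box (vec_of_complex l) (vec_of_complex u)"
    by (auto simp: complex_of_vec_def vec_of_complex_def mem_box_cart forall_2 in_box_complex_iff)
  moreover have "emeasure lborel (box (vec_of_complex l) (vec_of_complex u)) = ennreal ((Re u - Re l) * (Im u - Im l))"
    by (subst emeasure_lborel_box)
       (use le ne in \<open>auto simp: B inner_axis vec_of_complex_def\<close>)
  ultimately show "emeasure (distr lborel borel complex_of_vec) (box l u) = ennreal (\<Prod>b\<in>Basis. (u - l) \<bullet> b)"
    by (subst emeasure_distr) (auto simp: Basis_complex_def)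
qed simp

lemma nn_integral_complex_of_vec:
  assumes "F \<in> borel_measurable borel"
  shows "(\<integral>\<^sup>+z. F z \<partial>lborel) = (\<integral>\<^sup>+v. F (complex_of_vec v) \<partial>lborel)"
  by (subst distr_complex_of_vec[symmetric], rule nn_integral_distr) (use assms in simp_all)

lemma det_complex_mult:
  "\<bar>det (matrix (\<lambda>v. vec_of_complex (z * complex_of_vec v)))\<bar> = (cmod z)\<^sup>2"
  by (simp add: det_2 matrix_def vec_of_complex_def complex_of_vec_def axis_def cmod_power2)
     (simp add: power2_eq_square)

text \<open>The Jacobian of multiplication by a complex number is its squared modulus.\<close>

lemma nn_integral_holomorphic_substitution:
  fixes \<phi> z :: "complex \<Rightarrow> complex" and F :: "complex \<Rightarrow> real"
  assumes S: "S \<in> sets borel" and der: "\<And>x. x \<in> S \<Longrightarrow> (\<phi> has_derivative (\<lambda>h. z x * h)) (at x)" and inj: "inj_on \<phi> S"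
    and nn: "\<And>y. y \<in> \<phi> ` S \<Longrightarrow> 0 \<le> F y"
    and m1: "(\<lambda>y. indicator (\<phi> ` S) y * F y) \<in> borel_measurable borel"
    and m2: "(\<lambda>x. indicator S x * ((cmod (z x))\<^sup>2 * F (\<phi> x))) \<in> borel_measurable borel"
  shows "(\<integral>\<^sup>+y. ennreal (indicator (\<phi> ` S) y * F y) \<partial>lborel)
    = (\<integral>\<^sup>+x. ennreal (indicator S x * ((cmod (z x))\<^sup>2 * F (\<phi> x))) \<partial>lborel)"
proof -
  let ?g = "\<lambda>v. vec_of_complex (\<phi> (complex_of_vec v))" and ?S = "complex_of_vec -` S"
  let ?g' = "\<lambda>x h. vec_of_complex (z (complex_of_vec x) * complex_of_vec h)"
  have gS: "?g ` ?S = complex_of_vec -` (\<phi> ` S)"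
  proof (rule subset_antisym)
    show "?g ` ?S \<subseteq> complex_of_vec -` (\<phi> ` S)" by auto
    show "complex_of_vec -` (\<phi> ` S) \<subseteq> ?g ` ?S"
    proof (rule subsetI)
      fix v assume "v \<in> complex_of_vec -` (\<phi> ` S)"
      then obtain x where x: "x \<in> S" "complex_of_vec v = \<phi> x" unfolding vimage_def by blast
      have "v = vec_of_complex (complex_of_vec v)" by simp
      then have "v = ?g (vec_of_complex x)" "vec_of_complex x \<in> ?S" using x by simp_all
      then show "v \<in> ?g ` ?S" by blast
    qed
  qed
  have iv: "(indicator (complex_of_vec -` A) y :: real) = indicator A (complex_of_vec y)" for A y
    by (simp add: indicator_def)
  have m1': "(\<lambda>y. indicator (complex_of_vec -` (\<phi> ` S)) y * F (complex_of_vec y)) \<in> borel_measurable borel"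
    using measurable_compose[OF complex_vec_measurable(2) m1] by (simp add: iv)
  have m2': "(\<lambda>x. indicator ?S x * ((cmod (z (complex_of_vec x)))\<^sup>2 * F (\<phi> (complex_of_vec x)))) \<in> borel_measurable borel"
    using measurable_compose[OF complex_vec_measurable(2) m2] by (simp add: iv)
  have "(\<integral>\<^sup>+y. ennreal (indicator (?g ` ?S) y * F (complex_of_vec y)) \<partial>lborel)
    = (\<integral>\<^sup>+x. ennreal (indicator ?S x * (\<bar>det (matrix (?g' x))\<bar> * F (complex_of_vec (?g x)))) \<partial>lborel)"
  proof (rule nn_integral_change_of_variables)
    show "?S \<in> sets borel" using measurable_sets[OF complex_vec_measurable(2) S] by simp
    show "(?g has_derivative ?g' x) (at x)" if "x \<in> ?S" for x
    proof -
      have "(complex_of_vec has_derivative complex_of_vec) (at x)"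
        by (rule bounded_linear_imp_has_derivative[OF bounded_linear_complex_of_vec])
      from has_derivative_compose[OF this der] that
      have "((\<lambda>v. \<phi> (complex_of_vec v)) has_derivative (\<lambda>h. z (complex_of_vec x) * complex_of_vec h)) (at x)" by simp
      then show ?thesis by (rule bounded_linear.has_derivative[OF bounded_linear_vec_of_complex])
    qed
    show "inj_on ?g ?S"
    proof (rule inj_onI)
      fix x y assume "x \<in> ?S" "y \<in> ?S" "?g x = ?g y"
      then have "complex_of_vec (?g x) = complex_of_vec (?g y)" by simp
      then have "complex_of_vec x = complex_of_vec y" using inj \<open>x \<in> ?S\<close> \<open>y \<in> ?S\<close> by (auto dest: inj_onD)
      then have "vec_of_complex (complex_of_vec x) = vec_of_complex (complex_of_vec y)" by (rule arg_cong)
      then show "x = y" by simp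
    qed
    show "0 \<le> F (complex_of_vec y)" if "y \<in> ?g ` ?S" for y using that nn unfolding gS by auto
    show "(\<lambda>y. indicator (?g ` ?S) y * F (complex_of_vec y)) \<in> borel_measurable borel" unfolding gS by (rule m1')
    show "(\<lambda>x. indicator ?S x * (\<bar>det (matrix (?g' x))\<bar> * F (complex_of_vec (?g x)))) \<in> borel_measurable borel"
      unfolding det_complex_mult using m2' by simp
  qed
  then have "(\<integral>\<^sup>+y. ennreal (indicator (\<phi> ` S) (complex_of_vec y) * F (complex_of_vec y)) \<partial>lborel)
    = (\<integral>\<^sup>+x. ennreal (indicator S (complex_of_vec x) * ((cmod (z (complex_of_vec x)))\<^sup>2 * F (\<phi> (complex_of_vec x)))) \<partial>lborel)"
    unfolding gS det_complex_mult by (simp add: iv)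
  then show ?thesis
    by (subst (1 2) nn_integral_complex_of_vec) (use m1 m2 in simp_all)
qed

text \<open>Differentiate the translation invariance of the integral.\<close>
lemma integral_derivative_compact_support:
  fixes F :: "'a::euclidean_space \<Rightarrow> real"
  assumes F: "Ck_on 1 UNIV F" and supp: "\<And>x. x \<notin> cball x0 r \<Longrightarrow> F x = 0"
  shows "integrable lborel (\<lambda>x. frechet_derivative F (at x) v)" "(LINT x|lborel. frechet_derivative F (at x) v) = 0"
proof -
  let ?D = "\<lambda>x v. frechet_derivative F (at x) v"
  have D: "(F has_derivative ?D x) (at x)" for x using Ck_on_derivD[of 0 UNIV F x] F by simp
  have cD: "continuous_on UNIV (\<lambda>x. ?D x w)" for w using F by simp
  have cF: "continuous_on UNIV F" by (rule Ck_on_continuous[OF F])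
  have D0: "?D x w = 0" if x: "x \<notin> cball x0 r" for x w
  proof -
    have "open (- cball x0 r)" by (rule open_Compl[OF closed_cball])
    from frechet_derivative_cong_open[OF this, of x F "\<lambda>_. 0"] x supp
    show ?thesis by simp
  qed
  have "\<exists>B\<ge>0. \<forall>x. \<bar>?D x b\<bar> \<le> B" for b
  proof -
    have "compact ((\<lambda>x. ?D x b) ` cball x0 r)"
      by (rule compact_continuous_image[OF continuous_on_subset[OF cD subset_UNIV] compact_cball])
    from compact_imp_bounded[OF this] obtain B where "\<forall>y\<in>(\<lambda>x. ?D x b) ` cball x0 r. norm y \<le> B"
      unfolding bounded_iff ..
    then have B: "\<bar>?D x b\<bar> \<le> B" if "x \<in> cball x0 r" for x using that by simp
    have "\<bar>?D x b\<bar> \<le> max 0 B" for x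
      using B[of x] D0[of x b] by (cases "x \<in> cball x0 r") (simp_all del: mem_cball add: le_max_iff_disj)
    then show ?thesis by (intro exI[of _ "max 0 B"]) simp
  qed
  then obtain B where B: "\<And>b. B b \<ge> 0" "\<And>b x. \<bar>?D x b\<bar> \<le> B b" by metis
  define K where "K = (\<Sum>b\<in>Basis. B b)"
  have bd: "\<bar>?D x w\<bar> \<le> K * norm w" for x w
  proof -
    have lin: "linear (?D x)" by (rule has_derivative_linear[OF D])
    have "?D x w = ?D x (\<Sum>b\<in>Basis. (w \<bullet> b) *\<^sub>R b)" by (simp only: euclidean_representation)
    also have "\<dots> = (\<Sum>b\<in>Basis. (w \<bullet> b) * ?D x b)"
      by (simp only: linear_sum[OF lin] linear_cmul[OF lin] real_scaleR_def)
    finally have e: "?D x w = (\<Sum>b\<in>Basis. (w \<bullet> b) * ?D x b)" .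
    have "\<bar>\<Sum>b\<in>Basis. (w \<bullet> b) * ?D x b\<bar> \<le> (\<Sum>b\<in>Basis. B b * norm w)"
    proof (rule order_trans[OF sum_abs sum_mono])
      fix b :: 'a assume b: "b \<in> Basis"
      have "\<bar>w \<bullet> b\<bar> * \<bar>?D x b\<bar> \<le> norm w * B b"
        by (intro mult_mono Basis_le_norm b B) auto
      then show "\<bar>(w \<bullet> b) * ?D x b\<bar> \<le> B b * norm w" by (simp add: abs_mult mult.commute)
    qed
    then show ?thesis unfolding e K_def by (simp add: sum_distrib_right)
  qed
  have lip: "\<bar>F y - F x\<bar> \<le> K * norm (y - x)" for x y
  proof -
    have "norm (F y - F x) \<le> K * norm (y - x)"
    proof (rule differentiable_bound[of UNIV F ?D K y x])
      show "(F has_derivative ?D z) (at z within UNIV)" for z by (rule D)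
      show "onorm (?D z) \<le> K" for z using bd by (intro onorm_le) simp
    qed simp_all
    then show ?thesis by simp
  qed
  define q where "q n x = real n *\<^sub>R (F (x + inverse (real n) *\<^sub>R v) - F x)" for n x
  have iF: "integrable lborel F"
  proof -
    have "integrable lborel (\<lambda>x. indicator (cball x0 r) x *\<^sub>R F x)"
      by (rule borel_integrable_compact[OF compact_cball continuous_on_subset[OF cF]]) simp
    moreover have "(\<lambda>x. indicator (cball x0 r) x *\<^sub>R F x) = F"
    proof
      fix x show "indicator (cball x0 r) x *\<^sub>R F x = F x"
        using supp[of x] by (cases "x \<in> cball x0 r") (simp_all del: mem_cball)
    qed
    ultimately show ?thesis by simp
  qed
  have shift: "integrable lborel (\<lambda>x. F (x + a))" "(LINT x|lborel. F (x + a)) = (LINT x|lborel. F x)" for a :: 'a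
  proof -
    have m: "(+) a \<in> borel_measurable lborel" by simp
    have F': "F \<in> borel_measurable borel" by (rule borel_measurable_continuous_onI[OF cF])
    have "integrable (distr lborel borel ((+) a)) F" using iF by (simp add: lborel_distr_plus)
    then show "integrable lborel (\<lambda>x. F (x + a))"
      using integrable_distr_eq[of "(+) a" lborel borel F] F' by (simp add: add.commute)
    have "(LINT x|distr lborel borel ((+) a). F x) = (LINT x|lborel. F (a + x))"
      by (rule integral_distr) (use F' in simp_all)
    then show "(LINT x|lborel. F (x + a)) = (LINT x|lborel. F x)" by (simp add: lborel_distr_plus add.commute)
  qed
  have q0: "(LINT x|lborel. q n x) = 0" and iq: "integrable lborel (q n)" for n
    unfolding q_def using shift[of "inverse (real n) *\<^sub>R v"] iF by simp_all
  \<comment> \<open>For \<open>n > 0\<close> the increment is at most \<open>norm v\<close>, so the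
    quotient vanishes outside this ball; for \<open>n = 0\<close> it is zero anyway. Together with
    the Lipschitz bound this gives an integrable majorant.\<close>
  define R where "R = cball x0 (r + norm v)"
  have dom: "norm (q n x) \<le> K * norm v * indicator R x" for n x
  proof (cases "n = 0")
    case True
    have "0 \<le> K * norm v" using bd[of x0 v] abs_ge_zero[of "?D x0 v"] by linarith
    then show ?thesis using True by (simp add: q_def)
  next
    case n: False
    show ?thesis
    proof (cases "x \<in> R")
      case True
      have "norm (q n x) = real n * \<bar>F (x + inverse (real n) *\<^sub>R v) - F x\<bar>" by (simp add: q_def abs_mult)
      also have "\<dots> \<le> real n * (K * norm (x + inverse (real n) *\<^sub>R v - x))" by (intro mult_left_mono lip) simp
      also have "\<dots> = K * norm v" using n by simp
      finally show ?thesis using True by simp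
    next
      case False
      have "inverse (real n) * norm v \<le> 1 * norm v" using n by (intro mult_right_mono) (auto simp: inverse_le_1_iff)
      then have 1: "norm (inverse (real n) *\<^sub>R v) \<le> norm v" by simp
      have 2: "dist x0 x \<le> dist x0 (x + inverse (real n) *\<^sub>R v) + norm (inverse (real n) *\<^sub>R v)"
        using dist_triangle[of x0 x "x + inverse (real n) *\<^sub>R v"] by (simp add: dist_norm)
      have 3: "r + norm v < dist x0 x" using False unfolding R_def by (simp add: not_le)
      have "r < dist x0 (x + inverse (real n) *\<^sub>R v)" using 1 2 3 by linarith
      moreover have "r < dist x0 x" using 3 norm_ge_zero[of v] by linarith
      ultimately have "x + inverse (real n) *\<^sub>R v \<notin> cball x0 r" "x \<notin> cball x0 r" by (simp_all add: not_le)
      then have "q n x = 0" by (simp add: q_def supp)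
      then show ?thesis using False by simp
    qed
  qed
  have m: "(\<lambda>x. ?D x v) \<in> borel_measurable lborel"
    using borel_measurable_continuous_onI[OF cD] by simp
  have mq: "q n \<in> borel_measurable lborel" for n using iq by (rule borel_measurable_integrable)
  have w: "integrable lborel (\<lambda>x. K * norm v * indicator R x)"
    unfolding R_def using emeasure_bounded_finite[OF bounded_cball] by (intro integrable_mult_right integrable_real_indicator) auto
  have lim: "AE x in lborel. (\<lambda>n. q n x) \<longlonglongrightarrow> ?D x v"
    unfolding q_def using directional_difference_quotient[OF D] by simp
  show "integrable lborel (\<lambda>x. ?D x v)"
    by (rule integrable_dominated_convergence[OF m mq w lim]) (use dom in simp)
  have "(\<lambda>n. LINT x|lborel. q n x) \<longlonglongrightarrow> (LINT x|lborel. ?D x v)"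
    by (rule integral_dominated_convergence[OF m mq w lim]) (use dom in simp)
  then show "(LINT x|lborel. ?D x v) = 0" unfolding q0 by (simp add: LIMSEQ_const_iff)
qed

section \<open>The area measure\<close>

locale compact_surface = surface \<Sigma>
  for \<Sigma> :: "('s::{t2_space,second_countable_topology}, complex) riem_mfd" +
  assumes compact_UNIV: "compact (UNIV :: 's set)"
begin

definition img :: "('s, complex) chart \<Rightarrow> complex set" where "img c = snd c ` fst c"

definition dens :: "('s, complex) chart \<Rightarrow> 's set \<Rightarrow> ennreal" where
  "dens c B = (\<integral>\<^sup>+x. ennreal (indicator (snd c ` B) x * gloc c x 1 1) \<partial>lborel)"

text \<open>Extended by a constant outside the image, so that it is Borel measurable on the whole
  plane.\<close>

definition total_inv :: "('s, complex) chart \<Rightarrow> complex \<Rightarrow> 's" where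
  "total_inv c x = (if x \<in> img c then chart_inv c x else undefined)"

text \<open>Push-forward of the coordinate area. The density is zero outside the image, so the
  arbitrary value of \<open>total_inv\<close> there carries no mass.\<close>

definition chart_measure :: "('s, complex) chart \<Rightarrow> 's measure" where
  "chart_measure c = distr (density lborel (\<lambda>x. ennreal (indicator (img c) x * gloc c x 1 1))) borel (total_inv c)"

lemma gloc_conformal:
  assumes c: "c \<in> atlas \<Sigma>" and x: "x \<in> snd c ` fst c"
  shows "gloc c x z z = (cmod z)\<^sup>2 * gloc c x 1 1"
  using bilinear_conformal[OF gloc_bilinear[OF c x], of z] gloc_J[OF c x, of z z] gloc_J[OF c x, of 1 1] by simp

context
  fixes c assumes c: "c \<in> atlas \<Sigma>"
begin

lemma img_open: "open (img c)" unfolding img_def by (rule open_chart_image[OF c])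

lemma total_inv_measurable: "total_inv c \<in> borel_measurable borel"
  unfolding total_inv_def[abs_def]
  by (rule borel_measurable_continuous_on_if)
     (use img_open homeomorphism_cont2[OF homeo[OF c]] in \<open>auto simp: img_def\<close>)

lemma chart_image_vimage:
  assumes "B \<subseteq> fst c" shows "snd c ` B = total_inv c -` B \<inter> img c"
proof (rule subset_antisym)
  show "snd c ` B \<subseteq> total_inv c -` B \<inter> img c" using assms c by (auto simp: total_inv_def img_def)
  show "total_inv c -` B \<inter> img c \<subseteq> snd c ` B" using c by (auto simp: total_inv_def img_def)
qed

lemma chart_image_borel: "B \<in> sets borel \<Longrightarrow> B \<subseteq> fst c \<Longrightarrow> snd c ` B \<in> sets borel"
  unfolding chart_image_vimage using measurable_sets[OF total_inv_measurable, of B] img_open by auto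

lemma gloc_measurable:
  assumes "S \<in> sets borel" "S \<subseteq> img c"
  shows "(\<lambda>x. indicator S x * gloc c x 1 1) \<in> borel_measurable borel"
proof -
  have "continuous_on (img c) (\<lambda>x. gloc c x 1 1)"
    using smooth_gloc[OF c] Ck_on_continuous unfolding smooth_on_def img_def by blast
  from borel_measurable_continuous_on_indicator[OF assms(1) continuous_on_subset[OF this assms(2)]]
  show ?thesis by simp
qed

lemma emeasure_chart_measure:
  assumes B: "B \<in> sets borel"
  shows "emeasure (chart_measure c) B = dens c (B \<inter> fst c)"
proof -
  have m: "(\<lambda>x. ennreal (indicator (img c) x * gloc c x 1 1)) \<in> borel_measurable lborel"
    using gloc_measurable[of "img c"] img_open by simp
  have "emeasure (chart_measure c) B = emeasure (density lborel (\<lambda>x. ennreal (indicator (img c) x * gloc c x 1 1))) (total_inv c -` B)"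
    unfolding chart_measure_def using total_inv_measurable B by (subst emeasure_distr) auto
  also have "\<dots> = (\<integral>\<^sup>+x. ennreal (indicator (img c) x * gloc c x 1 1) * indicator (total_inv c -` B) x \<partial>lborel)"
    by (rule emeasure_density[OF m]) (use measurable_sets[OF total_inv_measurable B] in simp)
  also have "\<dots> = dens c (B \<inter> fst c)"
    unfolding dens_def
  proof (rule nn_integral_cong)
    fix x
    have "snd c ` (B \<inter> fst c) = total_inv c -` (B \<inter> fst c) \<inter> img c" by (rule chart_image_vimage) simp
    moreover have "x \<in> img c \<Longrightarrow> total_inv c x \<in> fst c" using c by (auto simp: total_inv_def img_def)
    ultimately have "x \<in> snd c ` (B \<inter> fst c) \<longleftrightarrow> x \<in> img c \<and> x \<in> total_inv c -` B" by auto
    then show "ennreal (indicator (img c) x * gloc c x 1 1) * indicator (total_inv c -` B) x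
      = ennreal (indicator (snd c ` (B \<inter> fst c)) x * gloc c x 1 1)"
      by (cases "x \<in> img c"; cases "x \<in> total_inv c -` B") simp_all
  qed
  finally show ?thesis .
qed

end

lemma sets_chart_measure: "sets (chart_measure c) = sets borel" by (simp add: chart_measure_def)

text \<open>The Jacobian of the transition map is exactly the factor by which the two conformal
  densities differ.\<close>

lemma dens_eq:
  assumes c: "c \<in> atlas \<Sigma>" and d: "d \<in> atlas \<Sigma>" and B: "B \<in> sets borel" "B \<subseteq> fst c" "B \<subseteq> fst d"
  shows "dens c B = dens d B"
proof -
  let ?S = "snd c ` B"
  have trS: "tr c d ` ?S = snd d ` B"
    unfolding image_image
  proof (rule image_cong)
    fix p assume "p \<in> B"
    then show "tr c d (snd c p) = snd d p" using B(2) by (intro tr_snd[OF c]) blast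
  qed simp
  have S: "?S \<in> sets borel" "snd d ` B \<in> sets borel"
    by (rule chart_image_borel[OF c B(1,2)], rule chart_image_borel[OF d B(1,3)])
  have sub: "?S \<subseteq> snd c ` (fst c \<inter> fst d)" "?S \<subseteq> img c" "snd d ` B \<subseteq> img d" using B by (auto simp: img_def)
  have conf: "(cmod (dtr c d x 1))\<^sup>2 * gloc d (tr c d x) 1 1 = gloc c x 1 1" if "x \<in> ?S" for x
  proof -
    obtain p where p: "x = snd c p" "p \<in> fst c" "p \<in> fst d" using \<open>x \<in> ?S\<close> B by blast
    have "snd d p \<in> snd d ` fst d" using p by blast
    from gloc_conformal[OF d this, of "dtr c d (snd c p) 1"] gloc_transform[OF c d p(2,3), of 1 1]
    show ?thesis unfolding p(1) tr_snd[OF c p(2)] by argo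
  qed
  have eq: "indicator ?S x * ((cmod (dtr c d x 1))\<^sup>2 * gloc d (tr c d x) 1 1) = indicator ?S x * gloc c x 1 1" for x
    using conf[of x] by (cases "x \<in> ?S") simp_all
  have "(\<integral>\<^sup>+y. ennreal (indicator (tr c d ` ?S) y * gloc d y 1 1) \<partial>lborel)
    = (\<integral>\<^sup>+x. ennreal (indicator ?S x * ((cmod (dtr c d x 1))\<^sup>2 * gloc d (tr c d x) 1 1)) \<partial>lborel)"
  proof (rule nn_integral_holomorphic_substitution[OF S(1)])
    fix x assume "x \<in> ?S"
    then have x: "x \<in> snd c ` (fst c \<inter> fst d)" using sub by blast
    have "dtr c d x = (\<lambda>h. dtr c d x 1 * h)"
    proof
      fix h show "dtr c d x h = dtr c d x 1 * h" using dtr_eq_mult[OF c d x, of h] by (simp only: mult.commute)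
    qed
    then show "(tr c d has_derivative (\<lambda>h. dtr c d x 1 * h)) (at x)"
      using tr_has_derivative[OF c d x] by simp
  next
    show "inj_on (tr c d) ?S"
    proof (rule inj_onI)
      fix x y assume "x \<in> ?S" "y \<in> ?S" and e: "tr c d x = tr c d y"
      then obtain p q where p: "x = snd c p" "p \<in> fst c" "p \<in> fst d" and q: "y = snd c q" "q \<in> fst c" "q \<in> fst d"
        using B by blast
      from e have "snd d p = snd d q" unfolding p(1) q(1) tr_snd[OF c p(2)] tr_snd[OF c q(2)] .
      then have "chart_inv d (snd d p) = chart_inv d (snd d q)" by (rule arg_cong)
      then show "x = y" using p q d by simp
    qed
    show "0 \<le> gloc d y 1 1" if "y \<in> tr c d ` ?S" for y
    proof -
      have "y \<in> snd d ` fst d" using that sub(3) unfolding trS img_def by blast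
      from gloc_pos[OF d this] show ?thesis by simp
    qed
    show "(\<lambda>y. indicator (tr c d ` ?S) y * gloc d y 1 1) \<in> borel_measurable borel"
      unfolding trS by (rule gloc_measurable[OF d S(2) sub(3)])
    show "(\<lambda>x. indicator ?S x * ((cmod (dtr c d x 1))\<^sup>2 * gloc d (tr c d x) 1 1)) \<in> borel_measurable borel"
      unfolding eq by (rule gloc_measurable[OF c S(1) sub(2)])
  qed
  then show ?thesis unfolding trS eq dens_def ..
qed

text \<open>On a Riemann surface the coordinate density of the area is the conformal factor.\<close>
lemma dens_area:
  assumes c: "c \<in> atlas \<Sigma>" and B: "B \<subseteq> fst c"
  shows "(\<integral>\<^sup>+x\<in>snd c ` B. ennreal (sqrt (gloc c x 1 1 * gloc c x \<i> \<i> - (gloc c x 1 \<i>)\<^sup>2)) \<partial>lborel) = dens c B"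
  unfolding dens_def
proof (rule nn_integral_cong)
  fix x
  show "ennreal (sqrt (gloc c x 1 1 * gloc c x \<i> \<i> - (gloc c x 1 \<i>)\<^sup>2)) * indicator (snd c ` B) x
    = ennreal (indicator (snd c ` B) x * gloc c x 1 1)"
  proof (cases "x \<in> snd c ` B")
    case True
    then have x: "x \<in> snd c ` fst c" using B by blast
    have "gloc c x \<i> \<i> = gloc c x 1 1" using gloc_J[OF c x, of 1 1] by simp
    moreover have "gloc c x 1 \<i> = 0"
      using gloc_J[OF c x, of 1 \<i>] gloc_sym[of c x 1 \<i>] bilinear_rneg[OF gloc_bilinear[OF c x], of \<i> 1] by simp
    ultimately show ?thesis using True gloc_pos[OF c x] by simp
  qed simp
qed

section \<open>Existence, uniqueness and finiteness of the area measure\<close>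

definition is_area :: "'s measure \<Rightarrow> bool" where
  "is_area \<mu> \<longleftrightarrow> sets \<mu> = sets borel \<and>
     (\<forall>c\<in>atlas \<Sigma>. \<forall>B\<in>sets borel. B \<subseteq> fst c \<longrightarrow> emeasure \<mu> B = dens c B)"

text \<open>Successive differences of finitely many chart domains, which exist by compactness. Borel
  pieces, each inside a single chart, suffice for gluing measures, so no smooth decomposition is
  involved.\<close>

lemma finite_disjoint_cover:
  "\<exists>(N :: nat) ch D. (\<forall>n<N. ch n \<in> atlas \<Sigma> \<and> D n \<subseteq> fst (ch n) \<and> D n \<in> sets borel) \<and>
     disjoint_family_on D {..<N} \<and> (\<Union>n<N. D n) = (UNIV :: 's set)"
proof -
  have "\<And>c. c \<in> atlas \<Sigma> \<Longrightarrow> open (fst c)" by (rule open_chart)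
  moreover have "UNIV \<subseteq> (\<Union>c\<in>atlas \<Sigma>. fst c)" using complex_atlas by (simp add: complex_atlas_def)
  ultimately obtain C where C: "C \<subseteq> atlas \<Sigma>" "finite C" "UNIV \<subseteq> (\<Union>c\<in>C. fst c)"
    using compactE_image[OF compact_UNIV, of "atlas \<Sigma>" fst] by metis
  obtain cs where cs: "set cs = C" using finite_list[OF C(2)] by blast
  define D where "D n = fst (cs ! n) - (\<Union>m<n. fst (cs ! m))" for n
  have at: "cs ! n \<in> atlas \<Sigma>" if "n < length cs" for n using that cs C(1) nth_mem by blast
  have Db: "D n \<in> sets borel" if n: "n < length cs" for n
  proof -
    have "open (fst (cs ! n))" "open (\<Union>m<n. fst (cs ! m))"
      using n by (auto intro!: open_chart at open_UN)
    then show ?thesis unfolding D_def by (intro sets.Diff borel_open)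
  qed
  show ?thesis
  proof (intro exI conjI allI impI)
    show "cs ! n \<in> atlas \<Sigma>" if "n < length cs" for n by (rule at[OF that])
    show "D n \<subseteq> fst (cs ! n)" for n by (auto simp: D_def)
    show "D n \<in> sets borel" if n: "n < length cs" for n by (rule Db[OF n])
    show "disjoint_family_on D {..<length cs}"
      unfolding disjoint_family_on_def
    proof (intro ballI impI)
      fix m n :: nat assume "m \<noteq> n"
      then consider "m < n" | "n < m" by linarith
      then show "D m \<inter> D n = {}" by cases (auto simp: D_def)
    qed
    have "p \<in> (\<Union>n<length cs. D n)" for p
    proof -
      have "\<exists>n. n < length cs \<and> p \<in> fst (cs ! n)"
        using C(3) cs by (metis UNIV_I UN_iff in_set_conv_nth subsetD)
      then obtain n where n: "n < length cs \<and> p \<in> fst (cs ! n)" "\<And>m. m < n \<Longrightarrow> \<not> (m < length cs \<and> p \<in> fst (cs ! m))"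
        using exists_least_iff[of "\<lambda>n. n < length cs \<and> p \<in> fst (cs ! n)"] by blast
      then have "p \<in> D n" by (auto simp: D_def)
      then show ?thesis using n by blast
    qed
    then show "(\<Union>n<length cs. D n) = UNIV" by blast
  qed
qed

lemma ex_area: "\<exists>\<mu>. is_area \<mu>"
proof -
  obtain N :: nat and ch D where chD: "\<forall>n<N. ch n \<in> atlas \<Sigma> \<and> D n \<subseteq> fst (ch n) \<and> D n \<in> sets borel"
    and dis: "disjoint_family_on D {..<N}" and un: "(\<Union>n<N. D n) = (UNIV :: 's set)"
    using finite_disjoint_cover by blast
  then have ch: "ch n \<in> atlas \<Sigma>" and D: "D n \<subseteq> fst (ch n)" "D n \<in> sets borel" if "n < N" for n using that by blast+
  \<comment> \<open>Each piece is measured in its own chart; \<open>dens_eq\<close> shows below that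
    any other chart gives the same value.\<close>
  define \<mu> where "\<mu> B = (\<Sum>n<N. emeasure (chart_measure (ch n)) (B \<inter> D n))" for B
  let ?M = "measure_of UNIV (sets borel) \<mu>"
  have em: "emeasure ?M B = \<mu> B" if "B \<in> sets borel" for B
  proof (rule emeasure_measure_of_sigma[OF _ _ _ that])
    show "sigma_algebra UNIV (sets (borel :: 's measure))"
      using sets.sigma_algebra_axioms[of "borel :: 's measure"] by simp
    show "positive (sets borel) \<mu>" by (simp add: positive_def \<mu>_def)
    show "countably_additive (sets borel) \<mu>"
    proof (rule countably_additiveI)
      fix A :: "nat \<Rightarrow> 's set" assume A: "range A \<subseteq> sets borel" "disjoint_family A"
      have "suminf (\<lambda>i. emeasure (chart_measure (ch n)) (A i \<inter> D n)) = emeasure (chart_measure (ch n)) (\<Union>i. A i \<inter> D n)" if n: "n < N" for n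
      proof (rule suminf_emeasure)
        show "range (\<lambda>i. A i \<inter> D n) \<subseteq> sets (chart_measure (ch n))"
          unfolding sets_chart_measure using A(1) D(2)[OF n] by (intro image_subsetI sets.Int) auto
        show "disjoint_family (\<lambda>i. A i \<inter> D n)"
          by (rule disjoint_family_on_bisimulation[OF A(2)]) blast
      qed
      moreover have "(\<Union>i. A i \<inter> D n) = (\<Union>i. A i) \<inter> D n" for n by blast
      ultimately have "\<mu> (\<Union>i. A i) = (\<Sum>n<N. suminf (\<lambda>i. emeasure (chart_measure (ch n)) (A i \<inter> D n)))"
        unfolding \<mu>_def by (intro sum.cong) auto
      also have "\<dots> = suminf (\<lambda>i. \<Sum>n<N. emeasure (chart_measure (ch n)) (A i \<inter> D n))"
        by (rule suminf_sum[symmetric]) (rule summableI)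
      finally show "suminf (\<lambda>i. \<mu> (A i)) = \<mu> (\<Union>i. A i)" unfolding \<mu>_def by simp
    qed
  qed
  have "is_area ?M"
    unfolding is_area_def
  proof (intro conjI ballI impI)
    show "sets ?M = sets borel" using sets.sigma_sets_eq[of "borel :: 's measure"] by simp
    fix c B assume c: "c \<in> atlas \<Sigma>" and B: "B \<in> sets (borel :: 's measure)" "B \<subseteq> fst c"
    have "emeasure (chart_measure (ch n)) (B \<inter> D n) = emeasure (chart_measure c) (B \<inter> D n)" if n: "n < N" for n
    proof -
      have BD: "B \<inter> D n \<in> sets borel" using B D(2)[OF n] by blast
      have "B \<inter> D n \<inter> fst (ch n) = B \<inter> D n" "B \<inter> D n \<inter> fst c = B \<inter> D n" using D(1)[OF n] B(2) by auto
      moreover have "dens (ch n) (B \<inter> D n) = dens c (B \<inter> D n)"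
        by (rule dens_eq[OF ch[OF n] c BD]) (use D(1)[OF n] B(2) in auto)
      ultimately show ?thesis
        unfolding emeasure_chart_measure[OF ch[OF n] BD] emeasure_chart_measure[OF c BD] by simp
    qed
    then have "emeasure ?M B = (\<Sum>n<N. emeasure (chart_measure c) (B \<inter> D n))"
      unfolding em[OF B(1)] \<mu>_def by (intro sum.cong) auto
    also have "\<dots> = emeasure (chart_measure c) (\<Union>n<N. B \<inter> D n)"
    proof (rule sum_emeasure)
      show "(\<lambda>n. B \<inter> D n) ` {..<N} \<subseteq> sets (chart_measure c)" unfolding sets_chart_measure using B D(2) by auto
      show "disjoint_family_on (\<lambda>n. B \<inter> D n) {..<N}" by (rule disjoint_family_on_bisimulation[OF dis]) blast
    qed simp
    also have "(\<Union>n<N. B \<inter> D n) = B" using un by blast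
    also have "emeasure (chart_measure c) B = dens c B"
      unfolding emeasure_chart_measure[OF c B(1)] using B(2) by (simp add: Int_absorb2)
    finally show "emeasure ?M B = dens c B" .
  qed
  then show ?thesis by blast
qed

text \<open>Finite additivity over the pieces expresses both measures by the same chart
  densities.\<close>

lemma area_unique:
  assumes \<mu>: "is_area \<mu>" and \<nu>: "is_area \<nu>"
  shows "\<mu> = \<nu>"
proof -
  obtain N :: nat and ch D where chD: "\<forall>n<N. ch n \<in> atlas \<Sigma> \<and> D n \<subseteq> fst (ch n) \<and> D n \<in> sets borel"
    and dis: "disjoint_family_on D {..<N}" and un: "(\<Union>n<N. D n) = (UNIV :: 's set)"
    using finite_disjoint_cover by blast
  then have ch: "ch n \<in> atlas \<Sigma>" and D: "D n \<subseteq> fst (ch n)" "D n \<in> sets borel" if "n < N" for n using that by blast+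
  have s: "sets \<mu> = sets borel" "sets \<nu> = sets borel" using \<mu> \<nu> by (auto simp: is_area_def)
  have *: "emeasure \<rho> B = (\<Sum>n<N. dens (ch n) (B \<inter> D n))" if \<rho>: "is_area \<rho>" and B: "B \<in> sets borel" for \<rho> B
  proof -
    have sr: "sets \<rho> = sets borel" using \<rho> by (simp add: is_area_def)
    have "dens (ch n) (B \<inter> D n) = emeasure \<rho> (B \<inter> D n)" if n: "n < N" for n
    proof -
      have BD: "B \<inter> D n \<in> sets borel" "B \<inter> D n \<subseteq> fst (ch n)" using B D(1,2)[OF n] by auto
      then show ?thesis using \<rho> ch[OF n] unfolding is_area_def by simp
    qed
    then have "(\<Sum>n<N. dens (ch n) (B \<inter> D n)) = (\<Sum>n<N. emeasure \<rho> (B \<inter> D n))"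
      by (intro sum.cong) auto
    also have "\<dots> = emeasure \<rho> (\<Union>n<N. B \<inter> D n)"
    proof (rule sum_emeasure)
      show "(\<lambda>n. B \<inter> D n) ` {..<N} \<subseteq> sets \<rho>" unfolding sr using B D(2) by auto
      show "disjoint_family_on (\<lambda>n. B \<inter> D n) {..<N}" by (rule disjoint_family_on_bisimulation[OF dis]) blast
    qed simp
    also have "(\<Union>n<N. B \<inter> D n) = B" using un by blast
    finally show ?thesis ..
  qed
  show ?thesis
  proof (rule measure_eqI)
    show "sets \<mu> = sets \<nu>" unfolding s ..
    show "emeasure \<mu> B = emeasure \<nu> B" if "B \<in> sets \<mu>" for B
      using that unfolding s(1) by (simp only: *[OF \<mu>] *[OF \<nu>])
  qed
qed

lemma is_area_measure: "is_area (area_measure \<Sigma>)"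
proof -
  have "area_measure \<Sigma> = (THE \<mu>. is_area \<mu>)"
    unfolding area_measure_def is_area_def
    by (rule arg_cong[where f=The]) (auto simp: dens_area fun_eq_iff)
  moreover have "is_area (THE \<mu>. is_area \<mu>)"
    by (rule theI') (use ex_area area_unique in blast)
  ultimately show ?thesis by simp
qed

lemma sets_area: "sets (area_measure \<Sigma>) = sets borel" and space_area: "space (area_measure \<Sigma>) = UNIV"
proof -
  show s: "sets (area_measure \<Sigma>) = sets borel" using is_area_measure by (simp add: is_area_def)
  show "space (area_measure \<Sigma>) = UNIV" using sets_eq_imp_space_eq[OF s] by simp
qed

lemma emeasure_area: "\<lbrakk>c \<in> atlas \<Sigma>; B \<in> sets borel; B \<subseteq> fst c\<rbrakk> \<Longrightarrow> emeasure (area_measure \<Sigma>) B = dens c B"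
  using is_area_measure by (simp add: is_area_def)

lemma measurable_area: "(\<psi> :: 's \<Rightarrow> 'b::topological_space) \<in> borel_measurable borel \<Longrightarrow> \<psi> \<in> borel_measurable (area_measure \<Sigma>)"
  using measurable_cong_sets[OF sets_area refl] by blast

text \<open>Restricted to the domain of \<open>c\<close>, the area measure is
  \<open>chart_measure c\<close>, and integrals against the push-forward of a density can be pulled
  back to the plane.\<close>

lemma integral_area_chart:
  fixes \<psi> :: "'s \<Rightarrow> real"
  assumes c: "c \<in> atlas \<Sigma>" and m: "\<psi> \<in> borel_measurable borel" and supp: "\<And>p. p \<notin> fst c \<Longrightarrow> \<psi> p = 0"
  shows "(LINT p|area_measure \<Sigma>. \<psi> p) = (LINT x|lborel. indicator (img c) x * (gloc c x 1 1 * \<psi> (chart_inv c x)))"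
proof -
  let ?\<mu> = "area_measure \<Sigma>" and ?k = "\<lambda>x. indicator (img c) x * gloc c x 1 1"
  have fc: "fst c \<in> sets borel" using open_chart[OF c] by simp
  have im: "(\<lambda>p. indicator (fst c) p :: real) \<in> borel_measurable ?\<mu>"
    by (rule borel_measurable_indicator) (use fc sets_area in simp)
  have eq: "density ?\<mu> (\<lambda>p. ennreal (indicator (fst c) p)) = chart_measure c"
  proof (rule measure_eqI)
    show "sets (density ?\<mu> (\<lambda>p. ennreal (indicator (fst c) p))) = sets (chart_measure c)"
      by (simp add: sets_area sets_chart_measure)
    fix B assume "B \<in> sets (density ?\<mu> (\<lambda>p. ennreal (indicator (fst c) p)))"
    then have B: "B \<in> sets borel" by (simp add: sets_area)
    then have B': "B \<in> sets ?\<mu>" "B \<inter> fst c \<in> sets ?\<mu>" "B \<inter> fst c \<in> sets borel" using fc by (auto simp: sets_area)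
    have "emeasure (density ?\<mu> (\<lambda>p. ennreal (indicator (fst c) p))) B = (\<integral>\<^sup>+p. ennreal (indicator (fst c) p) * indicator B p \<partial>?\<mu>)"
      by (rule emeasure_density[OF measurable_compose[OF im measurable_ennreal] B'(1)])
    also have "\<dots> = (\<integral>\<^sup>+p. indicator (B \<inter> fst c) p \<partial>?\<mu>)"
      by (rule nn_integral_cong) (simp split: split_indicator)
    also have "\<dots> = emeasure ?\<mu> (B \<inter> fst c)" by (rule nn_integral_indicator[OF B'(2)])
    also have "\<dots> = dens c (B \<inter> fst c)" by (rule emeasure_area[OF c B'(3)]) simp
    finally show "emeasure (density ?\<mu> (\<lambda>p. ennreal (indicator (fst c) p))) B = emeasure (chart_measure c) B"
      unfolding emeasure_chart_measure[OF c B] .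
  qed
  have k: "?k \<in> borel_measurable lborel" using gloc_measurable[OF c, of "img c"] img_open[OF c] by simp
  have "(LINT p|?\<mu>. \<psi> p) = (LINT p|?\<mu>. indicator (fst c) p *\<^sub>R \<psi> p)"
    by (rule Bochner_Integration.integral_cong[OF refl]) (use supp in \<open>simp split: split_indicator\<close>)
  also have "\<dots> = (LINT p|density ?\<mu> (\<lambda>p. ennreal (indicator (fst c) p)). \<psi> p)"
    by (rule integral_density[OF measurable_area[OF m] im, symmetric]) simp
  also have "\<dots> = (LINT p|chart_measure c. \<psi> p)" unfolding eq ..
  also have "\<dots> = (LINT x|density lborel (\<lambda>x. ennreal (?k x)). \<psi> (total_inv c x))"
    unfolding chart_measure_def by (rule integral_distr) (use total_inv_measurable[OF c] m in simp_all)
  also have "\<dots> = (LINT x|lborel. ?k x *\<^sub>R \<psi> (total_inv c x))"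
  proof (rule integral_density[OF _ k])
    show "(\<lambda>x. \<psi> (total_inv c x)) \<in> borel_measurable lborel"
      using measurable_compose[OF total_inv_measurable[OF c] m] by simp
    have "0 \<le> ?k x" for x using gloc_pos[OF c, of x] by (cases "x \<in> img c") (auto simp: img_def)
    then show "AE x in lborel. 0 \<le> ?k x" by simp
  qed
  also have "\<dots> = (LINT x|lborel. indicator (img c) x * (gloc c x 1 1 * \<psi> (chart_inv c x)))"
    by (rule Bochner_Integration.integral_cong[OF refl]) (simp add: total_inv_def split: split_indicator)
  finally show ?thesis .
qed

lemma coordinate_ball:
  assumes c: "c \<in> atlas \<Sigma>" and p: "p \<in> fst c"
  shows "\<exists>r>0. cball (snd c p) r \<subseteq> snd c ` fst c"
  using open_chart_image[OF c] p unfolding open_contains_cball by blast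

text \<open>The density is bounded on closed coordinate balls, so the measure is locally finite, and
  compactness does the rest. It makes continuous functions integrable.\<close>

lemma finite_measure_area: "finite_measure (area_measure \<Sigma>)"
proof
  have "\<exists>V. open V \<and> p \<in> V \<and> emeasure (area_measure \<Sigma>) V < \<infinity>" for p
  proof -
    let ?c = "chart_at \<Sigma> p"
    note C = chart_at[of p]
    obtain r where r: "r > 0" "cball (snd ?c p) r \<subseteq> snd ?c ` fst ?c" using coordinate_ball[OF C] by blast
    have "continuous_on (img ?c) (\<lambda>x. gloc ?c x 1 1)"
      using smooth_gloc[OF C(1)] Ck_on_continuous unfolding smooth_on_def img_def by blast
    then have "compact ((\<lambda>x. gloc ?c x 1 1) ` cball (snd ?c p) r)"
      using r(2) by (intro compact_continuous_image compact_cball) (auto simp: img_def intro: continuous_on_subset)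
    from compact_imp_bounded[OF this] obtain B where B: "\<forall>y\<in>(\<lambda>x. gloc ?c x 1 1) ` cball (snd ?c p) r. norm y \<le> B"
      unfolding bounded_iff ..
    let ?V = "fst ?c \<inter> snd ?c -` ball (snd ?c p) r"
    have V: "open ?V"
      by (rule continuous_open_preimage[OF homeomorphism_cont1[OF homeo[OF C(1)]] open_chart[OF C(1)] open_ball])
    have sub: "snd ?c ` ?V \<subseteq> cball (snd ?c p) r" by auto
    have "emeasure (area_measure \<Sigma>) ?V = dens ?c ?V" by (rule emeasure_area[OF C(1)]) (use V in auto)
    also have "\<dots> \<le> (\<integral>\<^sup>+x. ennreal B * indicator (cball (snd ?c p) r) x \<partial>lborel)"
      unfolding dens_def
    proof (rule nn_integral_mono)
      fix x
      show "ennreal (indicator (snd ?c ` ?V) x * gloc ?c x 1 1) \<le> ennreal B * indicator (cball (snd ?c p) r) x"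
      proof (cases "x \<in> snd ?c ` ?V")
        case True
        then have x: "x \<in> cball (snd ?c p) r" using sub by blast
        from bspec[OF B imageI[OF x]] have "gloc ?c x 1 1 \<le> B" by simp
        then show ?thesis using True x by (simp add: ennreal_leI del: mem_cball)
      qed simp
    qed
    also have "\<dots> = ennreal B * emeasure lborel (cball (snd ?c p) r)"
      by (rule nn_integral_cmult_indicator) simp
    also have "\<dots> < \<infinity>"
      using emeasure_bounded_finite[OF bounded_cball, of "snd ?c p" r] by (simp add: ennreal_mult_less_top)
    finally have "emeasure (area_measure \<Sigma>) ?V < \<infinity>" .
    then show ?thesis using V C r(1) by (intro exI[of _ ?V]) simp
  qed
  then obtain V where V: "\<And>p. open (V p)" "\<And>p. p \<in> V p" "\<And>p. emeasure (area_measure \<Sigma>) (V p) < \<infinity>" by metis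
  have "UNIV \<subseteq> (\<Union>p\<in>UNIV. V p)" using V(2) by blast
  then obtain P where P: "finite P" "UNIV \<subseteq> (\<Union>p\<in>P. V p)"
    using compactE_image[OF compact_UNIV, of UNIV V] V(1) by metis
  have "emeasure (area_measure \<Sigma>) (\<Union>p\<in>P. V p) \<le> (\<Sum>p\<in>P. emeasure (area_measure \<Sigma>) (V p))"
    by (rule emeasure_subadditive_finite[OF P(1)]) (use V(1) sets_area in auto)
  also have "\<dots> < \<infinity>" using P(1) V(3) by (simp add: less_top[symmetric])
  also have "(\<Union>p\<in>P. V p) = space (area_measure \<Sigma>)" unfolding space_area using P(2) by blast
  finally show "emeasure (area_measure \<Sigma>) (space (area_measure \<Sigma>)) \<noteq> \<infinity>" by simp
qed

lemma integrable_continuous: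
  fixes \<psi> :: "'s \<Rightarrow> 'b::{banach, second_countable_topology}"
  assumes "continuous_on UNIV \<psi>"
  shows "integrable (area_measure \<Sigma>) \<psi>"
proof -
  interpret finite_measure "area_measure \<Sigma>" by (rule finite_measure_area)
  from compact_imp_bounded[OF compact_continuous_image[OF assms compact_UNIV]]
  obtain B where "\<forall>y\<in>\<psi> ` UNIV. norm y \<le> B" unfolding bounded_iff ..
  then have "AE p in area_measure \<Sigma>. norm (\<psi> p) \<le> B" by simp
  then show ?thesis
    using measurable_area[OF borel_measurable_continuous_onI[OF assms]] by (rule integrable_const_bound)
qed

text \<open>The integral alone gives zero almost everywhere. A nonzero value would persist on an
  open set, whose chart image is open and hence not negligible.\<close>

lemma integral_zero_imp_zero:
  fixes \<psi> :: "'s \<Rightarrow> real"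
  assumes cont: "continuous_on UNIV \<psi>" and nn: "\<And>p. \<psi> p \<ge> 0" and zero: "(LINT p|area_measure \<Sigma>. \<psi> p) = 0"
  shows "\<psi> p = 0"
proof (rule ccontr)
  assume "\<psi> p \<noteq> 0"
  let ?c = "chart_at \<Sigma> p" and ?\<mu> = "area_measure \<Sigma>"
  note C = chart_at[of p]
  have ae: "AE p in ?\<mu>. \<psi> p = 0"
    using integral_nonneg_eq_0_iff_AE[OF integrable_continuous[OF cont]] nn zero by simp
  define V where "V = fst ?c \<inter> - (\<psi> -` {0})"
  have cl: "open (- (\<psi> -` {0}))"
    by (rule open_Compl) (use continuous_closed_vimage[of "{0}" \<psi>] cont in \<open>auto simp: continuous_on_eq_continuous_at\<close>)
  have V: "open V" unfolding V_def using open_chart[OF C(1)] cl by (rule open_Int)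
  have Vb: "V \<in> sets borel" "V \<subseteq> fst ?c" using V by (auto simp: V_def)
  have pV: "p \<in> V" using C(2) \<open>\<psi> p \<noteq> 0\<close> by (simp add: V_def)
  have Vc: "open (snd ?c ` V)" unfolding V_def by (rule open_chart_image_Int[OF C(1) cl])
  have Vi: "snd ?c ` V \<in> sets borel" "snd ?c ` V \<subseteq> img ?c" using Vc Vb(2) by (auto simp: img_def)
  have "AE q in ?\<mu>. q \<notin> V" using ae by eventually_elim (simp add: V_def)
  then have "emeasure ?\<mu> V = 0"
    by (rule AE_iff_measurable[THEN iffD1, rotated 2]) (use Vb in \<open>simp_all add: sets_area space_area\<close>)
  then have d0: "dens ?c V = 0" unfolding emeasure_area[OF C(1) Vb] .
  have m: "(\<lambda>x. ennreal (indicator (snd ?c ` V) x * gloc ?c x 1 1)) \<in> borel_measurable lborel"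
    using gloc_measurable[OF C(1) Vi] by simp
  from d0 have "AE x in lborel. ennreal (indicator (snd ?c ` V) x * gloc ?c x 1 1) = 0"
    unfolding dens_def nn_integral_0_iff_AE[OF m] .
  then have "AE x in lborel. x \<notin> snd ?c ` V"
  proof eventually_elim
    case (elim x)
    show ?case
    proof
      assume x: "x \<in> snd ?c ` V"
      then have "x \<in> snd ?c ` fst ?c" using Vb(2) by blast
      then have "gloc ?c x 1 1 > 0" by (rule gloc_pos[OF C(1)])
      then show False using elim x by (simp add: ennreal_eq_0_iff)
    qed
  qed
  then have "emeasure lborel (snd ?c ` V) = 0"
    by (rule AE_iff_measurable[THEN iffD1, rotated 2]) (use Vi in simp_all)
  then have "snd ?c ` V \<in> null_sets lborel" using Vi(1) by (simp add: null_sets_def)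
  then have "snd ?c ` V \<in> null_sets lebesgue" by (rule null_sets_completionI)
  then have "negligible (snd ?c ` V)" by (simp only: negligible_iff_null_sets)
  moreover have "snd ?c ` V \<noteq> {}" using pV by blast
  ultimately show False using open_not_negligible[OF Vc] by simp
qed

subsection \<open>The divergence theorem\<close>

lemma continuous_from_charts:
  fixes \<psi> :: "'s \<Rightarrow> 'b::topological_space"
  assumes "\<And>c. c \<in> atlas \<Sigma> \<Longrightarrow> continuous_on (snd c ` fst c) (\<lambda>x. \<psi> (chart_inv c x))"
  shows "continuous_on UNIV \<psi>"
proof -
  have "isCont \<psi> p" for p
  proof -
    let ?c = "chart_at \<Sigma> p"
    note C = chart_at[of p]
    have "continuous_on (fst ?c) (\<lambda>q. \<psi> (chart_inv ?c (snd ?c q)))"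
      by (rule continuous_on_compose2[OF assms[OF C(1)] homeomorphism_cont1[OF homeo[OF C(1)]]]) simp
    then have "continuous_on (fst ?c) \<psi>"
      by (rule continuous_on_cong[THEN iffD1, OF refl, rotated]) (use C in simp)
    then show ?thesis using continuous_on_eq_continuous_at[OF open_chart[OF C(1)]] C(2) by blast
  qed
  then show ?thesis by (intro continuous_at_imp_continuous_on ballI)
qed

definition C1 :: "('s \<Rightarrow> real) \<Rightarrow> bool" where
  "C1 \<eta> \<longleftrightarrow> (\<forall>c\<in>atlas \<Sigma>. Ck_on 1 (snd c ` fst c) (\<lambda>x. \<eta> (chart_inv c x)))"

definition dfun :: "('s \<Rightarrow> real) \<Rightarrow> 's \<Rightarrow> complex \<Rightarrow> real" where
  "dfun \<eta> p w = frechet_derivative (\<lambda>x. \<eta> (chart_inv (chart_at \<Sigma> p) x)) (at (snd (chart_at \<Sigma> p) p)) w"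

lemma C1D: "C1 \<eta> \<Longrightarrow> c \<in> atlas \<Sigma> \<Longrightarrow> Ck_on 1 (snd c ` fst c) (\<lambda>x. \<eta> (chart_inv c x))"
  by (simp only: C1_def)

lemma Ck1_has_derivative: "Ck_on 1 X F \<Longrightarrow> x \<in> X \<Longrightarrow> (F has_derivative frechet_derivative F (at x)) (at x)"
  using Ck_on_derivD[of 0 X F x] by simp

lemma C1_has_derivative:
  assumes \<eta>: "C1 \<eta>" and c: "c \<in> atlas \<Sigma>" and p: "p \<in> fst c"
  shows "((\<lambda>x. \<eta> (chart_inv c x)) has_derivative (\<lambda>k. dfun \<eta> p (from_chart \<Sigma> c p k))) (at (snd c p))"
proof -
  let ?c = "chart_at \<Sigma> p"
  note C = chart_at[of p]
  have x: "snd c p \<in> snd c ` (fst c \<inter> fst ?c)" "snd ?c p \<in> snd ?c ` fst ?c" using p C by auto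
  have "((\<lambda>x. \<eta> (chart_inv ?c x)) has_derivative dfun \<eta> p) (at (tr c ?c (snd c p)))"
    unfolding tr_snd[OF c p] dfun_def[abs_def] by (rule Ck1_has_derivative[OF C1D[OF \<eta> C(1)] x(2)])
  from has_derivative_compose[OF tr_has_derivative[OF c C(1) x(1)] this]
  have "((\<lambda>x. \<eta> (chart_inv ?c (tr c ?c x))) has_derivative (\<lambda>k. dfun \<eta> p (from_chart \<Sigma> c p k))) (at (snd c p))"
    by (simp only: from_chart_eq)
  then show ?thesis
    by (rule has_derivative_transform_within_open[OF _ overlap_open[OF c C(1)] x(1)]) (use c C in \<open>auto simp: tr_def\<close>)
qed

lemma linear_dfun: "C1 \<eta> \<Longrightarrow> linear (dfun \<eta> p)"
  unfolding dfun_def[abs_def]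
  by (rule has_derivative_linear[OF Ck1_has_derivative[OF C1D[OF _ chart_at(1)[of p]]]]) (use chart_at(2) in auto)

lemma divergence_of_continuous:
  assumes "divergence_of u \<theta>"
  shows "continuous_on UNIV u"
proof (rule continuous_from_charts)
  fix c assume c: "c \<in> atlas \<Sigma>"
  let ?D = "\<lambda>w x. frechet_derivative (oneform_loc c \<theta> w) (at x) w"
  have D: "continuous_on (snd c ` fst c) (?D w)" for w
  proof -
    have "Ck_on (Suc 0) (snd c ` fst c) (oneform_loc c \<theta> w)" using assms c unfolding divergence_of_def by simp
    then show ?thesis by simp
  qed
  have g: "continuous_on (snd c ` fst c) (\<lambda>x. gloc c x 1 1)"
    using smooth_gloc[OF c] Ck_on_continuous unfolding smooth_on_def by blast
  have g0: "gloc c x 1 1 \<noteq> 0" if "x \<in> snd c ` fst c" for x using gloc_pos[OF c that] by simp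
  have "continuous_on (snd c ` fst c) (\<lambda>x. (?D 1 x + ?D \<i> x) / gloc c x 1 1)"
    by (intro continuous_on_divide continuous_on_add D g ballI g0)
  moreover have "(?D 1 x + ?D \<i> x) / gloc c x 1 1 = u (chart_inv c x)" if x: "x \<in> snd c ` fst c" for x
  proof -
    obtain p where p: "x = snd c p" "p \<in> fst c" using x by blast
    have "gloc c x 1 1 * u p = ?D 1 x + ?D \<i> x" using assms c p unfolding divergence_of_def by blast
    then show ?thesis using g0[OF x] p c by (simp add: field_simps)
  qed
  ultimately show "continuous_on (snd c ` fst c) (\<lambda>x. u (chart_inv c x))"
    by (rule continuous_on_cong[THEN iffD1, OF refl, rotated])
qed

text \<open>The Leibniz rule: the extra term is the metric pairing of the differential of
  \<open>\<eta>\<close> with \<open>\<theta>\<close>, that is, their trace over \<open>1\<close>,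
  \<open>\<i>\<close> divided by \<open>lam\<close>.\<close>

lemma divergence_of_mult:
  assumes \<eta>: "C1 \<eta>" and u: "divergence_of u \<theta>"
  shows "divergence_of (\<lambda>p. \<eta> p * u p + (1 / lam p) * (dfun \<eta> p 1 * \<theta> p 1 + dfun \<eta> p \<i> * \<theta> p \<i>)) (\<lambda>p w. \<eta> p * \<theta> p w)"
  unfolding divergence_of_def
proof (intro conjI allI ballI)
  have lin: "linear (\<theta> p)" for p using u by (simp add: divergence_of_def)
  then show "linear (\<lambda>w. \<eta> p * \<theta> p w)" for p by (simp add: linear_iff algebra_simps)
  have ck: "Ck_on 1 (snd c ` fst c) (oneform_loc c \<theta> w)" if "c \<in> atlas \<Sigma>" for c w
    using u that unfolding divergence_of_def by blast
  have loc: "oneform_loc c (\<lambda>p w. \<eta> p * \<theta> p w) w = (\<lambda>x. \<eta> (chart_inv c x) * oneform_loc c \<theta> w x)" for c w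
    by (simp add: oneform_loc_def fun_eq_iff)
  show "Ck_on 1 (snd c ` fst c) (oneform_loc c (\<lambda>p w. \<eta> p * \<theta> p w) w)" if "c \<in> atlas \<Sigma>" for c w
    unfolding loc by (rule bounded_bilinear.Ck_on_prod[OF bounded_bilinear_mult open_chart_image[OF that] C1D[OF \<eta> that] ck[OF that]])
  fix c p assume c: "c \<in> atlas \<Sigma>" and p: "p \<in> fst c"
  have x: "snd c p \<in> snd c ` fst c" using p by blast
  let ?z = "from_chart \<Sigma> c p 1"
  have D: "frechet_derivative (oneform_loc c (\<lambda>p w. \<eta> p * \<theta> p w) w) (at (snd c p)) k
     = \<eta> p * frechet_derivative (oneform_loc c \<theta> w) (at (snd c p)) k + dfun \<eta> p (from_chart \<Sigma> c p k) * \<theta> p (from_chart \<Sigma> c p w)" for w k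
    unfolding loc
    using fun_cong[OF frechet_derivative_eqI[OF has_derivative_mult[OF C1_has_derivative[OF \<eta> c p] Ck1_has_derivative[OF ck[OF c] x]]], of w k]
    using c p by (simp add: oneform_loc_def)
  have Q: "bilinear (\<lambda>v w. dfun \<eta> p v * \<theta> p w)"
    using lin[of p] linear_dfun[OF \<eta>, of p] unfolding bilinear_def by (simp add: linear_iff algebra_simps)
  have "dfun \<eta> p ?z * \<theta> p ?z + dfun \<eta> p (\<i> * ?z) * \<theta> p (\<i> * ?z) = (cmod ?z)\<^sup>2 * (dfun \<eta> p 1 * \<theta> p 1 + dfun \<eta> p \<i> * \<theta> p \<i>)"
    using bilinear_conformal[OF Q, of ?z] by simp
  moreover have "from_chart \<Sigma> c p \<i> = \<i> * ?z" by (rule from_chart_mult[OF c p])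
  moreover have "gloc c (snd c p) 1 1 * u p =
        frechet_derivative (oneform_loc c \<theta> 1) (at (snd c p)) 1 + frechet_derivative (oneform_loc c \<theta> \<i>) (at (snd c p)) \<i>"
    using u c p unfolding divergence_of_def by blast
  moreover have "gloc c (snd c p) 1 1 * (1 / lam p) = (cmod ?z)\<^sup>2"
    unfolding gloc_lam[OF c p] using lam_pos[of p] by simp
  ultimately show "gloc c (snd c p) 1 1 * (\<eta> p * u p + (1 / lam p) * (dfun \<eta> p 1 * \<theta> p 1 + dfun \<eta> p \<i> * \<theta> p \<i>)) =
        frechet_derivative (oneform_loc c (\<lambda>p w. \<eta> p * \<theta> p w) 1) (at (snd c p)) 1 +
        frechet_derivative (oneform_loc c (\<lambda>p w. \<eta> p * \<theta> p w) \<i>) (at (snd c p)) \<i>"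
    unfolding D by (simp only: distrib_left mult.assoc[symmetric] mult.commute[of _ "\<eta> p"]) (simp add: algebra_simps)
qed

text \<open>The conformal factor in the divergence cancels the area density. What remains is a flat
  divergence with compact support, to which \<open>integral_derivative_compact_support\<close>
  applies in each component.\<close>

lemma divergence_supported:
  assumes u: "divergence_of u \<theta>" and c: "c \<in> atlas \<Sigma>" and x0: "cball x0 r \<subseteq> snd c ` fst c"
    and supp: "\<And>p w. p \<notin> chart_inv c ` cball x0 r \<Longrightarrow> \<theta> p w = 0"
  shows "(LINT p|area_measure \<Sigma>. u p) = 0"
proof -
  let ?K = "chart_inv c ` cball x0 r" and ?I = "snd c ` fst c"
  have K: "closed ?K"
    by (intro compact_imp_closed compact_continuous_image compact_cball
        continuous_on_subset[OF homeomorphism_cont2[OF homeo[OF c]] x0])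
  have Kc: "?K \<subseteq> fst c" using chart_inv_in[OF c] x0 by blast
  have xK: "x \<notin> cball x0 r" if "x \<in> ?I" "chart_inv c x \<notin> ?K" for x using that by blast
  have ck: "Ck_on 1 (snd d ` fst d) (oneform_loc d \<theta> w)" if "d \<in> atlas \<Sigma>" for d w
    using u that unfolding divergence_of_def by blast
  have u0: "u p = 0" if p: "p \<notin> ?K" for p
  proof -
    let ?d = "chart_at \<Sigma> p"
    note D = chart_at[of p]
    let ?Z = "snd ?d ` (fst ?d \<inter> - ?K)"
    have Z: "open ?Z" "snd ?d p \<in> ?Z" using open_chart_image_Int[OF D(1) open_Compl[OF K]] D p by auto
    have "frechet_derivative (oneform_loc ?d \<theta> w) (at (snd ?d p)) k = 0" for w k
    proof -
      have "frechet_derivative (oneform_loc ?d \<theta> w) (at (snd ?d p)) = frechet_derivative (\<lambda>_. 0) (at (snd ?d p))"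
      proof (rule frechet_derivative_cong_open[OF Z])
        fix y assume "y \<in> ?Z"
        then have "chart_inv ?d y \<notin> ?K" using D(1) by auto
        then show "oneform_loc ?d \<theta> w y = 0" unfolding oneform_loc_def by (rule supp)
      qed
      then show ?thesis by simp
    qed
    then have "gloc ?d (snd ?d p) 1 1 * u p = 0" using u D unfolding divergence_of_def by simp
    then show ?thesis using gloc_pos[OF D(1), of "snd ?d p"] D(2) by auto
  qed
  \<comment> \<open>Extension by zero. It is continuously differentiable across the boundary of the
    chart image because the support lies in a closed ball inside that image.\<close>
  define F where "F w x = (if x \<in> ?I then oneform_loc c \<theta> w x else 0)" for w x
  have F0: "F w x = 0" if "x \<notin> cball x0 r" for w x
  proof (cases "x \<in> ?I")
    case True
    have "chart_inv c x \<notin> ?K"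
    proof
      assume "chart_inv c x \<in> ?K"
      then obtain y where y: "y \<in> cball x0 r" "chart_inv c x = chart_inv c y" by blast
      then have "snd c (chart_inv c x) = snd c (chart_inv c y)" by simp
      then have "x = y" using snd_chart_inv[OF c] True y(1) x0 by auto
      then show False using that y(1) by simp
    qed
    then show ?thesis unfolding F_def oneform_loc_def using supp by simp
  qed (simp add: F_def)
  have F1: "Ck_on 1 UNIV (F w)" for w
  proof (rule Ck_on_local)
    fix x :: complex
    show "\<exists>Y. open Y \<and> x \<in> Y \<and> Ck_on 1 Y (F w)"
    proof (cases "x \<in> ?I")
      case True
      have "Ck_on 1 ?I (F w)"
        by (rule Ck_on_cong[THEN iffD2, OF open_chart_image[OF c] _ ck[OF c, of w]]) (simp add: F_def)
      then show ?thesis using True open_chart_image[OF c] by blast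
    next
      case False
      then have "x \<in> - cball x0 r" using x0 by blast
      moreover have "open (- cball x0 r)" by (rule open_Compl[OF closed_cball])
      moreover have "Ck_on 1 (- cball x0 r) (F w)"
        by (rule Ck_on_cong[THEN iffD2, OF _ _ Ck_on_const[where c=0]]) (use F0 in \<open>auto simp: open_Compl\<close>)
      ultimately show ?thesis by blast
    qed
  qed
  note int = integral_derivative_compact_support[OF F1 F0]
  have eq: "indicator (img c) x * (gloc c x 1 1 * u (chart_inv c x))
    = frechet_derivative (F 1) (at x) 1 + frechet_derivative (F \<i>) (at x) \<i>" for x
  proof (cases "x \<in> ?I")
    case True
    then obtain p where p: "x = snd c p" "p \<in> fst c" by blast
    have "frechet_derivative (F w) (at x) = frechet_derivative (oneform_loc c \<theta> w) (at x)" for w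
      by (rule frechet_derivative_cong_open[OF open_chart_image[OF c] True]) (simp add: F_def)
    moreover have "gloc c x 1 1 * u p = frechet_derivative (oneform_loc c \<theta> 1) (at x) 1 + frechet_derivative (oneform_loc c \<theta> \<i>) (at x) \<i>"
      using u c p unfolding divergence_of_def by blast
    ultimately show ?thesis using True p c by (simp add: img_def)
  next
    case False
    then have x: "x \<in> - cball x0 r" using x0 by blast
    have "frechet_derivative (F w) (at x) = frechet_derivative (\<lambda>_. 0) (at x)" for w
      by (rule frechet_derivative_cong_open[OF open_Compl[OF closed_cball] x]) (use F0 in auto)
    then show ?thesis using False by (simp add: img_def)
  qed
  have "(LINT p|area_measure \<Sigma>. u p) = (LINT x|lborel. indicator (img c) x * (gloc c x 1 1 * u (chart_inv c x)))"
    by (rule integral_area_chart[OF c borel_measurable_continuous_onI[OF divergence_of_continuous[OF u]]])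
       (use u0 Kc in blast)
  also have "\<dots> = (LINT x|lborel. frechet_derivative (F 1) (at x) 1) + (LINT x|lborel. frechet_derivative (F \<i>) (at x) \<i>)"
    unfolding eq by (rule Bochner_Integration.integral_add[OF int(1) int(1)])
  moreover have "(LINT x|lborel. frechet_derivative (F w) (at x) v) = 0" for w v by (rule int(2))
  ultimately show ?thesis by simp
qed

text \<open>A \<open>C\<^sup>1\<close> bump function suffices for the partition of unity.\<close>
definition bump :: "complex \<Rightarrow> real \<Rightarrow> complex \<Rightarrow> real" where
  "bump x0 r x = (let t = r\<^sup>2 - (x - x0) \<bullet> (x - x0) in max 0 t * t)"

lemma Ck_bump: "Ck_on 1 UNIV (bump x0 r)"
proof -
  have h: "Ck_on 1 UNIV (\<lambda>t::real. max 0 t * t)"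
  proof -
    \<comment> \<open>The square of the positive part. At \<open>0\<close> one factor is only
      continuous, but the other vanishes.\<close>
    have "((\<lambda>t. max 0 t * t) has_derivative (\<lambda>v. 2 * max 0 t * v)) (at t)" for t :: real
    proof (cases "t = 0")
      case True
      have "((\<lambda>y. max 0 y * y) has_derivative (\<lambda>v. max 0 t * v)) (at t)"
        by (rule has_derivative_mult_vanishing) (use True in \<open>auto intro!: continuous_intros derivative_eq_intros\<close>)
      then show ?thesis using True by simp
    next
      case False
      show ?thesis
      proof (cases "t > 0")
        case True
        have "((\<lambda>t. t * t) has_derivative (\<lambda>v. 2 * max 0 t * v)) (at t)"
          by (auto intro!: derivative_eq_intros simp: True less_imp_le algebra_simps)
        then show ?thesis
          by (rule has_derivative_transform_within_open[OF _ open_greaterThan[of 0]]) (use True in auto)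
      next
        case neg: False
        have "((\<lambda>t. 0) has_derivative (\<lambda>v. 2 * max 0 t * v)) (at t)"
          using neg by (auto intro!: derivative_eq_intros)
        then show ?thesis
          by (rule has_derivative_transform_within_open[OF _ open_lessThan[of 0]]) (use neg False in auto)
      qed
    qed
    then have "Ck_on (Suc 0) UNIV (\<lambda>t::real. max 0 t * t)"
      by (intro Ck_on_SucI[where F'="\<lambda>t v. 2 * max 0 t * v"]) (auto intro!: continuous_intros)
    then show ?thesis by simp
  qed
  have id: "Ck_on 1 UNIV (\<lambda>x. x - x0)"
  proof -
    have "((\<lambda>x. x - x0) has_derivative (\<lambda>v. v)) (at x)" for x
      by (auto intro!: derivative_eq_intros)
    then have "Ck_on (Suc 0) UNIV (\<lambda>x. x - x0)"
      by (intro Ck_on_SucI[where F'="\<lambda>x v. v"]) auto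
    then show ?thesis by simp
  qed
  have "Ck_on 1 UNIV (\<lambda>x. r\<^sup>2 + - ((x - x0) \<bullet> (x - x0)))"
    by (intro Ck_on_add Ck_on_const Ck_on_linear[OF bounded_linear_minus[OF bounded_linear_ident]]
        bounded_bilinear.Ck_on_prod[OF bounded_bilinear_inner] id open_UNIV)
  then have q: "Ck_on 1 UNIV (\<lambda>x. r\<^sup>2 - (x - x0) \<bullet> (x - x0))" by (simp only: diff_conv_add_uminus)
  show ?thesis unfolding bump_def[abs_def] Let_def
    using Ck_on_compose[OF open_UNIV open_UNIV _ q h] by simp
qed

lemma bump_nonneg: "bump x0 r x \<ge> 0"
  by (simp add: bump_def Let_def max_def)

lemma bump_pos: "r > 0 \<Longrightarrow> bump x0 r x0 > 0"
  by (simp add: bump_def Let_def)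

lemma bump_zero:
  assumes "x \<notin> cball x0 r" "r > 0"
  shows "bump x0 r x = 0"
proof -
  have "r < norm (x - x0)" using assms(1) by (simp add: dist_norm norm_minus_commute)
  then have "r\<^sup>2 \<le> (norm (x - x0))\<^sup>2" using assms(2) by (intro power_mono) auto
  then show ?thesis by (simp add: bump_def Let_def power2_norm_eq_inner)
qed

text \<open>The derivative \<open>dtr\<close> is continuous because it is differentiable. One
  continuous derivative is all that moving \<open>C1\<close> functions between charts asks of a
  transition map.\<close>

lemma Ck_tr:
  assumes "c \<in> atlas \<Sigma>" "d \<in> atlas \<Sigma>"
  shows "Ck_on 1 (snd c ` (fst c \<inter> fst d)) (tr c d)"
proof -
  have "isCont (\<lambda>x. dtr c d x v) x" if "x \<in> snd c ` (fst c \<inter> fst d)" for v x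
    by (rule has_derivative_continuous[OF dtr_has_derivative[OF assms that]])
  then have "continuous_on (snd c ` (fst c \<inter> fst d)) (\<lambda>x. dtr c d x v)" for v
    by (intro continuous_at_imp_continuous_on ballI)
  then have "Ck_on (Suc 0) (snd c ` (fst c \<inter> fst d)) (tr c d)"
    by (intro Ck_on_SucI[OF overlap_open[OF assms] tr_has_derivative[OF assms]]) (simp_all only: Ck_on.simps)
  then show ?thesis by simp
qed

lemma C1_bump:
  assumes c: "c \<in> atlas \<Sigma>" and r: "r > 0" "cball x0 r \<subseteq> snd c ` fst c"
  defines "\<eta> \<equiv> \<lambda>q. if q \<in> fst c then bump x0 r (snd c q) else 0"
  shows "C1 \<eta>" "\<And>q. q \<notin> chart_inv c ` cball x0 r \<Longrightarrow> \<eta> q = 0"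
proof -
  let ?K = "chart_inv c ` cball x0 r"
  have K: "closed ?K"
    by (intro compact_imp_closed compact_continuous_image compact_cball
        continuous_on_subset[OF homeomorphism_cont2[OF homeo[OF c]] r(2)])
  have Kc: "?K \<subseteq> fst c" using chart_inv_in[OF c] r(2) by blast
  show z: "\<eta> q = 0" if q: "q \<notin> ?K" for q
  proof (cases "q \<in> fst c")
    case True
    have "snd c q \<notin> cball x0 r"
    proof
      assume "snd c q \<in> cball x0 r"
      then have "chart_inv c (snd c q) \<in> ?K" by (rule imageI)
      then show False using q True c by simp
    qed
    then show ?thesis using bump_zero[OF _ r(1)] by (simp add: \<eta>_def)
  qed (simp add: \<eta>_def)
  show "C1 \<eta>" unfolding C1_def
  proof (intro ballI Ck_on_local)
    fix d x assume d: "d \<in> atlas \<Sigma>" and "x \<in> snd d ` fst d"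
    then obtain q where q: "x = snd d q" "q \<in> fst d" by blast
    show "\<exists>Y. open Y \<and> x \<in> Y \<and> Ck_on 1 Y (\<lambda>x. \<eta> (chart_inv d x))"
    proof (cases "q \<in> fst c")
      case True
      let ?Y = "snd d ` (fst d \<inter> fst c)"
      have o: "open ?Y" by (rule overlap_open[OF d c])
      have "Ck_on 1 ?Y (\<lambda>x. bump x0 r (tr d c x))"
        by (rule Ck_on_compose[OF o open_UNIV _ Ck_tr[OF d c] Ck_bump]) simp
      then have "Ck_on 1 ?Y (\<lambda>x. \<eta> (chart_inv d x))"
        by (rule Ck_on_cong[THEN iffD2, OF o, rotated]) (use d in \<open>auto simp: \<eta>_def tr_def\<close>)
      then show ?thesis using o q True by blast
    next
      case False
      let ?Y = "snd d ` (fst d \<inter> - ?K)"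
      have o: "open ?Y" by (rule open_chart_image_Int[OF d open_Compl[OF K]])
      have "\<eta> (chart_inv d y) = 0" if "y \<in> ?Y" for y
      proof -
        obtain q where "y = snd d q" "q \<in> fst d" "q \<notin> ?K" using \<open>y \<in> ?Y\<close> by blast
        then show ?thesis using z d by simp
      qed
      then have "Ck_on 1 ?Y (\<lambda>x. \<eta> (chart_inv d x))"
        by (rule Ck_on_cong[THEN iffD2, OF o _ Ck_on_const[OF o]])
      then show ?thesis using o q False Kc by blast
    qed
  qed
qed

text \<open>A partition of unity writes \<open>u\<close> as a sum of divergences of the forms
  \<open>\<rho> p q * \<theta> q w\<close>, each supported in a coordinate ball. The terms with
  differentials of the \<open>\<rho> p\<close> cancel, because these functions add up to 1.\<close>

theorem divergence_theorem:
  assumes u: "divergence_of u \<theta>"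
  shows "(LINT p|area_measure \<Sigma>. u p) = 0"
proof -
  have "\<exists>r>0. cball (snd (chart_at \<Sigma> p) p) r \<subseteq> snd (chart_at \<Sigma> p) ` fst (chart_at \<Sigma> p)" for p
    by (rule coordinate_ball[OF chart_at])
  then obtain r where r: "\<And>p. r p > 0" "\<And>p. cball (snd (chart_at \<Sigma> p) p) (r p) \<subseteq> snd (chart_at \<Sigma> p) ` fst (chart_at \<Sigma> p)"
    by metis
  define \<eta> where "\<eta> p = (\<lambda>q. if q \<in> fst (chart_at \<Sigma> p) then bump (snd (chart_at \<Sigma> p) p) (r p) (snd (chart_at \<Sigma> p) q) else 0)" for p
  let ?K = "\<lambda>p. chart_inv (chart_at \<Sigma> p) ` cball (snd (chart_at \<Sigma> p) p) (r p)"
  have \<eta>: "C1 (\<eta> p)" "\<And>q. q \<notin> ?K p \<Longrightarrow> \<eta> p q = 0" for p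
    unfolding \<eta>_def by (rule C1_bump[OF chart_at(1) r], rule C1_bump(2)[OF chart_at(1) r])
  have \<eta>0: "\<eta> p q \<ge> 0" for p q by (simp add: \<eta>_def bump_nonneg)
  have \<eta>p: "\<eta> p p > 0" for p using chart_at(2)[of p] bump_pos[OF r(1)] by (simp add: \<eta>_def)
  have C1_continuous: "continuous_on UNIV h" if "C1 h" for h
    by (rule continuous_from_charts, rule Ck_on_continuous, rule C1D[OF that])
  define V where "V p = {q. \<eta> p q > 0}" for p
  have "open (V p)" for p unfolding V_def
    by (rule open_Collect_less[OF continuous_on_const C1_continuous[OF \<eta>(1)]])
  moreover have "UNIV \<subseteq> (\<Union>p\<in>UNIV. V p)" using \<eta>p by (auto simp: V_def)
  ultimately obtain P where P: "finite P" "UNIV \<subseteq> (\<Union>p\<in>P. V p)"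
    using compactE_image[OF compact_UNIV, of UNIV V] by metis
  define N where "N q = (\<Sum>p\<in>P. \<eta> p q)" for q
  have N: "N q > 0" for q
  proof -
    obtain p where "p \<in> P" "\<eta> p q > 0" using P(2) by (auto simp: V_def)
    then show ?thesis unfolding N_def using \<eta>0 P(1) by (intro sum_pos2[of P p]) auto
  qed
  define \<rho> where "\<rho> p q = \<eta> p q * inverse (N q)" for p q
  have \<rho>: "C1 (\<rho> p)" for p
    unfolding C1_def \<rho>_def N_def
  proof (intro ballI)
    fix c assume c: "c \<in> atlas \<Sigma>"
    have "(\<Sum>p\<in>P. \<eta> p (chart_inv c x)) \<noteq> 0" for x using N[of "chart_inv c x"] by (simp add: N_def)
    then show "Ck_on 1 (snd c ` fst c) (\<lambda>x. \<eta> p (chart_inv c x) * inverse (\<Sum>p\<in>P. \<eta> p (chart_inv c x)))"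
      by (intro bounded_bilinear.Ck_on_prod[OF bounded_bilinear_mult] Ck_on_inverse Ck_on_sum open_chart_image[OF c] C1D[OF \<eta>(1) c])
  qed
  have \<rho>1: "(\<Sum>p\<in>P. \<rho> p q) = 1" for q
    using N[of q] unfolding \<rho>_def sum_distrib_right[symmetric] by (simp add: N_def)
  have d\<rho>: "(\<Sum>p\<in>P. dfun (\<rho> p) q w) = 0" for q w
  proof -
    let ?c = "chart_at \<Sigma> q"
    note C = chart_at[of q]
    have "((\<lambda>x. \<Sum>p\<in>P. \<rho> p (chart_inv ?c x)) has_derivative (\<lambda>w. \<Sum>p\<in>P. dfun (\<rho> p) q (from_chart \<Sigma> ?c q w))) (at (snd ?c q))"
      by (rule has_derivative_sum) (rule C1_has_derivative[OF \<rho> C])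
    then have "((\<lambda>x. 1::real) has_derivative (\<lambda>w. \<Sum>p\<in>P. dfun (\<rho> p) q w)) (at (snd ?c q))"
      unfolding \<rho>1 by simp
    from has_derivative_unique[OF this has_derivative_const] show ?thesis by (rule fun_cong)
  qed
  define v where "v p q = \<rho> p q * u q + (1 / lam q) * (dfun (\<rho> p) q 1 * \<theta> q 1 + dfun (\<rho> p) q \<i> * \<theta> q \<i>)" for p q
  have v: "divergence_of (v p) (\<lambda>q w. \<rho> p q * \<theta> q w)" for p
    unfolding v_def[abs_def] by (rule divergence_of_mult[OF \<rho> u])
  have v0: "(LINT q|area_measure \<Sigma>. v p q) = 0" for p
    by (rule divergence_supported[OF v[of p] chart_at(1)[of p] r(2)[of p]]) (simp add: \<rho>_def \<eta>(2))
  have "(\<Sum>p\<in>P. v p q) = u q" for q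
  proof -
    have "(\<Sum>p\<in>P. v p q) = (\<Sum>p\<in>P. \<rho> p q) * u q + (1 / lam q) * ((\<Sum>p\<in>P. dfun (\<rho> p) q 1) * \<theta> q 1 + (\<Sum>p\<in>P. dfun (\<rho> p) q \<i>) * \<theta> q \<i>)"
      unfolding v_def sum.distrib sum_distrib_left[symmetric] sum_distrib_right[symmetric] ..
    then show ?thesis by (simp only: \<rho>1 d\<rho>) simp
  qed
  then have "(LINT q|area_measure \<Sigma>. u q) = (LINT q|area_measure \<Sigma>. (\<Sum>p\<in>P. v p q))" by simp
  also have "\<dots> = (\<Sum>p\<in>P. (LINT q|area_measure \<Sigma>. v p q))"
    by (rule Bochner_Integration.integral_sum) (rule integrable_continuous[OF divergence_of_continuous[OF v]])
  finally show ?thesis by (simp add: v0)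
qed

end

section \<open>Linearity of the covariant derivatives\<close>

context curve
begin

lemma cov0_add:
  assumes c: "c \<in> atlas \<Sigma>" and d: "d \<in> atlas M" and x: "x \<in> W c d"
    and \<sigma>: "(\<sigma> has_derivative \<sigma>1) (at x)" and \<tau>: "(\<tau> has_derivative \<tau>1) (at x)"
    and \<rho>: "\<And>y. y \<in> W c d \<Longrightarrow> \<rho> y = \<sigma> y + \<tau> y"
  shows "cov0 c d \<rho> k x = cov0 c d \<sigma> k x + cov0 c d \<tau> k x"
proof -
  have "(\<rho> has_derivative (\<lambda>v. \<sigma>1 v + \<tau>1 v)) (at x)"
    by (rule has_derivative_transform_within_open[OF has_derivative_add[OF \<sigma> \<tau>] W_open[OF c d] x \<rho>[symmetric]])
  then show ?thesis
    unfolding cov0_def frechet_derivative_eqI[OF \<sigma>] frechet_derivative_eqI[OF \<tau>] \<rho>[OF x]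
      bilinear_radd[OF M.christoffel_bilinear[OF d floc_in[OF c d x]]]
    by (simp add: frechet_derivative_eqI)
qed

lemma section_loc_add:
  assumes c: "c \<in> atlas \<Sigma>" and d: "d \<in> atlas M" and x: "x \<in> W c d"
  shows "section_loc M f c d (\<lambda>p. s p + t p) x = section_loc M f c d s x + section_loc M f c d t x"
proof -
  obtain p where p: "x = snd c p" "p \<in> fst c" "f p \<in> fst d" using x by blast
  show ?thesis unfolding p(1) section_loc_snd[OF c p(2)] by (rule linear_add[OF M.linear_to_chart[OF d p(3)]])
qed

lemma form_loc_add:
  assumes c: "c \<in> atlas \<Sigma>" and d: "d \<in> atlas M" and x: "x \<in> W c d"
  shows "form_loc \<Sigma> M f c d (\<lambda>p w. \<beta> p w + \<gamma> p w) w x = form_loc \<Sigma> M f c d \<beta> w x + form_loc \<Sigma> M f c d \<gamma> w x"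
proof -
  obtain p where p: "x = snd c p" "p \<in> fst c" "f p \<in> fst d" using x by blast
  show ?thesis unfolding p(1) form_loc_snd[OF c p(2)] by (rule linear_add[OF M.linear_to_chart[OF d p(3)]])
qed

lemma section_loc_J:
  assumes c: "c \<in> atlas \<Sigma>" and d: "d \<in> atlas M" and x: "x \<in> W c d"
  shows "section_loc M f c d (\<lambda>p. J (s p)) x = J (section_loc M f c d s x)"
proof -
  obtain p where p: "x = snd c p" "p \<in> fst c" "f p \<in> fst d" using x by blast
  show ?thesis unfolding p(1) section_loc_snd[OF c p(2)] by (rule M.to_chart_J[OF d p(3)])
qed

lemma smooth_section_add:
  assumes s: "smooth_section \<Sigma> M f s" and t: "smooth_section \<Sigma> M f t"
  shows "smooth_section \<Sigma> M f (\<lambda>p. s p + t p)"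
  unfolding smooth_section_def smooth_on_def
proof (intro ballI allI)
  fix c d k assume cd: "c \<in> atlas \<Sigma>" "d \<in> atlas M"
  show "Ck_on k (W c d) (section_loc M f c d (\<lambda>p. s p + t p))"
    by (rule Ck_on_cong[THEN iffD2, OF W_open[OF cd] section_loc_add[OF cd]
          Ck_on_add[OF W_open[OF cd] section_smooth[OF s cd] section_smooth[OF t cd]]])
qed

lemma smooth_section_J:
  assumes s: "smooth_section \<Sigma> M f s"
  shows "smooth_section \<Sigma> M f (\<lambda>p. J (s p))"
  unfolding smooth_section_def smooth_on_def
proof (intro ballI allI)
  fix c d k assume cd: "c \<in> atlas \<Sigma>" "d \<in> atlas M"
  show "Ck_on k (W c d) (section_loc M f c d (\<lambda>p. J (s p)))"
    by (rule Ck_on_cong[THEN iffD2, OF W_open[OF cd] section_loc_J[OF cd]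
          Ck_on_linear[OF M.bounded_linear_J W_open[OF cd] section_smooth[OF s cd]]])
qed

text \<open>Negation is \<open>J\<close> applied twice.\<close>

lemma smooth_section_minus:
  assumes s: "smooth_section \<Sigma> M f s"
  shows "smooth_section \<Sigma> M f (\<lambda>p. - s p)"
  using smooth_section_J[OF smooth_section_J[OF s]] by simp

lemma smooth_section_diff:
  assumes s: "smooth_section \<Sigma> M f s" and t: "smooth_section \<Sigma> M f t"
  shows "smooth_section \<Sigma> M f (\<lambda>p. s p - t p)"
  using smooth_section_add[OF s smooth_section_minus[OF t]] by simp

lemma smooth_section_0: "smooth_section \<Sigma> M f (\<lambda>p. 0)"
  unfolding smooth_section_def smooth_on_def
proof (intro ballI allI)
  fix c d k assume cd: "c \<in> atlas \<Sigma>" "d \<in> atlas M"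
  show "Ck_on k (W c d) (section_loc M f c d (\<lambda>p. 0))"
  proof (rule Ck_on_cong[THEN iffD2, OF W_open[OF cd] _ Ck_on_const[OF W_open[OF cd], where c=0]])
    fix x assume "x \<in> W c d"
    then obtain p where p: "x = snd c p" "p \<in> fst c" "f p \<in> fst d" by blast
    show "section_loc M f c d (\<lambda>p. 0) x = 0"
      unfolding p(1) section_loc_snd[OF cd(1) p(2)] by (rule linear_0[OF M.linear_to_chart[OF cd(2) p(3)]])
  qed
qed

lemma smooth_form_0: "smooth_form \<Sigma> M f (\<lambda>p w. 0)"
  unfolding smooth_form_def smooth_on_def
proof (intro conjI ballI allI)
  show "linear (\<lambda>w::complex. 0 :: 'e)" by (rule linear_zero)
  fix c d w k assume cd: "c \<in> atlas \<Sigma>" "d \<in> atlas M"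
  show "Ck_on k (W c d) (form_loc \<Sigma> M f c d (\<lambda>p w. 0) w)"
  proof (rule Ck_on_cong[THEN iffD2, OF W_open[OF cd] _ Ck_on_const[OF W_open[OF cd], where c=0]])
    fix x assume "x \<in> W c d"
    then obtain p where p: "x = snd c p" "p \<in> fst c" "f p \<in> fst d" by blast
    show "form_loc \<Sigma> M f c d (\<lambda>p w. 0) w x = 0"
      unfolding p(1) form_loc_snd[OF cd(1) p(2)] by (rule linear_0[OF M.linear_to_chart[OF cd(2) p(3)]])
  qed
qed

lemma nabla_at:
  assumes s: "smooth_section \<Sigma> M f s"
  shows "nabla \<Sigma> M f s p k = cov0 (chart_at \<Sigma> p) (chart_at M (f p))
    (section_loc M f (chart_at \<Sigma> p) (chart_at M (f p)) s) k (snd (chart_at \<Sigma> p) p)"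
  using nabla_cov0[OF s S.chart_at(1) M.chart_at(1) S.chart_at(2) M.chart_at(2)] by simp

lemma in_W_chart_at: "snd (chart_at \<Sigma> p) p \<in> W (chart_at \<Sigma> p) (chart_at M (f p))"
  using S.chart_at[of p] M.chart_at[of "f p"] by blast

lemma nabla_add:
  assumes s: "smooth_section \<Sigma> M f s" and t: "smooth_section \<Sigma> M f t"
  shows "nabla \<Sigma> M f (\<lambda>p. s p + t p) p k = nabla \<Sigma> M f s p k + nabla \<Sigma> M f t p k"
  unfolding nabla_at[OF s] nabla_at[OF t] nabla_at[OF smooth_section_add[OF s t]]
  by (rule cov0_add[OF S.chart_at(1) M.chart_at(1) in_W_chart_at section_has_derivative[OF s S.chart_at(1) M.chart_at(1) in_W_chart_at]
        section_has_derivative[OF t S.chart_at(1) M.chart_at(1) in_W_chart_at] section_loc_add[OF S.chart_at(1) M.chart_at(1)]])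

lemma nabla_0: "nabla \<Sigma> M f (\<lambda>p. 0) p k = 0"
  using nabla_add[OF smooth_section_0 smooth_section_0, of p k] by simp

lemma nabla_J:
  assumes s: "smooth_section \<Sigma> M f s"
  shows "nabla \<Sigma> M f (\<lambda>p. J (s p)) p k = J (nabla \<Sigma> M f s p k)"
proof -
  let ?c = "chart_at \<Sigma> p" and ?d = "chart_at M (f p)"
  note C = S.chart_at(1)[of p] and D = M.chart_at(1)[of "f p"] and x = in_W_chart_at[of p]
  note loc = section_loc_J[OF C D]
  have fd: "frechet_derivative (section_loc M f ?c ?d (\<lambda>p. J (s p))) (at (snd ?c p))
      = frechet_derivative (\<lambda>z. J (section_loc M f ?c ?d s z)) (at (snd ?c p))"
    by (rule frechet_derivative_cong_open[OF W_open[OF C D] x loc])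
  have "cov0 ?c ?d (section_loc M f ?c ?d (\<lambda>p. J (s p))) k (snd ?c p)
      = cov0 ?c ?d (\<lambda>z. J (section_loc M f ?c ?d s z)) k (snd ?c p)"
    unfolding cov0_def loc[OF x] fd ..
  also have "\<dots> = J (cov0 ?c ?d (section_loc M f ?c ?d s) k (snd ?c p))"
    by (rule cov0_J[OF C D x section_has_derivative[OF s C D x]])
  finally show ?thesis unfolding nabla_at[OF s] nabla_at[OF smooth_section_J[OF s]] .
qed

lemma nabla_minus:
  assumes s: "smooth_section \<Sigma> M f s"
  shows "nabla \<Sigma> M f (\<lambda>p. - s p) p k = - nabla \<Sigma> M f s p k"
  using nabla_J[OF smooth_section_J[OF s], of p k] nabla_J[OF s, of p k] by simp

lemma smooth_form_add:
  assumes \<beta>: "smooth_form \<Sigma> M f \<beta>" and \<gamma>: "smooth_form \<Sigma> M f \<gamma>"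
  shows "smooth_form \<Sigma> M f (\<lambda>p w. \<beta> p w + \<gamma> p w)"
  unfolding smooth_form_def smooth_on_def
proof (intro conjI ballI allI)
  show "linear (\<lambda>w. \<beta> p w + \<gamma> p w)" for p
    by (rule linear_compose_add[OF form_linear[OF \<beta>] form_linear[OF \<gamma>]])
  fix c d w k assume cd: "c \<in> atlas \<Sigma>" "d \<in> atlas M"
  show "Ck_on k (W c d) (form_loc \<Sigma> M f c d (\<lambda>p w. \<beta> p w + \<gamma> p w) w)"
    by (rule Ck_on_cong[THEN iffD2, OF W_open[OF cd] form_loc_add[OF cd]
          Ck_on_add[OF W_open[OF cd] form_smooth[OF \<beta> cd] form_smooth[OF \<gamma> cd]]])
qed

lemma Divp_add:
  assumes \<beta>: "smooth_form \<Sigma> M f \<beta>" and \<gamma>: "smooth_form \<Sigma> M f \<gamma>"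
  shows "Divp (\<lambda>p w. \<beta> p w + \<gamma> p w) p = Divp \<beta> p + Divp \<gamma> p"
proof -
  note C = S.chart_at(1)[of p] and D = M.chart_at(1)[of "f p"] and x = in_W_chart_at[of p]
  have "cov0 (chart_at \<Sigma> p) (chart_at M (f p)) (form_loc \<Sigma> M f (chart_at \<Sigma> p) (chart_at M (f p)) (\<lambda>p w. \<beta> p w + \<gamma> p w) w) k (snd (chart_at \<Sigma> p) p)
    = cov0 (chart_at \<Sigma> p) (chart_at M (f p)) (form_loc \<Sigma> M f (chart_at \<Sigma> p) (chart_at M (f p)) \<beta> w) k (snd (chart_at \<Sigma> p) p)
    + cov0 (chart_at \<Sigma> p) (chart_at M (f p)) (form_loc \<Sigma> M f (chart_at \<Sigma> p) (chart_at M (f p)) \<gamma> w) k (snd (chart_at \<Sigma> p) p)" for w k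
    by (rule cov0_add[OF C D x form_has_derivative[OF \<beta> C D x] form_has_derivative[OF \<gamma> C D x] form_loc_add[OF C D]])
  then show ?thesis unfolding Divp_def Div_def by simp
qed

lemma Divp_0: "Divp (\<lambda>p w. 0) p = 0"
  using Divp_add[OF smooth_form_0 smooth_form_0, of p] by simp

text \<open>The trace of the covariant derivative of a form: the Christoffel symbols of the surface
  drop out because they are complex bilinear.\<close>
lemma trace_nabla_form:
  assumes \<beta>: "smooth_form \<Sigma> M f \<beta>"
  shows "nabla_form \<Sigma> M f \<beta> p (e1 \<Sigma> p) (e1 \<Sigma> p) + nabla_form \<Sigma> M f \<beta> p (e2 \<Sigma> p) (e2 \<Sigma> p) = (1 / S.lam p) *\<^sub>R Divp \<beta> p"
proof -
  let ?c = "chart_at \<Sigma> p" and ?d = "chart_at M (f p)"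
  note C = S.chart_at[of p] and D = M.chart_at[of "f p"] and x = in_W_chart_at[of p]
  have xc: "snd ?c p \<in> snd ?c ` fst ?c" using C by blast
  let ?Q = "\<lambda>k w. cov0 ?c ?d (form_loc \<Sigma> M f ?c ?d \<beta> w) k (snd ?c p)"
  let ?G = "christoffel \<Sigma> ?c (snd ?c p)"
  have n: "nabla_form \<Sigma> M f \<beta> p v w = ?Q v w - \<beta> p (?G v w)" for v w
    unfolding nabla_form_def Let_def cov0_def floc_snd[OF C(1) D(1) C(2)] form_loc_snd[OF C] differential_df by simp
  have G: "?G (\<i> * v) (\<i> * v) = - ?G v v" for v
    unfolding S.christoffel_J[OF C(1) xc] S.christoffel_J_left[OF C(1) xc] by simp
  have e: "(cmod (e1 \<Sigma> p))\<^sup>2 = 1 / S.lam p"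
    using S.lam_pos[of p] by (simp add: e1_def S.lam_def norm_divide power_divide)
  show ?thesis
    unfolding n e2_def G linear_neg[OF form_linear[OF \<beta>]]
    using bilinear_conformal[OF cov0_form_bilinear[OF \<beta> C(1) D(1) x], of "e1 \<Sigma> p"]
    unfolding e Divp_def Div_def by simp
qed

lemma nabla_form_minus:
  assumes \<beta>: "smooth_form \<Sigma> M f \<beta>"
  shows "nabla_form \<Sigma> M f \<beta> p v (- w) = - nabla_form \<Sigma> M f \<beta> p v w"
proof -
  let ?c = "chart_at \<Sigma> p" and ?d = "chart_at M (f p)"
  note C = S.chart_at[of p] and D = M.chart_at[of "f p"] and x = in_W_chart_at[of p]
  have xc: "snd ?c p \<in> snd ?c ` fst ?c" using C by blast
  have n: "nabla_form \<Sigma> M f \<beta> p v w = cov0 ?c ?d (form_loc \<Sigma> M f ?c ?d \<beta> w) v (snd ?c p) - \<beta> p (christoffel \<Sigma> ?c (snd ?c p) v w)" for v w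
    unfolding nabla_form_def Let_def cov0_def floc_snd[OF C(1) D(1) C(2)] form_loc_snd[OF C] differential_df by simp
  show ?thesis
    unfolding n bilinear_rneg[OF cov0_form_bilinear[OF \<beta> C(1) D(1) x]] bilinear_rneg[OF S.christoffel_bilinear[OF C(1) xc]]
      linear_neg[OF form_linear[OF \<beta>]] by simp
qed

text \<open>Two forms occur because, in real components, antilinearity of a (0,1)-form reads as an
  exchange: the first component at \<open>\<i> * w\<close> is the second one at
  \<open>w\<close>.\<close>

lemma nabla_form_antilinear:
  assumes \<beta>: "smooth_form \<Sigma> M f \<beta>" and \<gamma>: "smooth_form \<Sigma> M f \<gamma>" and eq: "\<And>p w. \<beta> p (\<i> * w) = \<gamma> p w"
  shows "nabla_form \<Sigma> M f \<beta> p v (\<i> * w) = nabla_form \<Sigma> M f \<gamma> p v w"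
proof -
  let ?c = "chart_at \<Sigma> p" and ?d = "chart_at M (f p)"
  note C = S.chart_at[of p] and D = M.chart_at[of "f p"] and x = in_W_chart_at[of p]
  have xc: "snd ?c p \<in> snd ?c ` fst ?c" using C by blast
  have loc: "form_loc \<Sigma> M f ?c ?d \<beta> (\<i> * w) y = form_loc \<Sigma> M f ?c ?d \<gamma> w y" if y: "y \<in> W ?c ?d" for y
  proof -
    obtain q where q: "y = snd ?c q" "q \<in> fst ?c" "f q \<in> fst ?d" using y by blast
    show ?thesis unfolding q(1) form_loc_snd[OF C(1) q(2)] S.from_chart_J[OF C(1) q(2)] eq ..
  qed
  have fd: "frechet_derivative (form_loc \<Sigma> M f ?c ?d \<beta> (\<i> * w)) (at (snd ?c p)) = frechet_derivative (form_loc \<Sigma> M f ?c ?d \<gamma> w) (at (snd ?c p))"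
    by (rule frechet_derivative_cong_open[OF W_open[OF C(1) D(1)] x loc])
  show ?thesis
    unfolding nabla_form_def Let_def fd eq S.christoffel_J[OF C(1) xc] ..
qed

end

section \<open>Spinor algebra\<close>

lemma cmult_cmult: "cmult z (cmult w x) = cmult (z * w) x"
  by (simp add: cmult_def prod_eq_iff algebra_simps)

lemma cmult_add: "cmult z (x + y) = cmult z x + cmult z y"
  and cmult_minus_left: "cmult (- z) x = - cmult z x"
  and cmult_0: "cmult z 0 = 0"
  and cmult_1: "cmult 1 x = x"
  and cmult_of_real: "cmult (complex_of_real r) x = r *\<^sub>R x"
  by (simp_all add: cmult_def prod_eq_iff algebra_simps)

lemma cmult_ii: "cmult \<i> x = (- snd x, fst x)" "cmult (- \<i>) x = (snd x, - fst x)"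
  by (simp_all add: cmult_def)

lemma complex_structure_vec: "complex_structure (\<lambda>v :: complex ^ 'n. \<i> *s v)"
proof (rule complex_structure.intro)
  show "linear (\<lambda>v :: complex ^ 'n. \<i> *s v)"
    by (rule linearI) (simp_all add: vec_eq_iff algebra_simps)
qed (simp add: vec_eq_iff)

text \<open>\<open>cmult \<i>\<close> sends \<open>(a, b)\<close> to \<open>(- b, a)\<close> while
  \<open>J\<close> acts componentwise, so each eigenspace is the graph of a map over the first
  component.\<close>

lemma T10_iff: "x \<in> T10 \<longleftrightarrow> snd x = - (\<i> *s fst x)"
  and T01_iff: "x \<in> T01 \<longleftrightarrow> snd x = \<i> *s fst x"
proof -
  interpret complex_structure "\<lambda>v :: complex ^ 'n. \<i> *s v" by (rule complex_structure_vec)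
  show "x \<in> T10 \<longleftrightarrow> snd x = - (\<i> *s fst x)"
    unfolding T10_def cext_def cmult_ii using J_J[of "fst x"] by (cases x) auto
  show "x \<in> T01 \<longleftrightarrow> snd x = \<i> *s fst x"
    unfolding T01_def cext_def cmult_ii using J_J[of "fst x"] by (cases x) auto
qed

text \<open>\<open>J\<close> is an isometry of \<open>B\<close>, hence unitary for the Hermitian
  extension, and its eigenspaces for distinct eigenvalues are orthogonal.\<close>

lemma herm_T10_T01:
  assumes B: "bilinear B" and J: "\<And>v w. B (\<i> *s v) (\<i> *s w) = B v (w :: complex ^ 'n)"
  shows "x \<in> T10 \<Longrightarrow> y \<in> T01 \<Longrightarrow> herm B x y = 0" "x \<in> T01 \<Longrightarrow> y \<in> T10 \<Longrightarrow> herm B x y = 0"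
proof -
  interpret complex_structure "\<lambda>v :: complex ^ 'n. \<i> *s v" by (rule complex_structure_vec)
  have J': "B (\<i> *s v) w = - B v (\<i> *s w)" for v w
    using J[of v "\<i> *s w"] by (simp only: J_J bilinear_rneg[OF B])
  show "x \<in> T10 \<Longrightarrow> y \<in> T01 \<Longrightarrow> herm B x y = 0" "x \<in> T01 \<Longrightarrow> y \<in> T10 \<Longrightarrow> herm B x y = 0"
    unfolding T10_iff T01_iff herm_def
    by (simp_all add: J J' bilinear_lneg[OF B] bilinear_rneg[OF B] complex_eq_iff)
qed

section \<open>Dolbeault operators and the Dirac operator\<close>

locale spinor_curve = curve \<Sigma> "\<lambda>v. \<i> *s v" M f + S: compact_surface \<Sigma>
  for \<Sigma> :: "('s::{t2_space,second_countable_topology}, complex) riem_mfd"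
    and M :: "('m::{t2_space,second_countable_topology}, complex ^ 'n) riem_mfd" and f :: "'s \<Rightarrow> 'm"
begin

abbreviation comp1 :: "('s \<Rightarrow> complex \<Rightarrow> (complex ^ 'n) cpx) \<Rightarrow> 's \<Rightarrow> complex \<Rightarrow> complex ^ 'n" where
  "comp1 \<beta> \<equiv> \<lambda>p w. fst (\<beta> p w)"

abbreviation comp2 :: "('s \<Rightarrow> complex \<Rightarrow> (complex ^ 'n) cpx) \<Rightarrow> 's \<Rightarrow> complex \<Rightarrow> complex ^ 'n" where
  "comp2 \<beta> \<equiv> \<lambda>p w. snd (\<beta> p w)"

definition Dst :: "('s \<Rightarrow> complex \<Rightarrow> (complex ^ 'n) cpx) \<Rightarrow> 's \<Rightarrow> (complex ^ 'n) cpx" where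
  "Dst \<beta> p = (dstar (comp1 \<beta>) p, dstar (comp2 \<beta>) p)"

lemma cforms01D:
  assumes "\<beta> \<in> cforms01 \<Sigma> M f"
  shows "smooth_form \<Sigma> M f (comp1 \<beta>)" "smooth_form \<Sigma> M f (comp2 \<beta>)"
    "fst (\<beta> p (\<i> * w)) = snd (\<beta> p w)" "snd (\<beta> p (\<i> * w)) = - fst (\<beta> p w)"
  using assms by (simp_all add: cforms01_def cmult_ii)

lemma dstar_eq: "smooth_form \<Sigma> M f \<beta> \<Longrightarrow> dstar \<beta> p = - ((1 / S.lam p) *\<^sub>R Divp \<beta> p)"
  by (simp add: dstar_def)

lemma dstar_eq_0: "smooth_form \<Sigma> M f \<beta> \<Longrightarrow> dstar \<beta> p = 0 \<longleftrightarrow> Divp \<beta> p = 0"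
  using S.lam_pos[of p] by (simp add: dstar_eq)

text \<open>The covariant derivative of an antilinear form is antilinear. Therefore the Clifford
  actions of \<open>e1\<close> and \<open>e2\<close> on it combine to its metric trace, which is a
  multiple of \<open>Dst\<close>.\<close>

lemma dirac_fst:
  assumes \<psi>: "(\<lambda>p. snd (\<psi> p)) \<in> cforms01 \<Sigma> M f" and z: "Dst (\<lambda>p. snd (\<psi> p)) p = 0"
  shows "fst (dirac \<Sigma> M f \<psi> p) = 0"
proof -
  define \<beta> where "\<beta> = (\<lambda>p. snd (\<psi> p))"
  have "\<beta> \<in> cforms01 \<Sigma> M f" using \<psi> by (simp only: \<beta>_def)
  note b = cforms01D[OF this]
  let ?e = "e1 \<Sigma> p" and ?e' = "e2 \<Sigma> p"
  define B where "B v w = (nabla_form \<Sigma> M f (comp1 \<beta>) p v w, nabla_form \<Sigma> M f (comp2 \<beta>) p v w)" for v w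
  have anti: "B v ?e' = cmult (- \<i>) (B v ?e)" for v
  proof -
    have 1: "nabla_form \<Sigma> M f (comp1 \<beta>) p v (\<i> * w) = nabla_form \<Sigma> M f (comp2 \<beta>) p v w" for w
      by (rule nabla_form_antilinear[OF b(1,2) b(3)])
    have "nabla_form \<Sigma> M f (comp2 \<beta>) p v (\<i> * w) = - nabla_form \<Sigma> M f (comp1 \<beta>) p v w" for w
      using 1[of "\<i> * w"] nabla_form_minus[OF b(1), of p v w] by (simp add: mult.assoc[symmetric])
    with 1 show ?thesis by (simp add: B_def e2_def cmult_ii)
  qed
  \<comment> \<open>By antilinearity \<open>\<i>\<close> times the value at \<open>e2\<close> equals
    the value at \<open>e1\<close>; hence a 2 over the normalising \<open>sqrt 2\<close>.\<close>
  have ev: "eval_eps \<Sigma> p (B v) = (2 / sqrt 2) *\<^sub>R B v ?e" for v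
    unfolding eval_eps_def anti cmult_cmult cmult_of_real by (simp add: cmult_1 scaleR_2[symmetric])
  have tr: "B ?e ?e + B ?e' ?e' = 0"
  proof -
    have "Divp (comp1 \<beta>) p = 0" "Divp (comp2 \<beta>) p = 0"
      using z dstar_eq_0[OF b(1)] dstar_eq_0[OF b(2)] by (simp_all add: Dst_def \<beta>_def prod_eq_iff)
    then show ?thesis
      using trace_nabla_form[OF b(1), of p] trace_nabla_form[OF b(2), of p] by (simp add: B_def prod_eq_iff)
  qed
  have "cmult \<i> (B ?e' ?e) = - B ?e' ?e'" unfolding anti[of ?e'] by (simp add: cmult_minus_left)
  moreover have "cmult \<i> (r *\<^sub>R x) = r *\<^sub>R cmult \<i> x" for r and x :: "(complex ^ 'n) cpx"
    by (simp add: cmult_ii)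
  moreover have "fst (dirac \<Sigma> M f \<psi> p) = - eval_eps \<Sigma> p (B ?e) + cmult \<i> (eval_eps \<Sigma> p (B ?e'))"
    by (simp add: dirac_def tspinor_add_def clifford1_def clifford2_def nablaS_def B_def[abs_def] \<beta>_def)
  ultimately have "fst (dirac \<Sigma> M f \<psi> p) = - ((2 / sqrt 2) *\<^sub>R (B ?e ?e + B ?e' ?e'))"
    unfolding ev by (simp add: scaleR_right_distrib)
  then show ?thesis unfolding tr by simp
qed

text \<open>On a section of either type the assumed sum is twice its Dolbeault operator evaluated at
  \<open>e1\<close>; the scalar \<open>kappa\<close> is common to both Clifford actions.\<close>

lemma dirac_snd:
  assumes "nablaC \<Sigma> M f (\<lambda>p. fst (\<psi> p)) p (e1 \<Sigma> p) + cmult \<i> (nablaC \<Sigma> M f (\<lambda>p. fst (\<psi> p)) p (e2 \<Sigma> p)) = 0"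
  shows "snd (dirac \<Sigma> M f \<psi> p) w = 0"
proof -
  let ?n = "nablaC \<Sigma> M f (\<lambda>p. fst (\<psi> p)) p"
  have "snd (dirac \<Sigma> M f \<psi> p) w = cmult (kappa \<Sigma> p w) (?n (e1 \<Sigma> p)) + cmult (\<i> * kappa \<Sigma> p w) (?n (e2 \<Sigma> p))"
    by (simp add: dirac_def tspinor_add_def clifford1_def clifford2_def nablaS_def)
  also have "\<dots> = cmult (kappa \<Sigma> p w) (?n (e1 \<Sigma> p) + cmult \<i> (?n (e2 \<Sigma> p)))"
    by (simp add: cmult_add cmult_cmult mult.commute)
  finally show ?thesis using assms by (simp add: cmult_0)
qed

lemma T10_closed:
  "x \<in> T10 \<Longrightarrow> y \<in> T10 \<Longrightarrow> x + y \<in> T10" "x \<in> T10 \<Longrightarrow> cmult z x \<in> T10" "x \<in> T10 \<Longrightarrow> - x \<in> T10"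
  and T01_closed:
  "x \<in> T01 \<Longrightarrow> y \<in> T01 \<Longrightarrow> x + y \<in> T01" "x \<in> T01 \<Longrightarrow> cmult z x \<in> T01" "x \<in> T01 \<Longrightarrow> - x \<in> (T01 :: (complex ^ 'n) cpx set)"
  unfolding T10_iff T01_iff
  by (simp_all only: cmult_def fst_conv snd_conv fst_add snd_add fst_uminus snd_uminus M.J_add M.J_diff M.J_scaleR M.J_minus M.J_J)
     simp_all

text \<open>By \<open>curv_J\<close> the value equals \<open>\<i>\<close> times itself.\<close>

lemma curv_0: "curv M q x y 0 = 0"
proof -
  define c where "c = curv M q x y 0"
  have "c = \<i> *s c" unfolding c_def using M.curv_J[of q x y 0] by simp
  have "c $ k = 0" for k
  proof -
    have "c $ k = (\<i> *s c) $ k" by (rule arg_cong[OF \<open>c = \<i> *s c\<close>])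
    then have "c $ k = \<i> * c $ k" by (simp only: vector_smult_component)
    then have "(1 - \<i>) * c $ k = 0" by (simp only: left_diff_distrib mult_1_left right_minus_eq)
    moreover have "1 - \<i> \<noteq> 0" by (simp add: complex_eq_iff)
    ultimately show ?thesis by (simp only: mult_eq_0_iff) blast
  qed
  then show ?thesis by (simp add: c_def[symmetric] vec_eq_iff)
qed

lemma curv_T: "x \<in> T10 \<Longrightarrow> cext (curv M q u v) x \<in> T10" "x \<in> T01 \<Longrightarrow> cext (curv M q u v) x \<in> T01"
proof -
  \<comment> \<open>Negation is multiplication by \<open>\<i>\<close> twice.\<close>
  have "curv M q u v (- w) = - curv M q u v w" for w
    using M.curv_J[of q u v "\<i> *s w"] M.curv_J[of q u v w] by simp
  then show "x \<in> T10 \<Longrightarrow> cext (curv M q u v) x \<in> T10" "x \<in> T01 \<Longrightarrow> cext (curv M q u v) x \<in> T01"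
    unfolding T10_iff T01_iff cext_def by (simp_all add: M.curv_J)
qed

lemma herm_zero: "bilinear B \<Longrightarrow> herm B 0 x = 0" "bilinear B \<Longrightarrow> herm B x 0 = 0"
  by (simp_all add: herm_def bilinear_lzero bilinear_rzero complex_eq_iff)

lemma curvature_term_zero:
  assumes cases: "snd (\<psi> p) = (\<lambda>w. 0) \<or> fst (\<psi> p) = 0 \<or> (fst (\<psi> p) \<in> T10 \<and> (\<forall>w. snd (\<psi> p) w \<in> T01))
    \<or> (fst (\<psi> p) \<in> T01 \<and> (\<forall>w. snd (\<psi> p) w \<in> T10))"
  shows "curvature_term \<Sigma> M f \<psi> p = 0"
proof -
  let ?B = "riem M (f p)"
  note B = M.riem_bilinear[of "f p"]
  have zero: "herm_spinor \<Sigma> M f p (\<psi> p) (curv_spinor \<Sigma> M f p x (\<psi> p)) = 0" for x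
  proof -
    let ?R = "\<lambda>e. cext (curv M (f p) x (dfp p e))"
    let ?r1 = "?R (e1 \<Sigma> p)" and ?r2 = "?R (e2 \<Sigma> p)"
    have R0: "?R e 0 = 0" for e by (simp add: cext_def curv_0 prod_eq_iff)
    have f: "fst (curv_spinor \<Sigma> M f p x (\<psi> p)) = - eval_eps \<Sigma> p (\<lambda>w. ?r1 (snd (\<psi> p) w)) + cmult \<i> (eval_eps \<Sigma> p (\<lambda>w. ?r2 (snd (\<psi> p) w)))"
      and s: "snd (curv_spinor \<Sigma> M f p x (\<psi> p)) w = cmult (kappa \<Sigma> p w) (?r1 (fst (\<psi> p))) + cmult (\<i> * kappa \<Sigma> p w) (?r2 (fst (\<psi> p)))" for w
      by (simp_all add: curv_spinor_def Let_def tspinor_add_def clifford1_def clifford2_def)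
    have tf: "fst (curv_spinor \<Sigma> M f p x (\<psi> p)) \<in> T10" if "\<forall>w. snd (\<psi> p) w \<in> T10"
      unfolding f eval_eps_def using that by (intro T10_closed curv_T) auto
    have tf': "fst (curv_spinor \<Sigma> M f p x (\<psi> p)) \<in> T01" if "\<forall>w. snd (\<psi> p) w \<in> T01"
      unfolding f eval_eps_def using that by (intro T01_closed curv_T) auto
    have ts: "snd (curv_spinor \<Sigma> M f p x (\<psi> p)) w \<in> T10" if "fst (\<psi> p) \<in> T10" for w
      unfolding s using that by (intro T10_closed curv_T)
    have ts': "snd (curv_spinor \<Sigma> M f p x (\<psi> p)) w \<in> T01" if "fst (\<psi> p) \<in> T01" for w
      unfolding s using that by (intro T01_closed curv_T)
    note h = herm_T10_T01[OF B M.riem_J]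
    consider "snd (\<psi> p) = (\<lambda>w. 0)" | "fst (\<psi> p) = 0" | "fst (\<psi> p) \<in> T10" "\<forall>w. snd (\<psi> p) w \<in> T01"
      | "fst (\<psi> p) \<in> T01" "\<forall>w. snd (\<psi> p) w \<in> T10" using cases by blast
    then show ?thesis
    proof cases
      case 1
      have "fst (curv_spinor \<Sigma> M f p x (\<psi> p)) = 0" unfolding f 1 by (simp add: R0 eval_eps_def cmult_0)
      then show ?thesis unfolding herm_spinor_def herm_form_def 1 by (simp add: herm_zero[OF B])
    next
      case 2
      have "snd (curv_spinor \<Sigma> M f p x (\<psi> p)) w = 0" for w unfolding s 2 by (simp add: R0 cmult_0)
      then show ?thesis unfolding herm_spinor_def herm_form_def 2 by (simp add: herm_zero[OF B])
    next
      case 3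
      then show ?thesis unfolding herm_spinor_def herm_form_def
        using h(1)[OF 3(1) tf'[OF 3(2)]] h(2)[OF _ ts[OF 3(1)]] by simp
    next
      case 4
      then show ?thesis unfolding herm_spinor_def herm_form_def
        using h(2)[OF 4(1) tf[OF 4(2)]] h(1)[OF _ ts'[OF 4(1)]] by simp
    qed
  qed
  \<comment> \<open>With all pairings zero, definiteness of the metric singles out \<open>0\<close>
    in the definite description.\<close>
  show ?thesis
    unfolding curvature_term_def zero
  proof (rule the_equality)
    show "\<forall>x. complex_of_real (?B 0 x) = 1 / 2 * 0" by (simp add: bilinear_lzero[OF B])
    fix y assume "\<forall>x. complex_of_real (?B y x) = 1 / 2 * 0"
    then have "?B y y = 0" by simp
    then show "y = 0" using M.riem_pos[of y "f p"] by force
  qed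
qed

lemma dirac_harmonicI:
  assumes \<psi>: "\<psi> \<in> twisted_spinors \<Sigma> M f"
    and s: "\<And>p. nablaC \<Sigma> M f (\<lambda>p. fst (\<psi> p)) p (e1 \<Sigma> p) + cmult \<i> (nablaC \<Sigma> M f (\<lambda>p. fst (\<psi> p)) p (e2 \<Sigma> p)) = 0"
    and \<beta>: "\<And>p. Dst (\<lambda>p. snd (\<psi> p)) p = 0"
    and cases: "\<And>p. snd (\<psi> p) = (\<lambda>w. 0) \<or> fst (\<psi> p) = 0 \<or> (fst (\<psi> p) \<in> T10 \<and> (\<forall>w. snd (\<psi> p) w \<in> T01))
    \<or> (fst (\<psi> p) \<in> T01 \<and> (\<forall>w. snd (\<psi> p) w \<in> T10))"
  shows "dirac_harmonic \<Sigma> M f \<psi>"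
  unfolding dirac_harmonic_def
proof (intro conjI allI)
  show "smooth_map \<Sigma> M f" by (rule smooth)
  show "\<psi> \<in> twisted_spinors \<Sigma> M f" by (rule \<psi>)
  show "tension_field \<Sigma> M f p = curvature_term \<Sigma> M f \<psi> p" for p
    unfolding tension_zero curvature_term_zero[OF cases] ..
  have c: "(\<lambda>p. snd (\<psi> p)) \<in> cforms01 \<Sigma> M f" using \<psi> by (simp add: twisted_spinors_def)
  show "dirac \<Sigma> M f \<psi> p = tspinor_zero" for p
    unfolding tspinor_zero_def prod_eq_iff using dirac_fst[OF c \<beta>] dirac_snd[OF s] by (simp add: fun_eq_iff)
qed

section \<open>Formal adjoints\<close>

lemma riem_continuous:
  assumes a: "smooth_section \<Sigma> M f a" and b: "smooth_section \<Sigma> M f b"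
  shows "continuous_on UNIV (\<lambda>p. riem M (f p) (a p) (b p))"
proof (rule S.continuous_from_charts)
  fix c assume c: "c \<in> atlas \<Sigma>"
  have "Ck_on 0 (snd c ` fst c) (\<lambda>x. riem M (f (chart_inv c x)) (a (chart_inv c x)) (b (chart_inv c x)))"
  proof (rule Ck_on_local)
    fix x assume "x \<in> snd c ` fst c"
    then obtain p where p: "x = snd c p" "p \<in> fst c" by blast
    let ?d = "chart_at M (f p)"
    note D = M.chart_at[of "f p"]
    have o: "open (W c ?d)" by (rule W_open[OF c D(1)])
    have sub: "floc c ?d ` W c ?d \<subseteq> snd ?d ` fst ?d" using floc_in[OF c D(1)] by blast
    have g0: "Ck_on 0 (snd ?d ` fst ?d) (\<lambda>y. M.gloc ?d y v w)" for v w
      using M.smooth_gloc[OF D(1)] unfolding smooth_on_def by blast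
    have "Ck_on 0 (W c ?d) (\<lambda>x. M.gloc ?d (floc c ?d x) (section_loc M f c ?d a x) (section_loc M f c ?d b x))"
      by (rule Ck_on_bilinear_family[OF o M.open_chart_image[OF D(1)] sub M.gloc_bilinear[OF D(1)] g0
            floc_smooth[OF c D(1)] section_smooth[OF a c D(1)] section_smooth[OF b c D(1)]])
    moreover have "riem M (f (chart_inv c y)) (a (chart_inv c y)) (b (chart_inv c y))
      = M.gloc ?d (floc c ?d y) (section_loc M f c ?d a y) (section_loc M f c ?d b y)" if y: "y \<in> W c ?d" for y
    proof -
      obtain q where q: "y = snd c q" "q \<in> fst c" "f q \<in> fst ?d" using y by blast
      show ?thesis unfolding q(1) section_loc_snd[OF c q(2)] floc_snd[OF c D(1) q(2)] bilin_loc_def using c D q by simp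
    qed
    ultimately have "Ck_on 0 (W c ?d) (\<lambda>x. riem M (f (chart_inv c x)) (a (chart_inv c x)) (b (chart_inv c x)))"
      by (rule Ck_on_cong[THEN iffD2, OF o, rotated])
    then show "\<exists>Y. open Y \<and> x \<in> Y \<and> Ck_on 0 Y (\<lambda>x. riem M (f (chart_inv c x)) (a (chart_inv c x)) (b (chart_inv c x)))"
      using o p D(2) by blast
  qed
  then show "continuous_on (snd c ` fst c) (\<lambda>x. riem M (f (chart_inv c x)) (a (chart_inv c x)) (b (chart_inv c x)))"
    by (simp only: Ck_on.simps)
qed

lemma csectionsD:
  assumes "s \<in> csections \<Sigma> M f"
  shows "smooth_section \<Sigma> M f (\<lambda>p. fst (s p))" "smooth_section \<Sigma> M f (\<lambda>p. snd (s p))"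
  using assms by (simp_all add: csections_def)

lemma herm_continuous:
  assumes s: "s \<in> csections \<Sigma> M f" and t: "t \<in> csections \<Sigma> M f"
  shows "continuous_on UNIV (\<lambda>p. herm (riem M (f p)) (s p) (t p))"
proof -
  let ?B = "\<lambda>p. riem M (f p)"
  have eq: "herm (?B p) (s p) (t p) = complex_of_real (?B p (fst (s p)) (fst (t p)) + ?B p (snd (s p)) (snd (t p)))
      + \<i> * complex_of_real (?B p (snd (s p)) (fst (t p)) - ?B p (fst (s p)) (snd (t p)))" for p
    by (simp add: herm_def complex_eq_iff)
  show ?thesis unfolding eq
    by (intro continuous_on_add continuous_on_mult continuous_on_const continuous_on_of_real continuous_on_diff
        riem_continuous csectionsD[OF s] csectionsD[OF t])
qed

lemma integral_complex_parts:
  assumes U: "continuous_on UNIV U" and V: "continuous_on UNIV V"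
  shows "(LINT p|area_measure \<Sigma>. complex_of_real (U p) + \<i> * complex_of_real (V p))
    = complex_of_real (LINT p|area_measure \<Sigma>. U p) + \<i> * complex_of_real (LINT p|area_measure \<Sigma>. V p)"
proof -
  note iU = S.integrable_continuous[OF U] and iV = S.integrable_continuous[OF V]
  have l: "bounded_linear (\<lambda>x. \<i> * complex_of_real x)"
    by (rule bounded_linear_compose[OF bounded_linear_mult_right bounded_linear_of_real])
  have 1: "integrable (area_measure \<Sigma>) (\<lambda>p. complex_of_real (U p))"
    by (rule integrable_bounded_linear[OF bounded_linear_of_real iU])
  have 2: "integrable (area_measure \<Sigma>) (\<lambda>p. \<i> * complex_of_real (V p))"
    by (rule integrable_bounded_linear[OF l iV])
  show ?thesis
    unfolding Bochner_Integration.integral_add[OF 1 2] integral_bounded_linear[OF bounded_linear_of_real iU]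
      integral_bounded_linear[OF l iV] ..
qed

text \<open>Covers both Dolbeault operators, which share the form in \<open>D\<close> on their
  domains. Existence is the divergence theorem. For uniqueness two candidates are tested against
  their difference, which is why \<open>E\<close> has to be closed under differences.\<close>

lemma formal_adjoint_eq:
  assumes E: "E \<subseteq> csections \<Sigma> M f" and diff: "\<And>s t. s \<in> E \<Longrightarrow> t \<in> E \<Longrightarrow> (\<lambda>p. s p - t p) \<in> E"
    and D: "\<And>s p v. s \<in> E \<Longrightarrow> D s p v = (1 / 2) *\<^sub>R (nablaC \<Sigma> M f s p v + cmult \<i> (nablaC \<Sigma> M f s p (\<i> * v)))"
    and \<beta>: "\<beta> \<in> cforms01 \<Sigma> M f" and DE: "Dst \<beta> \<in> E"
  shows "formal_adjoint E (L2_section \<Sigma> M f) (L2_form \<Sigma> M f) D \<beta> = Dst \<beta>"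
proof -
  let ?B = "\<lambda>p. riem M (f p)"
  note B = M.riem_bilinear
  note b = cforms01D[OF \<beta>]
  define u where "u a b p = (1 / S.lam p) * (?B p (nabla \<Sigma> M f a p 1) (b p 1) + ?B p (nabla \<Sigma> M f a p \<i>) (b p \<i>)
       + ?B p (a p) (Divp b p))" for a b p
  have div: "S.divergence_of (u a b) (\<lambda>p w. ?B p (a p) (b p w))" if "smooth_section \<Sigma> M f a" "smooth_form \<Sigma> M f b" for a b
    unfolding u_def[abs_def] by (rule divergence_pairing[OF that])
  have adj: "L2_form \<Sigma> M f (D s) \<beta> = L2_section \<Sigma> M f s (Dst \<beta>)" if s: "s \<in> E" for s
  proof -
    have sc: "s \<in> csections \<Sigma> M f" using s E by blast
    define s1 where "s1 = (\<lambda>p. fst (s p))"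
    define s2 where "s2 = (\<lambda>p. snd (s p))"
    have sm: "smooth_section \<Sigma> M f s1" "smooth_section \<Sigma> M f s2" using csectionsD[OF sc] by (simp_all only: s1_def s2_def)
    \<comment> \<open>Real and imaginary parts of the divergence of the complex one-form pairing
      \<open>s\<close> with \<open>\<beta>\<close> by \<open>herm\<close>; the four real divergences
      in them integrate to zero.\<close>
    let ?U = "\<lambda>p. u s1 (comp1 \<beta>) p + u s2 (comp2 \<beta>) p" and ?V = "\<lambda>p. u s2 (comp1 \<beta>) p - u s1 (comp2 \<beta>) p"
    have cu: "continuous_on UNIV (u s1 (comp1 \<beta>))" "continuous_on UNIV (u s2 (comp2 \<beta>))"
      "continuous_on UNIV (u s2 (comp1 \<beta>))" "continuous_on UNIV (u s1 (comp2 \<beta>))"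
      by (intro S.divergence_of_continuous[OF div] sm b(1,2))+
    have iu: "(LINT p|area_measure \<Sigma>. u s1 (comp1 \<beta>) p) = 0" "(LINT p|area_measure \<Sigma>. u s2 (comp2 \<beta>) p) = 0"
      "(LINT p|area_measure \<Sigma>. u s2 (comp1 \<beta>) p) = 0" "(LINT p|area_measure \<Sigma>. u s1 (comp2 \<beta>) p) = 0"
      by (intro S.divergence_theorem[OF div] sm b(1,2))+
    \<comment> \<open>The product rule. As \<open>\<beta>\<close> is antilinear, pairing it with
      \<open>D s\<close> agrees with pairing it with the whole covariant derivative.\<close>
    have pt: "herm_form \<Sigma> M f p (D s p) (\<beta> p)
      = herm (?B p) (s p) (Dst \<beta> p) + (complex_of_real (?U p) + \<i> * complex_of_real (?V p))" for p
    proof -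
      define r where "r = 1 / sqrt (S.lam p)"
      have l: "1 / S.lam p = r * r" using S.lam_pos[of p] by (simp add: r_def)
      have e: "e1 \<Sigma> p = r *\<^sub>R 1" "e2 \<Sigma> p = r *\<^sub>R \<i>"
        by (simp_all add: e1_def e2_def r_def S.lam_def scaleR_conv_of_real)
      have ie: "\<i> * (r *\<^sub>R 1) = r *\<^sub>R \<i>" "\<i> * (r *\<^sub>R \<i>) = (- r) *\<^sub>R 1" by (simp_all add: complex_eq_iff)
      note n1 = linear_cmul[OF linear_nabla[OF sm(1)]] and n2 = linear_cmul[OF linear_nabla[OF sm(2)]]
      have bi: "fst (\<beta> p \<i>) = snd (\<beta> p 1)" "snd (\<beta> p \<i>) = - fst (\<beta> p 1)" using b(3,4)[of p 1] by simp_all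
      have bl: "fst (\<beta> p (r *\<^sub>R w)) = r *\<^sub>R fst (\<beta> p w)" "snd (\<beta> p (r *\<^sub>R w)) = r *\<^sub>R snd (\<beta> p w)" for w
        by (rule linear_cmul[OF form_linear[OF b(1)]], rule linear_cmul[OF form_linear[OF b(2)]])
      define a1 where "a1 = nabla \<Sigma> M f s1 p 1"
      define ai where "ai = nabla \<Sigma> M f s1 p \<i>"
      define c1 where "c1 = nabla \<Sigma> M f s2 p 1"
      define ci where "ci = nabla \<Sigma> M f s2 p \<i>"
      define y where "y = fst (\<beta> p 1)"
      define z where "z = snd (\<beta> p 1)"
      define P where "P = Divp (comp1 \<beta>) p"
      define Q where "Q = Divp (comp2 \<beta>) p"
      have D1: "D s p (e1 \<Sigma> p) = ((r / 2) *\<^sub>R (a1 - ci), (r / 2) *\<^sub>R (c1 + ai))"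
        unfolding D[OF s] e(1) ie nablaC_def s1_def[symmetric] s2_def[symmetric] n1 n2 cmult_ii
        by (simp add: a1_def ai_def c1_def ci_def scaleR_right_distrib scaleR_right_diff_distrib)
      have D2: "D s p (e2 \<Sigma> p) = ((r / 2) *\<^sub>R (ai + c1), (r / 2) *\<^sub>R (ci - a1))"
        unfolding D[OF s] e(2) ie nablaC_def s1_def[symmetric] s2_def[symmetric] n1 n2 cmult_ii
        by (simp add: a1_def ai_def c1_def ci_def scaleR_right_distrib scaleR_right_diff_distrib)
      have b1: "fst (\<beta> p (e1 \<Sigma> p)) = r *\<^sub>R y" "snd (\<beta> p (e1 \<Sigma> p)) = r *\<^sub>R z"
        "fst (\<beta> p (e2 \<Sigma> p)) = r *\<^sub>R z" "snd (\<beta> p (e2 \<Sigma> p)) = - (r *\<^sub>R y)"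
        unfolding e bl bi y_def z_def by simp_all
      have U: "?U p = r * r * (?B p a1 y + ?B p ai z + ?B p (s1 p) P) + r * r * (?B p c1 z - ?B p ci y + ?B p (s2 p) Q)"
        "?V p = r * r * (?B p c1 y + ?B p ci z + ?B p (s2 p) P) - r * r * (?B p a1 z - ?B p ai y + ?B p (s1 p) Q)"
        unfolding u_def l bi a1_def ai_def c1_def ci_def y_def z_def P_def Q_def by (simp_all add: bilinear_rneg[OF B])
      have dst: "fst (Dst \<beta> p) = - ((r * r) *\<^sub>R P)" "snd (Dst \<beta> p) = - ((r * r) *\<^sub>R Q)"
        by (simp_all only: Dst_def fst_conv snd_conv dstar_eq[OF b(1)] dstar_eq[OF b(2)] l P_def Q_def)
      have h: "herm (?B p) (s p) (Dst \<beta> p) = Complex (- (r * r * ?B p (s1 p) P) - r * r * ?B p (s2 p) Q)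
          (- (r * r * ?B p (s2 p) P) + r * r * ?B p (s1 p) Q)"
        by (simp add: herm_def dst bilinear_rneg[OF B] bilinear_rmul[OF B] complex_eq_iff s1_def s2_def)
      show ?thesis
        unfolding herm_form_def h U unfolding herm_def D1 D2 fst_conv snd_conv b1
          bilinear_lmul[OF B] bilinear_rmul[OF B] bilinear_rneg[OF B] bilinear_ladd[OF B] bilinear_lsub[OF B]
        by (simp add: complex_eq_iff algebra_simps)
    qed
    have cU: "continuous_on UNIV ?U" and cV: "continuous_on UNIV ?V"
      by (intro continuous_on_add continuous_on_diff cu)+
    have i: "integrable (area_measure \<Sigma>) (\<lambda>p. complex_of_real (?U p) + \<i> * complex_of_real (?V p))"
      by (intro S.integrable_continuous continuous_on_add continuous_on_mult continuous_on_const continuous_on_of_real continuous_on_diff cu)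
    have i2: "integrable (area_measure \<Sigma>) (\<lambda>p. herm (?B p) (s p) (Dst \<beta> p))"
      by (rule S.integrable_continuous[OF herm_continuous[OF sc]]) (use DE E in blast)
    have zU: "(LINT p|area_measure \<Sigma>. ?U p) = 0"
      using Bochner_Integration.integral_add[OF S.integrable_continuous[OF cu(1)] S.integrable_continuous[OF cu(2)]] iu by simp
    have zV: "(LINT p|area_measure \<Sigma>. ?V p) = 0"
      using Bochner_Integration.integral_diff[OF S.integrable_continuous[OF cu(3)] S.integrable_continuous[OF cu(4)]] iu by simp
    have "(LINT p|area_measure \<Sigma>. complex_of_real (?U p) + \<i> * complex_of_real (?V p)) = 0"
      unfolding integral_complex_parts[OF cU cV] zU zV by simp
    then show ?thesis
      unfolding L2_form_def L2_section_def pt Bochner_Integration.integral_add[OF i2 i] by simp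
  qed
  show ?thesis
    unfolding formal_adjoint_def
  proof (rule the_equality)
    show "Dst \<beta> \<in> E \<and> (\<forall>s\<in>E. L2_form \<Sigma> M f (D s) \<beta> = L2_section \<Sigma> M f s (Dst \<beta>))"
      using DE adj by blast
    fix t assume t: "t \<in> E \<and> (\<forall>s\<in>E. L2_form \<Sigma> M f (D s) \<beta> = L2_section \<Sigma> M f s t)"
    \<comment> \<open>Tested against itself, the difference has vanishing \<open>L2\<close> norm,
      and its pointwise norm is continuous.\<close>
    define s where "s = (\<lambda>p. t p - Dst \<beta> p)"
    have sE: "s \<in> E" unfolding s_def using t DE by (intro diff) auto
    have sc: "s \<in> csections \<Sigma> M f" and dc: "Dst \<beta> \<in> csections \<Sigma> M f" using sE DE E by auto
    have eq: "L2_section \<Sigma> M f s t = L2_section \<Sigma> M f s (Dst \<beta>)" using t adj[OF sE] sE by simp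
    let ?q = "\<lambda>p. ?B p (fst (s p)) (fst (s p)) + ?B p (snd (s p)) (snd (s p))"
    have cq: "continuous_on UNIV ?q" by (intro continuous_on_add riem_continuous csectionsD[OF sc])
    have pt: "herm (?B p) (s p) (t p) = (complex_of_real (?q p) + \<i> * complex_of_real 0) + herm (?B p) (s p) (Dst \<beta> p)" for p
    proof -
      have "fst (t p) = fst (s p) + fst (Dst \<beta> p)" "snd (t p) = snd (s p) + snd (Dst \<beta> p)" by (simp_all add: s_def)
      then show ?thesis
        by (simp add: herm_def complex_eq_iff bilinear_radd[OF B] M.riem_sym[of "f p" "snd (s p)" "fst (s p)"])
    qed
    have i1: "integrable (area_measure \<Sigma>) (\<lambda>p. complex_of_real (?q p) + \<i> * complex_of_real 0)"
      by (intro S.integrable_continuous continuous_on_add continuous_on_mult continuous_on_const continuous_on_of_real riem_continuous csectionsD[OF sc])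
    have "L2_section \<Sigma> M f s t = (complex_of_real (LINT p|area_measure \<Sigma>. ?q p) + \<i> * complex_of_real (LINT p|area_measure \<Sigma>. 0))
        + L2_section \<Sigma> M f s (Dst \<beta>)"
      unfolding L2_section_def pt
        Bochner_Integration.integral_add[OF i1 S.integrable_continuous[OF herm_continuous[OF sc dc]]]
        integral_complex_parts[OF cq continuous_on_const] ..
    then have "(LINT p|area_measure \<Sigma>. ?q p) = 0" unfolding eq by simp
    moreover have nn: "0 \<le> ?B p v v" for p v
      using M.riem_pos[of v "f p"] bilinear_lzero[OF B, of "f p" v] by (cases "v = 0") auto
    ultimately have q0: "?q p = 0" for p
      by (intro S.integral_zero_imp_zero[OF cq]) (auto intro: add_nonneg_nonneg)
    have "s p = 0" for p
    proof -
      have "?B p (fst (s p)) (fst (s p)) = 0" "?B p (snd (s p)) (snd (s p)) = 0"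
        using q0[of p] nn[of p "fst (s p)"] nn[of p "snd (s p)"] by linarith+
      then have "fst (s p) = 0" "snd (s p) = 0" using M.riem_pos[of _ "f p"] by force+
      then show ?thesis by (simp add: prod_eq_iff)
    qed
    then show "t = Dst \<beta>" unfolding s_def by (auto simp: fun_eq_iff)
  qed
qed

text \<open>The type is preserved by differentiation because \<open>J\<close> is parallel:
  \<open>nabla_J\<close> carries the relation between the two components over to their
  derivatives.\<close>

lemma sections10D:
  assumes "s \<in> sections10 \<Sigma> M f"
  shows "s \<in> csections \<Sigma> M f" "s p \<in> T10" "nablaC \<Sigma> M f s p v \<in> T10"
proof -
  show s: "s \<in> csections \<Sigma> M f" "s p \<in> T10" for p using assms by (auto simp: sections10_def)
  have eq: "(\<lambda>p. snd (s p)) = (\<lambda>p. - (\<i> *s fst (s p)))" using s(2) by (simp add: T10_iff fun_eq_iff)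
  show "nablaC \<Sigma> M f s p v \<in> T10"
    unfolding T10_iff nablaC_def fst_conv snd_conv eq
    by (simp only: nabla_minus[OF smooth_section_J[OF csectionsD(1)[OF s(1)]]] nabla_J[OF csectionsD(1)[OF s(1)]])
qed

lemma sections01D:
  assumes "s \<in> sections01 \<Sigma> M f"
  shows "s \<in> csections \<Sigma> M f" "s p \<in> T01" "nablaC \<Sigma> M f s p v \<in> T01"
proof -
  show s: "s \<in> csections \<Sigma> M f" "s p \<in> T01" for p using assms by (auto simp: sections01_def)
  have eq: "(\<lambda>p. snd (s p)) = (\<lambda>p. \<i> *s fst (s p))" using s(2) by (simp add: T01_iff fun_eq_iff)
  show "nablaC \<Sigma> M f s p v \<in> T01"
    unfolding T01_iff nablaC_def fst_conv snd_conv eq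
    by (simp only: nabla_J[OF csectionsD(1)[OF s(1)]])
qed

text \<open>\<open>J\<close> acts as \<open>\<i>\<close> on \<open>T10\<close>. On
  \<open>T01\<close> it acts as \<open>- \<i>\<close>, and the opposite sign in
  \<open>dbar''\<close> leads to the same expression, so one adjoint computation serves both
  operators.\<close>

lemma dbar'_eq:
  assumes "s \<in> sections10 \<Sigma> M f"
  shows "dbar' \<Sigma> M f s p v = (1 / 2) *\<^sub>R (nablaC \<Sigma> M f s p v + cmult \<i> (nablaC \<Sigma> M f s p (\<i> * v)))"
  using sections10D(3)[OF assms, of p "\<i> * v"] unfolding dbar'_def T10_def by simp

lemma dbar''_eq:
  assumes "s \<in> sections01 \<Sigma> M f"
  shows "dbar'' \<Sigma> M f s p v = (1 / 2) *\<^sub>R (nablaC \<Sigma> M f s p v + cmult \<i> (nablaC \<Sigma> M f s p (\<i> * v)))"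
  using sections01D(3)[OF assms, of p "\<i> * v"] unfolding dbar''_def T01_def by (simp add: cmult_minus_left)

lemma csections_diff:
  assumes "s \<in> csections \<Sigma> M f" "t \<in> csections \<Sigma> M f"
  shows "(\<lambda>p. s p - t p) \<in> csections \<Sigma> M f"
  using smooth_section_diff[OF csectionsD(1)[OF assms(1)] csectionsD(1)[OF assms(2)]]
    smooth_section_diff[OF csectionsD(2)[OF assms(1)] csectionsD(2)[OF assms(2)]]
  by (simp add: csections_def)

lemma Dst_csections: "\<beta> \<in> cforms01 \<Sigma> M f \<Longrightarrow> Dst \<beta> \<in> csections \<Sigma> M f"
  using smooth_dstar[OF cforms01D(1)] smooth_dstar[OF cforms01D(2)] by (simp add: csections_def Dst_def)

text \<open>The point to check is that the divergence has values in \<open>T10\<close>, so that it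
  lies in the space where the adjoint is sought; this holds because \<open>Divp\<close> commutes
  with \<open>J\<close>.\<close>

lemma dbar'_adj_eq:
  assumes "\<beta> \<in> forms01_10 \<Sigma> M f"
  shows "dbar'_adj \<Sigma> M f \<beta> = Dst \<beta>"
proof -
  have \<beta>: "\<beta> \<in> cforms01 \<Sigma> M f" and T: "\<beta> p w \<in> T10" for p w using assms by (auto simp: forms01_10_def)
  note b = cforms01D[OF \<beta>]
  have "comp1 \<beta> = (\<lambda>p w. \<i> *s snd (\<beta> p w))"
    using T unfolding T10_iff by (simp add: fun_eq_iff)
  then have "Divp (comp1 \<beta>) p = \<i> *s Divp (comp2 \<beta>) p" for p using Divp_J(2)[OF b(2), of p] by simp
  then have "Dst \<beta> p \<in> T10" for p
    unfolding T10_iff Dst_def dstar_eq[OF b(1)] dstar_eq[OF b(2)] by simp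
  then have DE: "Dst \<beta> \<in> sections10 \<Sigma> M f" using Dst_csections[OF \<beta>] by (simp add: sections10_def)
  show ?thesis unfolding dbar'_adj_def
  proof (rule formal_adjoint_eq[OF _ _ dbar'_eq \<beta> DE])
    show "sections10 \<Sigma> M f \<subseteq> csections \<Sigma> M f" by (auto simp: sections10_def)
    show "(\<lambda>p. s p - t p) \<in> sections10 \<Sigma> M f" if "s \<in> sections10 \<Sigma> M f" "t \<in> sections10 \<Sigma> M f" for s t
      using csections_diff[OF sections10D(1)[OF that(1)] sections10D(1)[OF that(2)]]
        T10_closed(1)[OF sections10D(2)[OF that(1)] T10_closed(3)[OF sections10D(2)[OF that(2)]]]
      by (simp add: sections10_def)
  qed
qed

lemma dbar''_adj_eq:
  assumes "\<beta> \<in> forms01_01 \<Sigma> M f"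
  shows "dbar''_adj \<Sigma> M f \<beta> = Dst \<beta>"
proof -
  have \<beta>: "\<beta> \<in> cforms01 \<Sigma> M f" and T: "\<beta> p w \<in> T01" for p w using assms by (auto simp: forms01_01_def)
  note b = cforms01D[OF \<beta>]
  have "comp2 \<beta> = (\<lambda>p w. \<i> *s fst (\<beta> p w))"
    using T unfolding T01_iff by (simp add: fun_eq_iff)
  then have "Divp (comp2 \<beta>) p = \<i> *s Divp (comp1 \<beta>) p" for p using Divp_J(2)[OF b(1), of p] by simp
  then have "Dst \<beta> p \<in> T01" for p
    unfolding T01_iff Dst_def dstar_eq[OF b(1)] dstar_eq[OF b(2)] by simp
  then have DE: "Dst \<beta> \<in> sections01 \<Sigma> M f" using Dst_csections[OF \<beta>] by (simp add: sections01_def)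
  show ?thesis unfolding dbar''_adj_def
  proof (rule formal_adjoint_eq[OF _ _ dbar''_eq \<beta> DE])
    show "sections01 \<Sigma> M f \<subseteq> csections \<Sigma> M f" by (auto simp: sections01_def)
    show "(\<lambda>p. s p - t p) \<in> sections01 \<Sigma> M f" if "s \<in> sections01 \<Sigma> M f" "t \<in> sections01 \<Sigma> M f" for s t
      using csections_diff[OF sections01D(1)[OF that(1)] sections01D(1)[OF that(2)]]
        T01_closed(1)[OF sections01D(2)[OF that(1)] T01_closed(3)[OF sections01D(2)[OF that(2)]]]
      by (simp add: sections01_def)
  qed
qed

end

section \<open>Kernels\<close>

context spinor_curve
begin

lemma nablaC_add:
  assumes "s \<in> csections \<Sigma> M f" "t \<in> csections \<Sigma> M f"
  shows "nablaC \<Sigma> M f (\<lambda>p. s p + t p) p v = nablaC \<Sigma> M f s p v + nablaC \<Sigma> M f t p v"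
  by (simp add: nablaC_def nabla_add[OF csectionsD(1)[OF assms(1)] csectionsD(1)[OF assms(2)]]
      nabla_add[OF csectionsD(2)[OF assms(1)] csectionsD(2)[OF assms(2)]])

lemma csections_add:
  assumes "s \<in> csections \<Sigma> M f" "t \<in> csections \<Sigma> M f"
  shows "(\<lambda>p. s p + t p) \<in> csections \<Sigma> M f"
  using smooth_section_add[OF csectionsD(1)[OF assms(1)] csectionsD(1)[OF assms(2)]]
    smooth_section_add[OF csectionsD(2)[OF assms(1)] csectionsD(2)[OF assms(2)]]
  by (simp add: csections_def)

lemma csections_0: "(\<lambda>p. 0) \<in> csections \<Sigma> M f"
  by (simp add: csections_def smooth_section_0)

lemma nablaC_0: "nablaC \<Sigma> M f (\<lambda>p. 0) p v = 0"
  by (simp add: nablaC_def nabla_0 prod_eq_iff)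

lemma cforms01_add:
  assumes "\<beta> \<in> cforms01 \<Sigma> M f" "\<gamma> \<in> cforms01 \<Sigma> M f"
  shows "(\<lambda>p w. \<beta> p w + \<gamma> p w) \<in> cforms01 \<Sigma> M f"
  using smooth_form_add[OF cforms01D(1)[OF assms(1)] cforms01D(1)[OF assms(2)]]
    smooth_form_add[OF cforms01D(2)[OF assms(1)] cforms01D(2)[OF assms(2)]] assms
  by (simp add: cforms01_def cmult_add)

lemma cforms01_0: "(\<lambda>p w. 0) \<in> cforms01 \<Sigma> M f"
  by (simp add: cforms01_def smooth_form_0 cmult_0)

lemma Dst_add:
  assumes \<beta>: "\<beta> \<in> cforms01 \<Sigma> M f" and \<gamma>: "\<gamma> \<in> cforms01 \<Sigma> M f"
  shows "Dst (\<lambda>p w. \<beta> p w + \<gamma> p w) p = Dst \<beta> p + Dst \<gamma> p"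
proof -
  note b = cforms01D[OF \<beta>] and g = cforms01D[OF \<gamma>]
  have "dstar (\<lambda>p w. fst (\<beta> p w) + fst (\<gamma> p w)) p = dstar (comp1 \<beta>) p + dstar (comp1 \<gamma>) p"
    unfolding dstar_eq[OF b(1)] dstar_eq[OF g(1)] dstar_eq[OF smooth_form_add[OF b(1) g(1)]] Divp_add[OF b(1) g(1)]
    by (simp add: scaleR_right_distrib)
  moreover have "dstar (\<lambda>p w. snd (\<beta> p w) + snd (\<gamma> p w)) p = dstar (comp2 \<beta>) p + dstar (comp2 \<gamma>) p"
    unfolding dstar_eq[OF b(2)] dstar_eq[OF g(2)] dstar_eq[OF smooth_form_add[OF b(2) g(2)]] Divp_add[OF b(2) g(2)]
    by (simp add: scaleR_right_distrib)
  ultimately show ?thesis by (simp add: Dst_def)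
qed

lemma Dst_0: "Dst (\<lambda>p w. 0) p = 0"
  by (simp add: Dst_def dstar_eq[OF smooth_form_0] Divp_0 prod_eq_iff)

text \<open>Conditions that imply the Dirac equation, are closed under sums and hold on all four
  kernels; only the curvature term then needs a distinction between the four spaces.\<close>

definition dirac_kernel :: "('s \<Rightarrow> (complex ^ 'n) tspinor) set" where
  "dirac_kernel = {\<psi> \<in> twisted_spinors \<Sigma> M f.
     (\<forall>p. nablaC \<Sigma> M f (\<lambda>p. fst (\<psi> p)) p (e1 \<Sigma> p) + cmult \<i> (nablaC \<Sigma> M f (\<lambda>p. fst (\<psi> p)) p (e2 \<Sigma> p)) = 0) \<and>
     (\<forall>p. Dst (\<lambda>p. snd (\<psi> p)) p = 0)}"

lemma dirac_kernel_add:
  assumes "\<phi> \<in> dirac_kernel" "\<eta> \<in> dirac_kernel"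
  shows "(\<lambda>p. tspinor_add (\<phi> p) (\<eta> p)) \<in> dirac_kernel"
proof -
  have s: "(\<lambda>p. fst (\<phi> p)) \<in> csections \<Sigma> M f" "(\<lambda>p. fst (\<eta> p)) \<in> csections \<Sigma> M f"
    and b: "(\<lambda>p. snd (\<phi> p)) \<in> cforms01 \<Sigma> M f" "(\<lambda>p. snd (\<eta> p)) \<in> cforms01 \<Sigma> M f"
    using assms by (auto simp: dirac_kernel_def twisted_spinors_def)
  have "nablaC \<Sigma> M f (\<lambda>p. fst (\<phi> p) + fst (\<eta> p)) p (e1 \<Sigma> p)
      + cmult \<i> (nablaC \<Sigma> M f (\<lambda>p. fst (\<phi> p) + fst (\<eta> p)) p (e2 \<Sigma> p))
    = (nablaC \<Sigma> M f (\<lambda>p. fst (\<phi> p)) p (e1 \<Sigma> p) + cmult \<i> (nablaC \<Sigma> M f (\<lambda>p. fst (\<phi> p)) p (e2 \<Sigma> p)))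
      + (nablaC \<Sigma> M f (\<lambda>p. fst (\<eta> p)) p (e1 \<Sigma> p) + cmult \<i> (nablaC \<Sigma> M f (\<lambda>p. fst (\<eta> p)) p (e2 \<Sigma> p)))" for p
    unfolding nablaC_add[OF s] cmult_add by (simp only: add_ac)
  also have "\<dots> p = 0" for p using assms by (simp add: dirac_kernel_def)
  finally have n: "nablaC \<Sigma> M f (\<lambda>p. fst (\<phi> p) + fst (\<eta> p)) p (e1 \<Sigma> p)
      + cmult \<i> (nablaC \<Sigma> M f (\<lambda>p. fst (\<phi> p) + fst (\<eta> p)) p (e2 \<Sigma> p)) = 0" for p .
  have d: "Dst (\<lambda>p w. snd (\<phi> p) w + snd (\<eta> p) w) p = 0" for p
    unfolding Dst_add[OF b] using assms by (simp add: dirac_kernel_def)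
  show ?thesis
    using n d csections_add[OF s] cforms01_add[OF b] by (simp add: dirac_kernel_def twisted_spinors_def tspinor_add_def)
qed

lemma ker_dbar_props:
  "\<phi> \<in> ker_dbar' \<Sigma> M f \<Longrightarrow> \<phi> \<in> dirac_kernel \<and> (\<forall>p. fst (\<phi> p) \<in> T10 \<and> snd (\<phi> p) = (\<lambda>w. 0))"
  "\<phi> \<in> ker_dbar'' \<Sigma> M f \<Longrightarrow> \<phi> \<in> dirac_kernel \<and> (\<forall>p. fst (\<phi> p) \<in> T01 \<and> snd (\<phi> p) = (\<lambda>w. 0))"
proof -
  assume "\<phi> \<in> ker_dbar' \<Sigma> M f"
  then obtain s where \<phi>: "\<phi> = (\<lambda>p. (s p, \<lambda>w. 0))" and s: "s \<in> sections10 \<Sigma> M f" and z: "\<And>p v. dbar' \<Sigma> M f s p v = 0"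
    by (auto simp: ker_dbar'_def)
  have "nablaC \<Sigma> M f s p (e1 \<Sigma> p) + cmult \<i> (nablaC \<Sigma> M f s p (e2 \<Sigma> p)) = 0" for p
    using z[of p "e1 \<Sigma> p"] unfolding dbar'_eq[OF s] e2_def by simp
  then show "\<phi> \<in> dirac_kernel \<and> (\<forall>p. fst (\<phi> p) \<in> T10 \<and> snd (\<phi> p) = (\<lambda>w. 0))"
    using sections10D(1,2)[OF s] by (simp add: \<phi> dirac_kernel_def twisted_spinors_def cforms01_0 Dst_0)
next
  assume "\<phi> \<in> ker_dbar'' \<Sigma> M f"
  then obtain s where \<phi>: "\<phi> = (\<lambda>p. (s p, \<lambda>w. 0))" and s: "s \<in> sections01 \<Sigma> M f" and z: "\<And>p v. dbar'' \<Sigma> M f s p v = 0"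
    by (auto simp: ker_dbar''_def)
  have "nablaC \<Sigma> M f s p (e1 \<Sigma> p) + cmult \<i> (nablaC \<Sigma> M f s p (e2 \<Sigma> p)) = 0" for p
    using z[of p "e1 \<Sigma> p"] unfolding dbar''_eq[OF s] e2_def by simp
  then show "\<phi> \<in> dirac_kernel \<and> (\<forall>p. fst (\<phi> p) \<in> T01 \<and> snd (\<phi> p) = (\<lambda>w. 0))"
    using sections01D(1,2)[OF s] by (simp add: \<phi> dirac_kernel_def twisted_spinors_def cforms01_0 Dst_0)
qed

lemma ker_dbar_adj_props:
  "\<phi> \<in> ker_dbar'_adj \<Sigma> M f \<Longrightarrow> \<phi> \<in> dirac_kernel \<and> (\<forall>p. fst (\<phi> p) = 0 \<and> (\<forall>w. snd (\<phi> p) w \<in> T10))"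
  "\<phi> \<in> ker_dbar''_adj \<Sigma> M f \<Longrightarrow> \<phi> \<in> dirac_kernel \<and> (\<forall>p. fst (\<phi> p) = 0 \<and> (\<forall>w. snd (\<phi> p) w \<in> T01))"
proof -
  assume "\<phi> \<in> ker_dbar'_adj \<Sigma> M f"
  then obtain \<beta> where "\<phi> = (\<lambda>p. (0, \<beta> p))" "\<beta> \<in> forms01_10 \<Sigma> M f" "\<And>p. dbar'_adj \<Sigma> M f \<beta> p = 0"
    by (auto simp: ker_dbar'_adj_def)
  then show "\<phi> \<in> dirac_kernel \<and> (\<forall>p. fst (\<phi> p) = 0 \<and> (\<forall>w. snd (\<phi> p) w \<in> T10))"
    by (simp add: dirac_kernel_def twisted_spinors_def csections_0 nablaC_0 cmult_0 dbar'_adj_eq forms01_10_def)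
next
  assume "\<phi> \<in> ker_dbar''_adj \<Sigma> M f"
  then obtain \<beta> where "\<phi> = (\<lambda>p. (0, \<beta> p))" "\<beta> \<in> forms01_01 \<Sigma> M f" "\<And>p. dbar''_adj \<Sigma> M f \<beta> p = 0"
    by (auto simp: ker_dbar''_adj_def)
  then show "\<phi> \<in> dirac_kernel \<and> (\<forall>p. fst (\<phi> p) = 0 \<and> (\<forall>w. snd (\<phi> p) w \<in> T01))"
    by (simp add: dirac_kernel_def twisted_spinors_def csections_0 nablaC_0 cmult_0 dbar''_adj_eq forms01_01_def)
qed

lemma dirac_harmonic_sums:
  assumes "\<psi> \<in> ker_dbar' \<Sigma> M f \<oplus>\<^sub>s ker_dbar'' \<Sigma> M f \<or> \<psi> \<in> ker_dbar'_adj \<Sigma> M f \<oplus>\<^sub>s ker_dbar''_adj \<Sigma> M f \<or>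
    \<psi> \<in> ker_dbar' \<Sigma> M f \<oplus>\<^sub>s ker_dbar''_adj \<Sigma> M f \<or> \<psi> \<in> ker_dbar'' \<Sigma> M f \<oplus>\<^sub>s ker_dbar'_adj \<Sigma> M f"
  shows "dirac_harmonic \<Sigma> M f \<psi>"
proof -
  have harm: "dirac_harmonic \<Sigma> M f (\<lambda>p. tspinor_add (\<phi> p) (\<eta> p))" if k: "\<phi> \<in> dirac_kernel" "\<eta> \<in> dirac_kernel"
    and c: "\<And>p. (\<forall>w. snd (\<phi> p) w + snd (\<eta> p) w = 0) \<or> fst (\<phi> p) + fst (\<eta> p) = 0 \<or>
      (fst (\<phi> p) + fst (\<eta> p) \<in> T10 \<and> (\<forall>w. snd (\<phi> p) w + snd (\<eta> p) w \<in> T01)) \<or>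
      (fst (\<phi> p) + fst (\<eta> p) \<in> T01 \<and> (\<forall>w. snd (\<phi> p) w + snd (\<eta> p) w \<in> T10))" for \<phi> \<eta>
    using dirac_kernel_add[OF k] c unfolding dirac_kernel_def
    by (intro dirac_harmonicI) (simp_all add: tspinor_add_def fun_eq_iff)
  from assms consider
      \<phi> \<eta> where "\<psi> = (\<lambda>p. tspinor_add (\<phi> p) (\<eta> p))" "\<phi> \<in> ker_dbar' \<Sigma> M f" "\<eta> \<in> ker_dbar'' \<Sigma> M f"
    | \<phi> \<eta> where "\<psi> = (\<lambda>p. tspinor_add (\<phi> p) (\<eta> p))" "\<phi> \<in> ker_dbar'_adj \<Sigma> M f" "\<eta> \<in> ker_dbar''_adj \<Sigma> M f"
    | \<phi> \<eta> where "\<psi> = (\<lambda>p. tspinor_add (\<phi> p) (\<eta> p))" "\<phi> \<in> ker_dbar' \<Sigma> M f" "\<eta> \<in> ker_dbar''_adj \<Sigma> M f"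
    | \<phi> \<eta> where "\<psi> = (\<lambda>p. tspinor_add (\<phi> p) (\<eta> p))" "\<phi> \<in> ker_dbar'' \<Sigma> M f" "\<eta> \<in> ker_dbar'_adj \<Sigma> M f"
    unfolding tspinor_sum_def by blast
  then show ?thesis
  proof cases
    case 1
    with ker_dbar_props(1)[OF 1(2)] ker_dbar_props(2)[OF 1(3)] harm[of \<phi> \<eta>] show ?thesis by simp
  next
    case 2
    with ker_dbar_adj_props(1)[OF 2(2)] ker_dbar_adj_props(2)[OF 2(3)] harm[of \<phi> \<eta>] show ?thesis by simp
  next
    case 3
    with ker_dbar_props(1)[OF 3(2)] ker_dbar_adj_props(2)[OF 3(3)] harm[of \<phi> \<eta>] show ?thesis by simp
  next
    case 4
    with ker_dbar_props(2)[OF 4(2)] ker_dbar_adj_props(1)[OF 4(3)] harm[of \<phi> \<eta>] show ?thesis by simp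
  qed
qed

section \<open>A non-zero element in one of the spaces\<close>

lemma zero_in_kernels: "(\<lambda>p. tspinor_zero) \<in> ker_dbar' \<Sigma> M f" "(\<lambda>p. tspinor_zero) \<in> ker_dbar'' \<Sigma> M f"
proof -
  have s: "(\<lambda>p. 0) \<in> sections10 \<Sigma> M f" "(\<lambda>p. 0) \<in> sections01 \<Sigma> M f"
    by (simp_all add: sections10_def sections01_def csections_0 T10_iff T01_iff)
  have "dbar' \<Sigma> M f (\<lambda>p. 0) p v = 0" "dbar'' \<Sigma> M f (\<lambda>p. 0) p v = 0" for p v
    unfolding dbar'_eq[OF s(1)] dbar''_eq[OF s(2)] nablaC_0 by (simp_all add: cmult_0)
  with s show "(\<lambda>p. tspinor_zero) \<in> ker_dbar' \<Sigma> M f" "(\<lambda>p. tspinor_zero) \<in> ker_dbar'' \<Sigma> M f"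
    unfolding ker_dbar'_def ker_dbar''_def tspinor_zero_def by (auto intro!: exI[of _ "\<lambda>p. 0"])
qed

text \<open>The form is, up to a factor, the complex conjugate of the holomorphic section \<open>\<partial>f\<close> of
  \<open>K \<otimes> f\<^sup>*T\<^sup>1\<^sup>,\<^sup>0M\<close>.\<close>
lemma differential_in_kernel:
  "(\<lambda>p. (0, \<lambda>w. (dfp p w, \<i> *s dfp p w))) \<in> ker_dbar''_adj \<Sigma> M f"
proof -
  let ?\<beta> = "\<lambda>p w. (dfp p w, \<i> *s dfp p w)"
  have c: "?\<beta> \<in> cforms01 \<Sigma> M f"
    using smooth_form_differential Divp_J(1)[OF smooth_form_differential]
    by (simp add: cforms01_def cmult_ii holomorphic)
  then have b: "?\<beta> \<in> forms01_01 \<Sigma> M f" by (simp add: forms01_01_def T01_iff)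
  \<comment> \<open>Harmonicity of \<open>f\<close> in the first component, and its image under
    \<open>J\<close> in the second.\<close>
  have "Dst ?\<beta> p = 0" for p
    by (simp add: Dst_def dstar_eq[OF smooth_form_differential] dstar_eq[OF Divp_J(1)[OF smooth_form_differential]]
        Divp_J(2)[OF smooth_form_differential] Divp_differential prod_eq_iff)
  then show ?thesis using b unfolding ker_dbar''_adj_def by (auto simp: dbar''_adj_eq[OF b])
qed

text \<open>Coordinate expressions of \<open>f\<close> are constant on balls, so the level sets of
  \<open>f\<close> are open.\<close>

lemma constant_if_differential_zero:
  assumes z: "\<And>p w. dfp p w = 0" and conn: "connected (UNIV :: 's set)"
  shows "f p = f q"
proof -
  have "open {r. f r = f q}"
  proof (subst open_subopen, intro ballI)
    fix r assume "r \<in> {r. f r = f q}"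
    then have rq: "f r = f q" by simp
    let ?c = "chart_at \<Sigma> r" and ?d = "chart_at M (f r)"
    note c = S.chart_at(1)[of r] and d = M.chart_at(1)[of "f r"]
    obtain e where e: "e > 0" "ball (snd ?c r) e \<subseteq> W ?c ?d"
      using W_open[OF c d] in_W_chart_at[of r] by (meson open_contains_ball)
    have "(floc ?c ?d has_derivative (\<lambda>h. 0)) (at x)" if x: "x \<in> ball (snd ?c r) e" for x
    proof -
      obtain p where p: "x = snd ?c p" "p \<in> fst ?c" "f p \<in> fst ?d" using e(2) x by blast
      have "df ?c ?d x = (\<lambda>h. 0)"
        unfolding p(1) by (rule ext) (simp only: df_eq[OF c d p(2,3)] z linear_0[OF M.linear_to_chart[OF d p(3)]])
      then show ?thesis using floc_has_derivative[OF c d, of x] e(2) x by auto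
    qed
    from has_derivative_zero_constant[OF convex_ball has_derivative_at_withinI[OF this]]
    obtain k where k: "\<And>x. x \<in> ball (snd ?c r) e \<Longrightarrow> floc ?c ?d x = k" by metis
    let ?U = "fst ?c \<inter> snd ?c -` ball (snd ?c r) e"
    have "f y = f q" if y: "y \<in> ?U" for y
    proof -
      obtain y' where y': "snd ?c y = snd ?c y'" "y' \<in> fst ?c" "f y' \<in> fst ?d" using e(2) y by blast
      then have "y = y'" using S.chart_inv_snd[OF c] y by (metis IntD1)
      then have fy: "f y \<in> fst ?d" using y' by simp
      have "snd ?d (f y) = k" "snd ?d (f r) = k"
        using k[of "snd ?c y"] k[of "snd ?c r"] floc_snd[OF c d, of y] floc_snd[OF c d, of r] y e(1) S.chart_at(2)[of r] by auto
      then show ?thesis using M.chart_inv_snd[OF d fy] M.chart_inv_snd[OF d M.chart_at(2)] rq by metis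
    qed
    moreover have "open ?U"
      by (rule continuous_open_preimage[OF homeomorphism_cont1[OF S.homeo[OF c]] S.open_chart[OF c] open_ball])
    moreover have "r \<in> ?U" using e(1) S.chart_at(2)[of r] by simp
    ultimately show "\<exists>T. open T \<and> r \<in> T \<and> T \<subseteq> {r. f r = f q}" by blast
  qed
  then have "openin (top_of_set UNIV) {r \<in> UNIV. f r = f q}" by simp
  then have "\<forall>r\<in>UNIV. f r = f q"
    by (rule continuous_levelset_openin[OF conn f_continuous]) blast
  then show ?thesis by simp
qed

text \<open>For constant \<open>f\<close> all fibres are modelled in the same chart of the target. A
  constant vector is then a smooth section, and it is parallel.\<close>

lemma constant_section_in_kernel:
  assumes z: "\<And>p w. dfp p w = 0" and const: "\<And>p. f p = q"
  shows "(\<lambda>p. ((v, - (\<i> *s v)), \<lambda>w. 0)) \<in> ker_dbar' \<Sigma> M f"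
proof -
  have loc: "section_loc M f c d (\<lambda>p. u) = (\<lambda>x. to_chart M d q u)" for c d u
    by (simp add: section_loc_def const fun_eq_iff)
  have sm: "smooth_section \<Sigma> M f (\<lambda>p. u)" for u
    unfolding smooth_section_def smooth_on_def loc by (intro ballI allI Ck_on_const W_open)
  have "nabla \<Sigma> M f (\<lambda>p. u) p w = 0" for u p w
  proof -
    have "snd (chart_at M (f p)) (f p) \<in> snd (chart_at M (f p)) ` fst (chart_at M (f p))"
      using M.chart_at(2) by blast
    from bilinear_lzero[OF M.christoffel_bilinear[OF M.chart_at(1) this]] show ?thesis
      by (simp add: nabla_def Let_def loc z)
  qed
  then have n: "nablaC \<Sigma> M f (\<lambda>p. (v, - (\<i> *s v))) p w = 0" for p w by (simp add: nablaC_def prod_eq_iff)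
  have s: "(\<lambda>p. (v, - (\<i> *s v))) \<in> sections10 \<Sigma> M f"
    by (simp add: sections10_def csections_def sm T10_iff)
  have "dbar' \<Sigma> M f (\<lambda>p. (v, - (\<i> *s v))) p w = 0" for p w
    unfolding dbar'_eq[OF s] n by (simp add: cmult_0)
  with s show ?thesis
    unfolding ker_dbar'_def by (auto intro!: exI[of _ "\<lambda>p. (v, - (\<i> *s v))"])
qed

lemma tspinor_sumI: "\<phi> \<in> V1 \<Longrightarrow> \<eta> \<in> V2 \<Longrightarrow> (\<lambda>p. tspinor_add (\<phi> p) (\<eta> p)) \<in> V1 \<oplus>\<^sub>s V2"
  unfolding tspinor_sum_def by blast

lemma tspinor_add_zero: "tspinor_add \<phi> tspinor_zero = \<phi>" "tspinor_add tspinor_zero \<phi> = \<phi>"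
  by (simp_all add: tspinor_add_def tspinor_zero_def)

lemma nonzero_kernel:
  assumes conn: "connected (UNIV :: 's set)"
  shows "nonzero_space (ker_dbar' \<Sigma> M f \<oplus>\<^sub>s ker_dbar'' \<Sigma> M f) \<or> nonzero_space (ker_dbar' \<Sigma> M f \<oplus>\<^sub>s ker_dbar''_adj \<Sigma> M f)"
proof (cases "\<forall>p w. dfp p w = 0")
  case True
  \<comment> \<open>\<open>undefined\<close> stands for some index of the nonempty type
    \<open>'n\<close>, which makes the vector nonzero.\<close>
  let ?v = "axis undefined 1 :: complex ^ 'n"
  let ?\<psi> = "\<lambda>p::'s. ((?v, - (\<i> *s ?v)), \<lambda>w::complex. 0 :: (complex ^ 'n) cpx)"
  have "?\<psi> \<in> ker_dbar' \<Sigma> M f"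
    by (rule constant_section_in_kernel) (use True constant_if_differential_zero[OF _ conn, of _ undefined] in auto)
  from tspinor_sumI[OF this zero_in_kernels(2)] have "?\<psi> \<in> ker_dbar' \<Sigma> M f \<oplus>\<^sub>s ker_dbar'' \<Sigma> M f"
    by (simp only: tspinor_add_zero)
  moreover have "?\<psi> \<noteq> (\<lambda>p. tspinor_zero)" by (simp add: fun_eq_iff tspinor_zero_def zero_prod_def axis_eq_0_iff)
  ultimately show ?thesis unfolding nonzero_space_def by blast
next
  case False
  let ?\<psi> = "\<lambda>p. (0, \<lambda>w. (dfp p w, \<i> *s dfp p w)) :: (complex ^ 'n) tspinor"
  from tspinor_sumI[OF zero_in_kernels(1) differential_in_kernel]
  have "?\<psi> \<in> ker_dbar' \<Sigma> M f \<oplus>\<^sub>s ker_dbar''_adj \<Sigma> M f" by (simp only: tspinor_add_zero)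
  moreover have "?\<psi> \<noteq> (\<lambda>p. tspinor_zero)" using False by (auto simp: fun_eq_iff tspinor_zero_def zero_prod_def)
  ultimately show ?thesis unfolding nonzero_space_def by blast
qed

end

section \<open>The locale assumptions from the hypotheses of the theorem\<close>

lemma conformal_bilinear_form:
  fixes B :: "complex \<Rightarrow> complex \<Rightarrow> real"
  assumes B: "bilinear B" and sym: "\<And>v w. B v w = B w v" and J: "\<And>v w. B (\<i> * v) (\<i> * w) = B v w"
  shows "B v w = B 1 1 * Re (v * cnj w)"
proof -
  have ii: "B \<i> \<i> = B 1 1" using J[of 1 1] by simp
  have "B 1 \<i> = B \<i> (- 1)" using J[of 1 \<i>] by simp
  then have i: "B 1 \<i> = 0" "B \<i> 1 = 0" using sym[of 1 \<i>] bilinear_rneg[OF B, of \<i> 1] by simp_all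
  have v: "v = Re v *\<^sub>R 1 + Im v *\<^sub>R \<i>" and w: "w = Re w *\<^sub>R 1 + Im w *\<^sub>R \<i>" by (simp_all add: complex_eq_iff)
  have "B (a *\<^sub>R 1 + b *\<^sub>R \<i>) (c *\<^sub>R 1 + d *\<^sub>R \<i>) = B 1 1 * (a * c + b * d)" for a b c d
    by (simp add: bilinear_ladd[OF B] bilinear_radd[OF B] bilinear_lmul[OF B] bilinear_rmul[OF B] ii i
        algebra_simps del: scaleR_one)
  from this[of "Re v" "Im v" "Re w" "Im w", folded v w] show ?thesis by simp
qed

text \<open>Three-forms on a surface vanish. In a chart the Kaehler form is the conformal factor
  times \<open>Re (\<i> * v * cnj w)\<close>, and the cyclic sum becomes an algebraic identity for
  the real linear derivative \<open>G\<close> of that factor.\<close>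

lemma kaehler_surface:
  assumes \<Sigma>: "riemann_surface \<Sigma>" and h: "compatible_metric \<Sigma>"
  shows "kaehler ((*) \<i>) \<Sigma>"
proof -
  have cs: "complex_structure ((*) \<i>)"
    by (rule complex_structure.intro, rule linearI) (simp_all add: algebra_simps)
  have at: "complex_atlas ((*) \<i>) (atlas \<Sigma>)" using \<Sigma> by (simp add: riemann_surface_def)
  interpret X: complex_manifold "(*) \<i>" \<Sigma>
    by (rule complex_manifold.intro[OF cs]) (rule complex_manifold_axioms.intro[OF at])
  have metric: "riemannian_metric \<Sigma>" and J: "riem \<Sigma> p (\<i> * v) (\<i> * w) = riem \<Sigma> p v w" for p v w
    using h by (simp_all add: compatible_metric_def)
  have B: "bilinear (riem \<Sigma> p)" and sym: "riem \<Sigma> p v w = riem \<Sigma> p w v" for p v w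
    using metric unfolding riemannian_metric_def by blast+
  note conf = conformal_bilinear_form[OF B sym J]
  have closed: "frechet_derivative (\<lambda>y. bilin_loc \<Sigma> (\<lambda>q v. riem \<Sigma> q (\<i> * v)) c y v w) (at x) u +
        frechet_derivative (\<lambda>y. bilin_loc \<Sigma> (\<lambda>q v. riem \<Sigma> q (\<i> * v)) c y w u) (at x) v +
        frechet_derivative (\<lambda>y. bilin_loc \<Sigma> (\<lambda>q v. riem \<Sigma> q (\<i> * v)) c y u v) (at x) w = 0"
    if c: "c \<in> atlas \<Sigma>" and x: "x \<in> snd c ` fst c" for c x u v w
  proof -
    let ?g = "\<lambda>y. bilin_loc \<Sigma> (riem \<Sigma>) c y 1 1"
    have loc: "bilin_loc \<Sigma> (\<lambda>q v. riem \<Sigma> q (\<i> * v)) c y v w = ?g y * Re (\<i> * v * cnj w)"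
      if y: "y \<in> snd c ` fst c" for y v w
    proof -
      note p = X.chart_inv_in[OF c y]
      define a where "a = from_chart \<Sigma> c (chart_inv c y) 1"
      have m: "from_chart \<Sigma> c (chart_inv c y) v = v * a" for v
        unfolding a_def by (rule complex_linear_eq_mult[OF X.linear_from_chart[OF c p] X.from_chart_J[OF c p]])
      show ?thesis
        unfolding bilin_loc_def m conf[of _ "\<i> * (v * a)"] conf[of _ "1 * a"] by (simp add: algebra_simps)
    qed
    define G where "G = frechet_derivative ?g (at x)"
    have g: "(?g has_derivative G) (at x)"
      unfolding G_def using metric c x by (intro smooth_on_has_derivative) (auto simp: riemannian_metric_def)
    have d: "frechet_derivative (\<lambda>y. bilin_loc \<Sigma> (\<lambda>q v. riem \<Sigma> q (\<i> * v)) c y v w) (at x) u = G u * Re (\<i> * v * cnj w)" for u v w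
    proof -
      have "((\<lambda>y. bilin_loc \<Sigma> (\<lambda>q v. riem \<Sigma> q (\<i> * v)) c y v w) has_derivative (\<lambda>u. G u * Re (\<i> * v * cnj w))) (at x)"
        by (rule has_derivative_transform_within_open[OF has_derivative_mult_left[OF g] X.open_chart_image[OF c] x])
           (simp only: loc)
      from frechet_derivative_at[OF this] show ?thesis by metis
    qed
    have G: "G z = Re z * G 1 + Im z * G \<i>" for z
    proof -
      have "G (Re z *\<^sub>R 1 + Im z *\<^sub>R \<i>) = Re z * G 1 + Im z * G \<i>"
        by (simp only: linear_add[OF has_derivative_linear[OF g]] linear_cmul[OF has_derivative_linear[OF g]] real_scaleR_def)
      moreover have "z = Re z *\<^sub>R 1 + Im z *\<^sub>R \<i>" by (simp add: complex_eq_iff)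
      ultimately show ?thesis by simp
    qed
    show ?thesis unfolding d G[of u] G[of v] G[of w] by (simp add: algebra_simps)
  qed
  show ?thesis
    by (rule kaehler.intro[OF X.complex_manifold_axioms]) (rule kaehler_axioms.intro[OF metric J closed])
qed

lemma kaehler_manifold_kaehler:
  assumes "kaehler_manifold M"
  shows "kaehler (\<lambda>v. \<i> *s v) M"
proof -
  have at: "complex_atlas (\<lambda>v. \<i> *s v) (atlas M)" and k: "kaehler_form M = (\<lambda>q v. riem M q (\<i> *s v))"
    using assms by (simp_all add: kaehler_manifold_def kaehler_form_def fun_eq_iff)
  show ?thesis
    by (rule kaehler.intro[OF complex_manifold.intro[OF complex_structure_vec complex_manifold_axioms.intro[OF at]]],
        rule kaehler_axioms.intro)
       (use assms in \<open>auto simp: kaehler_manifold_def k\<close>)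
qed

lemma spinor_curve:
  assumes \<Sigma>: "riemann_surface \<Sigma>" and h: "compatible_metric \<Sigma>" and M: "kaehler_manifold M" and f: "J_holomorphic_curve \<Sigma> M f"
  shows "spinor_curve \<Sigma> M f"
proof -
  note S = kaehler_surface[OF \<Sigma> h]
  show ?thesis
  proof (rule spinor_curve.intro)
    show "curve \<Sigma> (\<lambda>v. \<i> *s v) M f"
      by (rule curve.intro[OF S kaehler_manifold_kaehler[OF M]], rule curve_axioms.intro)
         (use f in \<open>auto simp: J_holomorphic_curve_def\<close>)
    show "compact_surface \<Sigma>"
      by (rule compact_surface.intro[OF surface.intro[OF S]], rule compact_surface_axioms.intro)
         (use \<Sigma> in \<open>auto simp: riemann_surface_def\<close>)
  qed
qed

theorem theorem1p2:
  fixes \<Sigma> :: "('s::{t2_space,second_countable_topology}, complex) riem_mfd"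
    and M :: "('m::{t2_space,second_countable_topology}, complex ^ 'n) riem_mfd"
    and f :: "'s \<Rightarrow> 'm"
    and genus :: nat
    and A :: "'m chain set"
  assumes "riemann_surface \<Sigma>"
    and "has_genus (euclidean :: 's topology) genus"
    and "compatible_metric \<Sigma>"
    and "kaehler_manifold M"
    and "J_holomorphic_curve \<Sigma> M f"
    and "A = hom_induced 2 euclidean {} euclidean {} f (fundamental_class \<Sigma>)"
  shows "(\<forall>\<psi> \<in> twisted_spinors \<Sigma> M f.
           \<psi> \<in> ker_dbar' \<Sigma> M f \<oplus>\<^sub>s ker_dbar'' \<Sigma> M f \<or>
           \<psi> \<in> ker_dbar'_adj \<Sigma> M f \<oplus>\<^sub>s ker_dbar''_adj \<Sigma> M f \<or>
           \<psi> \<in> ker_dbar' \<Sigma> M f \<oplus>\<^sub>s ker_dbar''_adj \<Sigma> M f \<or>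
           \<psi> \<in> ker_dbar'' \<Sigma> M f \<oplus>\<^sub>s ker_dbar'_adj \<Sigma> M f
           \<longrightarrow> dirac_harmonic \<Sigma> M f \<psi>) \<and>
         (\<not> (genus = 1 \<and> chern_number M A = 0) \<longrightarrow>
           nonzero_space (ker_dbar' \<Sigma> M f \<oplus>\<^sub>s ker_dbar'' \<Sigma> M f) \<or>
           nonzero_space (ker_dbar'_adj \<Sigma> M f \<oplus>\<^sub>s ker_dbar''_adj \<Sigma> M f) \<or>
           nonzero_space (ker_dbar' \<Sigma> M f \<oplus>\<^sub>s ker_dbar''_adj \<Sigma> M f) \<or>
           nonzero_space (ker_dbar'' \<Sigma> M f \<oplus>\<^sub>s ker_dbar'_adj \<Sigma> M f))"
proof -
  interpret spinor_curve \<Sigma> M f using assms by (intro spinor_curve)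
  have "connected (UNIV :: 's set)" using assms(1) by (simp add: riemann_surface_def)
  from nonzero_kernel[OF this] show ?thesis using dirac_harmonic_sums by blast
qed

end
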